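(* There exists a constant $C>0$ which depends only on $\Omega$, $n$, and the shape regularity (constant $\gamma$) of $\mathcal{T}$ such that $$C^{-1}\,|||\phi|||_{\mathcal{X}} \le \|\phi\|_{-1} \le C\,|||\phi|||_{\mathcal{X}}\qquad\text{for all }\phi\in\mathcal{P}^0(\mathcal{T}),$$ where $$|||\phi|||_{\mathcal{X}}^2 := \inf\Big\{\sum_{E\in\mathcal{E}}\|\phi_E\|_{-1}^2 \,:\, \phi_E\in\mathcal{X}_E\ (E\in\mathcal{E}),\ \phi=\sum_{E\in\mathcal{E}}\phi_E\Big\},\qquad \mathcal{X}_E:=\mathrm{span}\{\mathrm{div}\,\boldsymbol\psi_E\}\subseteq\mathcal{P}^0(\mathcal{T}).$$
   Context: Domain: $n\ge 2$ and $\Omega\subset\mathbb{R}^n$ is a bounded connected polyhedral domain with Lipschitz boundary $\Gamma$. $(\cdot,\cdot)$ and $\|\cdot\|$ are the $L^2(\Omega)$ scalar product and norm; $H^{-1}(\Omega)=(H_0^1(\Omega))^*$ with duality extending $(\cdot,\cdot)$ and norm $\|\phi\|_{-1}:=\sup_{0\ne v\in H_0^1(\Omega)}\frac{(\phi,v)}{\|\nabla v\|}$. Mesh: $\mathcal{T}$ is a regular (finite, conforming, i.e. without hanging nodes) mesh of open, pairwise disjoint $n$-simplices with $\overline\Omega=\bigcup_{T\in\mathcal{T}}\overline T$. It is shape regular with constant $\gamma$: $\max_{T\in\mathcal{T}}\mathrm{diam}(T)^n/|T|\le\gamma<\infty$, where $|T|$ is the volume of $T$. $\mathcal{E}$ is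 the set of all facets (relatively open $(n-1)$-dimensional boundary simplices) of elements of $\mathcal{T}$; $|E|$ is the $(n-1)$-dimensional measure of $E$. $\mathcal{P}^0(\mathcal{T})$ is the space of $\mathcal{T}$-piecewise constant functions. Raviart--Thomas functions: an interior facet $E$ (not contained in $\Gamma$) is shared by exactly two elements $T^+,T^-$ (with a fixed labelling), $\overline{T^+}\cap\overline{T^-}=\overline E$; for a boundary facet $E\subset\Gamma$, $T^+$ is the unique element having $E$ as a facet and $T^-=\emptyset$. $\boldsymbol p_E^\pm$ is the vertex of $T^\pm$ opposite to $E$. Define $\boldsymbol\psi_E(\boldsymbol x):=\pm\frac{|E|}{n|T^\pm|}(\boldsymbol x-\boldsymbol p_E^\pm)$ for $\boldsymbol x\in T^\pm$, and $\boldsymbol\psi_E:=0$ elsewhere. Then $\mathrm{div}\,\boldsymbol\psi_E=\pm|E|/|T^\pm|$ on $T^\pm$ and $0$ elsewhere. One has $\mathcal{P}^0(\mathcal{T})=\sum_{E\in\mathcal{E}}\mathcal{X}_E$, so the infimum is over a nonempty set. *)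

theory Defs
  imports "HOL-Analysis.Analysis"
begin

section \<open>Domains\<close>

text \<open>Locally, after a rigid motion, \<open>\<Omega>\<close> lies strictly on one side of the graph of a Lipschitz
  function \<open>g\<close>. The direction \<open>e\<close> plays the role of the last coordinate axis, and only the values of
  \<open>g\<close> on the hyperplane orthogonal to \<open>e\<close> are used.\<close>

definition lipschitz_boundary :: "(real^'n) set \<Rightarrow> bool" where
  "lipschitz_boundary \<Omega> \<longleftrightarrow>
     (\<forall>x \<in> frontier \<Omega>. \<exists>U e g L.
        open U \<and> x \<in> U \<and> norm e = 1 \<and>
        lipschitz_on L {y. y \<bullet> e = 0} (g :: real^'n \<Rightarrow> real) \<and>
        \<Omega> \<inter> U = {y \<in> U. g (y - (y \<bullet> e) *\<^sub>R e) < y \<bullet> e})"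

definition polyhedral_lipschitz_domain :: "(real^'n) set \<Rightarrow> bool" where
  "polyhedral_lipschitz_domain \<Omega> \<longleftrightarrow>
     open \<Omega> \<and> \<Omega> \<noteq> {} \<and> connected \<Omega> \<and> bounded \<Omega> \<and> lipschitz_boundary \<Omega> \<and>
     (\<exists>\<P>. finite \<P> \<and> (\<forall>P \<in> \<P>. polytope P) \<and> closure \<Omega> = \<Union>\<P>)"

section \<open>Lebesgue and Sobolev spaces\<close>

text \<open>Elements of \<open>L\<^sup>2(\<Omega>)\<close> are represented by functions on the whole space, whose values outside
  \<open>\<Omega>\<close> are irrelevant.\<close>

definition L2 :: "(real^'n) set \<Rightarrow> (real^'n \<Rightarrow> 'b::euclidean_space) set" where
  "L2 \<Omega> = {f. f \<in> borel_measurable (lebesgue_on \<Omega>) \<and>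
                integrable (lebesgue_on \<Omega>) (\<lambda>x. (norm (f x))\<^sup>2)}"

definition L2_inner :: "(real^'n) set \<Rightarrow> (real^'n \<Rightarrow> 'b::euclidean_space) \<Rightarrow> (real^'n \<Rightarrow> 'b) \<Rightarrow> real" where
  "L2_inner \<Omega> f g = (LINT x|lebesgue_on \<Omega>. f x \<bullet> g x)"

definition L2_norm :: "(real^'n) set \<Rightarrow> (real^'n \<Rightarrow> 'b::euclidean_space) \<Rightarrow> real" where
  "L2_norm \<Omega> f = sqrt (L2_inner \<Omega> f f)"

definition partial :: "'n \<Rightarrow> (real^'n \<Rightarrow> 'b::real_normed_vector) \<Rightarrow> real^'n \<Rightarrow> 'b" where
  "partial i f x = frechet_derivative f (at x) (axis i 1)"

definition grad :: "(real^'n \<Rightarrow> real) \<Rightarrow> real^'n \<Rightarrow> real^'n" where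
  "grad f x = (\<chi> i. partial i f x)"

definition divergence :: "(real^'n \<Rightarrow> real^'n) \<Rightarrow> real^'n \<Rightarrow> real" where
  "divergence f x = (\<Sum>i\<in>UNIV. partial i f x $ i)"

fun Ck :: "nat \<Rightarrow> (real^'n \<Rightarrow> real) \<Rightarrow> bool" where
  "Ck 0 f \<longleftrightarrow> continuous_on UNIV f"
| "Ck (Suc k) f \<longleftrightarrow> f differentiable_on UNIV \<and> (\<forall>i. Ck k (partial i f))"

definition test_functions :: "(real^'n) set \<Rightarrow> (real^'n \<Rightarrow> real) set" where
  "test_functions \<Omega> = {f. (\<forall>k. Ck k f) \<and>
     compact (closure {x. f x \<noteq> 0}) \<and> closure {x. f x \<noteq> 0} \<subseteq> \<Omega>}"

definition weak_gradient ::
  "(real^'n) set \<Rightarrow> (real^'n \<Rightarrow> real) \<Rightarrow> (real^'n \<Rightarrow> real^'n) \<Rightarrow> bool" where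
  "weak_gradient \<Omega> u g \<longleftrightarrow> u \<in> L2 \<Omega> \<and> g \<in> L2 \<Omega> \<and>
     (\<forall>w \<in> test_functions \<Omega>. \<forall>i.
        (LINT x|lebesgue_on \<Omega>. u x * partial i w x) = - (LINT x|lebesgue_on \<Omega>. g x $ i * w x))"

text \<open>The closure of the test functions in \<open>H\<^sup>1(\<Omega>)\<close>.\<close>

definition H10 :: "(real^'n) set \<Rightarrow> (real^'n \<Rightarrow> real) set" where
  "H10 \<Omega> = {u. \<exists>g. weak_gradient \<Omega> u g \<and>
     (\<exists>w. (\<forall>k. w k \<in> test_functions \<Omega>) \<and>
        (\<lambda>k::nat. L2_norm \<Omega> (\<lambda>x. u x - w k x)) \<longlonglongrightarrow> 0 \<and>
        (\<lambda>k. L2_norm \<Omega> (\<lambda>x. g x - grad (w k) x)) \<longlonglongrightarrow> 0)}"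

text \<open>The dual norm, for functionals given by \<open>L\<^sup>2\<close> functions. The weak gradient \<open>g\<close> of \<open>v\<close> is unique
  almost everywhere; \<open>L2_norm \<Omega> v \<noteq> 0\<close> says that \<open>v\<close> is not the zero element. The supremum is over a
  set bounded above because of Friedrichs' inequality.\<close>

definition Hm1_norm :: "(real^'n) set \<Rightarrow> (real^'n \<Rightarrow> real) \<Rightarrow> real" where
  "Hm1_norm \<Omega> \<phi> =
     Sup {L2_inner \<Omega> \<phi> v / L2_norm \<Omega> g | v g. v \<in> H10 \<Omega> \<and> weak_gradient \<Omega> v g \<and> L2_norm \<Omega> v \<noteq> 0}"

section \<open>Meshes\<close>

text \<open>Conformity is the condition, contained in \<^const>\<open>triangulation\<close>, that any two closed elements
  meet in a common (possibly empty) face.\<close>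

definition regular_mesh :: "(real^'n) set \<Rightarrow> (real^'n) set set \<Rightarrow> bool" where
  "regular_mesh \<Omega> \<T> \<longleftrightarrow>
     finite \<T> \<and>
     (\<forall>T \<in> \<T>. \<exists>S. int CARD('n) simplex S \<and> T = interior S) \<and>
     pairwise disjnt \<T> \<and>
     triangulation (closure ` \<T>) \<and>
     closure \<Omega> = (\<Union>T\<in>\<T>. closure T)"

definition shape_regular :: "real \<Rightarrow> (real^'n) set set \<Rightarrow> bool" where
  "shape_regular \<gamma> \<T> \<longleftrightarrow> (\<forall>T \<in> \<T>. diameter T ^ CARD('n) / measure lebesgue T \<le> \<gamma>)"

definition P0 :: "(real^'n) set set \<Rightarrow> (real^'n \<Rightarrow> real) set" where
  "P0 \<T> = {f. (\<forall>T \<in> \<T>. \<exists>c. \<forall>x \<in> T. f x = c) \<and> (\<forall>x. x \<notin> \<Union>\<T> \<longrightarrow> f x = 0)}"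

text \<open>The functions in \<^const>\<open>P0\<close> vanish outside the (open) elements: this selects one representative of
  each \<open>L\<^sup>2(\<Omega>)\<close> class of piecewise constant functions, the mesh skeleton being a null set.\<close>

definition open_facet_of :: "(real^'n) set \<Rightarrow> (real^'n) set \<Rightarrow> bool" where
  "open_facet_of E T \<longleftrightarrow> (\<exists>F. F facet_of closure T \<and> E = rel_interior F)"

definition facets :: "(real^'n) set set \<Rightarrow> (real^'n) set set" where
  "facets \<T> = {E. \<exists>T \<in> \<T>. open_facet_of E T}"

text \<open>The \<open>(n-1)\<close>-dimensional measure of a subset \<open>E\<close> of a hyperplane, as the volume of the right prism of
  height 1 over \<open>E\<close>; it does not depend on the choice of the unit normal.\<close>

definition facet_measure :: "(real^'n) set \<Rightarrow> real" where
  "facet_measure E =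
     (let \<nu> = (SOME \<nu>. norm \<nu> = 1 \<and> (\<forall>x\<in>E. \<forall>y\<in>E. (x - y) \<bullet> \<nu> = 0))
      in measure lebesgue {x + t *\<^sub>R \<nu> | x t. x \<in> E \<and> 0 \<le> t \<and> t \<le> 1})"

text \<open>\<open>Tp E\<close> and \<open>Tm E\<close> are the elements \<open>T\<^sup>+\<close> and \<open>T\<^sup>-\<close> at the facet \<open>E\<close>, with \<open>T\<^sup>- = {}\<close> on the boundary.\<close>

definition facet_labelling ::
  "(real^'n) set \<Rightarrow> (real^'n) set set \<Rightarrow> ((real^'n) set \<Rightarrow> (real^'n) set) \<Rightarrow>
   ((real^'n) set \<Rightarrow> (real^'n) set) \<Rightarrow> bool" where
  "facet_labelling \<Omega> \<T> Tp Tm \<longleftrightarrow>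
     (\<forall>E \<in> facets \<T>.
        if E \<subseteq> frontier \<Omega>
        then {T \<in> \<T>. open_facet_of E T} = {Tp E} \<and> Tm E = {}
        else {T \<in> \<T>. open_facet_of E T} = {Tp E, Tm E} \<and> Tp E \<noteq> Tm E \<and>
             closure (Tp E) \<inter> closure (Tm E) = closure E)"

definition opposite_vertex :: "(real^'n) set \<Rightarrow> (real^'n) set \<Rightarrow> real^'n" where
  "opposite_vertex T E = (THE p. p extreme_point_of closure T \<and> p \<notin> closure E)"

section \<open>Raviart--Thomas functions and the decomposition norm\<close>

definition rt :: "((real^'n) set \<Rightarrow> (real^'n) set) \<Rightarrow> ((real^'n) set \<Rightarrow> (real^'n) set) \<Rightarrow>
    (real^'n) set \<Rightarrow> real^'n \<Rightarrow> real^'n" where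
  "rt Tp Tm E x =
     (if x \<in> Tp E then
        (facet_measure E / (real CARD('n) * measure lebesgue (Tp E))) *\<^sub>R (x - opposite_vertex (Tp E) E)
      else if x \<in> Tm E then
        - ((facet_measure E / (real CARD('n) * measure lebesgue (Tm E))) *\<^sub>R (x - opposite_vertex (Tm E) E))
      else 0)"

text \<open>Since \<open>rt Tp Tm E\<close> has continuous normal components across the interior facets, its distributional
  divergence is the classical divergence on the open elements. The value on the mesh skeleton, where
  \<open>rt Tp Tm E\<close> need not be differentiable, is set to 0 as in \<^const>\<open>P0\<close>.\<close>

definition rt_div :: "(real^'n) set set \<Rightarrow> ((real^'n) set \<Rightarrow> (real^'n) set) \<Rightarrow>
    ((real^'n) set \<Rightarrow> (real^'n) set) \<Rightarrow> (real^'n) set \<Rightarrow> real^'n \<Rightarrow> real" where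
  "rt_div \<T> Tp Tm E x = (if x \<in> \<Union>\<T> then divergence (rt Tp Tm E) x else 0)"

definition X_space :: "(real^'n) set set \<Rightarrow> ((real^'n) set \<Rightarrow> (real^'n) set) \<Rightarrow>
    ((real^'n) set \<Rightarrow> (real^'n) set) \<Rightarrow> (real^'n) set \<Rightarrow> (real^'n \<Rightarrow> real) set" where
  "X_space \<T> Tp Tm E = {\<lambda>x. c * rt_div \<T> Tp Tm E x | c. True}"

definition X_norm :: "(real^'n) set \<Rightarrow> (real^'n) set set \<Rightarrow> ((real^'n) set \<Rightarrow> (real^'n) set) \<Rightarrow>
    ((real^'n) set \<Rightarrow> (real^'n) set) \<Rightarrow> (real^'n \<Rightarrow> real) \<Rightarrow> real" where
  "X_norm \<Omega> \<T> Tp Tm \<phi> =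
     sqrt (Inf {\<Sum>E\<in>facets \<T>. (Hm1_norm \<Omega> (\<phi>E E))\<^sup>2 | \<phi>E.
                  (\<forall>E \<in> facets \<T>. \<phi>E E \<in> X_space \<T> Tp Tm E) \<and>
                  \<phi> = (\<lambda>x. \<Sum>E\<in>facets \<T>. \<phi>E E x)})"

end

theory Submission
  imports Defs
begin

text \<open>Up to shape constants, \<open>\<parallel>div \<psi>\<^sub>E\<parallel>\<^sub>-\<^sub>1\<close> is \<open>|E| d\<^sub>E\<close>, where \<open>d\<^sub>E\<^sup>2\<close> adds \<open>diam(T)\<^sup>2 / |T|\<close> over the elements at \<open>E\<close>.
  Writing \<open>(div \<psi>\<^sub>E, w) = - (\<psi>\<^sub>E, \<nabla>w)\<close>, Cauchy-Schwarz and the finite overlap of the supports give the upper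
  bound for \<open>\<parallel>\<phi>\<parallel>\<^sub>-\<^sub>1\<close>; bubble functions show that \<open>\<parallel>div \<psi>\<^sub>E\<parallel>\<^sub>-\<^sub>1\<close> is as large as claimed.

  For the lower bound, duality in finite dimension turns the existence of coefficients with
  \<open>\<phi> = \<Sum> c\<^sub>E div \<psi>\<^sub>E / |E|\<close> and \<open>\<Sum> c\<^sub>E\<^sup>2 d\<^sub>E\<^sup>2 \<le> K\<^sup>2 \<parallel>\<phi>\<parallel>\<^sup>2\<^sub>-\<^sub>1\<close> into the estimate
  \<open>(\<phi>, v) \<le> K \<parallel>\<phi>\<parallel>\<^sub>-\<^sub>1 (\<Sum> [v]\<^sub>E\<^sup>2 / d\<^sub>E\<^sup>2)\<^sup>1\<^sup>/\<^sup>2\<close> for piecewise constant \<open>v\<close> with facet jumps \<open>[v]\<^sub>E\<close>. To prove it,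
  replace \<open>v\<close> by a Lipschitz function \<open>w\<close> with the same element means that vanishes outside \<open>\<Omega>\<close>: interpolate
  a nodal value of \<open>v\<close> at each vertex, 0 on the boundary, and correct the means by bubbles. The
  gradient of \<open>w\<close> is controlled by the jumps because the elements at a point of \<open>closure \<Omega>\<close> are linked by
  facets: near that point \<open>\<Omega>\<close> is connected, and a generic segment avoids the faces of codimension two.\<close>

section \<open>Test functions and the dual norm\<close>

text \<open>Two concerns shape the proof. Uniformity: one constant has to serve all meshes, so every
  bound is traced back to n and \<gamma>. The Lipschitz boundary enters through qualitative facts
  (no slits, connectedness near a point), while the length of a chain of elements around a point is
  bounded by a volume count in which shape regularity is decisive. Regularity: the functions tested
  against \<phi> are Lipschitz, whereas \<open>H10\<close> is the closure of smooth functions. Soft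
  thresholding and mollification bridge this gap, and energies are read off from Lipschitz constants
  on the elements. In the same spirit the flux through a facet is a limit of volume integrals over
  thin layers, so that surface measure enters only as a scaling factor. The weights scale like
  diam(T)^(2-n): the field (x - p)/|T| has squared L2 norm at most diam(T)^2/|T|, and testing with a
  bubble, of slope about 1/diam(T), gives the same power from below. Jumps carry the reciprocal
  weight, which is what pairs them with coefficients in the duality argument.\<close>

lemma partial_eq: "(f has_derivative f') (at x) \<Longrightarrow> partial i f x = f' (axis i 1)"
  using frechet_derivative_at[of f f' x] by (simp add: partial_def)

lemma derivative_eq_grad:
  fixes f :: "real^'n \<Rightarrow> real"
  assumes "(f has_derivative f') (at x)"
  shows "f' h = grad f x \<bullet> h"
proof -
  interpret f': linear f' using assms has_derivative_linear by blast
  have "f' h = f' (\<Sum>i\<in>UNIV. h $ i *\<^sub>R axis i 1)"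
    by (simp add: scalar_mult_eq_scaleR[symmetric] basis_expansion)
  also have "\<dots> = (\<Sum>i\<in>UNIV. h $ i * f' (axis i 1))"
    by (simp add: f'.sum f'.scaleR)
  also have "\<dots> = grad f x \<bullet> h"
    by (simp add: inner_vec_def grad_def partial_eq[OF assms] mult.commute)
  finally show ?thesis .
qed

lemma has_derivative_grad:
  fixes f :: "real^'n \<Rightarrow> real"
  assumes "f differentiable at x"
  shows "(f has_derivative (\<lambda>h. grad f x \<bullet> h)) (at x)"
proof -
  obtain f' where f': "(f has_derivative f') (at x)" using assms differentiable_def by blast
  then show ?thesis using derivative_eq_grad[OF f'] by (metis (no_types, lifting) ext)
qed

lemma grad_eqI:
  fixes f :: "real^'n \<Rightarrow> real"
  assumes "(f has_derivative (\<lambda>h. a \<bullet> h)) (at x)"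
  shows "grad f x = a"
  using derivative_eq_grad[OF assms] by (metis vector_eq_rdot inner_commute)

lemma test_functionsD:
  assumes "w \<in> test_functions \<Omega>"
  shows "Ck k w" "w differentiable at x" "continuous_on A w" "continuous_on A (partial i w)"
    "compact (closure {x. w x \<noteq> 0})" "closure {x. w x \<noteq> 0} \<subseteq> \<Omega>" "x \<notin> \<Omega> \<Longrightarrow> w x = 0"
proof -
  have *: "\<And>k. Ck k w" using assms by (auto simp: test_functions_def)
  show "Ck k w" by (rule *)
  show "w differentiable at x" using *[of "Suc 0"] by (auto simp: differentiable_on_def)
  show "continuous_on A w" using *[of 0] continuous_on_subset[of UNIV w A] by simp
  show "continuous_on A (partial i w)" using *[of "Suc 0"] continuous_on_subset[of UNIV "partial i w" A] by simp
  show "compact (closure {x. w x \<noteq> 0})" "closure {x. w x \<noteq> 0} \<subseteq> \<Omega>"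
    using assms by (auto simp: test_functions_def)
  then show "x \<notin> \<Omega> \<Longrightarrow> w x = 0" using closure_subset[where S="{x. w x \<noteq> 0}"] by (auto simp: subset_iff)
qed

lemma partial_eq_0_outside:
  assumes "x \<notin> closure {x. f x \<noteq> 0}"
  shows "partial i f x = 0"
proof -
  have o: "open (- closure {x. f x \<noteq> 0})" by (rule open_Compl[OF closed_closure])
  have x: "x \<in> - closure {x. f x \<noteq> 0}" using assms by (simp only: Compl_iff not_False_eq_True)
  have z: "0 = f y" if "y \<in> - closure {x. f x \<noteq> 0}" for y
  proof -
    have "y \<notin> {x. f x \<noteq> 0}" by (rule contra_subsetD[OF closure_subset ComplD[OF that]])
    then show ?thesis by simp
  qed
  have "(f has_derivative (\<lambda>h. 0)) (at x)"
    by (rule has_derivative_transform_within_open[OF has_derivative_const[of 0 "at x"] o x z])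
  then show ?thesis by (rule partial_eq)
qed

lemma partial_test_function:
  assumes "w \<in> test_functions \<Omega>"
  shows "partial i w \<in> test_functions \<Omega>"
proof -
  have sub: "closure {x. partial i w x \<noteq> 0} \<subseteq> closure {x. w x \<noteq> 0}"
    by (rule closure_minimal) (use partial_eq_0_outside in auto)
  have "Ck k (partial i w)" for k using test_functionsD(1)[OF assms, of "Suc k"] by auto
  moreover have "compact (closure {x. partial i w x \<noteq> 0})"
    using sub test_functionsD(5)[OF assms] by (metis closed_closure compact_Int_closed inf.absorb2)
  ultimately show ?thesis using sub test_functionsD(6)[OF assms]
    unfolding test_functions_def by blast
qed

lemma Ck_add_scale: "Ck k f \<Longrightarrow> Ck k g \<Longrightarrow> Ck k (\<lambda>x. a * f x + b * g x)"
proof (induction k arbitrary: f g)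
  case 0 then show ?case by (auto intro!: continuous_intros)
next
  case (Suc k)
  have d: "f differentiable at x" "g differentiable at x" for x
    using Suc.prems by (auto simp: differentiable_on_def)
  have "partial i (\<lambda>x. a * f x + b * g x) = (\<lambda>x. a * partial i f x + b * partial i g x)" for i
  proof
    fix x
    obtain f' g' where fg: "(f has_derivative f') (at x)" "(g has_derivative g') (at x)"
      using d[of x] by (auto simp: differentiable_def)
    show "partial i (\<lambda>x. a * f x + b * g x) x = a * partial i f x + b * partial i g x"
      unfolding partial_eq[OF fg(1)] partial_eq[OF fg(2)]
      by (rule partial_eq) (auto intro!: derivative_eq_intros fg)
  qed
  moreover have "(\<lambda>x. a * f x + b * g x) differentiable_on UNIV"
    using Suc.prems by (auto intro!: derivative_intros)
  ultimately show ?case using Suc by auto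
qed

lemma test_function_scale:
  assumes "w \<in> test_functions \<Omega>" "a \<noteq> 0"
  shows "(\<lambda>x. a * w x) \<in> test_functions \<Omega>"
proof -
  have "{x. a * w x \<noteq> 0} = {x. w x \<noteq> 0}" using assms(2) by auto
  moreover have "Ck k (\<lambda>x. a * w x)" for k
    using Ck_add_scale[OF test_functionsD(1)[OF assms(1), of k] test_functionsD(1)[OF assms(1), of k], of a 0]
    by simp
  ultimately show ?thesis using assms by (auto simp: test_functions_def)
qed

lemma grad_scale:
  assumes "w differentiable at x"
  shows "grad (\<lambda>x. a * w x) x = a *\<^sub>R grad w x"
  by (rule grad_eqI) (auto intro!: derivative_eq_intros has_derivative_grad assms)

lemma continuous_grad:
  assumes "w \<in> test_functions \<Omega>"
  shows "continuous_on A (grad w)"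
  unfolding grad_def using test_functionsD(4)[OF assms] by (intro continuous_intros)

section \<open>Compactly supported continuous functions and integration by parts\<close>

text \<open>The class in which the Lebesgue, Borel and gauge integrals over the whole space all
  exist and agree, so that the proof may pass between them. Some compact set outside which
  \<open>f\<close> vanishes is asked for, a form that products inherit at once.\<close>

definition cc :: "('a::euclidean_space \<Rightarrow> 'b::euclidean_space) \<Rightarrow> bool" where
  "cc f \<longleftrightarrow> continuous_on UNIV f \<and> (\<exists>K. compact K \<and> (\<forall>x. x \<notin> K \<longrightarrow> f x = 0))"

lemma cc_absint:
  assumes "cc f" shows "f absolutely_integrable_on UNIV"
proof -
  obtain K where K: "compact K" "\<And>x. x \<notin> K \<Longrightarrow> f x = 0" and c: "continuous_on UNIV f"
    using assms by (auto simp: cc_def)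
  obtain a b where ab: "K \<subseteq> cbox a b" by (metis K(1) bounded_subset_cbox_symmetric compact_imp_bounded)
  have "f absolutely_integrable_on cbox a b"
    using c by (intro absolutely_integrable_continuous) (auto intro: continuous_on_subset)
  then show ?thesis
    using absolutely_integrable_spike_set_eq[where f=f and S="cbox a b" and T=UNIV] K(2) ab
    by (force intro: negligible_subset[OF negligible_empty])
qed

lemma cc_integrable:
  assumes "cc f" shows "integrable lebesgue f" "f integrable_on UNIV"
   "integral\<^sup>L lebesgue f = integral UNIV f"
  using cc_absint[OF assms]
   apply (simp add: set_integrable_def)
  using absolutely_integrable_on_def assms cc_absint apply blast
  using set_lebesgue_integral_eq_integral(2)[OF cc_absint[OF assms]]
  by (simp add: set_lebesgue_integral_def)

lemma cc_lebesgue_on: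
  assumes "cc f" "\<And>x. x \<notin> S \<Longrightarrow> f x = 0" "S \<in> sets lebesgue"
  shows "integrable (lebesgue_on S) f" "integral\<^sup>L (lebesgue_on S) f = integral UNIV f"
proof -
  have e: "(\<lambda>x. indicat_real S x *\<^sub>R f x) = f" using assms(2) by (auto simp: indicator_def)
  show "integrable (lebesgue_on S) f"
    using cc_integrable(1)[OF assms(1)] assms(3) e by (simp add: integrable_restrict_space)
  show "integral\<^sup>L (lebesgue_on S) f = integral UNIV f"
    using cc_integrable(3)[OF assms(1)] assms(3) e by (simp add: integral_restrict_space)
qed

lemma cc_test:
  assumes "w \<in> test_functions \<Omega>"
  shows "cc w" "cc (partial i w)" "cc (grad w)"
proof -
  have *: "cc u" if "u \<in> test_functions \<Omega>" for u
    unfolding cc_def using test_functionsD(3,5)[OF that] closure_subset[where S="{x. u x \<noteq> 0}"]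
    by (intro conjI exI[of _ "closure {x. u x \<noteq> 0}"]) auto
  show "cc w" "cc (partial i w)" by (intro * assms partial_test_function)+
  have "grad w x = 0" if "x \<notin> closure {x. w x \<noteq> 0}" for x
    using partial_eq_0_outside[OF that] by (simp add: grad_def vec_eq_iff)
  then show "cc (grad w)" unfolding cc_def
    using continuous_grad[OF assms] test_functionsD(5)[OF assms]
    by (intro conjI exI[of _ "closure {x. w x \<noteq> 0}"]) auto
qed

lemma cc_mult: "cc f \<Longrightarrow> continuous_on UNIV g \<Longrightarrow> cc (\<lambda>x. f x * g x)" for f g :: "_ \<Rightarrow> real"
  unfolding cc_def by (auto intro!: continuous_intros)

lemma cc_norm2: "cc f \<Longrightarrow> cc (\<lambda>x. (norm (f x))\<^sup>2)"
  unfolding cc_def by (auto intro!: continuous_intros)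

lemma open_lebesgue[simp]: "open S \<Longrightarrow> S \<in> sets lebesgue" by auto

lemma cc_L2:
  assumes "cc f" "open \<Omega>" shows "f \<in> L2 \<Omega>"
proof -
  have "integrable lebesgue (\<lambda>x. (norm (f x))\<^sup>2)" using cc_integrable cc_norm2 assms by blast
  then have "integrable (lebesgue_on \<Omega>) (\<lambda>x. (norm (f x))\<^sup>2)"
    using assms(2) integrable_mult_indicator[of \<Omega> lebesgue "\<lambda>x. (norm (f x))\<^sup>2"]
    by (subst integrable_restrict_space) auto
  moreover have "f \<in> borel_measurable lebesgue"
    using cc_integrable(1)[OF assms(1)] by auto
  then have "f \<in> borel_measurable (lebesgue_on \<Omega>)" by (simp add: measurable_restrict_space1)
  ultimately show ?thesis by (simp add: L2_def)
qed

lemma cc_lborel: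
  assumes "cc f"
  shows "integrable lborel f" "integral\<^sup>L lborel f = integral UNIV f"
proof -
  have [measurable]: "f \<in> borel_measurable lborel"
    using assms unfolding cc_def by (simp add: borel_measurable_continuous_onI)
  show "integrable lborel f" using cc_integrable(1)[OF assms] integrable_completion[of f lborel] by simp
  show "integral\<^sup>L lborel f = integral UNIV f"
    using cc_integrable(3)[OF assms] integral_completion[of f lborel] by simp
qed

lemma integral_shift_UNIV:
  fixes f :: "real^'n \<Rightarrow> real"
  assumes "cc f"
  shows "integral UNIV (\<lambda>x. f (x + c)) = integral UNIV f"
proof -
  have f: "continuous_on UNIV f" using assms by (simp add: cc_def)
  then have [measurable]: "f \<in> borel_measurable borel" by (rule borel_measurable_continuous_onI)
  obtain K where K: "compact K" "\<And>x. x \<notin> K \<Longrightarrow> f x = 0" using assms by (auto simp: cc_def)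
  have "cc (\<lambda>x. f (c + x))" unfolding cc_def
  proof (intro conjI exI allI impI)
    show "continuous_on UNIV (\<lambda>x. f (c + x))"
      by (intro continuous_on_compose2[OF f] continuous_intros) auto
    show "compact ((+) (- c) ` K)" using K(1) by (rule compact_translation)
    fix x assume "x \<notin> (+) (- c) ` K"
    then have "c + x \<notin> K" by (metis add_minus_cancel image_eqI minus_minus)
    then show "f (c + x) = 0" by (rule K)
  qed
  then have "integral UNIV (\<lambda>x. f (c + x)) = integral\<^sup>L lborel (\<lambda>x. f (c + x))"
    using cc_lborel(2) by metis
  also have "\<dots> = integral\<^sup>L (distr lborel borel ((+) c)) f"
    by (subst integral_distr) auto
  finally show ?thesis by (simp add: lborel_distr_plus cc_lborel[OF assms] add.commute)
qed

text \<open>The integral of \<open>f\<close> translated by \<open>t\<close> along axis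
  \<open>i\<close> does not depend on \<open>t\<close>; differentiating under the integral sign at
  \<open>t = 0\<close> gives the claim. This takes the place of Fubini's theorem and the fundamental
  theorem of calculus.\<close>

lemma integral_partial_zero:
  fixes f :: "real^'n \<Rightarrow> real"
  assumes f: "cc f" "f differentiable_on UNIV" and p: "\<And>i. continuous_on UNIV (partial i f)"
  shows "integral UNIV (partial i f) = 0"
proof -
  obtain K where K: "compact K" "\<And>x. x \<notin> K \<Longrightarrow> f x = 0"
    using f by (auto simp: cc_def)
  obtain B where B: "B > 0" "\<And>x. x \<in> K \<Longrightarrow> norm x \<le> B"
    using compact_imp_bounded[OF K(1)] bounded_pos[of K] by auto
  \<comment> \<open>The margin 1 keeps the support of every translate with |t| < 1 inside one box,
    so that the Leibniz rule has a fixed compact domain of integration.\<close>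
  obtain a b where ab: "ball 0 (B+1) \<subseteq> cbox a (b::real^'n)" by (metis bounded_ball bounded_subset_cbox_symmetric)
  let ?e = "axis i 1 :: real^'n"
  have df: "(f has_derivative (\<lambda>h. grad f x \<bullet> h)) (at x)" for x
    using f(2) has_derivative_grad by (auto simp: differentiable_on_def)
  have cg: "continuous_on UNIV (grad f)" unfolding grad_def using p by (intro continuous_intros)
  have gi: "grad f x \<bullet> ?e = partial i f x" for x by (simp add: grad_def inner_axis)
  have z: "f (x + t *\<^sub>R ?e) = 0" if "t \<in> {-1<..<1}" "x \<notin> cbox a b" for x t
  proof -
    have "x \<notin> ball 0 (B+1)" using that ab by auto
    moreover have "norm (t *\<^sub>R ?e) < 1" using that by auto
    moreover have "norm x \<le> norm (x + t *\<^sub>R ?e) + norm (t *\<^sub>R ?e)"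
      using norm_triangle_ineq4[of "x + t *\<^sub>R ?e" "t *\<^sub>R ?e"] by simp
    ultimately have "norm (x + t *\<^sub>R ?e) > B" by auto
    then show ?thesis using B(2) K(2) by force
  qed
  have sh: "integral (cbox a b) (\<lambda>x. f (x + t *\<^sub>R ?e)) = integral UNIV f" if "t \<in> {-1<..<1}" for t
  proof -
    have "integral (cbox a b) (\<lambda>x. f (x + t *\<^sub>R ?e)) = integral UNIV (\<lambda>x. f (x + t *\<^sub>R ?e))"
      by (rule integral_spike_set) (use z that in \<open>auto intro: negligible_subset[OF negligible_empty]\<close>)
    also have "\<dots> = integral UNIV f"
      by (rule integral_shift_UNIV[OF f(1)])
    finally show ?thesis .
  qed
  have cf: "continuous_on UNIV f" using f(1) by (simp add: cc_def)
  have o: "(0::real) \<in> {-1<..<1}" "open {-1<..<1::real}" by auto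
  have D1: "((\<lambda>t. integral (cbox a b) (\<lambda>x. f (x + t *\<^sub>R ?e))) has_field_derivative
          integral (cbox a b) (\<lambda>x. partial i f (x + 0 *\<^sub>R ?e))) (at 0 within {-1<..<1})"
  proof (rule leibniz_rule_field_derivative)
    show "((\<lambda>t. f (x + t *\<^sub>R ?e)) has_field_derivative partial i f (x + t *\<^sub>R ?e)) (at t within {-1<..<1})" for t x
      unfolding gi[symmetric] has_field_derivative_def
      by (rule has_derivative_eq_rhs, rule has_derivative_compose[OF _ df])
         (auto intro!: derivative_eq_intros simp: fun_eq_iff inner_commute)
    show "(\<lambda>x. f (x + t *\<^sub>R ?e)) integrable_on cbox a b" for t
      by (intro integrable_continuous continuous_on_compose2[OF cf] continuous_intros) auto
    show "continuous_on ({-1<..<1} \<times> cbox a b) (\<lambda>(t, x). partial i f (x + t *\<^sub>R ?e))"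
      unfolding split_beta by (intro continuous_on_compose2[OF p] continuous_intros) auto
  qed auto
  have "((\<lambda>t. integral UNIV f) has_field_derivative 0) (at 0)" by (rule DERIV_const)
  then have D2: "((\<lambda>t. integral (cbox a b) (\<lambda>x. f (x + t *\<^sub>R ?e))) has_field_derivative 0) (at 0)"
    by (rule has_field_derivative_transform_within_open[OF _ o(2) o(1)]) (simp add: sh)
  have "integral (cbox a b) (partial i f) = 0"
    using DERIV_unique[OF D1[unfolded at_within_open[OF o]] D2] by simp
  moreover have "integral (cbox a b) (partial i f) = integral UNIV (partial i f)"
  proof (rule integral_spike_set)
    have "partial i f x = 0" if "x \<notin> cbox a b" for x
    proof (rule partial_eq_0_outside)
      have "closure {x. f x \<noteq> 0} \<subseteq> K" using K compact_imp_closed by (intro closure_minimal) auto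
      then show "x \<notin> closure {x. f x \<noteq> 0}" using that ab B by force
    qed
    then show "negligible {x \<in> UNIV - cbox a b. partial i f x \<noteq> 0}"
      by (auto intro: negligible_subset[OF negligible_empty])
  qed auto
  ultimately show ?thesis by simp
qed

lemma integral_by_parts_test:
  assumes u: "u \<in> test_functions \<Omega>" and w: "w \<in> test_functions \<Omega>"
  shows "integral UNIV (\<lambda>x. u x * partial i w x) = - integral UNIV (\<lambda>x. partial i u x * w x)"
proof -
  have uw: "continuous_on UNIV u" "continuous_on UNIV w" "\<And>i. continuous_on UNIV (partial i u)"
     "\<And>i. continuous_on UNIV (partial i w)"
    by (fact test_functionsD(3)[OF u] test_functionsD(3)[OF w] test_functionsD(4)[OF u] test_functionsD(4)[OF w])+
  have p: "partial i (\<lambda>x. u x * w x) = (\<lambda>x. u x * partial i w x + partial i u x * w x)" for i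
  proof
    fix x
    obtain u' w' where *: "(u has_derivative u') (at x)" "(w has_derivative w') (at x)"
      using test_functionsD(2)[OF u, of x] test_functionsD(2)[OF w, of x] by (auto simp: differentiable_def)
    show "partial i (\<lambda>x. u x * w x) x = u x * partial i w x + partial i u x * w x"
      unfolding *[THEN partial_eq] by (rule partial_eq) (auto intro!: derivative_eq_intros *)
  qed
  have "integral UNIV (partial i (\<lambda>x. u x * w x)) = 0"
  proof (rule integral_partial_zero)
    show "cc (\<lambda>x. u x * w x)" by (rule cc_mult[OF cc_test(1)[OF u] uw(2)])
    show "(\<lambda>x. u x * w x) differentiable_on UNIV"
      unfolding differentiable_on_def using test_functionsD(2)[OF u] test_functionsD(2)[OF w]
      by (intro ballI differentiable_mult) auto
    show "continuous_on UNIV (partial i (\<lambda>x. u x * w x))" for i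
      unfolding p by (intro continuous_intros uw)
  qed
  moreover have "cc (\<lambda>x. partial i u x * w x)" by (rule cc_mult[OF cc_test(2)[OF u] uw(2)])
  moreover have "cc (\<lambda>x. u x * partial i w x)" by (rule cc_mult[OF cc_test(1)[OF u] uw(4)])
  ultimately show ?thesis unfolding p
    using integral_add[of "\<lambda>x. u x * partial i w x" UNIV "\<lambda>x. partial i u x * w x"]
       cc_integrable(2)[of "\<lambda>x. u x * partial i w x"] cc_integrable(2)[of "\<lambda>x. partial i u x * w x"]
    by simp
qed

lemma weak_gradient_test:
  assumes u: "u \<in> test_functions \<Omega>" and "open \<Omega>"
  shows "weak_gradient \<Omega> u (grad u)"
  unfolding weak_gradient_def
proof (intro conjI ballI allI)
  show "u \<in> L2 \<Omega>" "grad u \<in> L2 \<Omega>" by (intro cc_L2 cc_test[OF u] assms(2))+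
  fix w i assume w: "w \<in> test_functions \<Omega>"
  have "cc (\<lambda>x. partial i u x * w x)" "cc (\<lambda>x. u x * partial i w x)"
    by (intro cc_mult cc_test[OF u] test_functionsD(3)[OF w] test_functionsD(4)[OF w])+
  then have "(LINT x|lebesgue_on \<Omega>. u x * partial i w x) = integral UNIV (\<lambda>x. u x * partial i w x)"
    "(LINT x|lebesgue_on \<Omega>. partial i u x * w x) = integral UNIV (\<lambda>x. partial i u x * w x)"
    using test_functionsD(7)[OF u] test_functionsD(7)[OF w] assms(2)
    by (intro cc_lebesgue_on; simp)+
  then show "(LINT x|lebesgue_on \<Omega>. u x * partial i w x) = - (LINT x|lebesgue_on \<Omega>. grad u x $ i * w x)"
    using integral_by_parts_test[OF u w] by (simp add: grad_def)
qed

lemma L2_norm_0: "L2_norm \<Omega> (\<lambda>x. 0) = 0"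
  by (simp add: L2_norm_def L2_inner_def)

lemma test_H10:
  assumes u: "u \<in> test_functions \<Omega>" and "open \<Omega>"
  shows "u \<in> H10 \<Omega>"
  unfolding H10_def using weak_gradient_test[OF assms] u
  by (auto intro!: exI[of _ "grad u"] exI[of _ "\<lambda>k. u"] simp: L2_norm_0)

section \<open>The scalar product of L2\<close>

lemma L2_inner_integrable:
  assumes f: "f \<in> L2 \<Omega>" and g: "g \<in> L2 \<Omega>"
  shows "integrable (lebesgue_on \<Omega>) (\<lambda>x. f x \<bullet> g x)"
proof (rule Bochner_Integration.integrable_bound)
  show "integrable (lebesgue_on \<Omega>) (\<lambda>x. (norm (f x))\<^sup>2 + (norm (g x))\<^sup>2)"
    using f g by (auto simp: L2_def)
  show "(\<lambda>x. f x \<bullet> g x) \<in> borel_measurable (lebesgue_on \<Omega>)"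
    using f g by (auto simp: L2_def intro!: borel_measurable_inner)
  show "AE x in lebesgue_on \<Omega>. norm (f x \<bullet> g x) \<le> norm ((norm (f x))\<^sup>2 + (norm (g x))\<^sup>2)"
  proof (rule AE_I2)
    fix x
    have "norm (f x \<bullet> g x) \<le> norm (f x) * norm (g x)" by (simp add: Cauchy_Schwarz_ineq2)
    also have "\<dots> \<le> (norm (f x))\<^sup>2 + (norm (g x))\<^sup>2"
      using sum_squares_bound[of "norm (f x)" "norm (g x)"] mult_nonneg_nonneg[OF norm_ge_zero[of "f x"] norm_ge_zero[of "g x"]] by linarith
    finally show "norm (f x \<bullet> g x) \<le> norm ((norm (f x))\<^sup>2 + (norm (g x))\<^sup>2)" by simp
  qed
qed

lemma L2_lin:
  assumes f: "f \<in> L2 \<Omega>" and g: "g \<in> L2 \<Omega>"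
  shows "(\<lambda>x. a *\<^sub>R f x + b *\<^sub>R g x) \<in> L2 \<Omega>"
proof -
  have "integrable (lebesgue_on \<Omega>) (\<lambda>x. a^2 * (norm (f x))\<^sup>2 + b^2 * (norm (g x))\<^sup>2 + 2*a*b* (f x \<bullet> g x))"
    using f g L2_inner_integrable[OF f g] by (auto simp: L2_def)
  moreover have "a^2 * (norm (f x))\<^sup>2 + b^2 * (norm (g x))\<^sup>2 + 2*a*b* (f x \<bullet> g x) = (norm (a *\<^sub>R f x + b *\<^sub>R g x))\<^sup>2" for x
    unfolding power2_norm_eq_inner by (simp add: inner_simps inner_commute power2_eq_square algebra_simps)
  ultimately show ?thesis using f g by (auto simp: L2_def)
qed

lemma L2_diff: "f \<in> L2 \<Omega> \<Longrightarrow> g \<in> L2 \<Omega> \<Longrightarrow> (\<lambda>x. f x - g x) \<in> L2 \<Omega>"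
  using L2_lin[of f \<Omega> g 1 "-1"] by simp

lemma L2_inner_lin_left:
  assumes "f \<in> L2 \<Omega>" "g \<in> L2 \<Omega>" "h \<in> L2 \<Omega>"
  shows "L2_inner \<Omega> (\<lambda>x. a *\<^sub>R f x + b *\<^sub>R g x) h = a * L2_inner \<Omega> f h + b * L2_inner \<Omega> g h"
  using L2_inner_integrable[OF assms(1,3)] L2_inner_integrable[OF assms(2,3)]
  by (simp add: L2_inner_def inner_add_left)

lemma L2_inner_commute: "L2_inner \<Omega> f g = L2_inner \<Omega> g f"
  by (simp add: L2_inner_def inner_commute)

lemma L2_inner_diff_left:
  assumes "f \<in> L2 \<Omega>" "g \<in> L2 \<Omega>" "h \<in> L2 \<Omega>"
  shows "L2_inner \<Omega> (\<lambda>x. f x - g x) h = L2_inner \<Omega> f h - L2_inner \<Omega> g h"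
  using L2_inner_lin_left[OF assms, of 1 "-1"] by simp

lemma L2_inner_self_ge_0: "L2_inner \<Omega> f f \<ge> 0"
  unfolding L2_inner_def by (rule integral_nonneg_AE) auto

lemma L2_norm_ge_0: "L2_norm \<Omega> f \<ge> 0"
  by (simp add: L2_norm_def L2_inner_self_ge_0)

lemma L2_norm_power2: "(L2_norm \<Omega> f)\<^sup>2 = L2_inner \<Omega> f f"
  by (simp add: L2_norm_def L2_inner_self_ge_0)

lemma L2_Cauchy_Schwarz:
  assumes f: "f \<in> L2 \<Omega>" and g: "g \<in> L2 \<Omega>"
  shows "\<bar>L2_inner \<Omega> f g\<bar> \<le> L2_norm \<Omega> f * L2_norm \<Omega> g"
proof -
  let ?A = "L2_inner \<Omega> f f" and ?B = "L2_inner \<Omega> f g" and ?D = "L2_inner \<Omega> g g"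
  have q: "t^2 * ?A - 2 * t * ?B + ?D \<ge> 0" for t
  proof -
    let ?h = "\<lambda>x. t *\<^sub>R f x + (-1) *\<^sub>R g x"
    have h: "?h \<in> L2 \<Omega>" by (rule L2_lin[OF f g])
    have "L2_inner \<Omega> ?h ?h = t * (t * ?A + (-1) * L2_inner \<Omega> g f) + (-1) * (t * ?B + (-1) * ?D)"
      unfolding L2_inner_lin_left[OF f g h] L2_inner_commute[of \<Omega> f ?h] L2_inner_commute[of \<Omega> g ?h]
        L2_inner_lin_left[OF f g f] L2_inner_lin_left[OF f g g] ..
    then show ?thesis using L2_inner_self_ge_0[of \<Omega> ?h]
      by (simp add: L2_inner_commute[of \<Omega> g f] algebra_simps power2_eq_square)
  qed
  have "?B^2 \<le> ?A * ?D"
  proof (cases "?A = 0")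
    case True
    have "?B = 0"
    proof (rule ccontr)
      assume "?B \<noteq> 0"
      \<comment> \<open>With this \<open>t\<close> the remaining linear expression equals
        -1.\<close>
      then show False using q[of "(?D + 1) / (2 * ?B)"] True by simp
    qed
    then show ?thesis using True by simp
  next
    case False
    then have A: "?A > 0" using L2_inner_self_ge_0[of \<Omega> f] by linarith
    \<comment> \<open>The quadratic is minimal at \<open>t = ?B / ?A\<close>.\<close>
    have "(?B / ?A)^2 * ?A - 2 * (?B / ?A) * ?B + ?D = ?D - ?B^2 / ?A"
      using A by (simp add: field_simps power2_eq_square)
    then have "?B^2 / ?A \<le> ?D" using q[of "?B / ?A"] by linarith
    then show ?thesis using A by (simp add: field_simps)
  qed
  then have "\<bar>?B\<bar> \<le> sqrt (?A * ?D)" by (metis real_sqrt_abs real_sqrt_le_iff)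
  then show ?thesis by (simp add: L2_norm_def real_sqrt_mult)
qed

section \<open>Limits along test functions, and bounds for the dual norm\<close>

lemma L2_inner_tendsto:
  assumes f: "f \<in> L2 \<Omega>" and w: "\<And>k. w k \<in> L2 \<Omega>" and v: "v \<in> L2 \<Omega>"
    and lim: "(\<lambda>k. L2_norm \<Omega> (\<lambda>x. v x - w k x)) \<longlonglongrightarrow> 0"
  shows "(\<lambda>k. L2_inner \<Omega> f (w k)) \<longlonglongrightarrow> L2_inner \<Omega> f v"
proof -
  have "(\<lambda>k. L2_inner \<Omega> f v - L2_inner \<Omega> f (w k)) \<longlonglongrightarrow> 0"
  proof (rule Lim_null_comparison)
    show "(\<lambda>k. L2_norm \<Omega> f * L2_norm \<Omega> (\<lambda>x. v x - w k x)) \<longlonglongrightarrow> 0"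
      using tendsto_mult_left[OF lim, of "L2_norm \<Omega> f"] by simp
    show "\<forall>\<^sub>F k in sequentially. norm (L2_inner \<Omega> f v - L2_inner \<Omega> f (w k)) \<le> L2_norm \<Omega> f * L2_norm \<Omega> (\<lambda>x. v x - w k x)"
    proof (rule always_eventually, rule)
      fix k
      have "L2_inner \<Omega> f v - L2_inner \<Omega> f (w k) = L2_inner \<Omega> f (\<lambda>x. v x - w k x)"
        using L2_inner_diff_left[OF v w[of k] f] by (simp add: L2_inner_commute[of \<Omega> f])
      then show "norm (L2_inner \<Omega> f v - L2_inner \<Omega> f (w k)) \<le> L2_norm \<Omega> f * L2_norm \<Omega> (\<lambda>x. v x - w k x)"
        using L2_Cauchy_Schwarz[OF f L2_diff[OF v w[of k]]] by simp
    qed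
  qed
  then show ?thesis using Lim_transform_eq[of "\<lambda>k. L2_inner \<Omega> f v" "\<lambda>k. L2_inner \<Omega> f (w k)"] tendsto_const by blast
qed

text \<open>No uniqueness of weak gradients is needed: with test functions \<open>w\<^sub>k\<close> whose gradients tend to \<open>h\<close>,
  \<open>\<parallel>h\<parallel>\<^sup>2 = lim (h, \<nabla>w\<^sub>k) = lim (g, \<nabla>w\<^sub>k) = (g, h) \<le> \<parallel>g\<parallel> \<parallel>h\<parallel>\<close>.\<close>

lemma cc_axis:
  fixes f :: "real^'n \<Rightarrow> real"
  assumes "cc f" shows "cc (\<lambda>x. axis i (f x))"
proof -
  have "continuous_on UNIV (\<lambda>x. f x *\<^sub>R axis i (1::real))"
    using assms by (intro continuous_intros) (simp add: cc_def)
  moreover have "(\<lambda>x. f x *\<^sub>R axis i (1::real)) = (\<lambda>x. axis i (f x))"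
    by (simp add: fun_eq_iff vec_eq_iff axis_def)
  ultimately have c: "continuous_on UNIV (\<lambda>x. axis i (f x))" by metis
  obtain K where "compact K" "\<And>x. x \<notin> K \<Longrightarrow> f x = 0" using assms by (auto simp: cc_def)
  then have "compact K \<and> (\<forall>x. x \<notin> K \<longrightarrow> axis i (f x) = 0)" by (auto simp: axis_def vec_eq_iff)
  then show ?thesis unfolding cc_def using c by blast
qed

lemma weak_gradient_limit_norm_le:
  assumes g: "weak_gradient \<Omega> v g" and h: "weak_gradient \<Omega> v h" and "open \<Omega>"
    and w: "\<And>k. w k \<in> test_functions \<Omega>"
    and lim: "(\<lambda>k. L2_norm \<Omega> (\<lambda>x. h x - grad (w k) x)) \<longlonglongrightarrow> 0"
  shows "L2_norm \<Omega> h \<le> L2_norm \<Omega> g"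
proof -
  have L2: "g \<in> L2 \<Omega>" "h \<in> L2 \<Omega>" "\<And>k. grad (w k) \<in> L2 \<Omega>"
    using g h cc_L2[OF cc_test(3)[OF w] \<open>open \<Omega>\<close>] by (auto simp: weak_gradient_def)
  \<comment> \<open>Each \<open>partial i (w k)\<close> is again a test function. Hence the pairing
    of a weak gradient of \<open>v\<close> with \<open>grad (w k)\<close> is a pairing of
    \<open>v\<close> with second derivatives, the same for every weak gradient of
    \<open>v\<close>.\<close>
  have e: "L2_inner \<Omega> g' (grad (w k)) = (\<Sum>i\<in>UNIV. - (LINT x|lebesgue_on \<Omega>. v x * partial i (partial i (w k)) x))"
    if g': "weak_gradient \<Omega> v g'" for g' k
  proof -
    have L: "g' \<in> L2 \<Omega>" using g' by (simp add: weak_gradient_def)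
    have "integrable (lebesgue_on \<Omega>) (\<lambda>x. g' x $ i * partial i (w k) x)" for i
    proof -
      \<comment> \<open>A field with a single component turns the integrability of inner products
        into that of one summand.\<close>
      have "cc (\<lambda>x. axis i (partial i (w k) x))"
        by (rule cc_axis[OF cc_test(2)[OF w]])
      then have "(\<lambda>x. axis i (partial i (w k) x)) \<in> L2 \<Omega>" by (rule cc_L2[OF _ \<open>open \<Omega>\<close>])
      from L2_inner_integrable[OF L this] show ?thesis by (simp add: inner_axis)
    qed
    then have "L2_inner \<Omega> g' (grad (w k)) = (\<Sum>i\<in>UNIV. (LINT x|lebesgue_on \<Omega>. g' x $ i * partial i (w k) x))"
      unfolding L2_inner_def by (simp add: inner_vec_def grad_def)
    also have "\<dots> = (\<Sum>i\<in>UNIV. - (LINT x|lebesgue_on \<Omega>. v x * partial i (partial i (w k)) x))"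
      using g' partial_test_function[OF w] by (simp add: weak_gradient_def)
    finally show ?thesis .
  qed
  have "(\<lambda>k. L2_inner \<Omega> h (grad (w k))) \<longlonglongrightarrow> L2_inner \<Omega> h h"
    by (rule L2_inner_tendsto[OF L2(2) L2(3) L2(2) lim])
  moreover have "(\<lambda>k. L2_inner \<Omega> g (grad (w k))) \<longlonglongrightarrow> L2_inner \<Omega> g h"
    by (rule L2_inner_tendsto[OF L2(1) L2(3) L2(2) lim])
  ultimately have "L2_inner \<Omega> h h = L2_inner \<Omega> g h"
    unfolding e[OF g] e[OF h] by (rule LIMSEQ_unique)
  also have "\<dots> \<le> L2_norm \<Omega> g * L2_norm \<Omega> h" using L2_Cauchy_Schwarz[OF L2(1,2)] by linarith
  finally have "L2_norm \<Omega> h * L2_norm \<Omega> h \<le> L2_norm \<Omega> g * L2_norm \<Omega> h"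
    by (simp add: L2_norm_power2[symmetric] power2_eq_square)
  then show ?thesis using L2_norm_ge_0[of \<Omega> g] L2_norm_ge_0[of \<Omega> h]
    by (metis mult_right_le_imp_le order_le_less)
qed

text \<open>The bound passes to the limit along the test functions that approximate
  \<open>v\<close>. Their gradients converge to one particular weak gradient \<open>h\<close>; since
  the norm of \<open>h\<close> is at most that of any other weak gradient, the given
  \<open>g\<close> may stand in the conclusion.\<close>

lemma H10_pairing_le:
  assumes "open \<Omega>" and \<phi>: "\<phi> \<in> L2 \<Omega>" and M: "0 \<le> M"
    and bd: "\<And>w. w \<in> test_functions \<Omega> \<Longrightarrow> L2_inner \<Omega> \<phi> w \<le> M * L2_norm \<Omega> (grad w)"
    and v: "v \<in> H10 \<Omega>" and g: "weak_gradient \<Omega> v g"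
  shows "L2_inner \<Omega> \<phi> v \<le> M * L2_norm \<Omega> g"
proof -
  obtain h w where h: "weak_gradient \<Omega> v h" and w: "\<And>k. w k \<in> test_functions \<Omega>"
    and l1: "(\<lambda>k. L2_norm \<Omega> (\<lambda>x. v x - w k x)) \<longlonglongrightarrow> 0"
    and l2: "(\<lambda>k. L2_norm \<Omega> (\<lambda>x. h x - grad (w k) x)) \<longlonglongrightarrow> 0"
    using v unfolding H10_def by blast
  have L2: "v \<in> L2 \<Omega>" "h \<in> L2 \<Omega>" using h by (auto simp: weak_gradient_def)
  have wL: "w k \<in> L2 \<Omega>" "grad (w k) \<in> L2 \<Omega>" for k
    by (rule cc_L2[OF cc_test(1)[OF w] \<open>open \<Omega>\<close>], rule cc_L2[OF cc_test(3)[OF w] \<open>open \<Omega>\<close>])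
  have tri: "L2_norm \<Omega> (grad (w k)) \<le> L2_norm \<Omega> h + L2_norm \<Omega> (\<lambda>x. h x - grad (w k) x)" for k
  proof -
    let ?d = "\<lambda>x. h x - grad (w k) x"
    have d: "?d \<in> L2 \<Omega>" by (rule L2_diff[OF L2(2) wL(2)])
    have "L2_inner \<Omega> (grad (w k)) (grad (w k)) = L2_inner \<Omega> h h - 2 * L2_inner \<Omega> h ?d + L2_inner \<Omega> ?d ?d"
      using L2_inner_diff_left[OF L2(2) wL(2)[of k] d] L2_inner_diff_left[OF L2(2) wL(2)[of k] L2(2)]
       L2_inner_diff_left[OF L2(2) wL(2)[of k] wL(2)[of k]]
       L2_inner_commute[of \<Omega> h ?d] L2_inner_commute[of \<Omega> "grad (w k)" ?d] L2_inner_commute[of \<Omega> "grad (w k)" h]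
      by linarith
    also have "\<dots> \<le> (L2_norm \<Omega> h)\<^sup>2 + 2 * (L2_norm \<Omega> h * L2_norm \<Omega> ?d) + (L2_norm \<Omega> ?d)\<^sup>2"
      using L2_Cauchy_Schwarz[OF L2(2) d] unfolding L2_norm_power2 by linarith
    also have "\<dots> = (L2_norm \<Omega> h + L2_norm \<Omega> ?d)\<^sup>2" by (simp add: power2_eq_square algebra_simps)
    finally show ?thesis unfolding L2_norm_power2[symmetric]
      by (rule power2_le_imp_le) (simp add: L2_norm_ge_0)
  qed
  have "(\<lambda>k. L2_inner \<Omega> \<phi> (w k)) \<longlonglongrightarrow> L2_inner \<Omega> \<phi> v"
    by (rule L2_inner_tendsto[OF \<phi> wL(1) L2(1) l1])
  moreover have "(\<lambda>k. M * (L2_norm \<Omega> h + L2_norm \<Omega> (\<lambda>x. h x - grad (w k) x))) \<longlonglongrightarrow> M * (L2_norm \<Omega> h + 0)"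
    by (intro tendsto_intros l2)
  moreover have "L2_inner \<Omega> \<phi> (w k) \<le> M * (L2_norm \<Omega> h + L2_norm \<Omega> (\<lambda>x. h x - grad (w k) x))" for k
    using bd[OF w, of k] mult_left_mono[OF tri[of k] M] by linarith
  ultimately have "L2_inner \<Omega> \<phi> v \<le> M * (L2_norm \<Omega> h + 0)"
    by (intro LIMSEQ_le) auto
  also have "\<dots> \<le> M * L2_norm \<Omega> g"
    using weak_gradient_limit_norm_le[OF g h \<open>open \<Omega>\<close> w l2] M by (simp add: mult_left_mono)
  finally show ?thesis .
qed

text \<open>The dual norm ranges over \<open>v\<close> of nonzero \<open>L2_norm\<close>. A
  continuous function that is nonzero at a point is nonzero on an open set, which is not
  negligible.\<close>

lemma L2_norm_pos:
  assumes "u \<in> test_functions \<Omega>" "open \<Omega>" "u x \<noteq> 0"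
  shows "L2_norm \<Omega> u \<noteq> 0"
proof
  assume 0: "L2_norm \<Omega> u = 0"
  have c: "continuous_on UNIV u" "cc u" using test_functionsD(3)[OF assms(1)] cc_test(1)[OF assms(1)] .
  then have cc2: "cc (\<lambda>x. (norm (u x))\<^sup>2)" by (intro cc_norm2)
  have "integral UNIV (\<lambda>x. (norm (u x))\<^sup>2) = L2_inner \<Omega> u u"
    unfolding L2_inner_def using cc_lebesgue_on(2)[OF cc2, of \<Omega>] test_functionsD(7)[OF assms(1)] assms(2)
    by (simp add: power2_eq_square)
  also have "\<dots> = 0" using 0 by (simp add: L2_norm_power2[symmetric])
  finally have "integral UNIV (\<lambda>x. (norm (u x))\<^sup>2) = 0" .
  have o: "open {x. u x \<noteq> 0}" using c by (intro open_Collect_neq) auto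
  then have "\<not> negligible {x. u x \<noteq> 0}" using assms(3) open_not_negligible by blast
  moreover have "AE x in lebesgue. (norm (u x))\<^sup>2 = 0"
    using \<open>integral UNIV (\<lambda>x. (norm (u x))\<^sup>2) = 0\<close> cc_integrable(1,3)[OF cc2]
    by (subst integral_nonneg_eq_0_iff_AE[symmetric]) auto
  then have "negligible {x. u x \<noteq> 0}"
    using borel_open[OF o] by (simp add: negligible_iff_null_sets AE_iff_null)
  ultimately show False by simp
qed

text \<open>If \<open>g\<close> has norm 0, the quotient is 0 by the convention for division, and
  the bound holds because \<open>M\<close> is nonnegative.\<close>

lemma Hm1_set_bound:
  assumes "open \<Omega>" and \<phi>: "\<phi> \<in> L2 \<Omega>" and M: "0 \<le> M"
    and bd: "\<And>w. w \<in> test_functions \<Omega> \<Longrightarrow> L2_inner \<Omega> \<phi> w \<le> M * L2_norm \<Omega> (grad w)"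
    and v: "v \<in> H10 \<Omega>" and g: "weak_gradient \<Omega> v g"
  shows "L2_inner \<Omega> \<phi> v / L2_norm \<Omega> g \<le> M"
proof (cases "L2_norm \<Omega> g = 0")
  case False
  then have "L2_norm \<Omega> g > 0" using L2_norm_ge_0[of \<Omega> g] by linarith
  then show ?thesis using H10_pairing_le[OF assms] by (simp add: field_simps)
qed (use M in simp)

text \<open>The nonzero test function \<open>u\<close> makes the set of quotients nonempty; without
  an element, \<open>Sup\<close> would be an unspecified value.\<close>

lemma Hm1_norm_le:
  assumes "open \<Omega>" and \<phi>: "\<phi> \<in> L2 \<Omega>" and M: "0 \<le> M"
    and bd: "\<And>w. w \<in> test_functions \<Omega> \<Longrightarrow> L2_inner \<Omega> \<phi> w \<le> M * L2_norm \<Omega> (grad w)"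
    and u: "u \<in> test_functions \<Omega>" "u x \<noteq> 0"
  shows "Hm1_norm \<Omega> \<phi> \<le> M"
  unfolding Hm1_norm_def
proof (rule cSup_least)
  show "{L2_inner \<Omega> \<phi> v / L2_norm \<Omega> g |v g. v \<in> H10 \<Omega> \<and> weak_gradient \<Omega> v g \<and> L2_norm \<Omega> v \<noteq> 0} \<noteq> {}"
    using test_H10[OF u(1) \<open>open \<Omega>\<close>] weak_gradient_test[OF u(1) \<open>open \<Omega>\<close>] L2_norm_pos[OF u(1) \<open>open \<Omega>\<close> u(2)] by blast
qed (use Hm1_set_bound[OF assms(1-4)] in blast)

text \<open>The a priori constant \<open>M\<close> bounds the quotients, so that \<open>Sup\<close>
  is a genuine supremum. It also settles the case of a vanishing gradient norm, in which the
  quotient carries no information.\<close>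

lemma pairing_le_Hm1_norm:
  assumes "open \<Omega>" and \<phi>: "\<phi> \<in> L2 \<Omega>" and M: "0 \<le> M"
    and bd: "\<And>w. w \<in> test_functions \<Omega> \<Longrightarrow> L2_inner \<Omega> \<phi> w \<le> M * L2_norm \<Omega> (grad w)"
    and w: "w \<in> test_functions \<Omega>"
  shows "L2_inner \<Omega> \<phi> w \<le> Hm1_norm \<Omega> \<phi> * L2_norm \<Omega> (grad w)"
proof (cases "L2_norm \<Omega> (grad w) = 0")
  case True
  then show ?thesis using bd[OF w] by simp
next
  case False
  then have p: "L2_norm \<Omega> (grad w) > 0" using L2_norm_ge_0[of \<Omega> "grad w"] by linarith
  have "\<exists>x. w x \<noteq> 0"
  proof (rule ccontr)
    assume "\<not> ?thesis"
    then have "w = (\<lambda>x. 0)" by auto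
    then have "grad w = (\<lambda>x. 0)" by (auto intro!: grad_eqI)
    then show False using False by (simp add: L2_norm_0)
  qed
  then obtain x where x: "w x \<noteq> 0" by blast
  have "L2_inner \<Omega> \<phi> w / L2_norm \<Omega> (grad w) \<le> Hm1_norm \<Omega> \<phi>"
    unfolding Hm1_norm_def
  proof (rule cSup_upper)
    show "L2_inner \<Omega> \<phi> w / L2_norm \<Omega> (grad w) \<in> {L2_inner \<Omega> \<phi> v / L2_norm \<Omega> g |v g. v \<in> H10 \<Omega> \<and> weak_gradient \<Omega> v g \<and> L2_norm \<Omega> v \<noteq> 0}"
      using test_H10[OF w \<open>open \<Omega>\<close>] weak_gradient_test[OF w \<open>open \<Omega>\<close>] L2_norm_pos[OF w \<open>open \<Omega>\<close> x] by blast
    show "bdd_above {L2_inner \<Omega> \<phi> v / L2_norm \<Omega> g |v g. v \<in> H10 \<Omega> \<and> weak_gradient \<Omega> v g \<and> L2_norm \<Omega> v \<noteq> 0}"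
      using Hm1_set_bound[OF assms(1-4)] unfolding bdd_above_def by blast
  qed
  then show ?thesis using p by (simp add: field_simps)
qed

text \<open>Pairing with \<open>u\<close> and with its negative gives two bounds whose left-hand
  sides are opposite. If \<open>grad u\<close> has norm 0, the quotient of \<open>u\<close> is 0 and
  belongs to the set under the supremum.\<close>

lemma Hm1_norm_ge_0:
  assumes "open \<Omega>" and \<phi>: "\<phi> \<in> L2 \<Omega>" and M: "0 \<le> M"
    and bd: "\<And>w. w \<in> test_functions \<Omega> \<Longrightarrow> L2_inner \<Omega> \<phi> w \<le> M * L2_norm \<Omega> (grad w)"
    and u: "u \<in> test_functions \<Omega>" "u x \<noteq> 0"
  shows "0 \<le> Hm1_norm \<Omega> \<phi>"
proof -
  have m: "(\<lambda>x. (-1) * u x) \<in> test_functions \<Omega>" by (rule test_function_scale[OF u(1)]) simp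
  have g: "grad (\<lambda>x. (-1) * u x) x = - grad u x" for x
    using grad_scale[OF test_functionsD(2)[OF u(1)], of "-1"] by simp
  have 1: "L2_inner \<Omega> \<phi> u \<le> Hm1_norm \<Omega> \<phi> * L2_norm \<Omega> (grad u)"
    by (rule pairing_le_Hm1_norm[OF assms(1-4) u(1)])
  have 2: "L2_inner \<Omega> \<phi> (\<lambda>x. (-1) * u x) \<le> Hm1_norm \<Omega> \<phi> * L2_norm \<Omega> (grad (\<lambda>x. (-1) * u x))"
    by (rule pairing_le_Hm1_norm[OF assms(1-4) m])
  have e: "L2_inner \<Omega> \<phi> (\<lambda>x. (-1) * u x) = - L2_inner \<Omega> \<phi> u" "L2_norm \<Omega> (grad (\<lambda>x. (-1) * u x)) = L2_norm \<Omega> (grad u)"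
    unfolding L2_inner_def L2_norm_def g by simp_all
  have N: "0 \<le> Hm1_norm \<Omega> \<phi> * L2_norm \<Omega> (grad u)" using 1 2 unfolding e by linarith
  show ?thesis
  proof (cases "L2_norm \<Omega> (grad u) = 0")
    case False
    then show ?thesis using N L2_norm_ge_0[of \<Omega> "grad u"] by (simp add: zero_le_mult_iff)
  next
    case True
    have "L2_inner \<Omega> \<phi> u / L2_norm \<Omega> (grad u) \<le> Hm1_norm \<Omega> \<phi>"
      unfolding Hm1_norm_def
    proof (rule cSup_upper)
      show "L2_inner \<Omega> \<phi> u / L2_norm \<Omega> (grad u) \<in> {L2_inner \<Omega> \<phi> v / L2_norm \<Omega> g |v g. v \<in> H10 \<Omega> \<and> weak_gradient \<Omega> v g \<and> L2_norm \<Omega> v \<noteq> 0}"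
        using test_H10[OF u(1) \<open>open \<Omega>\<close>] weak_gradient_test[OF u(1) \<open>open \<Omega>\<close>] L2_norm_pos[OF u(1) \<open>open \<Omega>\<close> u(2)] by blast
      show "bdd_above {L2_inner \<Omega> \<phi> v / L2_norm \<Omega> g |v g. v \<in> H10 \<Omega> \<and> weak_gradient \<Omega> v g \<and> L2_norm \<Omega> v \<noteq> 0}"
        using Hm1_set_bound[OF assms(1-4)] unfolding bdd_above_def by blast
    qed
    then show ?thesis using True by simp
  qed
qed

section \<open>Mollification\<close>

text \<open>The polynomial in 1/t makes the family closed under differentiation, so that all
  derivatives of the cut-off exp(-1/t) are covered at once.\<close>

definition flat_exp :: "real poly \<Rightarrow> real \<Rightarrow> real" where
  "flat_exp p t = (if t \<le> 0 then 0 else poly p (1/t) * exp (- (1/t)))"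

lemma poly_exp_tendsto_0: "((\<lambda>x::real. poly p x * exp (- x)) \<longlongrightarrow> 0) at_top"
proof -
  have "((\<lambda>x. \<Sum>i\<le>degree p. coeff p i * (x ^ i / exp x)) \<longlongrightarrow> (\<Sum>i\<le>degree p. coeff p i * 0)) at_top"
    by (intro tendsto_sum tendsto_mult tendsto_const tendsto_power_div_exp_0)
  then show ?thesis by (simp add: poly_altdef sum_distrib_right exp_minus divide_inverse mult.assoc)
qed

lemma flat_exp_tendsto_0: "(flat_exp p \<longlongrightarrow> 0) (at 0)"
proof -
  have "((\<lambda>t. poly p (1/t) * exp (- (1/t))) \<longlongrightarrow> 0) (at_right 0)"
    using filterlim_compose[OF poly_exp_tendsto_0 filterlim_inverse_at_top_right]
    by (simp add: inverse_eq_divide)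
  then have r: "(flat_exp p \<longlongrightarrow> 0) (at_right 0)"
    by (rule Lim_transform_eventually) (auto simp: flat_exp_def eventually_at_filter)
  have l: "(flat_exp p \<longlongrightarrow> 0) (at_left 0)"
    by (rule Lim_transform_eventually[OF tendsto_const]) (auto simp: flat_exp_def eventually_at_filter)
  show ?thesis using l r filterlim_split_at by blast
qed

text \<open>With s = 1/t one has d/dt = -s^2 d/ds, which produces the polynomial s^2 (p - p'). At 0
  the difference quotient is again a member of the family, with polynomial s p, and tends to
  0.\<close>

lemma flat_exp_deriv:
  "(flat_exp p has_real_derivative flat_exp ([:0,0,1:] * (p - pderiv p)) t) (at t)"
proof -
  consider "t > 0" | "t = 0" | "t < 0" by linarith
  then show ?thesis
  proof cases
    case 1
    have "((\<lambda>t. poly p (1/t) * exp (- (1/t))) has_real_derivative flat_exp ([:0,0,1:] * (p - pderiv p)) t) (at t)"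
      using 1 by (auto intro!: derivative_eq_intros simp: flat_exp_def field_simps power2_eq_square)
    then show ?thesis
      by (rule has_field_derivative_transform_within_open[where S="{0<..}"]) (use 1 in \<open>auto simp: flat_exp_def\<close>)
  next
    case 2
    have "(flat_exp ([:0,1:] * p) \<longlongrightarrow> 0) (at 0)" by (rule flat_exp_tendsto_0)
    then have "((\<lambda>h. (flat_exp p (0 + h) - flat_exp p 0) / h) \<longlongrightarrow> 0) (at 0)"
      by (rule Lim_transform_eventually) (auto simp: flat_exp_def eventually_at_filter)
    then show ?thesis using 2 by (simp add: DERIV_def flat_exp_def)
  next
    case 3
    have "((\<lambda>t. 0) has_real_derivative flat_exp ([:0,0,1:] * (p - pderiv p)) t) (at t)"
      using 3 by (simp add: flat_exp_def)
    then show ?thesis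
      by (rule has_field_derivative_transform_within_open[where S="{..<0}"]) (use 3 in \<open>auto simp: flat_exp_def\<close>)
  qed
qed

text \<open>The algebra generated by constants, coordinates and bumps. Because it is closed under
  \<open>partial\<close>, its members are smooth, and no formula for a higher derivative is ever
  written down.\<close>

inductive_set bump_algebra :: "(real^'n \<Rightarrow> real) set" where
  const: "(\<lambda>x. c) \<in> bump_algebra"
| coord: "(\<lambda>x. x $ i) \<in> bump_algebra"
| bump: "(\<lambda>x. flat_exp p (1 - x \<bullet> x)) \<in> bump_algebra"
| add: "f \<in> bump_algebra \<Longrightarrow> g \<in> bump_algebra \<Longrightarrow> (\<lambda>x. f x + g x) \<in> bump_algebra"
| mult: "f \<in> bump_algebra \<Longrightarrow> g \<in> bump_algebra \<Longrightarrow> (\<lambda>x. f x * g x) \<in> bump_algebra"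

lemma bump_algebra_deriv:
  fixes f :: "real^'n \<Rightarrow> real"
  assumes "f \<in> bump_algebra"
  shows "(\<forall>x. f differentiable at x) \<and> (\<forall>i. partial i f \<in> bump_algebra)"
  using assms
proof induction
  case (const c)
  have "partial i (\<lambda>x. c) = (\<lambda>x. 0)" for i :: 'n by (rule ext, rule partial_eq) (auto intro!: derivative_eq_intros)
  then show ?case by (auto intro: bump_algebra.const)
next
  case (coord j)
  have d: "((\<lambda>x::real^'n. x $ j) has_derivative (\<lambda>h. h $ j)) (at x)" for x
    by (intro bounded_linear_imp_has_derivative bounded_linear_vec_nth)
  have "partial i (\<lambda>x. x $ j) = (\<lambda>x. axis i 1 $ j)" for i :: 'n by (rule ext, rule partial_eq) (rule d)
  then show ?case using d by (auto intro: bump_algebra.const simp: differentiable_def)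
next
  case (bump p)
  let ?q = "[:0,0,1:] * (p - pderiv p)"
  have d: "((\<lambda>x::real^'n. flat_exp p (1 - x \<bullet> x)) has_derivative (\<lambda>h. flat_exp ?q (1 - x \<bullet> x) * (- (2 * (x \<bullet> h))))) (at x)" for x
    by (rule has_derivative_eq_rhs, rule has_derivative_compose[OF _ flat_exp_deriv[unfolded has_field_derivative_def], of "\<lambda>x. 1 - x \<bullet> x"])
       (auto intro!: derivative_eq_intros simp: inner_commute)
  have "partial i (\<lambda>x. flat_exp p (1 - x \<bullet> x)) = (\<lambda>x. flat_exp ?q (1 - x \<bullet> x) * (-2 * x $ i))" for i :: 'n
    by (rule ext, subst partial_eq[OF d]) (simp add: inner_axis)
  moreover have "(\<lambda>x::real^'n. flat_exp ?q (1 - x \<bullet> x) * (-2 * x $ i)) \<in> bump_algebra" for i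
    by (intro bump_algebra.intros)
  ultimately show ?case using d by (auto simp: differentiable_def)
next
  case (add f g)
  then obtain f' g' where d: "\<And>x. (f has_derivative f' x) (at x)" "\<And>x. (g has_derivative g' x) (at x)"
    unfolding differentiable_def by metis
  have "((\<lambda>x. f x + g x) has_derivative (\<lambda>h. f' x h + g' x h)) (at x)" for x
    by (auto intro!: derivative_eq_intros d)
  moreover from partial_eq[OF this] have "partial i (\<lambda>x. f x + g x) = (\<lambda>x. partial i f x + partial i g x)" for i
    unfolding partial_eq[OF d(1)] partial_eq[OF d(2)] by (rule ext)
  ultimately show ?case using add by (auto simp: differentiable_def intro: bump_algebra.add)
next
  case (mult f g)
  then obtain f' g' where d: "\<And>x. (f has_derivative f' x) (at x)" "\<And>x. (g has_derivative g' x) (at x)"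
    unfolding differentiable_def by metis
  have "((\<lambda>x. f x * g x) has_derivative (\<lambda>h. f x * g' x h + f' x h * g x)) (at x)" for x
    by (auto intro!: derivative_eq_intros d)
  moreover from partial_eq[OF this] have "partial i (\<lambda>x. f x * g x) = (\<lambda>x. f x * partial i g x + partial i f x * g x)" for i
    unfolding partial_eq[OF d(1)] partial_eq[OF d(2)] by (rule ext)
  ultimately show ?case using mult by (auto simp: differentiable_def intro!: bump_algebra.add bump_algebra.mult)
qed

lemma bump_algebra_continuous:
  assumes "f \<in> bump_algebra" shows "continuous_on A f"
  using bump_algebra_deriv[OF assms]
  by (intro differentiable_imp_continuous_on) (simp add: differentiable_on_def differentiable_at_withinI)

text \<open>Differentiation under the integral sign, with the derivative falling on
  \<open>f\<close>; of \<open>w\<close> only continuity is used. The fixed box serves as the compact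
  domain of integration.\<close>

lemma has_derivative_convolution:
  fixes w f :: "real^'n \<Rightarrow> real"
  assumes w: "continuous_on UNIV w" and f: "f \<in> bump_algebra" and "d \<noteq> 0"
  shows "((\<lambda>x. integral (cbox a b) (\<lambda>y. w y * f ((x - y) /\<^sub>R d))) has_derivative
      (\<lambda>h. (\<chi> i. integral (cbox a b) (\<lambda>y. w y * (partial i f ((x - y) /\<^sub>R d) / d))) \<bullet> h)) (at x)"
proof -
  have df: "(f has_derivative (\<lambda>h. grad f x \<bullet> h)) (at x)" for x
    using bump_algebra_deriv[OF f] has_derivative_grad by blast
  have cp: "continuous_on A (partial i f)" for A i using bump_algebra_deriv[OF f] bump_algebra_continuous by blast
  then have cg: "continuous_on UNIV (grad f)" unfolding grad_def by (intro continuous_intros)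
  let ?D = "\<lambda>x y. (w y / d) *\<^sub>R grad f ((x - y) /\<^sub>R d)"
  have cD: "continuous_on A (\<lambda>(x,y). ?D x y)" for A unfolding split_beta
    by (intro continuous_intros continuous_on_compose2[OF w] continuous_on_compose2[OF cg]) (use \<open>d \<noteq> 0\<close> in auto)
  have A1: "((\<lambda>x. integral (cbox a b) (\<lambda>y. w y * f ((x - y) /\<^sub>R d))) has_derivative
      blinfun_apply (integral (cbox a b) (\<lambda>y. blinfun_inner_left (?D x y)))) (at x within UNIV)"
  proof (rule leibniz_rule)
    show "((\<lambda>x. w y * f ((x - y) /\<^sub>R d)) has_derivative blinfun_apply (blinfun_inner_left (?D x y))) (at x within UNIV)" for x y
    proof -
      have "((\<lambda>x. f ((x - y) /\<^sub>R d)) has_derivative (\<lambda>h. grad f ((x - y) /\<^sub>R d) \<bullet> (h /\<^sub>R d))) (at x)"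
        by (rule has_derivative_compose[OF _ df]) (auto intro!: derivative_eq_intros)
      from has_derivative_mult_right[OF this, of "w y"] show ?thesis
        by (rule has_derivative_eq_rhs) (auto simp: fun_eq_iff field_simps inner_commute)
    qed
    show "(\<lambda>y. w y * f ((x - y) /\<^sub>R d)) integrable_on cbox a b" for x
      by (intro integrable_continuous continuous_intros continuous_on_compose2[OF w]
         continuous_on_compose2[OF bump_algebra_continuous[OF f, of UNIV]]) auto
    show "continuous_on (UNIV \<times> cbox a b) (\<lambda>(x,y). blinfun_inner_left (?D x y))"
      using bounded_linear.continuous_on[OF bounded_linear_blinfun_inner_left cD[of "UNIV \<times> cbox a b"]]
      by (simp add: split_beta)
  qed auto
  \<comment> \<open>The Leibniz rule yields an integral with values in bounded linear maps.
    Evaluation at \<open>h\<close> commutes with the integral and returns the gradient in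
    components.\<close>
  have A2: "blinfun_apply (integral (cbox a b) (\<lambda>y. blinfun_inner_left (?D x y))) h
     = (\<chi> i. integral (cbox a b) (\<lambda>y. w y * (partial i f ((x - y) /\<^sub>R d) / d))) \<bullet> h" for h
  proof -
    have cDy: "continuous_on (cbox a b) (?D x)"
      by (intro continuous_intros continuous_on_compose2[OF w] continuous_on_compose2[OF cg]) (use \<open>d \<noteq> 0\<close> in auto)
    then have i: "?D x integrable_on cbox a b" by (rule integrable_continuous)
    have "(\<lambda>y. blinfun_inner_left (?D x y)) integrable_on cbox a b"
      by (intro integrable_continuous bounded_linear.continuous_on[OF bounded_linear_blinfun_inner_left] cDy)
    from integral_linear[OF this, of "\<lambda>B. blinfun_apply B h"]
    have "blinfun_apply (integral (cbox a b) (\<lambda>y. blinfun_inner_left (?D x y))) h = integral (cbox a b) (\<lambda>y. ?D x y \<bullet> h)"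
      by (simp add: o_def blinfun.bounded_linear_left blinfun_inner_left.rep_eq inner_commute)
    also have "\<dots> = integral (cbox a b) (?D x) \<bullet> h"
      using integral_linear[OF i bounded_linear_inner_left, of h] by (simp add: o_def)
    also have "integral (cbox a b) (?D x) = (\<chi> i. integral (cbox a b) (\<lambda>y. w y * (partial i f ((x - y) /\<^sub>R d) / d)))"
      using integral_linear[OF i bounded_linear_vec_nth] by (simp add: vec_eq_iff o_def grad_def)
    finally show ?thesis .
  qed
  show ?thesis using A1 unfolding A2 by simp
qed

text \<open>Each derivative replaces \<open>f\<close> by \<open>partial i f\<close>, which stays in
  the algebra, and produces a factor 1/d; the free factor \<open>c\<close> absorbs it in the
  induction.\<close>

lemma Ck_convolution:
  fixes w f :: "real^'n \<Rightarrow> real"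
  assumes w: "continuous_on UNIV w" and f: "f \<in> bump_algebra" and "d \<noteq> 0"
  shows "Ck k (\<lambda>x. c * integral (cbox a b) (\<lambda>y. w y * f ((x - y) /\<^sub>R d)))"
  using f
proof (induction k arbitrary: f c)
  case 0
  have "continuous_on UNIV (\<lambda>x. integral (cbox a b) (\<lambda>y. w y * f ((x - y) /\<^sub>R d)))"
    using has_derivative_convolution[OF w 0 \<open>d \<noteq> 0\<close>]
    by (intro continuous_at_imp_continuous_on ballI) (rule has_derivative_continuous)
  then show ?case by (auto intro!: continuous_intros)
next
  case (Suc k)
  note D = has_derivative_mult_right[OF has_derivative_convolution[OF w Suc.prems \<open>d \<noteq> 0\<close>], where x=c]
  have "partial i (\<lambda>x. c * integral (cbox a b) (\<lambda>y. w y * f ((x - y) /\<^sub>R d)))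
     = (\<lambda>x. (c / d) * integral (cbox a b) (\<lambda>y. w y * partial i f ((x - y) /\<^sub>R d)))" for i
    by (rule ext, subst partial_eq[OF D]) (simp add: inner_axis)
  moreover have "Ck k (\<lambda>x. (c / d) * integral (cbox a b) (\<lambda>y. w y * partial i f ((x - y) /\<^sub>R d)))" for i
    using bump_algebra_deriv[OF Suc.prems] by (intro Suc.IH) blast
  moreover have "(\<lambda>x. c * integral (cbox a b) (\<lambda>y. w y * f ((x - y) /\<^sub>R d))) differentiable_on UNIV"
    using D unfolding differentiable_on_def differentiable_def by blast
  ultimately show ?case unfolding Ck.simps by metis
qed

lemma mollifier:
  assumes "0 < d"
  obtains \<rho> :: "real^'n \<Rightarrow> real" where "cc \<rho>" "\<And>u. 0 \<le> \<rho> u" "\<And>u. d \<le> norm u \<Longrightarrow> \<rho> u = 0"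
    "integral UNIV \<rho> = 1"
    "\<And>w k. cc w \<Longrightarrow> Ck k (\<lambda>x. integral UNIV (\<lambda>u. w (x + u) * \<rho> u))"
proof -
  define f :: "real^'n \<Rightarrow> real" where "f = (\<lambda>x. flat_exp 1 (1 - x \<bullet> x))"
  have f: "f \<in> bump_algebra" unfolding f_def by (rule bump_algebra.bump)
  have f0: "0 \<le> f x" for x by (simp add: f_def flat_exp_def)
  have fpos: "0 < f 0" by (simp add: f_def flat_exp_def)
  have fout: "f x = 0" if "1 \<le> norm x" for x
    using that power_mono[of 1 "norm x" 2] by (simp add: f_def flat_exp_def dot_square_norm)
  have even: "f (- x) = f x" for x by (simp add: f_def)
  define g where "g = (\<lambda>u. f (u /\<^sub>R d))"
  have g0: "0 \<le> g u" for u by (simp add: g_def f0)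
  have gout: "g u = 0" if "d \<le> norm u" for u
    unfolding g_def using that \<open>0 < d\<close> by (intro fout) (simp add: field_simps)
  have gc: "continuous_on UNIV g" unfolding g_def
    by (intro continuous_on_compose2[OF bump_algebra_continuous[OF f, of UNIV]] continuous_intros) auto
  have ccg: "cc g" unfolding cc_def using gc gout
    by (intro conjI exI[of _ "cball 0 d"]) auto
  define N where "N = integral UNIV g"
  have "N > 0"
  proof -
    have "N \<ge> 0" unfolding N_def by (intro integral_nonneg cc_integrable(2)[OF ccg] g0)
    moreover have "N \<noteq> 0"
    proof
      assume "N = 0"
      have "AE x in lebesgue. g x = 0"
        using \<open>N = 0\<close> cc_integrable(1,3)[OF ccg] g0 unfolding N_def
        by (subst integral_nonneg_eq_0_iff_AE[symmetric]) auto
      moreover have o: "open {x. g x \<noteq> 0}" using gc by (intro open_Collect_neq) auto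
      ultimately have "negligible {x. g x \<noteq> 0}"
        using borel_open[OF o] by (simp add: negligible_iff_null_sets AE_iff_null)
      moreover have "g 0 \<noteq> 0" using fpos by (simp add: g_def)
      ultimately show False using open_not_negligible[OF o] by blast
    qed
    ultimately show ?thesis by simp
  qed
  show thesis
  proof (rule that[of "\<lambda>u. g u / N"])
    show "cc (\<lambda>u. g u / N)" using cc_mult[OF ccg continuous_on_const[of UNIV "1 / N"]] by simp
    show "0 \<le> g u / N" for u using g0 \<open>N > 0\<close> by simp
    show "g u / N = 0" if "d \<le> norm u" for u using gout that by simp
    show "integral UNIV (\<lambda>u. g u / N) = 1" using \<open>N > 0\<close> by (simp add: N_def)
    fix w :: "real^'n \<Rightarrow> real" and k assume w: "cc w"
    then have wc: "continuous_on UNIV w" by (simp add: cc_def)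
    obtain K where K: "compact K" "\<And>x. x \<notin> K \<Longrightarrow> w x = 0" using w by (auto simp: cc_def)
    obtain a where ab: "K \<subseteq> cbox (- a) a" using bounded_subset_cbox_symmetric[OF compact_imp_bounded[OF K(1)]] .
    \<comment> \<open>The substitution y = x + u and the evenness of the bump turn the average into
      a convolution in which \<open>x\<close> occurs only in the smooth factor.\<close>
    have e: "integral UNIV (\<lambda>u. w (x + u) * (g u / N)) = (1 / N) * integral (cbox (-a) a) (\<lambda>y. w y * f ((x - y) /\<^sub>R d))" for x
    proof -
      have "cc (\<lambda>y. w y * g (y - x))"
        by (intro cc_mult[OF w] continuous_on_compose2[OF gc] continuous_intros) auto
      from integral_shift_UNIV[OF this, of x]
      have "integral UNIV (\<lambda>u. w (x + u) * g u) = integral UNIV (\<lambda>y. w y * g (y - x))"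
        by (simp add: add.commute)
      also have "(\<lambda>y. w y * g (y - x)) = (\<lambda>y. w y * f ((x - y) /\<^sub>R d))"
        using even[of "(x - y) /\<^sub>R d" for y] by (simp add: g_def fun_eq_iff flip: scaleR_minus_right)
      also have "integral UNIV \<dots> = integral (cbox (-a) a) (\<lambda>y. w y * f ((x - y) /\<^sub>R d))"
        using ab K(2) by (intro integral_spike_set) (auto intro: negligible_subset[OF negligible_empty])
      finally show ?thesis by simp
    qed
    show "Ck k (\<lambda>x. integral UNIV (\<lambda>u. w (x + u) * (g u / N)))"
      unfolding e using Ck_convolution[OF wc f, of d k "1 / N" "-a" a] \<open>0 < d\<close> by blast
  qed
qed

section \<open>Lipschitz functions as test objects for the dual norm\<close>

text \<open>Differentiating \<open>f\<close> in the direction of its own gradient gives |grad f|^2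
  \<le> L |grad f|. A point at distance \<open>e / 2\<close> shows that \<open>L\<close> is
  nonnegative.\<close>

lemma norm_grad_le:
  fixes f :: "real^'n \<Rightarrow> real"
  assumes f: "f differentiable at x" and "0 < e" and L: "\<And>y. dist x y < e \<Longrightarrow> \<bar>f y - f x\<bar> \<le> L * dist x y"
  shows "norm (grad f x) \<le> L"
proof (cases "grad f x = 0")
  case True
  obtain y where y: "dist x y = e / 2"
    using vector_choose_dist[of "e / 2" x] \<open>0 < e\<close> by auto
  then have "0 \<le> L * (e / 2)" using L[of y] \<open>0 < e\<close> by force
  then show ?thesis using True \<open>0 < e\<close> by (simp add: zero_le_mult_iff)
next
  case False
  let ?g = "grad f x"
  have "((\<lambda>t. f (x + t *\<^sub>R ?g)) has_derivative (\<lambda>t. ?g \<bullet> (t *\<^sub>R ?g))) (at 0)"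
    by (rule has_derivative_compose[of "\<lambda>t. x + t *\<^sub>R ?g"])
      (auto intro!: derivative_eq_intros has_derivative_grad f)
  then have "((\<lambda>t. f (x + t *\<^sub>R ?g)) has_real_derivative (?g \<bullet> ?g)) (at 0)"
    by (simp add: has_field_derivative_def mult.commute[of "?g \<bullet> ?g"] mult_commute_abs)
  then have lim: "((\<lambda>h. (f (x + h *\<^sub>R ?g) - f x) / h) \<longlongrightarrow> ?g \<bullet> ?g) (at 0)"
    by (simp add: DERIV_def)
  have "?g \<bullet> ?g \<le> L * norm ?g"
  proof (rule tendsto_upperbound[OF lim])
    have "\<forall>\<^sub>F h in at 0. \<bar>h\<bar> < e / norm ?g"
      using False \<open>0 < e\<close> by (auto simp: eventually_at dist_real_def intro!: exI[of _ "e / norm ?g"])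
    then show "\<forall>\<^sub>F h in at 0. (f (x + h *\<^sub>R ?g) - f x) / h \<le> L * norm ?g"
    proof (eventually_elim)
      case (elim h)
      have "\<bar>f (x + h *\<^sub>R ?g) - f x\<bar> \<le> L * (\<bar>h\<bar> * norm ?g)"
        using L[of "x + h *\<^sub>R ?g"] elim False by (simp add: dist_norm field_simps)
      then have "h \<noteq> 0 \<Longrightarrow> \<bar>(f (x + h *\<^sub>R ?g) - f x) / h\<bar> \<le> L * norm ?g"
        by (simp add: field_simps)
      moreover have "0 \<le> L * norm ?g"
      proof -
        obtain y where y: "dist x y = e / 2"
          using vector_choose_dist[of "e / 2" x] \<open>0 < e\<close> by auto
        then have "0 \<le> L * (e / 2)" using L[of y] \<open>0 < e\<close> by force
        then show ?thesis using \<open>0 < e\<close> by (simp add: zero_le_mult_iff)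
      qed
      ultimately show ?case using abs_ge_self[of "(f (x + h *\<^sub>R ?g) - f x) / h"] by (cases "h = 0") (simp, linarith)
    qed
  qed simp
  then have "norm ?g * norm ?g \<le> L * norm ?g" by (simp add: dot_square_norm power2_eq_square)
  then show ?thesis using False by simp
qed

text \<open>The odd function that moves every real number by \<open>e\<close> towards 0 and stops
  there. An error of at most \<open>e\<close> buys exact vanishing where the argument is small,
  without raising Lipschitz constants.\<close>

definition soft_threshold :: "real \<Rightarrow> real \<Rightarrow> real" where
  "soft_threshold e r = max 0 (r - e) + min 0 (r + e)"

lemma soft_threshold:
  assumes "0 < e"
  shows "\<bar>soft_threshold e r - soft_threshold e s\<bar> \<le> \<bar>r - s\<bar>" "\<bar>soft_threshold e r - r\<bar> \<le> e"
    "\<bar>r\<bar> \<le> e \<Longrightarrow> soft_threshold e r = 0"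
  using assms by (auto simp: soft_threshold_def max_def min_def)

text \<open>Two averages with the same kernel of mass 1 differ by no more than the functions do. A
  constant \<open>v\<close> yields the uniform error of mollification; equal functions at two base
  points yield its Lipschitz constant.\<close>

lemma averaging_bounds:
  fixes w \<rho> :: "real^'n \<Rightarrow> real"
  assumes w: "continuous_on UNIV w" and r: "cc \<rho>" "\<And>u. 0 \<le> \<rho> u" "\<And>u. d \<le> norm u \<Longrightarrow> \<rho> u = 0" "integral UNIV \<rho> = 1"
    and b: "\<And>u. norm u < d \<Longrightarrow> \<bar>w (x + u) - v (y + u)\<bar> \<le> B" and v: "continuous_on UNIV v"
  shows "\<bar>integral UNIV (\<lambda>u. w (x + u) * \<rho> u) - integral UNIV (\<lambda>u. v (y + u) * \<rho> u)\<bar> \<le> B"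
proof -
  have cc: "cc (\<lambda>u. w (x + u) * \<rho> u)" if "continuous_on UNIV w" for w and x
    using cc_mult[OF r(1), of "\<lambda>u. w (x + u)"] continuous_on_compose2[OF that, of UNIV "\<lambda>u. x + u"]
    by (simp add: mult.commute continuous_on_add)
  have "integral UNIV (\<lambda>u. w (x + u) * \<rho> u) - integral UNIV (\<lambda>u. v (y + u) * \<rho> u)
     = integral UNIV (\<lambda>u. w (x + u) * \<rho> u - v (y + u) * \<rho> u)"
    by (intro integral_diff[symmetric] cc_integrable cc w v)
  also have "\<bar>\<dots>\<bar> \<le> integral UNIV (\<lambda>u. B * \<rho> u)"
    unfolding real_norm_def[symmetric]
  proof (rule integral_norm_bound_integral)
    show "(\<lambda>u. w (x + u) * \<rho> u - v (y + u) * \<rho> u) integrable_on UNIV"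
      by (intro integrable_diff cc_integrable cc w v)
    show "(\<lambda>u. B * \<rho> u) integrable_on UNIV" using cc_integrable(2)[OF r(1)] by (rule integrable_on_mult_right)
    show "norm (w (x + u) * \<rho> u - v (y + u) * \<rho> u) \<le> B * \<rho> u" for u
      using b[of u] r(2)[of u] r(3)[of u] by (cases "norm u < d") (auto simp: abs_mult simp flip: left_diff_distrib intro!: mult_right_mono)
  qed
  finally show ?thesis using r(4) by simp
qed

text \<open>Soft thresholding makes the support a compact subset of \<open>\<Omega>\<close>; mollification then stays inside.\<close>

lemma test_approximation:
  fixes w :: "real^'n \<Rightarrow> real"
  assumes \<Omega>: "open \<Omega>" "bounded \<Omega>" and w: "L-lipschitz_on UNIV w" "\<And>x. x \<notin> \<Omega> \<Longrightarrow> w x = 0" and "0 < e"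
  obtains W where "W \<in> test_functions \<Omega>" "\<And>x. \<bar>W x - w x\<bar> \<le> (1 + L) * e"
    "\<And>x l A. ball x e \<subseteq> A \<Longrightarrow> l-lipschitz_on A w \<Longrightarrow> norm (grad W x) \<le> l"
proof -
  define K where "K = {x. e \<le> \<bar>w x\<bar>}"
  have wc: "continuous_on UNIV w" using w(1) by (rule lipschitz_on_continuous_on)
  have "K \<subseteq> \<Omega>" using w(2) \<open>0 < e\<close> by (force simp: K_def)
  have "closed K" unfolding K_def using wc by (intro closed_Collect_le continuous_intros)
  then have "compact K" using \<open>K \<subseteq> \<Omega>\<close> \<open>bounded \<Omega>\<close> bounded_subset compact_eq_bounded_closed by blast
  obtain r where r: "r > 0" "(\<Union>x\<in>K. ball x r) \<subseteq> \<Omega>"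
    using compact_subset_open_imp_ball_epsilon_subset[OF \<open>compact K\<close> \<Omega>(1) \<open>K \<subseteq> \<Omega>\<close>] by blast
  \<comment> \<open>Below \<open>r\<close>, the smoothing keeps the support in \<Omega>. At most
    \<open>e/2\<close>, it keeps x + u and y + u in the ball of radius \<open>e\<close> about x
    whenever dist x y < e/2.\<close>
  define d where "d = min (e/2) (r/2)"
  have d: "0 < d" "d \<le> e / 2" "d < r" using r \<open>0 < e\<close> by (auto simp: d_def)
  define v where "v x = soft_threshold e (w x)" for x
  note st = soft_threshold[OF \<open>0 < e\<close>]
  have vl: "l-lipschitz_on A v" if "l-lipschitz_on A w" for l A
    using that st(1) unfolding lipschitz_on_def v_def dist_real_def by (meson order_trans)
  have vc: "continuous_on UNIV v" by (rule lipschitz_on_continuous_on[OF vl[OF w(1)]])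
  have v0: "v x = 0" if "x \<notin> K" for x using st(3)[of "w x"] that by (auto simp: v_def K_def)
  have ccv: "cc v" unfolding cc_def using vc v0 \<open>compact K\<close> by blast
  obtain \<rho> :: "real^'n \<Rightarrow> real" where \<rho>: "cc \<rho>" "\<And>u. 0 \<le> \<rho> u" "\<And>u. d \<le> norm u \<Longrightarrow> \<rho> u = 0" "integral UNIV \<rho> = 1"
    "\<And>w k. cc w \<Longrightarrow> Ck k (\<lambda>x. integral UNIV (\<lambda>u. w (x + u) * \<rho> u))"
    by (rule mollifier[OF d(1)]) blast
  define W where "W x = integral UNIV (\<lambda>u. v (x + u) * \<rho> u)" for x
  have Ck: "Ck k W" for k unfolding W_def using \<rho>(5)[OF ccv] .
  let ?S = "(\<lambda>z. fst z + snd z) ` (K \<times> cball 0 d)"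
  have cS: "compact ?S"
    using \<open>compact K\<close> by (intro compact_continuous_image compact_Times continuous_intros) auto
  have supp: "{x. W x \<noteq> 0} \<subseteq> ?S"
  proof
    fix x assume "x \<in> {x. W x \<noteq> 0}"
    then have "W x \<noteq> 0" by simp
    have "\<exists>u. v (x + u) * \<rho> u \<noteq> 0"
    proof (rule ccontr)
      assume "\<not> ?thesis"
      then have "(\<lambda>u. v (x + u) * \<rho> u) = (\<lambda>u. 0)" by auto
      then have "W x = 0" unfolding W_def by simp
      then show False using \<open>W x \<noteq> 0\<close> by simp
    qed
    then obtain u where u': "v (x + u) \<noteq> 0" "\<rho> u \<noteq> 0" by auto
    have u: "x + u \<in> K" "norm u < d" using u'(1) v0[of "x + u"] u'(2) \<rho>(3)[of u] by linarith+
    then have "x = fst (x + u, -u) + snd (x + u, -u)" "(x + u, -u) \<in> K \<times> cball 0 d" by auto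
    then show "x \<in> ?S" by blast
  qed
  have SO: "?S \<subseteq> \<Omega>"
  proof
    fix x assume "x \<in> ?S"
    then obtain y z where "x = y + z" "y \<in> K" "norm z \<le> d" by auto
    then have "x \<in> ball y r" using d by (simp add: dist_norm)
    then show "x \<in> \<Omega>" using r \<open>y \<in> K\<close> by blast
  qed
  have cl: "closure {x. W x \<noteq> 0} \<subseteq> ?S" using supp cS by (intro closure_minimal compact_imp_closed)
  have "compact (closure {x. W x \<noteq> 0})"
    using closed_Int_compact[OF closed_closure cS, of "{x. W x \<noteq> 0}"] cl by (simp only: Int_absorb2)
  then have W: "W \<in> test_functions \<Omega>" unfolding test_functions_def
    by (intro CollectI conjI allI Ck order_trans[OF cl SO])
  have one: "W x = integral UNIV (\<lambda>u. v (x + u) * \<rho> u)" for x by (simp add: W_def)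
  have L0: "0 \<le> L" using w(1) by (rule lipschitz_on_nonneg)
  show thesis
  proof (rule that[OF W])
    fix x
    have wx: "w x = integral UNIV (\<lambda>u. (\<lambda>y. w x) (x + u) * \<rho> u)" using \<rho>(4) by simp
    \<comment> \<open>The threshold contributes \<open>e\<close>, the shift by \<open>u\<close> at
      most \<open>L * e\<close>.\<close>
    have b: "\<bar>v (x + u) - w x\<bar> \<le> e + L * e" if "norm u < d" for u
    proof -
      have "\<bar>w (x + u) - w x\<bar> \<le> L * e"
        using lipschitz_onD[OF w(1), of "x + u" x] mult_left_mono[OF _ L0, of "norm u" e] d that by (auto simp: dist_norm)
      then show ?thesis using st(2)[of "w (x + u)"] unfolding v_def by linarith
    qed
    have "\<bar>W x - w x\<bar> \<le> e + L * e"
      using averaging_bounds[OF vc \<rho>(1-4), where d=d and x=x and v="\<lambda>y. w x" and y=x and B="e + L * e"] b \<rho>(4) unfolding one by simp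
    then show "\<bar>W x - w x\<bar> \<le> (1 + L) * e" by (simp add: algebra_simps)
  next
    fix x l A assume A: "ball x e \<subseteq> A" and l: "l-lipschitz_on A w"
    show "norm (grad W x) \<le> l"
    proof (rule norm_grad_le[OF test_functionsD(2)[OF W]])
      show "0 < e / 2" using \<open>0 < e\<close> by simp
      fix y assume y: "dist x y < e / 2"
      show "\<bar>W y - W x\<bar> \<le> l * dist x y"
        unfolding one
      proof (rule averaging_bounds[OF vc \<rho>(1-4) _ vc])
        fix u :: "real^'n" assume u: "norm u < d"
        have "dist x (x + u) < e" using u d \<open>0 < e\<close> by (simp add: dist_norm)
        moreover have "dist x (y + u) < e"
          using u d y norm_triangle_ineq4[of "x - y" u] by (simp add: dist_norm algebra_simps)
        ultimately have "x + u \<in> A" "y + u \<in> A" using A by auto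
        then show "\<bar>v (y + u) - v (x + u)\<bar> \<le> l * dist x y"
          using lipschitz_onD[OF vl[OF l], of "y + u" "x + u"] by (simp add: dist_real_def dist_commute)
      qed
    qed
  qed
qed

lemma nontrivial_test_function:
  fixes \<Omega> :: "(real^'n) set"
  assumes "open \<Omega>" "bounded \<Omega>" "x0 \<in> \<Omega>"
  obtains u x where "u \<in> test_functions \<Omega>" "u x \<noteq> 0"
proof -
  obtain r where r: "r > 0" "ball x0 r \<subseteq> \<Omega>" using assms(1,3) openE by blast
  define w :: "real^'n \<Rightarrow> real" where "w x = max 0 (r - dist x x0)" for x
  have l: "1-lipschitz_on UNIV w"
  proof (rule lipschitz_onI)
    fix x y :: "real^'n"
    show "dist (w x) (w y) \<le> 1 * dist x y"
      using dist_triangle[of x x0 y] dist_triangle[of y x0 x]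
      unfolding w_def dist_real_def dist_commute[of y x0] dist_commute[of y x] dist_commute[of x x0]
      by (simp add: max_def abs_if)
  qed simp
  have w0: "w x = 0" if "x \<notin> \<Omega>" for x
  proof -
    have "x \<notin> ball x0 r" using that r by blast
    then show ?thesis by (simp add: w_def dist_commute)
  qed
  \<comment> \<open>The cone \<open>w\<close> has height \<open>r\<close> at \<open>x0\<close>; with
    this parameter the approximation error is at most \<open>r/2\<close>, so the approximant is
    nonzero there.\<close>
  have e: "0 < r / 4" using r by simp
  obtain W where W: "W \<in> test_functions \<Omega>" "\<And>x. \<bar>W x - w x\<bar> \<le> (1 + 1) * (r / 4)"
  proof (rule test_approximation[OF assms(1,2) l w0 e])
    fix W assume "W \<in> test_functions \<Omega>" "\<And>x. \<bar>W x - w x\<bar> \<le> (1 + 1) * (r / 4)"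
    then show thesis by (rule that)
  qed
  have "w x0 = r" using r by (simp add: w_def)
  then have "W x0 \<noteq> 0" using W(2)[of x0] r by auto
  then show thesis using that W(1) by blast
qed

lemma L2_norm_cmp:
  assumes f: "f \<in> L2 \<Omega>" and g: "g \<in> L2 \<Omega>" and le: "\<And>x. x \<in> \<Omega> \<Longrightarrow> norm (f x) \<le> norm (g x)"
    and "\<Omega> \<in> sets lebesgue"
  shows "L2_norm \<Omega> f \<le> L2_norm \<Omega> g"
proof -
  have "L2_inner \<Omega> f f \<le> L2_inner \<Omega> g g" unfolding L2_inner_def
    using L2_inner_integrable[OF f f] L2_inner_integrable[OF g g]
  proof (rule integral_mono)
    fix x assume "x \<in> space (lebesgue_on \<Omega>)"
    then have "norm (f x) \<le> norm (g x)" by (simp add: le)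
    from power_mono[OF this, of 2] show "f x \<bullet> f x \<le> g x \<bullet> g x" by (simp add: dot_square_norm)
  qed
  then show ?thesis by (simp add: L2_norm_def)
qed

lemma emeasure_bounded_open: "open (\<Omega>::(real^'n) set) \<Longrightarrow> bounded \<Omega> \<Longrightarrow> \<Omega> \<in> lmeasurable"
  by (simp add: lmeasurable_open)

lemma const_L2:
  assumes "open (\<Omega>::(real^'n) set)" "bounded \<Omega>"
  shows "(\<lambda>x. c::real) \<in> L2 \<Omega>" "L2_norm \<Omega> (\<lambda>x. c) = \<bar>c\<bar> * sqrt (measure lebesgue \<Omega>)"
proof -
  interpret finite_measure "lebesgue_on \<Omega>"
    using emeasure_bounded_open[OF assms] by (simp add: finite_measure_lebesgue_on)
  show "(\<lambda>x. c) \<in> L2 \<Omega>" by (simp add: L2_def)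
  have "L2_inner \<Omega> (\<lambda>x. c) (\<lambda>x. c) = c * c * measure lebesgue \<Omega>"
    unfolding L2_inner_def using assms(1) by (simp add: measure_restrict_space)
  then show "L2_norm \<Omega> (\<lambda>x. c) = \<bar>c\<bar> * sqrt (measure lebesgue \<Omega>)"
    by (simp add: L2_norm_def real_sqrt_mult)
qed

text \<open>Controlling the gradient by Lipschitz constants on the pieces avoids differentiating \<open>w\<close>.\<close>

lemma pairing_le_lipschitz:
  fixes w :: "real^'n \<Rightarrow> real"
  assumes \<Omega>: "open \<Omega>" "bounded \<Omega>" and ne: "\<Omega> \<noteq> {}" and \<phi>: "\<phi> \<in> L2 \<Omega>" and M: "0 \<le> M"
    and bd: "\<And>w. w \<in> test_functions \<Omega> \<Longrightarrow> L2_inner \<Omega> \<phi> w \<le> M * L2_norm \<Omega> (grad w)"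
    and w: "l0-lipschitz_on UNIV w" "\<And>x. x \<notin> \<Omega> \<Longrightarrow> w x = 0"
    and T: "finite \<T>" "\<And>T. T \<in> \<T> \<Longrightarrow> open T" "\<And>T. T \<in> \<T> \<Longrightarrow> T \<subseteq> \<Omega>" "pairwise disjnt \<T>"
      "negligible (\<Omega> - \<Union>\<T>)"
    and l: "\<And>T. T \<in> \<T> \<Longrightarrow> (l T)-lipschitz_on T w"
  shows "L2_inner \<Omega> \<phi> w \<le> Hm1_norm \<Omega> \<phi> * sqrt (\<Sum>T\<in>\<T>. measure lebesgue T * (l T)\<^sup>2)"
proof -
  obtain y0 where "y0 \<in> \<Omega>" using ne by blast
  then obtain u x0 where u: "u \<in> test_functions \<Omega>" "u x0 \<noteq> 0" by (rule nontrivial_test_function[OF \<Omega>]) blast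
  have H0: "0 \<le> Hm1_norm \<Omega> \<phi>" by (rule Hm1_norm_ge_0[OF \<Omega>(1) \<phi> M bd u])
  define e where "e k = 1 / real (Suc k)" for k
  have e: "0 < e k" for k by (simp add: e_def)
  have elim0: "e \<longlonglongrightarrow> 0" unfolding e_def by (rule LIMSEQ_Suc[OF lim_1_over_n])
  have "\<exists>W. W \<in> test_functions \<Omega> \<and> (\<forall>x. \<bar>W x - w x\<bar> \<le> (1 + l0) * e k) \<and>
     (\<forall>x l A. ball x (e k) \<subseteq> A \<longrightarrow> l-lipschitz_on A w \<longrightarrow> norm (grad W x) \<le> l)" for k
  proof (rule test_approximation[OF \<Omega> w e[of k]])
    fix W assume *: "W \<in> test_functions \<Omega>" "\<And>x. \<bar>W x - w x\<bar> \<le> (1 + l0) * e k"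
      "\<And>x l A. ball x (e k) \<subseteq> A \<Longrightarrow> l-lipschitz_on A w \<Longrightarrow> norm (grad W x) \<le> l"
    show ?thesis by (intro exI[of _ W] conjI allI impI) (fact *)+
  qed
  then obtain W where W: "\<And>k. W k \<in> test_functions \<Omega>" "\<And>k x. \<bar>W k x - w x\<bar> \<le> (1 + l0) * e k"
     "\<And>k x l A. ball x (e k) \<subseteq> A \<Longrightarrow> l-lipschitz_on A w \<Longrightarrow> norm (grad (W k) x) \<le> l"
    by metis
  have wc: "continuous_on UNIV w" using w(1) by (rule lipschitz_on_continuous_on)
  have "cc w" unfolding cc_def using wc w(2) closure_subset[of \<Omega>] \<Omega>(2)
    by (intro conjI exI[of _ "closure \<Omega>"]) auto
  then have wL: "w \<in> L2 \<Omega>" by (rule cc_L2[OF _ \<Omega>(1)])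
  have WL: "W k \<in> L2 \<Omega>" for k by (rule cc_L2[OF cc_test(1)[OF W(1)] \<Omega>(1)])
  have GL: "grad (W k) \<in> L2 \<Omega>" for k by (rule cc_L2[OF cc_test(3)[OF W(1)] \<Omega>(1)])
  have l0: "0 \<le> l0" using w(1) by (rule lipschitz_on_nonneg)
  have Plim: "(\<lambda>k. L2_inner \<Omega> \<phi> (W k)) \<longlonglongrightarrow> L2_inner \<Omega> \<phi> w"
  proof (rule L2_inner_tendsto[OF \<phi> WL wL])
    have A: "(\<lambda>k. (1 + l0) * e k * sqrt (measure lebesgue \<Omega>)) \<longlonglongrightarrow> (1 + l0) * 0 * sqrt (measure lebesgue \<Omega>)"
      by (intro tendsto_intros elim0)
    have "norm (L2_norm \<Omega> (\<lambda>x. w x - W k x)) \<le> (1 + l0) * e k * sqrt (measure lebesgue \<Omega>)" for k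
    proof -
      have "L2_norm \<Omega> (\<lambda>x. w x - W k x) \<le> L2_norm \<Omega> (\<lambda>x. (1 + l0) * e k)"
        using W(2)[of k] by (intro L2_norm_cmp L2_diff wL WL const_L2 \<Omega> open_lebesgue) (auto simp: abs_minus_commute intro: order_trans[OF _ abs_ge_self])
      then show ?thesis using const_L2(2)[OF \<Omega>, of "(1 + l0) * e k"] l0 e[of k] L2_norm_ge_0[of \<Omega> "\<lambda>x. w x - W k x"] by simp
    qed
    note Bd = this
    from A have "(\<lambda>k. (1 + l0) * e k * sqrt (measure lebesgue \<Omega>)) \<longlonglongrightarrow> 0" by simp
    then show "(\<lambda>k. L2_norm \<Omega> (\<lambda>x. w x - W k x)) \<longlonglongrightarrow> 0"
      by (rule Lim_null_comparison[OF always_eventually[OF allI[OF Bd]]])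
  qed
  \<comment> \<open>\<open>S k T\<close> consists of the points whose \<open>e k\<close>-ball lies
    in \<open>T\<close>. There the gradient of the approximant obeys the local constant
    \<open>l T\<close>; elsewhere only the global constant \<open>l0\<close> is available. Since
    almost every point of \<Omega> eventually enters some \<open>S k T\<close>, the majorants
    \<open>F k\<close> tend to \<open>G\<close> almost everywhere, dominated by
    \<open>B\<close>.\<close>
  define S where "S k T = - (\<Union>y\<in>-T. ball y (e k))" for k and T :: "(real^'n) set"
  define G where "G x = (\<Sum>T\<in>\<T>. (l T)\<^sup>2 * indicat_real T x)" for x
  define F where "F k x = (if x \<in> (\<Union>T\<in>\<T>. S k T) then G x else l0\<^sup>2)" for k x
  have S: "x \<in> S k T \<longleftrightarrow> ball x (e k) \<subseteq> T" for k T x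
    unfolding S_def using dist_commute[of x] by (force simp: subset_iff)
  have ST: "x \<in> S k T \<Longrightarrow> x \<in> T" for k T x unfolding S using e[of k] by auto
  have cS: "closed (S k T)" for k T unfolding S_def by auto
  have GT: "G x = (l T)\<^sup>2" if "T \<in> \<T>" "x \<in> T" for x T
  proof -
    have "G x = (\<Sum>T'\<in>{T}. (l T')\<^sup>2 * indicat_real T' x)" unfolding G_def
      using T(1,4) that by (intro sum.mono_neutral_right) (auto simp: pairwise_def disjnt_def indicator_def)
    then show ?thesis using that by simp
  qed
  have gradle: "(norm (grad (W k) x))\<^sup>2 \<le> F k x" for k x
  proof (cases "x \<in> (\<Union>T\<in>\<T>. S k T)")
    case True
    then obtain T where T': "T \<in> \<T>" "x \<in> S k T" by blast
    then have "norm (grad (W k) x) \<le> l T" using W(3)[of x k T "l T"] l S by blast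
    then show ?thesis unfolding F_def using True GT[OF T'(1) ST[OF T'(2)]] by (simp add: power_mono)
  next
    case False
    have "norm (grad (W k) x) \<le> l0" using W(3)[of x k UNIV l0] w(1) by blast
    then show ?thesis unfolding F_def using False by (simp add: power_mono)
  qed
  interpret finite_measure "lebesgue_on \<Omega>"
    using emeasure_bounded_open[OF \<Omega>] by (simp add: finite_measure_lebesgue_on)
  have Gm[measurable]: "G \<in> borel_measurable (lebesgue_on \<Omega>)" unfolding G_def
    using T(2) by (intro borel_measurable_sum borel_measurable_times borel_measurable_const measurable_restrict_space1 borel_measurable_indicator) auto
  have Fm[measurable]: "F k \<in> borel_measurable (lebesgue_on \<Omega>)" for k
  proof -
    have "closed (\<Union>T\<in>\<T>. S k T)" using T(1) cS by (intro closed_UN) auto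
    then have "(\<Union>T\<in>\<T>. S k T) \<in> sets lebesgue" by auto
    then have "{x. x \<in> (\<Union>T\<in>\<T>. S k T)} \<in> sets lebesgue" by (simp only: Collect_mem_eq)
    then have "Measurable.pred (lebesgue_on \<Omega>) (\<lambda>x. x \<in> (\<Union>T\<in>\<T>. S k T))"
      by (intro measurable_restrict_space1) (simp add: pred_def)
    then show ?thesis unfolding F_def by measurable
  qed
  define B where "B = (\<Sum>T\<in>\<T>. (l T)\<^sup>2) + l0\<^sup>2"
  have G0: "0 \<le> G x" "G x \<le> (\<Sum>T\<in>\<T>. (l T)\<^sup>2)" for x
    unfolding G_def by (auto intro!: sum_nonneg sum_mono simp: indicator_def)
  have FB: "0 \<le> F k x" "F k x \<le> B" for k x
    using G0[of x] by (auto simp: F_def B_def intro: add_increasing2 sum_nonneg)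
  have Fi: "integrable (lebesgue_on \<Omega>) (F k)" for k
    using FB by (intro integrable_const_bound[of _ B]) auto
  have Flim0: "(\<lambda>k. LINT x|lebesgue_on \<Omega>. F k x) \<longlonglongrightarrow> (LINT x|lebesgue_on \<Omega>. G x)"
  proof (rule integral_dominated_convergence[where w="\<lambda>x. B"])
    have "AE x in lebesgue. x \<notin> \<Omega> - \<Union>\<T>"
      using T(5) by (intro AE_not_in) (simp add: negligible_iff_null_sets)
    then have "AE x in lebesgue_on \<Omega>. x \<in> \<Union>\<T>"
      using \<Omega>(1) by (subst AE_restrict_space_iff) (auto elim!: eventually_mono)
    then show "AE x in lebesgue_on \<Omega>. (\<lambda>k. F k x) \<longlonglongrightarrow> G x"
    proof eventually_elim
      case (elim x)
      then obtain T where T': "T \<in> \<T>" "x \<in> T" by blast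
      obtain r where r: "0 < r" "ball x r \<subseteq> T" using T(2) T' openE by blast
      have "\<forall>\<^sub>F k in sequentially. e k < r" by (rule order_tendstoD(2)[OF elim0 r(1)])
      then have "\<forall>\<^sub>F k in sequentially. G x = F k x"
      proof eventually_elim
        case (elim k)
        then have "x \<in> S k T" unfolding S using r(2) by auto
        then show ?case using T' unfolding F_def by auto
      qed
      then show ?case by (rule Lim_transform_eventually[OF tendsto_const])
    qed
  qed (use FB in auto)
  have Gint: "(LINT x|lebesgue_on \<Omega>. G x) = (\<Sum>T\<in>\<T>. measure lebesgue T * (l T)\<^sup>2)"
  proof -
    have [simp]: "T \<inter> \<Omega> = T" if "T \<in> \<T>" for T using T(3)[OF that] by blast
    have "T \<in> sets (lebesgue_on \<Omega>)" if "T \<in> \<T>" for T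
      using T(2,3)[OF that] \<Omega>(1) by (simp add: sets_restrict_space_iff)
    then have "(LINT x|lebesgue_on \<Omega>. G x) = (\<Sum>T\<in>\<T>. LINT x|lebesgue_on \<Omega>. (l T)\<^sup>2 * indicat_real T x)"
      unfolding G_def by (intro Bochner_Integration.integral_sum integrable_mult_right integrable_real_indicator) (auto simp: emeasure_eq_measure)
    also have "\<dots> = (\<Sum>T\<in>\<T>. measure lebesgue T * (l T)\<^sup>2)"
      using T(3) \<Omega>(1) by (intro sum.cong) (auto simp: measure_restrict_space)
    finally show ?thesis .
  qed
  from Flim0 have Flim: "(\<lambda>k. LINT x|lebesgue_on \<Omega>. F k x) \<longlonglongrightarrow> (\<Sum>T\<in>\<T>. measure lebesgue T * (l T)\<^sup>2)" unfolding Gint .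
  have bnd: "L2_inner \<Omega> \<phi> (W k) \<le> Hm1_norm \<Omega> \<phi> * sqrt (LINT x|lebesgue_on \<Omega>. F k x)" for k
  proof -
    have "L2_inner \<Omega> (grad (W k)) (grad (W k)) \<le> (LINT x|lebesgue_on \<Omega>. F k x)"
      unfolding L2_inner_def using gradle[of k]
      by (intro integral_mono L2_inner_integrable[OF GL GL] Fi) (simp add: dot_square_norm)
    then have "L2_norm \<Omega> (grad (W k)) \<le> sqrt (LINT x|lebesgue_on \<Omega>. F k x)"
      by (simp add: L2_norm_def)
    from mult_left_mono[OF this H0] show ?thesis
      using pairing_le_Hm1_norm[OF \<Omega>(1) \<phi> M bd W(1), of k] by linarith
  qed
  have "(\<lambda>k. Hm1_norm \<Omega> \<phi> * sqrt (LINT x|lebesgue_on \<Omega>. F k x)) \<longlonglongrightarrow> Hm1_norm \<Omega> \<phi> * sqrt (\<Sum>T\<in>\<T>. measure lebesgue T * (l T)\<^sup>2)"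
    by (intro tendsto_intros Flim)
  then show ?thesis using bnd by (intro LIMSEQ_le[OF Plim]) auto
qed

section \<open>Simplices\<close>

definition simplex_vertices :: "(real^'n) set \<Rightarrow> bool" where
  "simplex_vertices V \<longleftrightarrow> \<not> affine_dependent V \<and> card V = Suc CARD('n)"

text \<open>Gradient of the barycentric coordinate of \<open>p\<close>: the affine function with
  value 1 at \<open>p\<close> and this gradient vanishes at the other vertices. With the choice
  operator, \<open>bary\<close> is an affine function for every \<open>V\<close>; that the equations
  can be solved is shown only for simplices.\<close>

definition bary_grad :: "(real^'n) set \<Rightarrow> real^'n \<Rightarrow> real^'n" where
  "bary_grad V p = (SOME g. \<forall>q\<in>V - {p}. 1 + g \<bullet> (q - p) = 0)"

definition bary :: "(real^'n) set \<Rightarrow> real^'n \<Rightarrow> real^'n \<Rightarrow> real" where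
  "bary V p x = 1 + bary_grad V p \<bullet> (x - p)"

lemma bary_self[simp]: "bary V p p = 1" by (simp add: bary_def)

lemma bary_diff: "bary V p x - bary V p y = bary_grad V p \<bullet> (x - y)"
  by (simp add: bary_def inner_diff_right)

lemma bary_convex_comb: "bary V p ((1 - t) *\<^sub>R x + t *\<^sub>R y) = (1 - t) * bary V p x + t * bary V p y"
  by (simp add: bary_def inner_add_right inner_diff_right algebra_simps)

lemma bary_sum:
  assumes "finite I" "sum u I = 1"
  shows "bary V p (\<Sum>i\<in>I. u i *\<^sub>R x i) = (\<Sum>i\<in>I. u i * bary V p (x i))"
proof -
  have "(\<Sum>i\<in>I. u i * bary V p (x i)) = (\<Sum>i\<in>I. u i * (1 - bary_grad V p \<bullet> p) + bary_grad V p \<bullet> (u i *\<^sub>R x i))"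
    by (intro sum.cong) (auto simp: bary_def inner_diff_right algebra_simps)
  also have "\<dots> = (1 - bary_grad V p \<bullet> p) + bary_grad V p \<bullet> (\<Sum>i\<in>I. u i *\<^sub>R x i)"
    using assms by (simp add: sum.distrib inner_sum_right flip: sum_distrib_right)
  finally show ?thesis by (simp add: bary_def inner_diff_right)
qed

lemma continuous_on_bary[continuous_intros]: "continuous_on A f \<Longrightarrow> continuous_on A (\<lambda>x. bary V p (f x))"
  unfolding bary_def by (intro continuous_intros)

lemma abs_bary_diff_le: "\<bar>bary V p x - bary V p y\<bar> \<le> norm (bary_grad V p) * norm (x - y)"
  unfolding bary_diff by (rule Cauchy_Schwarz_ineq2)

context
  fixes V :: "(real^'n) set"
  assumes V: "simplex_vertices V"
begin

lemma simplex_vertices_finite: "finite V"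
  using V aff_independent_finite by (auto simp: simplex_vertices_def)

text \<open>The differences of the other vertices to \<open>p\<close> are linearly independent, so
  some linear functional takes the value -1 on all of them. The vector representing it,
  \<open>adjoint f 1\<close>, shows that the choice in \<open>bary_grad\<close> succeeds.\<close>

lemma bary_other:
  assumes "p \<in> V" "q \<in> V" "q \<noteq> p"
  shows "bary V p q = 0"
proof -
  have "independent ((\<lambda>x. - p + x) ` (V - {p}))"
    using V assms(1) affine_dependent_iff_dependent2[of p V] by (simp add: simplex_vertices_def)
  from linear_independent_extend[OF this, of "\<lambda>x. -1 :: real"] obtain f :: "real^'n \<Rightarrow> real"
    where f: "linear f" "\<And>x. x \<in> (\<lambda>x. - p + x) ` (V - {p}) \<Longrightarrow> f x = -1" by blast
  have "adjoint f 1 \<bullet> x = f x" for x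
    using adjoint_works[OF f(1), of x 1] by (simp add: inner_commute)
  then have "\<forall>q\<in>V - {p}. 1 + adjoint f 1 \<bullet> (q - p) = 0" using f(2) by auto
  from someI[where P="\<lambda>g. \<forall>q\<in>V - {p}. 1 + g \<bullet> (q - p) = 0", OF this]
  show ?thesis using assms by (simp add: bary_def bary_grad_def)
qed

lemma bary_vertex: "p \<in> V \<Longrightarrow> q \<in> V \<Longrightarrow> bary V p q = (if p = q then 1 else 0)"
  using bary_other by auto

lemma bary_sum_vertices:
  assumes "sum u V = 1" "q \<in> V"
  shows "bary V q (\<Sum>p\<in>V. u p *\<^sub>R p) = u q"
  using assms simplex_vertices_finite by (simp add: bary_sum bary_vertex if_distrib[of "\<lambda>x. _ * x"] cong: if_cong)

lemma affine_hull_simplex_vertices: "affine hull V = UNIV"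
  using V by (intro affine_independent_span_eq) (auto simp: simplex_vertices_def)

lemma bary_represent:
  shows "(\<Sum>p\<in>V. bary V p x) = 1" "(\<Sum>p\<in>V. bary V p x *\<^sub>R p) = x"
proof -
  have "x \<in> affine hull V" by (simp add: affine_hull_simplex_vertices)
  then obtain u where u: "sum u V = 1" "(\<Sum>p\<in>V. u p *\<^sub>R p) = x"
    using affine_hull_finite[OF simplex_vertices_finite] by auto
  then have "bary V q x = u q" if "q \<in> V" for q using bary_sum_vertices[OF u(1) that] by simp
  then show "(\<Sum>p\<in>V. bary V p x) = 1" "(\<Sum>p\<in>V. bary V p x *\<^sub>R p) = x" using u by (simp_all cong: sum.cong)
qed

lemma convex_hull_bary: "convex hull V = {x. \<forall>p\<in>V. 0 \<le> bary V p x}"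
proof (intro equalityI subsetI)
  fix x assume "x \<in> convex hull V"
  then obtain u where u: "\<And>p. p \<in> V \<Longrightarrow> 0 \<le> u p" "sum u V = 1" "(\<Sum>p\<in>V. u p *\<^sub>R p) = x"
    unfolding convex_hull_finite[OF simplex_vertices_finite] by auto
  then show "x \<in> {x. \<forall>p\<in>V. 0 \<le> bary V p x}" using bary_sum_vertices[OF u(2)] by auto
next
  fix x assume "x \<in> {x. \<forall>p\<in>V. 0 \<le> bary V p x}"
  then show "x \<in> convex hull V"
    unfolding convex_hull_finite[OF simplex_vertices_finite] using bary_represent[of x] by auto
qed

lemma bary_le_1:
  assumes "x \<in> convex hull V" "p \<in> V" shows "bary V p x \<le> 1"
proof -
  have "bary V p x \<le> (\<Sum>q\<in>V. bary V q x)"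
    using assms simplex_vertices_finite by (intro member_le_sum) (auto simp: convex_hull_bary)
  then show ?thesis by (simp add: bary_represent)
qed

lemma interior_convex_hull_bary: "interior (convex hull V) = {x. \<forall>p\<in>V. 0 < bary V p x}"
proof (rule interior_unique)
  show "{x. \<forall>p\<in>V. 0 < bary V p x} \<subseteq> convex hull V" by (auto simp: convex_hull_bary intro: less_imp_le)
  have "{x. \<forall>p\<in>V. 0 < bary V p x} = (\<Inter>p\<in>V. {x. 0 < bary V p x})" by auto
  also have "open \<dots>" using simplex_vertices_finite
    by (intro open_INT ballI open_Collect_less continuous_intros) auto
  finally show "open {x. \<forall>p\<in>V. 0 < bary V p x}" .
  fix U assume U: "U \<subseteq> convex hull V" "open U"
  show "U \<subseteq> {x. \<forall>p\<in>V. 0 < bary V p x}"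
  proof (clarify)
    fix x p assume x: "x \<in> U" "p \<in> V"
    obtain r where r: "r > 0" "ball x r \<subseteq> U" using U x openE by blast
    \<comment> \<open>Moving away from \<open>p\<close> changes the coordinate b of \<open>p\<close>
      to b + t (b - 1). If b were 0, this motion would leave the simplex at once, although
      \<open>U\<close> is open.\<close>
    have "((\<lambda>t. x + t *\<^sub>R (x - p)) \<longlongrightarrow> x + 0 *\<^sub>R (x - p)) (at_right 0)" by (intro tendsto_intros)
    then have "((\<lambda>t. x + t *\<^sub>R (x - p)) \<longlongrightarrow> x) (at_right 0)" by simp
    from topological_tendstoD[OF this open_ball, of x r]
    have "\<forall>\<^sub>F t in at_right 0. x + t *\<^sub>R (x - p) \<in> ball x r" using r by simp
    then have "\<forall>\<^sub>F t in at_right (0::real). x + t *\<^sub>R (x - p) \<in> ball x r \<and> t > 0"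
      by (intro eventually_conj) (auto simp: eventually_at_right_less)
    then obtain t where t: "x + t *\<^sub>R (x - p) \<in> ball x r" "t > 0"
      using eventually_happens'[OF trivial_limit_at_right_real[of 0]] by blast
    then have "0 \<le> bary V p (x + t *\<^sub>R (x - p))" using r U x convex_hull_bary by blast
    moreover have "bary V p (x + t *\<^sub>R (x - p)) = bary V p x + t * (bary V p x - 1)"
      by (simp add: bary_def algebra_simps inner_add_right inner_diff_right)
    moreover have "bary V p x \<ge> 0" using x U convex_hull_bary by blast
    ultimately have "bary V p x \<noteq> 0" using t by (intro notI) simp
    then show "0 < bary V p x" using \<open>bary V p x \<ge> 0\<close> by simp
  qed
qed

lemma facet_bary:
  assumes "p \<in> V"
  shows "convex hull (V - {p}) = {x \<in> convex hull V. bary V p x = 0}"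
proof (intro equalityI subsetI)
  fix x assume x: "x \<in> convex hull (V - {p})"
  then obtain u where u: "\<And>q. q \<in> V - {p} \<Longrightarrow> 0 \<le> u q" "sum u (V - {p}) = 1" "(\<Sum>q\<in>V - {p}. u q *\<^sub>R q) = x"
    using convex_hull_finite[of "V - {p}"] simplex_vertices_finite by auto
  have "bary V p x = (\<Sum>q\<in>V - {p}. u q * bary V p q)"
    unfolding u(3)[symmetric] using u(2) simplex_vertices_finite by (intro bary_sum) auto
  also have "\<dots> = 0" using assms by (intro sum.neutral) (auto simp: bary_other)
  finally show "x \<in> {x \<in> convex hull V. bary V p x = 0}" using x hull_mono[of "V - {p}" V convex] by auto
next
  fix x assume x: "x \<in> {x \<in> convex hull V. bary V p x = 0}"
  have "(\<Sum>q\<in>V - {p}. bary V q x) = 1" "(\<Sum>q\<in>V - {p}. bary V q x *\<^sub>R q) = x"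
    using bary_represent[of x] x sum.remove[OF simplex_vertices_finite assms, of "\<lambda>q. bary V q x"]
      sum.remove[OF simplex_vertices_finite assms, of "\<lambda>q. bary V q x *\<^sub>R q"] by auto
  then show "x \<in> convex hull (V - {p})"
    using convex_hull_finite[of "V - {p}"] simplex_vertices_finite x by (auto simp: convex_hull_bary)
qed

lemma interior_nonempty: "interior (convex hull V) \<noteq> {}"
proof -
  define c where "c = (\<Sum>p\<in>V. (1 / card V) *\<^sub>R p)"
  have "card V > 0" using V by (simp add: simplex_vertices_def)
  then have "bary V q c = 1 / card V" if "q \<in> V" for q
    unfolding c_def using that by (intro bary_sum_vertices) auto
  then have "c \<in> interior (convex hull V)" using \<open>card V > 0\<close> by (simp add: interior_convex_hull_bary)
  then show ?thesis by blast
qed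

lemma closure_interior_simplex: "closure (interior (convex hull V)) = convex hull V"
  using convex_closure_interior[OF convex_convex_hull interior_nonempty] simplex_vertices_finite
  by (simp add: compact_imp_closed finite_imp_compact_convex_hull)

lemma simplex_lmeasurable: "interior (convex hull V) \<in> lmeasurable"
  using simplex_vertices_finite by (intro lmeasurable_open) (auto simp: finite_imp_bounded_convex_hull bounded_interior)

lemma measure_simplex_pos: "0 < measure lebesgue (interior (convex hull V))"
proof -
  have "\<not> negligible (interior (convex hull V))" using interior_nonempty open_not_negligible by blast
  then show ?thesis using simplex_lmeasurable by (simp add: negligible_iff_measure zero_less_measure_iff)
qed

end

section \<open>Shape regularity of a single simplex\<close>

lemma measure_cball_le:
  fixes p :: "real^'n"
  assumes "0 \<le> r" shows "measure lebesgue (cball p r) \<le> (2 * r) ^ CARD('n)"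
proof -
  let ?e = "\<chi> i. r"
  have "cball p r \<subseteq> cbox (p - ?e) (p + ?e)"
  proof
    fix x assume "x \<in> cball p r"
    then have "\<bar>(x - p) $ i\<bar> \<le> r" for i using component_le_norm_cart[of "x - p" i] by (simp add: dist_norm norm_minus_commute)
    then show "x \<in> cbox (p - ?e) (p + ?e)" by (auto simp: mem_box_cart abs_le_iff) (smt (verit))+
  qed
  then have "measure lebesgue (cball p r) \<le> measure lebesgue (cbox (p - ?e) (p + ?e))"
    by (intro measure_mono_fmeasurable) auto
  also have "\<dots> = (2 * r) ^ CARD('n)"
  proof -
    have "p \<in> cbox (p - ?e) (p + ?e)" using assms by (simp add: mem_box_cart)
    then have "cbox (p - ?e) (p + ?e) \<noteq> {}" by blast
    then show ?thesis using content_cbox_cart[of "p - ?e" "p + ?e"] by simp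
  qed
  finally show ?thesis .
qed

text \<open>Translates of a slab in normal direction are disjoint; this bounds the volume of the slab
  without rotating coordinates.\<close>

lemma slab_volume:
  fixes g p :: "real^'n"
  assumes S: "S \<in> lmeasurable" "S \<subseteq> cball p h" "\<And>x. x \<in> S \<Longrightarrow> 0 < 1 + g \<bullet> (x - p)" "\<And>x. x \<in> S \<Longrightarrow> 1 + g \<bullet> (x - p) \<le> 1"
    and gh: "1 \<le> norm g * h" and "0 < h"
  shows "measure lebesgue S * (norm g * h) \<le> (6 * h) ^ CARD('n)"
proof -
  \<comment> \<open>Since \<open>norm g * h\<close> is at least 1, rounding it up at most doubles
    it.\<close>
  define N where "N = nat \<lceil>norm g * h\<rceil>"
  have N: "norm g * h \<le> real N" "real N \<le> 2 * (norm g * h)"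
    using gh by (auto simp: N_def) linarith+
  have g: "g \<noteq> 0" using gh by auto
  \<comment> \<open>\<open>u\<close> raises the affine function by exactly 1, so the
    \<open>j\<close>-th translate occupies values in (j, j+1], and the translates are disjoint.
    Fewer than \<open>N\<close> steps of length 1/|g| stay within distance
    \<open>2 * h\<close>.\<close>
  define u where "u = g /\<^sub>R (norm g)\<^sup>2"
  have gu: "g \<bullet> u = 1" using g by (simp add: u_def dot_square_norm)
  have nu: "norm u = 1 / norm g" using g by (simp add: u_def power2_eq_square field_simps)
  define A where "A j = (+) (real j *\<^sub>R u) ` S" for j
  have lam: "real j < 1 + g \<bullet> (x - p) \<and> 1 + g \<bullet> (x - p) \<le> real j + 1" if "x \<in> A j" for x j
    using that S(3,4) gu by (force simp: A_def inner_add_right inner_diff_right)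
  have disj: "disjoint_family_on A {..<N}"
    unfolding disjoint_family_on_def
  proof (clarsimp simp: set_eq_iff, goal_cases)
    case (1 m n x)
    then have "real m < real n + 1" "real n < real m + 1" using lam by (meson le_less_trans less_le_trans)+
    then show ?case using 1 by simp
  qed
  have mA: "A j \<in> lmeasurable" "measure lebesgue (A j) = measure lebesgue S" for j
    using S(1) measurable_translation measure_translation by (auto simp: A_def)
  have "A j \<subseteq> cball p (3 * h)" if "j < N" for j
  proof
    fix x assume "x \<in> A j"
    then obtain y where y: "y \<in> S" "x = real j *\<^sub>R u + y" by (auto simp: A_def)
    have "norm (real j *\<^sub>R u) \<le> real N * (1 / norm g)" using that by (simp add: nu divide_right_mono)
    also have "\<dots> \<le> 2 * h" using N(2) g by (simp add: field_simps)
    finally have "norm (real j *\<^sub>R u) \<le> 2 * h" .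
    moreover have "dist p y \<le> h" using S(2) y by auto
    ultimately show "x \<in> cball p (3 * h)" using norm_triangle_ineq[of "real j *\<^sub>R u" "y - p"]
      by (simp add: y dist_norm norm_minus_commute algebra_simps)
  qed
  then have "measure lebesgue (\<Union>j<N. A j) \<le> measure lebesgue (cball p (3 * h))"
    using mA by (intro measure_mono_fmeasurable) (auto simp: fmeasurableD)
  also have "measure lebesgue (\<Union>j<N. A j) = (\<Sum>j<N. measure lebesgue (A j))"
    using mA disj by (intro measure_UNION') (auto simp: pairwise_def disjnt_def disjoint_family_on_def)
  finally have "real N * measure lebesgue S \<le> measure lebesgue (cball p (3 * h))" using mA by simp
  also have "\<dots> \<le> (6 * h) ^ CARD('n)" using measure_cball_le[of "3 * h" p] \<open>0 < h\<close> by simp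
  finally have "real N * measure lebesgue S \<le> (6 * h) ^ CARD('n)" .
  moreover have "measure lebesgue S * (norm g * h) \<le> real N * measure lebesgue S"
    using mult_right_mono[OF N(1), of "measure lebesgue S"] by (simp add: mult.commute)
  ultimately show ?thesis by linarith
qed

context
  fixes V :: "(real^'n) set" and h \<gamma> :: real
  assumes V: "simplex_vertices V"
    and h: "h = diameter (convex hull V)"
    and shape: "h ^ CARD('n) \<le> \<gamma> * measure lebesgue (interior (convex hull V))"
begin

lemma simplex_dist_le: "x \<in> convex hull V \<Longrightarrow> y \<in> convex hull V \<Longrightarrow> dist x y \<le> h"
  unfolding h using finite_imp_bounded_convex_hull[OF simplex_vertices_finite[OF V]]
  by (rule diameter_bounded_bound)

lemma simplex_two_vertices: "p \<in> V \<Longrightarrow> \<exists>q\<in>V. q \<noteq> p"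
proof (rule ccontr)
  assume "p \<in> V" "\<not> (\<exists>q\<in>V. q \<noteq> p)"
  then have "V = {p}" by blast
  then show False using V by (simp add: simplex_vertices_def)
qed

lemma simplex_diameter_pos: "0 < h"
proof -
  have "V \<noteq> {}" using V by (auto simp: simplex_vertices_def)
  then obtain p q where "p \<in> V" "q \<in> V" "q \<noteq> p" using simplex_two_vertices by blast
  then have "0 < dist p q" "dist p q \<le> h" using simplex_dist_le[of p q] by (auto simp: hull_inc)
  then show ?thesis by linarith
qed

lemma shape_constant_pos: "0 < \<gamma>"
proof (rule ccontr)
  assume "\<not> 0 < \<gamma>"
  then have "\<gamma> * measure lebesgue (interior (convex hull V)) \<le> 0"
    using measure_simplex_pos[OF V] by (simp add: mult_le_0_iff)
  then show False using shape zero_less_power[OF simplex_diameter_pos, of "CARD('n)"] by linarith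
qed

lemma bary_grad_ge: "p \<in> V \<Longrightarrow> q \<in> V \<Longrightarrow> q \<noteq> p \<Longrightarrow> 1 \<le> norm (bary_grad V p) * dist p q"
  using abs_bary_diff_le[of V p p q] bary_other[OF V, of p q] by (simp add: dist_norm)

text \<open>The reciprocal of the gradient's norm is the height of the simplex over the facet
  opposite to \<open>p\<close>. A flat simplex fits into a thin slab and has little volume, contrary
  to \<open>shape\<close>. The factor 6^n is the volume of the cube around a ball of radius 3 in
  units of the diameter.\<close>

lemma bary_grad_le:
  assumes p: "p \<in> V" shows "norm (bary_grad V p) * h \<le> 6 ^ CARD('n) * \<gamma>"
proof -
  let ?T = "interior (convex hull V)"
  obtain q where q: "q \<in> V" "q \<noteq> p" using simplex_two_vertices p by blast
  have "dist p q \<le> h" using simplex_dist_le p q by (simp add: hull_inc)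
  then have gh: "1 \<le> norm (bary_grad V p) * h"
    using bary_grad_ge[OF p q] mult_left_mono[of "dist p q" h "norm (bary_grad V p)"] by simp
  have "measure lebesgue ?T * (norm (bary_grad V p) * h) \<le> (6 * h) ^ CARD('n)"
  proof (rule slab_volume[OF simplex_lmeasurable[OF V] _ _ _ gh simplex_diameter_pos, where p=p])
    show "?T \<subseteq> cball p h" using simplex_dist_le interior_subset p by (force simp: hull_inc)
    fix x assume x: "x \<in> ?T"
    show "0 < 1 + bary_grad V p \<bullet> (x - p)" using x p interior_convex_hull_bary[OF V] by (auto simp: bary_def)
    show "1 + bary_grad V p \<bullet> (x - p) \<le> 1"
      using bary_le_1[OF V _ p, of x] x interior_subset by (auto simp: bary_def)
  qed
  then have "measure lebesgue ?T * (norm (bary_grad V p) * h) \<le> 6 ^ CARD('n) * h ^ CARD('n)"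
    by (simp add: power_mult_distrib)
  also have "\<dots> \<le> 6 ^ CARD('n) * (\<gamma> * measure lebesgue ?T)"
    by (intro mult_left_mono shape) simp
  finally have "measure lebesgue ?T * (norm (bary_grad V p) * h) \<le> measure lebesgue ?T * (6 ^ CARD('n) * \<gamma>)"
    by (simp add: mult_ac)
  then show ?thesis using measure_simplex_pos[OF V] by simp
qed

text \<open>Along an edge the coordinate of one endpoint falls from 1 to 0; a short edge would need
  a steep coordinate, which \<open>bary_grad_le\<close> excludes.\<close>

lemma simplex_edge_ge:
  assumes "p \<in> V" "q \<in> V" "p \<noteq> q"
  shows "h \<le> 6 ^ CARD('n) * \<gamma> * dist p q"
proof -
  have "h * 1 \<le> h * (norm (bary_grad V p) * dist p q)"
    using bary_grad_ge[of p q] assms simplex_diameter_pos by (intro mult_left_mono) auto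
  also have "\<dots> = (norm (bary_grad V p) * h) * dist p q" by simp
  also have "\<dots> \<le> 6 ^ CARD('n) * \<gamma> * dist p q"
    by (intro mult_right_mono bary_grad_le assms) simp
  finally show ?thesis by simp
qed

lemma simplex_measure_le: "measure lebesgue (interior (convex hull V)) \<le> (2 * h) ^ CARD('n)"
proof -
  have "V \<noteq> {}" using V by (auto simp: simplex_vertices_def)
  then obtain p where "p \<in> V" by blast
  then have "interior (convex hull V) \<subseteq> cball p h" using simplex_dist_le interior_subset by (force simp: hull_inc)
  then have "measure lebesgue (interior (convex hull V)) \<le> measure lebesgue (cball p h)"
    using simplex_lmeasurable[OF V] by (intro measure_mono_fmeasurable) (auto simp: fmeasurableD)
  also have "\<dots> \<le> (2 * h) ^ CARD('n)" using measure_cball_le[of h p] simplex_diameter_pos by (simp add: less_imp_le)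
  finally show ?thesis .
qed

lemma bary_lipschitz:
  assumes "p \<in> V" shows "(6 ^ CARD('n) * \<gamma> / h)-lipschitz_on A (bary V p)"
proof (rule lipschitz_onI)
  fix x y :: "real^'n"
  have "norm (bary_grad V p) \<le> 6 ^ CARD('n) * \<gamma> / h"
    using bary_grad_le[OF assms] simplex_diameter_pos by (simp add: field_simps)
  then have "norm (bary_grad V p) * norm (x - y) \<le> 6 ^ CARD('n) * \<gamma> / h * norm (x - y)"
    by (intro mult_right_mono) auto
  then show "dist (bary V p x) (bary V p y) \<le> 6 ^ CARD('n) * \<gamma> / h * dist x y"
    using abs_bary_diff_le[of V p x y] by (simp add: dist_real_def dist_norm)
qed (use shape_constant_pos simplex_diameter_pos in simp)

end

section \<open>Bubble functions\<close>

text \<open>A pyramid over the simplex, used in place of the customary product of barycentric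
  coordinates: as a minimum it inherits their Lipschitz constant, and the positive part extends it
  by 0.\<close>

definition bubble :: "(real^'n) set \<Rightarrow> real^'n \<Rightarrow> real" where
  "bubble V x = max 0 (Min ((\<lambda>p. bary V p x) ` V))"

context
  fixes V :: "(real^'n) set"
  assumes V: "simplex_vertices V"
begin

lemma simplex_vertices_nonempty: "V \<noteq> {}" using V by (auto simp: simplex_vertices_def)

lemma bubble_outside:
  assumes "x \<notin> interior (convex hull V)" shows "bubble V x = 0"
proof -
  obtain p where "p \<in> V" "bary V p x \<le> 0" using assms by (auto simp: interior_convex_hull_bary[OF V] not_less)
  moreover from this have "Min ((\<lambda>p. bary V p x) ` V) \<le> bary V p x"
    using simplex_vertices_finite[OF V] by (intro Min_le) auto
  ultimately show ?thesis by (simp add: bubble_def)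
qed

lemma bubble_lipschitz:
  assumes L: "\<And>p. p \<in> V \<Longrightarrow> L-lipschitz_on UNIV (bary V p)"
  shows "L-lipschitz_on UNIV (bubble V)"
proof (rule lipschitz_onI)
  fix x y
  have *: "Min ((\<lambda>p. bary V p x) ` V) \<le> Min ((\<lambda>p. bary V p y) ` V) + L * dist x y" for x y
  proof -
    have "Min ((\<lambda>p. bary V p y) ` V) \<in> (\<lambda>p. bary V p y) ` V"
      using simplex_vertices_finite[OF V] simplex_vertices_nonempty by (intro Min_in) auto
    then obtain p where p: "p \<in> V" "Min ((\<lambda>p. bary V p y) ` V) = bary V p y" by blast
    have "Min ((\<lambda>p. bary V p x) ` V) \<le> bary V p x" using p simplex_vertices_finite[OF V] by (intro Min_le) auto
    then show ?thesis using lipschitz_onD[OF L[OF p(1)], of x y] p by (simp add: dist_real_def)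
  qed
  show "dist (bubble V x) (bubble V y) \<le> L * dist x y"
    using *[of x y] *[of y x] by (auto simp: bubble_def dist_real_def dist_commute max_def)
next
  show "0 \<le> L" using simplex_vertices_nonempty L lipschitz_on_nonneg by blast
qed

lemma cc_bubble: "cc (bubble V)"
proof -
  have "(\<Sum>p\<in>V. norm (bary_grad V p))-lipschitz_on UNIV (bubble V)"
  proof (rule bubble_lipschitz, rule lipschitz_onI)
    fix p x y assume "p \<in> V"
    then have "norm (bary_grad V p) \<le> (\<Sum>p\<in>V. norm (bary_grad V p))"
      using simplex_vertices_finite[OF V] by (intro member_le_sum) auto
    from mult_right_mono[OF this norm_ge_zero[of "x - y"]]
    show "dist (bary V p x) (bary V p y) \<le> (\<Sum>p\<in>V. norm (bary_grad V p)) * dist x y"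
      unfolding dist_real_def dist_norm by (rule order_trans[OF abs_bary_diff_le])
  qed (simp add: sum_nonneg)
  then have "continuous_on UNIV (bubble V)" by (rule lipschitz_on_continuous_on)
  moreover have "compact (convex hull V)" using simplex_vertices_finite[OF V] by (rule finite_imp_compact_convex_hull)
  moreover have "bubble V x = 0" if "x \<notin> convex hull V" for x
    using that interior_subset by (intro bubble_outside) blast
  ultimately show ?thesis unfolding cc_def by blast
qed

text \<open>Contract the simplex by 1/2 towards its centroid, where all coordinates equal 1/(n+1).
  On the copy, of volume |T|/2^n, every coordinate is at least 1/(2(n+1)).\<close>

lemma bubble_integral:
  "measure lebesgue (interior (convex hull V)) / (2 ^ CARD('n) * (2 * (CARD('n) + 1))) \<le> integral UNIV (bubble V)"
proof -
  let ?T = "interior (convex hull V)"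
  let ?N = "real CARD('n) + 1"
  have fin: "finite V" by (rule simplex_vertices_finite[OF V])
  define c where "c = (\<Sum>p\<in>V. (1 / card V) *\<^sub>R p)"
  have cV: "card V = CARD('n) + 1" using V by (simp add: simplex_vertices_def)
  have bc: "bary V q c = 1 / ?N" if "q \<in> V" for q
    unfolding c_def using that cV by (subst bary_sum_vertices[OF V]) auto
  define S where "S = (\<lambda>x. (1/2) *\<^sub>R x + (1/2) *\<^sub>R c) ` ?T"
  have mS: "measure lebesgue S = (1/2) ^ CARD('n) * measure lebesgue ?T"
    unfolding S_def using measure_lebesgue_affine[of "1/2" "(1/2) *\<^sub>R c" ?T] by simp
  have bS: "1 / (2 * ?N) \<le> bubble V y" if "y \<in> S" for y
  proof -
    obtain x where x: "x \<in> ?T" "y = (1 - 1/2) *\<^sub>R x + (1/2) *\<^sub>R c" using \<open>y \<in> S\<close> by (auto simp: S_def)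
    have "1 / (2 * ?N) \<le> bary V p y" if "p \<in> V" for p
    proof -
      have "0 < bary V p x" using x that interior_convex_hull_bary[OF V] by blast
      then show ?thesis unfolding x bary_convex_comb bc[OF that] by simp
    qed
    then have "1 / (2 * ?N) \<le> Min ((\<lambda>p. bary V p y) ` V)" using fin simplex_vertices_nonempty by simp
    then show ?thesis by (simp add: bubble_def)
  qed
  have "open S" unfolding S_def using open_affinity[of ?T "1/2" "(1/2) *\<^sub>R c"] by (simp add: add.commute)
  moreover have "S \<subseteq> ?T" using bS bubble_outside by force
  then have "bounded S" using fin finite_imp_bounded_convex_hull bounded_interior bounded_subset by blast
  ultimately have SL: "S \<in> lmeasurable" by (simp add: lmeasurable_open)
  have bi: "bubble V integrable_on S"
    using set_integrable_subset[OF cc_absint[OF cc_bubble], of S] SL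
    by (auto simp: fmeasurableD absolutely_integrable_on_def)
  have ci: "(\<lambda>x. 1 / (2 * ?N)) integrable_on S" using SL by (intro integrable_on_const)
  have "measure lebesgue S * (1 / (2 * ?N)) = integral S (\<lambda>x. 1 / (2 * ?N))"
    using lmeasure_integral[OF SL] integral_mult_right[of S "1 / (2 * ?N)" "\<lambda>x. 1"] by simp
  also have "\<dots> \<le> integral S (bubble V)"
    using bS by (intro integral_le ci bi) auto
  also have "\<dots> \<le> integral UNIV (bubble V)"
    by (intro integral_subset_le bi cc_integrable(2)[OF cc_bubble]) (auto simp: bubble_def)
  finally show ?thesis unfolding mS by (simp add: power_one_over field_simps)
qed

end

section \<open>Affine changes of variables\<close>

text \<open>The change of variables theorems of the library need a well-ordered index type. An arbitrary
  finite type is copied to a well-ordered one and the results are transported back.\<close>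

typedef 'a ordered_copy = "UNIV :: 'a set" morphisms uncopy copy by simp

instance ordered_copy :: (finite) finite
proof
  have "(UNIV :: 'a ordered_copy set) = range copy"
    using uncopy_inverse by (metis surj_def)
  then show "finite (UNIV :: 'a ordered_copy set)" by (metis finite finite_imageI)
qed

definition copy_index :: "'a::finite ordered_copy \<Rightarrow> nat" where
  "copy_index = (SOME f. inj f)"

lemma inj_copy_index: "inj (copy_index :: 'a::finite ordered_copy \<Rightarrow> nat)"
proof -
  have "\<exists>f :: 'a ordered_copy \<Rightarrow> nat. inj f"
    using finite_imp_inj_to_nat_seg[of "UNIV :: 'a ordered_copy set"] by auto
  then show ?thesis unfolding copy_index_def by (rule someI_ex)
qed

instantiation ordered_copy :: (finite) wellorder
begin

definition less_eq_ordered_copy :: "'a ordered_copy \<Rightarrow> 'a ordered_copy \<Rightarrow> bool" where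
  "x \<le> y \<longleftrightarrow> copy_index x \<le> copy_index y"

definition less_ordered_copy :: "'a ordered_copy \<Rightarrow> 'a ordered_copy \<Rightarrow> bool" where
  "x < y \<longleftrightarrow> copy_index x < copy_index y"

instance
proof
  fix P :: "'a ordered_copy \<Rightarrow> bool" and a :: "'a ordered_copy"
  assume step: "\<And>x. (\<And>y. y < x \<Longrightarrow> P y) \<Longrightarrow> P x"
  show "P a"
  proof (induction a rule: measure_induct_rule[where f=copy_index])
    case (less x)
    show ?case by (rule step, rule less) (simp only: less_ordered_copy_def)
  qed
qed (auto simp: less_eq_ordered_copy_def less_ordered_copy_def dest: injD[OF inj_copy_index])

end

definition to_copy :: "real^'n \<Rightarrow> real^('n ordered_copy)" where
  "to_copy x = (\<chi> i. x $ uncopy i)"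

definition from_copy :: "real^('n ordered_copy) \<Rightarrow> real^'n" where
  "from_copy y = (\<chi> i. y $ copy i)"

lemma copy_simps[simp]: "from_copy (to_copy x) = x" "to_copy (from_copy y) = y"
  by (simp_all add: to_copy_def from_copy_def vec_eq_iff copy_inverse uncopy_inverse)

lemma linear_copy: "linear to_copy" "linear from_copy"
  by (auto intro!: linearI simp: to_copy_def from_copy_def vec_eq_iff)

lemma to_copy_box: "to_copy ` box l u = box (to_copy l) (to_copy u)"
proof -
  have "x \<in> box (to_copy l) (to_copy u) \<longleftrightarrow> from_copy x \<in> box l u" for x
    by (auto simp: mem_box_cart to_copy_def from_copy_def) (metis copy_inverse[OF UNIV_I] uncopy_inverse)+
  then show ?thesis by (force simp: image_iff)
qed

lemma prod_UNIV_copy: "(\<Prod>i\<in>UNIV. f (uncopy i)) = (\<Prod>i\<in>(UNIV :: 'n::finite set). f i)"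
  by (rule prod.reindex_bij_witness[of _ copy uncopy]) (auto simp: copy_inverse uncopy_inverse)

lemma prod_Basis_cart:
  fixes l u :: "real^'n"
  assumes "\<And>i. l $ i \<le> u $ i"
  shows "(\<Prod>b\<in>Basis. (u - l) \<bullet> b) = (\<Prod>i\<in>UNIV. u $ i - l $ i)"
proof -
  have "l \<in> cbox l u" using assms by (simp add: mem_box_cart)
  then have "cbox l u \<noteq> {}" by blast
  moreover have "\<forall>b\<in>Basis. l \<bullet> b \<le> u \<bullet> b" using assms by (auto simp: Basis_vec_def inner_axis)
  ultimately show ?thesis using content_cbox_cart[of l u] content_cbox'[of l u]
    by (simp add: inner_diff_left)
qed

lemma emeasure_lborel_box_cart:
  fixes l u :: "real^'n"
  assumes "\<And>i. l $ i \<le> u $ i"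
  shows "emeasure lborel (box l u) = ennreal (\<Prod>i\<in>UNIV. u $ i - l $ i)"
proof -
  have "\<forall>b\<in>Basis. l \<bullet> b \<le> u \<bullet> b" using assms by (auto simp: Basis_vec_def inner_axis)
  then show ?thesis using prod_Basis_cart[OF assms] by (simp add: emeasure_lborel_box_eq)
qed

lemma lborel_eq_cartI:
  fixes M :: "(real^'n) measure"
  assumes "\<And>l u. (\<And>i. l $ i \<le> u $ i) \<Longrightarrow> emeasure M (box l u) = ennreal (\<Prod>i\<in>UNIV. u $ i - l $ i)"
    and "sets M = sets borel"
  shows "lborel = M"
proof (rule lborel_eqI)
  fix l u :: "real^'n" assume "\<And>b. b \<in> Basis \<Longrightarrow> l \<bullet> b \<le> u \<bullet> b"
  then have "l $ i \<le> u $ i" for i using axis_in_Basis_iff[of i "1::real"] by (fastforce simp: inner_axis)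
  then show "emeasure M (box l u) = ennreal (\<Prod>b\<in>Basis. (u - l) \<bullet> b)"
    using assms(1)[of l u] prod_Basis_cart[of l u] by simp
qed (rule assms(2))

lemma copy_measurable[measurable]: "to_copy \<in> borel \<rightarrow>\<^sub>M borel" "from_copy \<in> borel \<rightarrow>\<^sub>M borel"
  using linear_copy by (auto intro!: borel_measurable_continuous_onI linear_continuous_on simp: linear_conv_bounded_linear)

lemma lborel_to_copy: "distr lborel borel to_copy = lborel"
proof (rule lborel_eq_cartI[symmetric])
  fix l u :: "real^('n::finite ordered_copy)" assume le: "\<And>i. l $ i \<le> u $ i"
  have "to_copy -` box l u = box (from_copy l) (from_copy u)"
    using to_copy_box[of "from_copy l" "from_copy u"] by (auto simp: set_eq_iff) (metis copy_simps(1) imageE)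
  then have "emeasure (distr lborel borel to_copy) (box l u) = emeasure lborel (box (from_copy l) (from_copy u))"
    by (simp add: emeasure_distr)
  also have "\<dots> = ennreal (\<Prod>i\<in>UNIV. u $ copy i - l $ copy i)"
    using le by (subst emeasure_lborel_box_cart) (auto simp: from_copy_def)
  also have "(\<Prod>i\<in>UNIV. u $ copy i - l $ copy i) = (\<Prod>i\<in>UNIV. u $ i - l $ i)"
    using prod_UNIV_copy[of "\<lambda>i. u $ copy i - l $ copy i"] by (simp add: uncopy_inverse)
  finally show "emeasure (distr lborel borel to_copy) (box l u) = ennreal (\<Prod>i\<in>UNIV. u $ i - l $ i)" .
qed simp

lemma emeasure_to_copy:
  assumes "S \<in> sets borel"
  shows "emeasure lborel (from_copy -` S) = emeasure lborel S"
proof -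
  have "from_copy -` S \<in> sets borel" using measurable_sets[OF copy_measurable(2) assms] by simp
  then have "emeasure lborel (from_copy -` S) = emeasure lborel (to_copy -` from_copy -` S)"
    by (subst lborel_to_copy[symmetric]) (simp add: emeasure_distr)
  then show ?thesis by (simp flip: vimage_comp add: vimage_def)
qed

text \<open>Lebesgue measure and its image under \<open>g\<close> agree on boxes up to a factor, and
  boxes determine the measure. The factor is |det g|, obtained from the inverse of \<open>g\<close>
  conjugated to the ordered copy. Only its positivity is recorded, because it will cancel in
  quotients of integrals.\<close>

lemma lborel_linear:
  fixes g :: "real^'n \<Rightarrow> real^'n"
  assumes g: "linear g" "inj g"
  obtains m where "0 < m" "lborel = density (distr lborel borel g) (\<lambda>_. ennreal m)"
proof -
  obtain h where h: "linear h" "\<And>x. h (g x) = x"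
    using linear_injective_left_inverse[OF g] by (auto simp: o_def fun_eq_iff)
  have gh: "g (h x) = x" for x
    using linear_inj_imp_surj[OF g] h(2) by (metis surj_def)
  have gm[measurable]: "g \<in> borel \<rightarrow>\<^sub>M borel"
    using g(1) by (intro borel_measurable_continuous_onI linear_continuous_on) (simp add: linear_conv_bounded_linear)
  have hm: "h \<in> borel \<rightarrow>\<^sub>M borel"
    using h(1) by (intro borel_measurable_continuous_onI linear_continuous_on) (simp add: linear_conv_bounded_linear)
  define B where "B = to_copy \<circ> h \<circ> from_copy"
  have B: "linear B" unfolding B_def using linear_copy h(1) by (intro linear_compose) auto
  have "inj B" unfolding B_def inj_def using gh by (metis comp_apply copy_simps)
  define c where "c = \<bar>det (matrix B)\<bar>"
  have c: "0 < c" unfolding c_def using det_nz_iff_inj[OF B] \<open>inj B\<close> by simp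
  have box: "emeasure lborel (g -` box l u) = ennreal (c * (\<Prod>i\<in>UNIV. u $ i - l $ i))" if le: "\<And>i. l $ i \<le> u $ i" for l u
  proof -
    have gb: "g -` box l u \<in> sets borel" using measurable_sets[OF gm, of "box l u"] by simp
    have "from_copy -` (g -` box l u) = B ` (to_copy ` box l u)"
    proof (intro equalityI subsetI)
      fix x assume "x \<in> from_copy -` (g -` box l u)"
      then have "g (from_copy x) \<in> box l u" by simp
      moreover have "x = B (to_copy (g (from_copy x)))" by (simp add: B_def h(2))
      ultimately show "x \<in> B ` (to_copy ` box l u)" by blast
    qed (auto simp: B_def gh)
    also have "to_copy ` box l u = box (to_copy l) (to_copy u)" by (rule to_copy_box)
    finally have e: "from_copy -` (g -` box l u) = B ` box (to_copy l) (to_copy u)" .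
    have "from_copy -` (g -` box l u) \<in> sets borel" using measurable_sets[OF copy_measurable(2) gb] by simp
    then have Bb: "B ` box (to_copy l) (to_copy u) \<in> sets borel" by (simp add: e)
    have Bl: "B ` box (to_copy l) (to_copy u) \<in> lmeasurable" by (rule measurable_linear_image[OF B lmeasurable_box])
    have "emeasure lborel (g -` box l u) = emeasure lborel (B ` box (to_copy l) (to_copy u))"
      using emeasure_to_copy[OF gb] e by simp
    also have "\<dots> = emeasure lebesgue (B ` box (to_copy l) (to_copy u))" using Bb by simp
    also have "\<dots> = ennreal (measure lebesgue (B ` box (to_copy l) (to_copy u)))"
      by (rule emeasure_eq_measure2[OF Bl])
    also have "measure lebesgue (B ` box (to_copy l) (to_copy u)) = c * measure lebesgue (box (to_copy l) (to_copy u))"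
      unfolding c_def by (rule measure_linear_image[OF B lmeasurable_box])
    also have "measure lebesgue (box (to_copy l) (to_copy u)) = (\<Prod>i\<in>UNIV. u $ uncopy i - l $ uncopy i)"
    proof -
      have "emeasure lborel (box (to_copy l) (to_copy u)) = ennreal (\<Prod>i\<in>UNIV. u $ uncopy i - l $ uncopy i)"
        using le by (subst emeasure_lborel_box_cart) (auto simp: to_copy_def)
      moreover have "0 \<le> (\<Prod>i\<in>UNIV. u $ uncopy i - l $ uncopy i)" using le by (intro prod_nonneg) auto
      ultimately show ?thesis by (simp add: measure_def)
    qed
    also have "\<dots> = (\<Prod>i\<in>UNIV. u $ i - l $ i)" by (rule prod_UNIV_copy)
    finally show ?thesis .
  qed
  show thesis
  proof (rule that)
    show "0 < 1 / c" using c by simp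
    show "lborel = density (distr lborel borel g) (\<lambda>_. ennreal (1 / c))"
    proof (rule lborel_eq_cartI)
      fix l u :: "real^'n" assume le: "\<And>i. l $ i \<le> u $ i"
      have "emeasure (density (distr lborel borel g) (\<lambda>_. ennreal (1 / c))) (box l u)
        = ennreal (1 / c) * emeasure lborel (g -` box l u)"
        by (subst emeasure_density_const) (auto simp: emeasure_distr)
      also have "\<dots> = ennreal (\<Prod>i\<in>UNIV. u $ i - l $ i)"
        unfolding box[OF le] using c by (simp flip: ennreal_mult')
      finally show "emeasure (density (distr lborel borel g) (\<lambda>_. ennreal (1 / c))) (box l u) = ennreal (\<Prod>i\<in>UNIV. u $ i - l $ i)" .
    qed simp
  qed
qed

lemma lborel_integral_shift:
  fixes f :: "real^'n \<Rightarrow> real"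
  assumes [measurable]: "f \<in> borel_measurable borel"
  shows "integral\<^sup>L lborel (\<lambda>x. f (a + x)) = integral\<^sup>L lborel f"
  by (subst lborel_distr_plus[of a, symmetric]) (simp add: integral_distr)

lemma lborel_integral_affine:
  fixes g :: "real^'n \<Rightarrow> real^'n"
  assumes g: "linear g" "inj g"
  obtains m where "0 < m" "\<And>(f :: real^'n \<Rightarrow> real). f \<in> borel_measurable borel \<Longrightarrow>
     integral\<^sup>L lborel f = m * integral\<^sup>L lborel (\<lambda>x. f (a + g x))"
proof -
  obtain m where m: "0 < m" "lborel = density (distr lborel borel g) (\<lambda>_. ennreal m)" by (rule lborel_linear[OF g])
  have gm[measurable]: "g \<in> borel \<rightarrow>\<^sub>M borel"
    using g(1) by (intro borel_measurable_continuous_onI linear_continuous_on) (simp add: linear_conv_bounded_linear)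
  have "integral\<^sup>L lborel f = m * integral\<^sup>L lborel (\<lambda>x. f (a + g x))" if [measurable]: "f \<in> borel_measurable borel" for f :: "real^'n \<Rightarrow> real"
  proof -
    have "integral\<^sup>L lborel f = integral\<^sup>L lborel (\<lambda>x. f (a + x))" by (rule lborel_integral_shift[symmetric]) measurable
    also have "\<dots> = integral\<^sup>L (density (distr lborel borel g) (\<lambda>_. ennreal m)) (\<lambda>x. f (a + x))" using m(2) by simp
    also have "\<dots> = m * integral\<^sup>L lborel (\<lambda>x. f (a + g x))" using m(1)
      by (simp add: integral_density integral_distr)
    finally show ?thesis .
  qed
  then show thesis using that m(1) by blast
qed

lemma lborel_integral_homothety:
  fixes f :: "real^'n \<Rightarrow> real"
  assumes [measurable]: "f \<in> borel_measurable borel" and "0 < s"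
  shows "integral\<^sup>L lborel f = s ^ CARD('n) * integral\<^sup>L lborel (\<lambda>x. f (p + s *\<^sub>R (x - p)))"
proof -
  have "integral\<^sup>L lborel f = integral\<^sup>L (density (distr lborel borel (\<lambda>x. (p - s *\<^sub>R p) + s *\<^sub>R x)) (\<lambda>_. \<bar>s\<bar>^DIM(real^'n))) f"
    using lborel_affine[of s "p - s *\<^sub>R p"] \<open>0 < s\<close> by simp
  also have "\<dots> = s ^ CARD('n) * integral\<^sup>L lborel (\<lambda>x. f ((p - s *\<^sub>R p) + s *\<^sub>R x))"
    using \<open>0 < s\<close> by (simp add: integral_density integral_distr ennreal_power)
  finally show ?thesis by (simp add: algebra_simps)
qed

lemma integrable_indicator_bounded:
  fixes f :: "real^'n \<Rightarrow> real"
  assumes "T \<in> sets borel" "bounded T" "f \<in> borel_measurable borel" and B: "\<And>x. x \<in> T \<Longrightarrow> \<bar>f x\<bar> \<le> B"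
  shows "integrable lborel (\<lambda>x. indicat_real T x * f x)"
proof (rule Bochner_Integration.integrable_bound)
  have "emeasure lborel T < \<infinity>" using assms(2) by (rule emeasure_bounded_finite)
  then show "integrable lborel (\<lambda>x. indicat_real T x * \<bar>B\<bar>)" using assms(1)
    by (intro integrable_mult_left) (simp add: integrable_indicator_iff)
  show "(\<lambda>x. indicat_real T x * f x) \<in> borel_measurable lborel" using assms(1,3) by simp
  show "AE x in lborel. norm (indicat_real T x * f x) \<le> norm (indicat_real T x * \<bar>B\<bar>)"
    using B by (intro AE_I2) (force simp: indicator_def)
qed

lemma integrable_indicator_continuous:
  fixes f :: "real^'n \<Rightarrow> real"
  assumes "T \<in> sets borel" "bounded T" and f: "continuous_on UNIV f"
  shows "integrable lborel (\<lambda>x. indicat_real T x * f x)"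
proof -
  have "compact (f ` closure T)"
    using assms(2) f by (intro compact_continuous_image) (auto intro: continuous_on_subset)
  then obtain B where B: "\<And>x. x \<in> closure T \<Longrightarrow> \<bar>f x\<bar> \<le> B"
    using compact_imp_bounded bounded_iff by (metis image_eqI real_norm_def)
  then show ?thesis using assms closure_subset[of T]
    by (intro integrable_indicator_bounded[where B=B]) (auto intro: borel_measurable_continuous_onI)
qed

lemma integral_indicator_lborel:
  "T \<in> sets borel \<Longrightarrow> integral\<^sup>L lborel (indicat_real T) = measure lebesgue T"
  by (simp add: measure_def)

section \<open>Facet traces as limits over thin layers\<close>

text \<open>The slice of the simplex along the facet opposite to \<open>p\<close>, of thickness
  proportional to \<open>t\<close>. Integrals over it, divided by \<open>t\<close> and the volume,
  stand in for the integral over the facet.\<close>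

definition layer :: "(real^'n) set \<Rightarrow> real^'n \<Rightarrow> real \<Rightarrow> (real^'n) set" where
  "layer V p t = {x \<in> interior (convex hull V). bary V p x \<le> t}"

lemma layer_borel: "layer V p t \<in> sets borel"
proof -
  have "closed {x. bary V p x \<le> t}" by (intro closed_Collect_le continuous_intros)
  moreover have "layer V p t = interior (convex hull V) \<inter> {x. bary V p x \<le> t}" by (auto simp: layer_def)
  ultimately show ?thesis by auto
qed

lemma bounded_simplex:
  assumes "simplex_vertices V" shows "bounded (interior (convex hull V))" "bounded (layer V p t)"
proof -
  show b: "bounded (interior (convex hull V))"
    using simplex_vertices_finite[OF assms] by (simp add: finite_imp_bounded_convex_hull bounded_interior)
  show "bounded (layer V p t)" by (rule bounded_subset[OF b]) (auto simp: layer_def)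
qed

text \<open>The affine map that fixes the common facet \<open>F\<close> and takes the vertex \<open>p\<close> to \<open>q\<close>.\<close>

lemma layer_transport:
  fixes p q :: "real^'n"
  assumes V: "simplex_vertices (insert p F)" and W: "simplex_vertices (insert q F)" and pq: "p \<notin> F" "q \<notin> F"
  obtains m where "0 < m" "\<And>f :: real^'n \<Rightarrow> real. f \<in> borel_measurable borel \<Longrightarrow>
     integral\<^sup>L lborel f = m * integral\<^sup>L lborel (\<lambda>x. f (x + bary (insert p F) p x *\<^sub>R (q - p)))"
    "\<And>x r. r \<in> F \<Longrightarrow> bary (insert q F) r (x + bary (insert p F) p x *\<^sub>R (q - p)) = bary (insert p F) r x"
    "\<And>x. bary (insert q F) q (x + bary (insert p F) p x *\<^sub>R (q - p)) = bary (insert p F) p x"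
proof -
  let ?V = "insert p F" and ?W = "insert q F"
  define \<Phi> where "\<Phi> x = x + bary ?V p x *\<^sub>R (q - p)" for x
  have fin: "finite F" using simplex_vertices_finite[OF V] by simp
  \<comment> \<open>The barycentric coordinates of the image point: those of \<open>x\<close>, with
    the coordinate of \<open>p\<close> handed over to \<open>q\<close>.\<close>
  define u where "u x v = (if v = q then bary ?V p x else bary ?V v x)" for x v
  have uF: "v \<in> F \<Longrightarrow> u x v = bary ?V v x" "u x q = bary ?V p x" for x v using pq by (auto simp: u_def)
  have u1: "sum (u x) ?W = 1" for x
    using bary_represent(1)[OF V, of x] fin pq uF by (simp cong: sum.cong)
  have u2: "(\<Sum>v\<in>?W. u x v *\<^sub>R v) = \<Phi> x" for x
  proof -
    have "(\<Sum>v\<in>?W. u x v *\<^sub>R v) = bary ?V p x *\<^sub>R q + (\<Sum>v\<in>F. bary ?V v x *\<^sub>R v)"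
      using fin pq uF by (simp cong: sum.cong)
    moreover have "bary ?V p x *\<^sub>R p + (\<Sum>v\<in>F. bary ?V v x *\<^sub>R v) = x"
      using bary_represent(2)[OF V, of x] fin pq by simp
    ultimately show ?thesis unfolding \<Phi>_def by (simp add: algebra_simps)
  qed
  have b: "v \<in> ?W \<Longrightarrow> bary ?W v (\<Phi> x) = u x v" for v x
    using bary_sum_vertices[OF W u1, of v x] by (simp only: u2)
  have inj\<Phi>: "inj \<Phi>"
  proof (rule injI)
    fix x y assume "\<Phi> x = \<Phi> y"
    moreover from this have "bary ?V p x = bary ?V p y" using b[of q x] b[of q y] uF(2) by simp
    ultimately show "x = y" by (simp add: \<Phi>_def)
  qed
  define g where "g h = h + (bary_grad ?V p \<bullet> h) *\<^sub>R (q - p)" for h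
  define a where "a = bary ?V p 0 *\<^sub>R (q - p)"
  have ag: "a + g x = \<Phi> x" for x
    by (simp add: a_def g_def \<Phi>_def bary_def algebra_simps inner_diff_right)
  have "linear g" unfolding g_def by (intro linearI) (simp_all add: algebra_simps inner_add_right)
  moreover have "inj g" using inj\<Phi> ag unfolding inj_def by metis
  ultimately obtain m where m: "0 < m" "\<And>(f :: real^'n \<Rightarrow> real). f \<in> borel_measurable borel \<Longrightarrow>
     integral\<^sup>L lborel f = m * integral\<^sup>L lborel (\<lambda>x. f (a + g x))" using lborel_integral_affine[of g a] by blast
  show thesis
    by (rule that[OF m(1)]) (use m(2) b uF in \<open>simp_all only: ag \<Phi>_def[symmetric] insert_iff simp_thms\<close>)
qed

text \<open>The affine map of \<open>layer_transport\<close> carries one layer onto the other and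
  scales all volumes by the same factor, which cancels in the quotients. It displaces the points of
  the layer by at most \<open>t * dist p q\<close>, and \<open>w\<close> is Lipschitz.\<close>

lemma layer_compare:
  fixes p q :: "real^'n"
  assumes V: "simplex_vertices (insert p F)" and W: "simplex_vertices (insert q F)" and pq: "p \<notin> F" "q \<notin> F"
    and w: "L-lipschitz_on UNIV w" and "0 \<le> t"
  shows "\<bar>integral\<^sup>L lborel (\<lambda>x. indicat_real (layer (insert q F) q t) x * w x) / measure lebesgue (interior (convex hull (insert q F)))
      - integral\<^sup>L lborel (\<lambda>x. indicat_real (layer (insert p F) p t) x * w x) / measure lebesgue (interior (convex hull (insert p F)))\<bar>
     \<le> (L * (t * dist p q)) * (measure lebesgue (layer (insert p F) p t) / measure lebesgue (interior (convex hull (insert p F))))"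
proof -
  let ?V = "insert p F" and ?W = "insert q F"
  let ?T = "interior (convex hull ?V)" and ?S = "interior (convex hull ?W)"
  let ?\<Phi> = "\<lambda>x. x + bary ?V p x *\<^sub>R (q - p)"
  obtain m where m: "0 < m" "\<And>f :: real^'n \<Rightarrow> real. f \<in> borel_measurable borel \<Longrightarrow>
     integral\<^sup>L lborel f = m * integral\<^sup>L lborel (\<lambda>x. f (?\<Phi> x))"
    and b: "\<And>x r. r \<in> F \<Longrightarrow> bary ?W r (?\<Phi> x) = bary ?V r x" "\<And>x. bary ?W q (?\<Phi> x) = bary ?V p x"
    by (rule layer_transport[OF V W pq]) blast
  have wc: "continuous_on UNIV w" using w by (rule lipschitz_on_continuous_on)
  then have wm[measurable]: "w \<in> borel_measurable borel" by (rule borel_measurable_continuous_onI)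
  have iS: "?\<Phi> x \<in> ?S \<longleftrightarrow> x \<in> ?T" for x
    by (simp add: interior_convex_hull_bary[OF V] interior_convex_hull_bary[OF W] b)
  then have il: "?\<Phi> x \<in> layer ?W q t \<longleftrightarrow> x \<in> layer ?V p t" for x by (simp add: layer_def b)
  have ind: "indicat_real ?S (?\<Phi> x) = indicat_real ?T x" "indicat_real (layer ?W q t) (?\<Phi> x) = indicat_real (layer ?V p t) x" for x
    using iS[of x] il[of x] by (simp_all only: indicator_def)
  have "integral\<^sup>L lborel (indicat_real ?S) = m * integral\<^sup>L lborel (\<lambda>x. indicat_real ?S (?\<Phi> x))"
    by (rule m(2)) auto
  then have "measure lebesgue ?S = m * measure lebesgue ?T"
    unfolding ind using integral_indicator_lborel[of ?S] integral_indicator_lborel[of ?T] by simp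
  moreover have "integral\<^sup>L lborel (\<lambda>x. indicat_real (layer ?W q t) x * w x) = m * integral\<^sup>L lborel (\<lambda>x. indicat_real (layer ?V p t) x * w (?\<Phi> x))"
    using m(2)[of "\<lambda>x. indicat_real (layer ?W q t) x * w x"] layer_borel[of ?W q t] unfolding ind by simp
  ultimately have e: "integral\<^sup>L lborel (\<lambda>x. indicat_real (layer ?W q t) x * w x) / measure lebesgue ?S
     = integral\<^sup>L lborel (\<lambda>x. indicat_real (layer ?V p t) x * w (?\<Phi> x)) / measure lebesgue ?T" using m(1) by simp
  have c\<Phi>: "continuous_on UNIV (\<lambda>x. w (?\<Phi> x))"
    by (intro continuous_on_compose2[OF wc] continuous_intros) auto
  have i1: "integrable lborel (\<lambda>x. indicat_real (layer ?V p t) x * w (?\<Phi> x))"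
    by (intro integrable_indicator_continuous layer_borel bounded_simplex[OF V] c\<Phi>)
  have i2: "integrable lborel (\<lambda>x. indicat_real (layer ?V p t) x * w x)"
    by (intro integrable_indicator_continuous layer_borel bounded_simplex[OF V] wc)
  have i3: "integrable lborel (\<lambda>x. indicat_real (layer ?V p t) x * (L * (t * dist p q)))"
    by (intro integrable_indicator_continuous layer_borel bounded_simplex[OF V] continuous_intros)
  have L0: "0 \<le> L" using w by (rule lipschitz_on_nonneg)
  have pw: "\<bar>w (?\<Phi> x) - w x\<bar> \<le> L * (t * dist p q)" if "x \<in> layer ?V p t" for x
  proof -
    have "0 \<le> bary ?V p x" using that interior_convex_hull_bary[OF V] by (auto simp: layer_def less_imp_le)
    then have "dist (?\<Phi> x) x \<le> t * dist p q" using that by (simp add: dist_norm norm_minus_commute layer_def mult_right_mono)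
    then have "L * dist (?\<Phi> x) x \<le> L * (t * dist p q)" using L0 by (rule mult_left_mono)
    then show ?thesis using lipschitz_onD[OF w, of "?\<Phi> x" x] by (simp add: dist_real_def)
  qed
  have "\<bar>integral\<^sup>L lborel (\<lambda>x. indicat_real (layer ?V p t) x * w (?\<Phi> x)) - integral\<^sup>L lborel (\<lambda>x. indicat_real (layer ?V p t) x * w x)\<bar>
    = \<bar>integral\<^sup>L lborel (\<lambda>x. indicat_real (layer ?V p t) x * w (?\<Phi> x) - indicat_real (layer ?V p t) x * w x)\<bar>"
    using i1 i2 by simp
  also have "\<dots> \<le> integral\<^sup>L lborel (\<lambda>x. indicat_real (layer ?V p t) x * (L * (t * dist p q)))"
    using i1 i2 i3 pw by (intro integral_abs_bound[THEN order_trans] integral_mono) (auto simp: indicator_def)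
  also have "\<dots> = (L * (t * dist p q)) * measure lebesgue (layer ?V p t)"
    using integral_indicator_lborel[OF layer_borel[of ?V p t]] by simp
  finally show ?thesis unfolding e using measure_simplex_pos[OF V]
    by (simp add: divide_right_mono flip: diff_divide_distrib)
qed

text \<open>Removing the layer of thickness 1 - s from the simplex leaves its image under the
  homothety of ratio \<open>s\<close> centred at \<open>p\<close>.\<close>

lemma layer_homothety:
  assumes V: "simplex_vertices V" and p: "p \<in> V" and w: "continuous_on UNIV w" and s: "0 < s" "s \<le> 1"
  shows "integral\<^sup>L lborel (\<lambda>x. indicat_real (layer V p (1 - s)) x * w x) =
     integral\<^sup>L lborel (\<lambda>x. indicat_real (interior (convex hull V)) x * w x)
      - s ^ CARD('n) * integral\<^sup>L lborel (\<lambda>x. indicat_real (interior (convex hull V)) x * w (p + s *\<^sub>R (x - (p::real^'n))))"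
proof -
  let ?T = "interior (convex hull V)"
  let ?C = "?T - layer V p (1 - s)"
  have C: "?C \<in> sets borel" "bounded ?C" using layer_borel[of V p "1 - s"] bounded_simplex(1)[OF V] by (auto intro: bounded_subset)
  have [measurable]: "w \<in> borel_measurable borel" using w by (rule borel_measurable_continuous_onI)
  have C': "p + s *\<^sub>R (x - p) \<in> ?C \<longleftrightarrow> x \<in> ?T" for x
  proof -
    have eq: "p + s *\<^sub>R (x - p) = (1 - s) *\<^sub>R p + s *\<^sub>R x" by (simp add: algebra_simps)
    have "bary V r (p + s *\<^sub>R (x - p)) = s * bary V r x" if "r \<in> V" "r \<noteq> p" for r
      unfolding eq bary_convex_comb using bary_other[OF V that(1) p] that by simp
    moreover have "bary V p (p + s *\<^sub>R (x - p)) = (1 - s) + s * bary V p x"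
      unfolding eq bary_convex_comb by simp
    moreover have "0 < s * y \<longleftrightarrow> 0 < y" for y using s by (simp add: zero_less_mult_iff)
    ultimately show ?thesis using s p unfolding layer_def interior_convex_hull_bary[OF V]
      by (simp add: not_le) (metis add_nonneg_pos diff_ge_0_iff_ge)
  qed
  have ind: "indicat_real ?C (p + s *\<^sub>R (x - p)) = indicat_real ?T x" for x
    using C'[of x] by (simp only: indicator_def)
  have "(\<lambda>x. indicat_real ?C x * w x) \<in> borel_measurable borel" using C(1) by measurable
  from lborel_integral_homothety[OF this s(1), of p]
  have "integral\<^sup>L lborel (\<lambda>x. indicat_real ?C x * w x) = s ^ CARD('n) * integral\<^sup>L lborel (\<lambda>x. indicat_real ?T x * w (p + s *\<^sub>R (x - p)))"
    unfolding ind .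
  moreover have "integral\<^sup>L lborel (\<lambda>x. indicat_real ?T x * w x) =
     integral\<^sup>L lborel (\<lambda>x. indicat_real ?C x * w x + indicat_real (layer V p (1 - s)) x * w x)"
    by (intro Bochner_Integration.integral_cong) (auto simp: indicator_def layer_def)
  moreover have "\<dots> = integral\<^sup>L lborel (\<lambda>x. indicat_real ?C x * w x) + integral\<^sup>L lborel (\<lambda>x. indicat_real (layer V p (1 - s)) x * w x)"
    by (intro Bochner_Integration.integral_add integrable_indicator_continuous C w layer_borel bounded_simplex V)
  ultimately show ?thesis by simp
qed

lemma layer_measure:
  fixes p :: "real^'n"
  assumes V: "simplex_vertices V" and p: "p \<in> V" and s: "0 < s" "s \<le> 1"
  shows "measure lebesgue (layer V p (1 - s)) / measure lebesgue (interior (convex hull V)) = 1 - s ^ CARD('n)"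
  using layer_homothety[OF V p continuous_on_const[of UNIV 1] s] measure_simplex_pos[OF V]
    integral_indicator_lborel[OF layer_borel[of V p "1 - s"]] integral_indicator_lborel[of "interior (convex hull V)"]
  by (simp add: field_simps)

text \<open>By the divergence theorem for \<open>(x - p) w\<close>, whose normal component vanishes on the facets through \<open>p\<close>,
  this is \<open>n\<close> times the mean of \<open>w\<close> over the facet opposite to \<open>p\<close>.\<close>

definition trace_functional :: "(real^'n) set \<Rightarrow> real^'n \<Rightarrow> (real^'n \<Rightarrow> real) \<Rightarrow> real" where
  "trace_functional V p w = (CARD('n) * integral\<^sup>L lborel (\<lambda>x. indicat_real (interior (convex hull V)) x * w x)
     + integral\<^sup>L lborel (\<lambda>x. indicat_real (interior (convex hull V)) x * ((x - p) \<bullet> grad w x)))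
     / measure lebesgue (interior (convex hull V))"

lemma directional_quotient_tendsto:
  fixes w :: "real^'n \<Rightarrow> real"
  assumes w: "w differentiable at x" and t: "t \<longlonglongrightarrow> 0" "\<And>k. t k \<noteq> 0"
  shows "(\<lambda>k. (w x - w (x - t k *\<^sub>R v)) / t k) \<longlonglongrightarrow> v \<bullet> grad w x"
proof -
  have "((\<lambda>s. w (x + s *\<^sub>R v)) has_derivative (\<lambda>s. grad w x \<bullet> (s *\<^sub>R v))) (at 0)"
    by (rule has_derivative_compose[of "\<lambda>s. x + s *\<^sub>R v"])
      (auto intro!: derivative_eq_intros has_derivative_grad w)
  moreover have "(\<lambda>s. grad w x \<bullet> (s *\<^sub>R v)) = (*) (v \<bullet> grad w x)" by (auto simp: inner_commute)
  ultimately have "((\<lambda>s. w (x + s *\<^sub>R v)) has_real_derivative (v \<bullet> grad w x)) (at 0)"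
    by (simp only: has_field_derivative_def)
  then have lim: "((\<lambda>h. (w (x + h *\<^sub>R v) - w x) / h) \<longlongrightarrow> v \<bullet> grad w x) (at 0)"
    by (simp add: DERIV_def)
  have "filterlim (\<lambda>k. - t k) (at 0) sequentially"
    using tendsto_minus[OF t(1)] t(2) by (simp add: filterlim_at)
  from filterlim_compose[OF lim this] show ?thesis
    by (rule Lim_transform_eventually) (auto intro!: always_eventually simp: field_simps t(2))
qed

text \<open>With J the integral of \<open>w\<close> and I(t) that of \<open>w\<close> pulled back by
  the contraction towards \<open>p\<close>, the layer integral is (J - I(t)) + (1 - (1 - t)^n) I(t).
  Divided by t, the first part tends to the integral of the derivative of \<open>w\<close> along x -
  p, with the Lipschitz bound as majorant, and the second to n J by the geometric sum.\<close>

lemma trace_functional_limit: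
  fixes p :: "real^'n"
  assumes V: "simplex_vertices V" and p: "p \<in> V" and w: "L-lipschitz_on UNIV w" "\<And>x. w differentiable at x"
    and g: "continuous_on UNIV (grad w)"
    and t: "t \<longlonglongrightarrow> 0" "\<And>k. 0 < t k" "\<And>k. t k < 1"
  shows "(\<lambda>k. integral\<^sup>L lborel (\<lambda>x. indicat_real (layer V p (t k)) x * w x) / measure lebesgue (interior (convex hull V)) / t k)
     \<longlonglongrightarrow> trace_functional V p w"
proof -
  let ?T = "interior (convex hull V)"
  let ?n = "CARD('n)"
  have T: "?T \<in> sets borel" "bounded ?T" using bounded_simplex[OF V] by auto
  have wc: "continuous_on UNIV w" using w(1) by (rule lipschitz_on_continuous_on)
  define I where "I k = integral\<^sup>L lborel (\<lambda>x. indicat_real ?T x * w (x - t k *\<^sub>R (x - p)))" for k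
  define J where "J = integral\<^sup>L lborel (\<lambda>x. indicat_real ?T x * w x)"
  define Q where "Q k = integral\<^sup>L lborel (\<lambda>x. indicat_real ?T x * ((w x - w (x - t k *\<^sub>R (x - p))) / t k))" for k
  have wk: "continuous_on UNIV (\<lambda>x. w (x - t k *\<^sub>R (x - p)))" for k
    by (intro continuous_on_compose2[OF wc] continuous_intros) auto
  have Qk: "Q k = (J - I k) / t k" for k
  proof -
    have "Q k = integral\<^sup>L lborel (\<lambda>x. (indicat_real ?T x * w x - indicat_real ?T x * w (x - t k *\<^sub>R (x - p))) / t k)"
      unfolding Q_def by (intro Bochner_Integration.integral_cong) (auto simp: algebra_simps)
    then show ?thesis unfolding J_def I_def
      using integrable_indicator_continuous[OF T wc] integrable_indicator_continuous[OF T wk[of k]] by simp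
  qed
  obtain D where D: "\<And>x. x \<in> ?T \<Longrightarrow> norm (x - p) \<le> D"
  proof -
    have "bounded ((\<lambda>x. x - p) ` ?T)" using T(2) bounded_translation[of ?T "- p"] by simp
    then show thesis using that unfolding bounded_iff by blast
  qed
  have L0: "0 \<le> L" using w(1) by (rule lipschitz_on_nonneg)
  have "Q \<longlonglongrightarrow> integral\<^sup>L lborel (\<lambda>x. indicat_real ?T x * ((x - p) \<bullet> grad w x))"
    unfolding Q_def
  proof (rule integral_dominated_convergence[where w="\<lambda>x. indicat_real ?T x * (L * D)"])
    show "(\<lambda>x. indicat_real ?T x * ((x - p) \<bullet> grad w x)) \<in> borel_measurable lborel"
      by (rule borel_measurable_integrable, rule integrable_indicator_continuous[OF T]) (intro continuous_intros g)
    show "(\<lambda>x. indicat_real ?T x * ((w x - w (x - t k *\<^sub>R (x - p))) / t k)) \<in> borel_measurable lborel" for k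
      by (rule borel_measurable_integrable, rule integrable_indicator_continuous[OF T])
        (use t(2)[of k] in \<open>intro continuous_intros wc wk; simp\<close>)
    show "integrable lborel (\<lambda>x. indicat_real ?T x * (L * D))"
      by (rule integrable_indicator_continuous[OF T]) (intro continuous_intros)
    show "AE x in lborel. (\<lambda>k. indicat_real ?T x * ((w x - w (x - t k *\<^sub>R (x - p))) / t k))
        \<longlonglongrightarrow> indicat_real ?T x * ((x - p) \<bullet> grad w x)"
      using t(1) t(2) by (intro AE_I2 tendsto_mult tendsto_const directional_quotient_tendsto w(2)) (auto simp: less_imp_neq[symmetric])
    show "AE x in lborel. norm (indicat_real ?T x * ((w x - w (x - t k *\<^sub>R (x - p))) / t k)) \<le> indicat_real ?T x * (L * D)" for k
    proof (rule AE_I2)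
      fix x
      show "norm (indicat_real ?T x * ((w x - w (x - t k *\<^sub>R (x - p))) / t k)) \<le> indicat_real ?T x * (L * D)"
      proof (cases "x \<in> ?T")
        case True
        have "\<bar>w x - w (x - t k *\<^sub>R (x - p))\<bar> \<le> L * (t k * norm (x - p))"
          using lipschitz_onD[OF w(1), of x "x - t k *\<^sub>R (x - p)"] t(2)[of k] by (simp add: dist_real_def dist_norm)
        also have "\<dots> \<le> L * (t k * D)" using D[OF True] L0 t(2)[of k] by (intro mult_left_mono) auto
        finally show ?thesis using True t(2)[of k] by (simp add: field_simps)
      qed simp
    qed
  qed
  note Qlim = this
  have Ilim: "I \<longlonglongrightarrow> J"
  proof -
    have "(\<lambda>k. J - t k * Q k) \<longlonglongrightarrow> J - 0 * integral\<^sup>L lborel (\<lambda>x. indicat_real ?T x * ((x - p) \<bullet> grad w x))"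
      by (intro tendsto_intros Qlim t)
    moreover have "J - t k * Q k = I k" for k using Qk[of k] t(2)[of k] by simp
    ultimately show ?thesis by simp
  qed
  have "(\<lambda>k. (Q k + (\<Sum>j<?n. (1 - t k) ^ j) * I k) / measure lebesgue ?T)
    \<longlonglongrightarrow> (integral\<^sup>L lborel (\<lambda>x. indicat_real ?T x * ((x - p) \<bullet> grad w x)) + (\<Sum>j<?n. (1 - 0) ^ j) * J) / measure lebesgue ?T"
    using measure_simplex_pos[OF V] by (intro tendsto_intros Qlim Ilim t) auto
  moreover have "(Q k + (\<Sum>j<?n. (1 - t k) ^ j) * I k) / measure lebesgue ?T
     = integral\<^sup>L lborel (\<lambda>x. indicat_real (layer V p (t k)) x * w x) / measure lebesgue ?T / t k" for k
  proof -
    have "(\<lambda>x. p + (1 - t k) *\<^sub>R (x - p)) = (\<lambda>x. x - t k *\<^sub>R (x - p))" by (simp add: algebra_simps)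
    then have "integral\<^sup>L lborel (\<lambda>x. indicat_real (layer V p (t k)) x * w x) = J - (1 - t k) ^ ?n * I k"
      using layer_homothety[OF V p wc, of "1 - t k"] t(2)[of k] t(3)[of k] unfolding J_def I_def by (simp add: fun_eq_iff)
    also have "\<dots> = (J - I k) + (1 - (1 - t k) ^ ?n) * I k" by (simp add: algebra_simps)
    also have "1 - (1 - t k) ^ ?n = t k * (\<Sum>j<?n. (1 - t k) ^ j)"
      using one_diff_power_eq[where x="1 - t k" and n="?n"] by simp
    finally show ?thesis using t(2)[of k] by (simp add: Qk add_divide_distrib field_simps)
  qed
  ultimately show ?thesis unfolding trace_functional_def J_def by (simp add: add.commute)
qed

section \<open>Agreement across a facet and vanishing on the boundary\<close>

text \<open>Both sides are limits of scaled layer integrals. By \<open>layer_compare\<close> these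
  differ by a multiple of t times the volume fraction of the layer; division by t still leaves the
  volume fraction, which tends to 0.\<close>

lemma trace_functional_eq:
  fixes p q :: "real^'n"
  assumes V: "simplex_vertices (insert p F)" and W: "simplex_vertices (insert q F)" and pq: "p \<notin> F" "q \<notin> F"
    and w: "L-lipschitz_on UNIV w" "\<And>x. w differentiable at x" and g: "continuous_on UNIV (grad w)"
  shows "trace_functional (insert q F) q w = trace_functional (insert p F) p w"
proof -
  \<comment> \<open>The double successor keeps \<open>t k\<close> strictly below 1, so that the
    ratio 1 - t k of the homothety stays positive.\<close>
  define t where "t k = 1 / real (Suc (Suc k))" for k
  have "t \<longlonglongrightarrow> 0" unfolding t_def by (rule LIMSEQ_Suc[OF LIMSEQ_Suc[OF lim_1_over_n]])
  then have t: "t \<longlonglongrightarrow> 0" "\<And>k. 0 < t k" "\<And>k. t k < 1" by (auto simp: t_def)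
  define R where "R V p k = integral\<^sup>L lborel (\<lambda>x. indicat_real (layer V p (t k)) x * w x) / measure lebesgue (interior (convex hull V)) / t k"
    for V and p :: "real^'n" and k
  have "(\<lambda>k. R (insert q F) q k - R (insert p F) p k) \<longlonglongrightarrow> trace_functional (insert q F) q w - trace_functional (insert p F) p w"
    unfolding R_def by (intro tendsto_diff trace_functional_limit[OF W _ w g t] trace_functional_limit[OF V _ w g t]) auto
  moreover have "(\<lambda>k. R (insert q F) q k - R (insert p F) p k) \<longlonglongrightarrow> 0"
  proof (rule Lim_null_comparison)
    have "(\<lambda>k. L * dist p q * (1 - (1 - t k) ^ CARD('n))) \<longlonglongrightarrow> L * dist p q * (1 - (1 - 0) ^ CARD('n))"
      by (intro tendsto_intros t)
    then show "(\<lambda>k. L * dist p q * (1 - (1 - t k) ^ CARD('n))) \<longlonglongrightarrow> 0" by simp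
    have "\<bar>R (insert q F) q k - R (insert p F) p k\<bar> \<le> L * dist p q * (1 - (1 - t k) ^ CARD('n))" for k
    proof -
      have lm: "measure lebesgue (layer (insert p F) p (t k)) / measure lebesgue (interior (convex hull insert p F)) = 1 - (1 - t k) ^ CARD('n)"
        using layer_measure[OF V, of p "1 - t k"] t(2,3)[of k] by (simp add: less_imp_le)
      have "\<bar>R (insert q F) q k - R (insert p F) p k\<bar> * t k \<le> (L * (t k * dist p q)) * (1 - (1 - t k) ^ CARD('n))"
        using layer_compare[OF V W pq w(1), of "t k", unfolded lm] t(2,3)[of k]
        unfolding R_def diff_divide_distrib[symmetric] abs_divide by (simp add: less_imp_le)
      then have "\<bar>R (insert q F) q k - R (insert p F) p k\<bar> * t k \<le> (L * dist p q * (1 - (1 - t k) ^ CARD('n))) * t k"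
        by (simp add: algebra_simps)
      then show ?thesis using t(2)[of k] by simp
    qed
    then show "\<forall>\<^sub>F k in sequentially. norm (R (insert q F) q k - R (insert p F) p k) \<le> L * dist p q * (1 - (1 - t k) ^ CARD('n))"
      by simp
  qed
  ultimately have "trace_functional (insert q F) q w - trace_functional (insert p F) p w = 0" by (rule LIMSEQ_unique)
  then show ?thesis by simp
qed

text \<open>Every point of the layer lies within \<open>t * dist p r\<close> of the facet, for a
  fixed vertex \<open>r\<close> of it, so a Lipschitz function vanishing on the facet is of order t
  there. Division by t leaves the vanishing volume fraction of the layer.\<close>

lemma trace_functional_zero:
  fixes p :: "real^'n"
  assumes V: "simplex_vertices (insert p F)" and p: "p \<notin> F"
    and w: "L-lipschitz_on UNIV w" "\<And>x. w differentiable at x" and g: "continuous_on UNIV (grad w)"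
    and z: "\<And>x. x \<in> convex hull F \<Longrightarrow> w x = 0"
  shows "trace_functional (insert p F) p w = 0"
proof -
  let ?V = "insert p F"
  define t where "t k = 1 / real (Suc (Suc k))" for k
  have "t \<longlonglongrightarrow> 0" unfolding t_def by (rule LIMSEQ_Suc[OF LIMSEQ_Suc[OF lim_1_over_n]])
  then have t: "t \<longlonglongrightarrow> 0" "\<And>k. 0 < t k" "\<And>k. t k < 1" by (auto simp: t_def)
  define R where "R k = integral\<^sup>L lborel (\<lambda>x. indicat_real (layer ?V p (t k)) x * w x) / measure lebesgue (interior (convex hull ?V)) / t k" for k
  have wc: "continuous_on UNIV w" using w(1) by (rule lipschitz_on_continuous_on)
  have fin: "finite F" using simplex_vertices_finite[OF V] by simp
  have "card F = CARD('n)" using V p fin by (simp add: simplex_vertices_def)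
  then have "F \<noteq> {}" by auto
  then obtain r where r: "r \<in> F" by blast
  then have rp: "r \<noteq> p" using p by blast
  have L0: "0 \<le> L" using w(1) by (rule lipschitz_on_nonneg)
  have pw: "\<bar>w x\<bar> \<le> L * (s * dist p r)" if "x \<in> layer ?V p s" for x s
  proof -
    \<comment> \<open>Parallel to the edge from \<open>p\<close> to \<open>r\<close>, the whole
      coordinate of \<open>p\<close> is transferred to \<open>r\<close>; this lands on the
      facet.\<close>
    let ?y = "x + bary ?V p x *\<^sub>R (r - p)"
    have x: "\<And>v. v \<in> ?V \<Longrightarrow> 0 < bary ?V v x" "bary ?V p x \<le> s"
      using that interior_convex_hull_bary[OF V] by (auto simp: layer_def)
    have e: "bary ?V v ?y = bary ?V v x + bary ?V p x * (bary ?V v r - bary ?V v p)" for v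
      using bary_diff[of ?V v ?y x] bary_diff[of ?V v r p] by simp
    have "0 \<le> bary ?V v ?y" if "v \<in> ?V" for v
    proof (cases "v = p")
      case True then show ?thesis unfolding e using bary_other[OF V, of p r] r rp by auto
    next
      case False
      have "bary ?V v p = 0" by (rule bary_other[OF V that]) (use False in auto)
      moreover have "0 \<le> bary ?V v r" using bary_vertex[OF V that, of r] r by simp
      ultimately show ?thesis unfolding e using x that by (simp add: less_imp_le)
    qed
    moreover have "bary ?V p ?y = 0" unfolding e using bary_other[OF V, of p r] r rp by auto
    ultimately have "?y \<in> convex hull (?V - {p})"
      using facet_bary[OF V, of p] convex_hull_bary[OF V] by auto
    then have "w ?y = 0" using z p by simp
    moreover have "dist ?y x \<le> s * dist p r" using x by (simp add: dist_norm norm_minus_commute mult_right_mono less_imp_le)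
    then have "L * dist ?y x \<le> L * (s * dist p r)" using L0 by (rule mult_left_mono)
    ultimately show ?thesis using lipschitz_onD[OF w(1), of ?y x] by (simp add: dist_real_def)
  qed
  have "R \<longlonglongrightarrow> trace_functional ?V p w"
    unfolding R_def by (rule trace_functional_limit[OF V _ w g t]) simp
  moreover have "R \<longlonglongrightarrow> 0"
  proof (rule Lim_null_comparison)
    have "(\<lambda>k. L * dist p r * (1 - (1 - t k) ^ CARD('n))) \<longlonglongrightarrow> L * dist p r * (1 - (1 - 0) ^ CARD('n))"
      by (intro tendsto_intros t)
    then show "(\<lambda>k. L * dist p r * (1 - (1 - t k) ^ CARD('n))) \<longlonglongrightarrow> 0" by simp
    have "\<bar>R k\<bar> \<le> L * dist p r * (1 - (1 - t k) ^ CARD('n))" for k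
    proof -
      have i1: "integrable lborel (\<lambda>x. indicat_real (layer ?V p (t k)) x * w x)"
        by (intro integrable_indicator_continuous layer_borel bounded_simplex[OF V] wc)
      have i3: "integrable lborel (\<lambda>x. indicat_real (layer ?V p (t k)) x * (L * (t k * dist p r)))"
        by (intro integrable_indicator_continuous layer_borel bounded_simplex[OF V] continuous_intros)
      have "\<bar>integral\<^sup>L lborel (\<lambda>x. indicat_real (layer ?V p (t k)) x * w x)\<bar> \<le> integral\<^sup>L lborel (\<lambda>x. indicat_real (layer ?V p (t k)) x * (L * (t k * dist p r)))"
        using i1 i3 pw by (intro integral_abs_bound[THEN order_trans] integral_mono) (auto simp: indicator_def)
      also have "\<dots> = (L * (t k * dist p r)) * measure lebesgue (layer ?V p (t k))"
        using integral_indicator_lborel[OF layer_borel[of ?V p "t k"]] by simp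
      finally have "\<bar>R k\<bar> * t k \<le> (L * (t k * dist p r)) * (measure lebesgue (layer ?V p (t k)) / measure lebesgue (interior (convex hull ?V)))"
        unfolding R_def using measure_simplex_pos[OF V] t(2)[of k] by (simp add: divide_right_mono)
      also have "\<dots> = (L * dist p r * (1 - (1 - t k) ^ CARD('n))) * t k"
        using layer_measure[OF V, of p "1 - t k"] t(2,3)[of k] by (simp add: less_imp_le)
      finally show ?thesis using t(2)[of k] by simp
    qed
    then show "\<forall>\<^sub>F k in sequentially. norm (R k) \<le> L * dist p r * (1 - (1 - t k) ^ CARD('n))"
      by simp
  qed
  ultimately show ?thesis by (rule LIMSEQ_unique)
qed

lemma test_function_lipschitz:
  fixes w :: "real^'n \<Rightarrow> real"
  assumes w: "w \<in> test_functions \<Omega>"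
  obtains L where "L-lipschitz_on UNIV w"
proof -
  obtain K where K: "compact K" "\<And>x. x \<notin> K \<Longrightarrow> grad w x = 0" and c: "continuous_on UNIV (grad w)"
    using cc_test(3)[OF w] by (auto simp: cc_def)
  have "compact (grad w ` K)" using K(1) c by (intro compact_continuous_image) (auto intro: continuous_on_subset)
  then obtain B where B: "\<And>x. x \<in> K \<Longrightarrow> norm (grad w x) \<le> B" using compact_imp_bounded bounded_iff by (metis image_eqI)
  have B': "norm (grad w x) \<le> max 0 B" for x using B[of x] K(2)[of x] by (cases "x \<in> K") auto
  have "(max 0 B)-lipschitz_on UNIV w"
  proof (rule bounded_derivative_imp_lipschitz)
    show "(w has_derivative (\<lambda>h. grad w x \<bullet> h)) (at x within UNIV)" for x
      using has_derivative_grad[OF test_functionsD(2)[OF w]] .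
    show "onorm (\<lambda>h. grad w x \<bullet> h) \<le> max 0 B" for x
    proof (rule onorm_le)
      fix h
      have "norm (grad w x \<bullet> h) \<le> norm (grad w x) * norm h" by (simp add: Cauchy_Schwarz_ineq2)
      also have "\<dots> \<le> max 0 B * norm h" using B'[of x] by (intro mult_right_mono) auto
      finally show "norm (grad w x \<bullet> h) \<le> max 0 B * norm h" .
    qed
  qed auto
  then show thesis by (rule that)
qed

section \<open>Duality in finite dimension\<close>

text \<open>Riesz representation for a positive semidefinite form, by Gram-Schmidt orthogonalisation.\<close>

lemma semidefinite_riesz:
  fixes l :: "'e \<Rightarrow> 'i \<Rightarrow> real" and I :: "'i set"
  defines "D \<equiv> \<lambda>e x. \<Sum>i\<in>I. l e i * x i"
  assumes I: "finite I" and E: "finite E" and "S \<subseteq> I"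
    and "\<And>x. (\<forall>i. i \<notin> S \<longrightarrow> x i = 0) \<Longrightarrow> (\<forall>e\<in>E. D e x = 0) \<Longrightarrow> (\<Sum>i\<in>I. b i * x i) = 0"
  shows "\<exists>v. (\<forall>i. i \<notin> S \<longrightarrow> v i = 0) \<and>
     (\<forall>x. (\<forall>i. i \<notin> S \<longrightarrow> x i = 0) \<longrightarrow> (\<Sum>e\<in>E. D e v * D e x) = (\<Sum>i\<in>I. b i * x i))"
proof -
  have lin: "D e (\<lambda>i. x i + t * y i) = D e x + t * D e y" for e x y t
    unfolding D_def by (simp add: sum.distrib algebra_simps sum_distrib_left)
  have linb: "(\<Sum>i\<in>I. b i * (x i + t * y i)) = (\<Sum>i\<in>I. b i * x i) + t * (\<Sum>i\<in>I. b i * y i)" for b x y :: "'i \<Rightarrow> real" and t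
    by (simp add: sum.distrib algebra_simps sum_distrib_left)
  have "finite S" using I \<open>S \<subseteq> I\<close> finite_subset by blast
  then show ?thesis using assms(4,5)
  proof (induction S arbitrary: b rule: finite_induct)
    case empty
    show ?case
    proof (intro exI[of _ "\<lambda>i. 0"] conjI allI impI)
      fix x :: "'i \<Rightarrow> real" assume "\<forall>i. i \<notin> {} \<longrightarrow> x i = 0"
      then show "(\<Sum>e\<in>E. D e (\<lambda>i. 0) * D e x) = (\<Sum>i\<in>I. b i * x i)" by (simp add: D_def)
    qed simp
  next
    case (insert u S)
    define du where "du i = (if i = u then 1 else 0 :: real)" for i
    have SI: "S \<subseteq> I" using insert.prems(1) by simp
    have "(\<Sum>i\<in>I. b i * x i) = 0" if "\<forall>i. i \<notin> S \<longrightarrow> x i = 0" "\<forall>e\<in>E. D e x = 0" for x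
      using that by (intro insert.prems(2)) auto
    from insert.IH[OF SI this] obtain v where v: "\<And>i. i \<notin> S \<Longrightarrow> v i = 0"
      "\<And>x. (\<forall>i. i \<notin> S \<longrightarrow> x i = 0) \<Longrightarrow> (\<Sum>e\<in>E. D e v * D e x) = (\<Sum>i\<in>I. b i * x i)" by blast
    \<comment> \<open>These coefficients represent the functional that pairs with the new unit
      vector \<open>du\<close> in the form. The induction hypothesis, general in \<open>b\<close>,
      is thus available for it as well.\<close>
    define c where "c i = (\<Sum>e\<in>E. D e du * l e i)" for i
    have c: "(\<Sum>i\<in>I. c i * x i) = (\<Sum>e\<in>E. D e du * D e x)" for x
      unfolding c_def D_def sum_distrib_left sum_distrib_right by (subst sum.swap) (simp add: mult_ac)
    have "(\<Sum>i\<in>I. c i * x i) = 0" if "\<forall>i. i \<notin> S \<longrightarrow> x i = 0" "\<forall>e\<in>E. D e x = 0" for x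
      unfolding c using that by simp
    from insert.IH[OF SI this] obtain p where p: "\<And>i. i \<notin> S \<Longrightarrow> p i = 0"
      "\<And>x. (\<forall>i. i \<notin> S \<longrightarrow> x i = 0) \<Longrightarrow> (\<Sum>e\<in>E. D e p * D e x) = (\<Sum>e\<in>E. D e du * D e x)" unfolding c by blast
    \<comment> \<open>Gram-Schmidt: \<open>p\<close> is a projection of \<open>du\<close> onto the
      vectors supported in \<open>S\<close>, and \<open>q\<close> is orthogonal to them in the
      form.\<close>
    define q where "q i = du i + (-1) * p i" for i
    have q0: "i \<notin> insert u S \<Longrightarrow> q i = 0" for i using p(1) by (simp add: q_def du_def)
    have qu: "q u = 1" using p(1) insert.hyps(2) by (simp add: q_def du_def)
    have Dq: "D e q = D e du - D e p" for e unfolding q_def lin by simp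
    have orth: "(\<Sum>e\<in>E. D e q * D e x) = 0" if "\<forall>i. i \<notin> S \<longrightarrow> x i = 0" for x
      using p(2)[OF that] by (simp add: Dq left_diff_distrib sum_subtractf)
    define A where "A = (\<Sum>e\<in>E. D e q * D e q)"
    \<comment> \<open>If \<open>A = 0\<close>, all \<open>D e q\<close> vanish, hence
      \<open>b\<close> vanishes on \<open>q\<close> by the kernel assumption, and any
      \<open>t\<close> would do.\<close>
    define t where "t = (if A = 0 then 0 else ((\<Sum>i\<in>I. b i * q i) - (\<Sum>e\<in>E. D e v * D e q)) / A)"
    have tA: "(\<Sum>e\<in>E. D e v * D e q) + t * A = (\<Sum>i\<in>I. b i * q i)"
    proof (cases "A = 0")
      case True
      then have "\<forall>e\<in>E. D e q = 0" unfolding A_def using E by (simp add: sum_nonneg_eq_0_iff)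
      moreover from this have "(\<Sum>i\<in>I. b i * q i) = 0" using q0 by (intro insert.prems(2)) auto
      ultimately show ?thesis using True by simp
    next
      case False
      then show ?thesis by (simp add: t_def)
    qed
    show ?case
    proof (intro exI[of _ "\<lambda>i. v i + t * q i"] conjI allI impI)
      show "v i + t * q i = 0" if "i \<notin> insert u S" for i using v(1) q0 that by simp
      fix x :: "'i \<Rightarrow> real" assume x: "\<forall>i. i \<notin> insert u S \<longrightarrow> x i = 0"
      define y where "y i = x i + (- x u) * q i" for i
      have y: "\<forall>i. i \<notin> S \<longrightarrow> y i = 0"
      proof (intro allI impI)
        fix i assume "i \<notin> S"
        then show "y i = 0" using x q0[of i] qu by (cases "i = u") (auto simp: y_def)
      qed
      have xy: "x = (\<lambda>i. y i + x u * q i)" by (simp add: y_def)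
      have 1: "(\<Sum>e\<in>E. D e (\<lambda>i. v i + t * q i) * D e y) = (\<Sum>i\<in>I. b i * y i)"
        using v(2)[OF y] orth[OF y] by (simp add: lin algebra_simps sum.distrib flip: sum_distrib_left)
      have "(\<Sum>e\<in>E. D e q * D e v) = 0" using orth[of v] v(1) by simp
      then have 2: "(\<Sum>e\<in>E. D e (\<lambda>i. v i + t * q i) * D e q) = (\<Sum>i\<in>I. b i * q i)"
        using tA by (simp add: lin A_def algebra_simps sum.distrib flip: sum_distrib_left)
      have "(\<Sum>e\<in>E. D e (\<lambda>i. v i + t * q i) * D e x) = (\<Sum>e\<in>E. D e (\<lambda>i. v i + t * q i) * D e (\<lambda>i. y i + x u * q i))"
        by (subst xy) (rule refl)
      also have "\<dots> = (\<Sum>e\<in>E. D e (\<lambda>i. v i + t * q i) * D e y) + x u * (\<Sum>e\<in>E. D e (\<lambda>i. v i + t * q i) * D e q)"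
        unfolding lin[of _ y] by (simp only: distrib_left sum.distrib sum_distrib_left mult.left_commute)
      also have "\<dots> = (\<Sum>i\<in>I. b i * (y i + x u * q i))" unfolding 1 2 linb ..
      also have "\<dots> = (\<Sum>i\<in>I. b i * x i)" by (simp add: y_def)
      finally show "(\<Sum>e\<in>E. D e (\<lambda>i. v i + t * q i) * D e x) = (\<Sum>i\<in>I. b i * x i)" .
    qed
  qed
qed

text \<open>The estimate, used for \<open>x\<close> and for its negative, shows that
  \<open>b\<close> vanishes on the common kernel of the functionals. Its Riesz representer
  \<open>v\<close> provides the coefficients c_e = l_e(v). Their squared norm is b(v), and the
  estimate at \<open>v\<close> itself bounds it.\<close>

lemma finite_dual_decomposition:
  fixes l :: "'e \<Rightarrow> 'i \<Rightarrow> real" and I :: "'i set"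
  assumes I: "finite I" and E: "finite E"
    and K: "\<And>x. (\<Sum>i\<in>I. b i * x i) \<le> K * sqrt (\<Sum>e\<in>E. (\<Sum>i\<in>I. l e i * x i)\<^sup>2)"
  obtains c where "\<And>i. i \<in> I \<Longrightarrow> (\<Sum>e\<in>E. c e * l e i) = b i" "(\<Sum>e\<in>E. (c e)\<^sup>2) \<le> K\<^sup>2"
proof -
  have "(\<Sum>i\<in>I. b i * x i) = 0" if "\<forall>e\<in>E. (\<Sum>i\<in>I. l e i * x i) = 0" for x
    using K[of x] K[of "\<lambda>i. - x i"] that by (simp add: sum_negf)
  then obtain v where v: "\<And>x. (\<forall>i. i \<notin> I \<longrightarrow> x i = 0) \<Longrightarrow>
      (\<Sum>e\<in>E. (\<Sum>i\<in>I. l e i * v i) * (\<Sum>i\<in>I. l e i * x i)) = (\<Sum>i\<in>I. b i * x i)" "\<And>i. i \<notin> I \<Longrightarrow> v i = 0"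
    using semidefinite_riesz[OF I E subset_refl, of l b] by blast
  define c where "c e = (\<Sum>i\<in>I. l e i * v i)" for e
  show thesis
  proof (rule that)
    fix i assume i: "i \<in> I"
    have d: "(\<Sum>j\<in>I. f j * (if j = i then 1 else 0)) = f i" for f :: "'i \<Rightarrow> real"
      using I i by (simp add: if_distrib[of "\<lambda>y. _ * y"] cong: if_cong)
    show "(\<Sum>e\<in>E. c e * l e i) = b i"
      using v(1)[of "\<lambda>j. if j = i then 1 else 0"] i unfolding d c_def by auto
  next
    have "(\<Sum>e\<in>E. (c e)\<^sup>2) = (\<Sum>i\<in>I. b i * v i)"
      using v(1)[of v] v(2) unfolding c_def by (simp add: power2_eq_square)
    also have "\<dots> \<le> K * sqrt (\<Sum>e\<in>E. (c e)\<^sup>2)" unfolding c_def by (rule K)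
    finally have le: "(\<Sum>e\<in>E. (c e)\<^sup>2) \<le> K * sqrt (\<Sum>e\<in>E. (c e)\<^sup>2)" .
    let ?s = "sqrt (\<Sum>e\<in>E. (c e)\<^sup>2)"
    have s: "0 \<le> ?s" "?s\<^sup>2 = (\<Sum>e\<in>E. (c e)\<^sup>2)" by (auto simp: sum_nonneg)
    show "(\<Sum>e\<in>E. (c e)\<^sup>2) \<le> K\<^sup>2"
    proof (cases "?s = 0")
      case True
      have "(\<Sum>e\<in>E. (c e)\<^sup>2) = 0" using s(2) unfolding True by simp
      then show ?thesis by simp
    next
      case False
      then have "0 < ?s" using s(1) by linarith
      moreover have "?s * ?s \<le> K * ?s" using le s(2) by (simp only: power2_eq_square)
      ultimately have "?s \<le> K" by (simp only: mult_le_cancel_right_pos)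
      then show ?thesis using power_mono[OF _ s(1), of K 2] s(2) by simp
    qed
  qed
qed

section \<open>Meshes and vertex stars\<close>

lemma lipschitz_boundaryE:
  fixes \<Omega> :: "(real^'n) set"
  assumes "lipschitz_boundary \<Omega>" "x \<in> frontier \<Omega>"
  obtains U0 e L and g :: "real^'n \<Rightarrow> real" where "open U0" "x \<in> U0" "norm e = 1" "L-lipschitz_on {y. y \<bullet> e = 0} g"
    "\<Omega> \<inter> U0 = {y \<in> U0. g (y - (y \<bullet> e) *\<^sub>R e) < y \<bullet> e}"
  using bspec[OF assms(1)[unfolded lipschitz_boundary_def] assms(2)] by (elim exE conjE) (rule that)

text \<open>Below the graph lies an open set disjoint from \<Omega>, hence from its closure. A small
  step from \<open>x\<close> against the direction \<open>e\<close> leads into it.\<close>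

lemma lipschitz_boundary_exterior:
  fixes \<Omega> :: "(real^'n) set"
  assumes \<Omega>: "open \<Omega>" "lipschitz_boundary \<Omega>" and x: "x \<in> frontier \<Omega>" "open U" "x \<in> U"
  obtains y where "y \<in> U" "y \<notin> closure \<Omega>"
proof -
  obtain U0 e L and g :: "real^'n \<Rightarrow> real" where U0: "open U0" "x \<in> U0" "norm e = 1" "L-lipschitz_on {y. y \<bullet> e = 0} g"
    "\<Omega> \<inter> U0 = {y \<in> U0. g (y - (y \<bullet> e) *\<^sub>R e) < y \<bullet> e}"
    by (rule lipschitz_boundaryE[OF \<Omega>(2) x(1)])
  have ee: "e \<bullet> e = 1" using U0(3) by (simp add: dot_square_norm)
  have gc: "continuous_on UNIV (\<lambda>y. g (y - (y \<bullet> e) *\<^sub>R e))"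
    by (rule continuous_on_compose2[OF lipschitz_on_continuous_on[OF U0(4)]])
       (auto intro!: continuous_intros simp: inner_diff_left ee)
  define N where "N = U0 \<inter> {y. y \<bullet> e < g (y - (y \<bullet> e) *\<^sub>R e)}"
  have "open N" unfolding N_def by (intro open_Int U0 open_Collect_less gc continuous_intros)
  moreover have "N \<inter> \<Omega> = {}" using U0(5) by (force simp: N_def)
  ultimately have Nc: "N \<inter> closure \<Omega> = {}" by (metis open_Int_closure_eq_empty)
  have xg: "x \<bullet> e \<le> g (x - (x \<bullet> e) *\<^sub>R e)"
  proof -
    have "x \<notin> \<Omega>" using x(1) \<Omega>(1) by (simp add: frontier_def interior_open)
    then have "x \<notin> {y \<in> U0. g (y - (y \<bullet> e) *\<^sub>R e) < y \<bullet> e}" unfolding U0(5)[symmetric] by simp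
    then show ?thesis using U0(2) by simp
  qed
  have "open (U \<inter> U0)" "x \<in> U \<inter> U0" using x U0 by auto
  then obtain r where r: "r > 0" "ball x r \<subseteq> U \<inter> U0" using openE by blast
  let ?y = "x - (r/2) *\<^sub>R e"
  have "?y \<in> ball x r" using r U0(3) by (simp add: dist_norm)
  then have yU: "?y \<in> U" "?y \<in> U0" using r by auto
  have Py: "?y - (?y \<bullet> e) *\<^sub>R e = x - (x \<bullet> e) *\<^sub>R e" by (simp add: inner_diff_left ee algebra_simps)
  have "?y \<bullet> e < x \<bullet> e" using r by (simp add: inner_diff_left ee)
  then have "?y \<in> N" unfolding N_def Int_iff mem_Collect_eq Py using yU xg by linarith
  then show thesis using that yU Nc by blast
qed

text \<open>At a boundary point, \<open>W\<close> is the slab between the graph and its translate by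
  \<open>d\<close> over a small ball of the hyperplane, a continuous image of a convex product.
  Placing it between \<Omega> in a smaller and \<Omega> in a larger ball avoids any claim that
  \<Omega> meets balls in connected sets.\<close>

lemma lipschitz_boundary_connected:
  fixes \<Omega> :: "(real^'n) set"
  assumes \<Omega>: "open \<Omega>" "lipschitz_boundary \<Omega>" and x: "x \<in> closure \<Omega>" and "0 < r"
  obtains W s where "open W" "connected W" "W \<subseteq> \<Omega> \<inter> ball x r" "0 < s" "\<Omega> \<inter> ball x s \<subseteq> W"
proof (cases "x \<in> \<Omega>")
  case True
  then obtain s where s: "s > 0" "ball x s \<subseteq> \<Omega>" using \<Omega>(1) openE by blast
  show thesis
    by (rule that[of "ball x (min r s)" "min r s"]) (use s \<open>0 < r\<close> in auto)
next
  case False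
  then have xf: "x \<in> frontier \<Omega>" using x \<Omega>(1) by (simp add: frontier_def interior_open)
  obtain U0 e L and g :: "real^'n \<Rightarrow> real" where U0: "open U0" "x \<in> U0" "norm e = 1" "L-lipschitz_on {y. y \<bullet> e = 0} g"
    "\<Omega> \<inter> U0 = {y \<in> U0. g (y - (y \<bullet> e) *\<^sub>R e) < y \<bullet> e}"
    by (rule lipschitz_boundaryE[OF \<Omega>(2) xf])
  have ee: "e \<bullet> e = 1" using U0(3) by (simp add: dot_square_norm)
  define P where "P y = y - (y \<bullet> e) *\<^sub>R e" for y
  have P: "P y \<bullet> e = 0" "y = P y + (y \<bullet> e) *\<^sub>R e" "P y - P z = P (y - z)" for y z
    by (auto simp: P_def inner_diff_left ee algebra_simps)
  have Pn: "norm (P y) \<le> norm y" for y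
  proof -
    have "(norm (P y))\<^sup>2 = (norm y)\<^sup>2 - (y \<bullet> e)\<^sup>2"
      unfolding power2_norm_eq_inner P_def
      by (simp add: inner_diff_left inner_diff_right ee inner_commute[of e y] power2_eq_square[of "y \<bullet> e"])
    then have "(norm (P y))\<^sup>2 \<le> (norm y)\<^sup>2" by simp
    then show ?thesis by (rule power2_le_imp_le) simp
  qed
  have Pc: "continuous_on A P" for A unfolding P_def by (intro continuous_intros)
  have gc0: "continuous_on {y. y \<bullet> e = 0} g" by (rule lipschitz_on_continuous_on[OF U0(4)])
  have gc: "continuous_on UNIV (\<lambda>y. g (P y))"
    by (rule continuous_on_compose2[OF gc0 Pc]) (auto simp: P)
  \<comment> \<open>The point \<open>x\<close> is not above the graph, since it is not in \<Omega>,
    and not below it, since it is a limit of points of \<Omega>.\<close>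
  have xg: "g (P x) = x \<bullet> e"
  proof (rule antisym)
    have "x \<notin> {y \<in> U0. g (y - (y \<bullet> e) *\<^sub>R e) < y \<bullet> e}" unfolding U0(5)[symmetric] using False by simp
    then show "x \<bullet> e \<le> g (P x)" using U0(2) by (simp add: P_def)
    show "g (P x) \<le> x \<bullet> e"
    proof (rule ccontr)
      assume "\<not> ?thesis"
      then have "x \<in> U0 \<inter> {y. y \<bullet> e < g (P y)}" using U0(2) by simp
      moreover have "open (U0 \<inter> {y. y \<bullet> e < g (P y)})" by (intro open_Int U0 open_Collect_less gc continuous_intros)
      ultimately have "(U0 \<inter> {y. y \<bullet> e < g (P y)}) \<inter> \<Omega> \<noteq> {}" using x by (metis disjoint_iff open_Int_closure_eq_empty)
      then obtain y where "y \<in> U0" "y \<bullet> e < g (P y)" "y \<in> \<Omega>" by blast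
      then have "y \<in> {y \<in> U0. g (y - (y \<bullet> e) *\<^sub>R e) < y \<bullet> e}" unfolding U0(5)[symmetric] by simp
      then show False using \<open>y \<bullet> e < g (P y)\<close> by (simp add: P_def)
    qed
  qed
  obtain r0 where r0: "r0 > 0" "ball x r0 \<subseteq> U0" using U0 openE by blast
  \<comment> \<open>Points of \<open>W\<close> will differ from \<open>x\<close> by less than
    \<open>d\<close> across and by less than \<open>2 * d\<close> along \<open>e\<close>, hence by
    less than \<open>4 * d\<close> in total.\<close>
  define d where "d = min r r0 / 4"
  have d: "0 < d" using r0 \<open>0 < r\<close> by (simp add: d_def)
  obtain \<rho>0 where \<rho>0: "\<rho>0 > 0" "\<And>q. q \<bullet> e = 0 \<Longrightarrow> dist q (P x) < \<rho>0 \<Longrightarrow> dist (g q) (g (P x)) < d / 2"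
    using gc0[unfolded continuous_on_iff, rule_format, of "P x" "d / 2"] P(1)[of x] d by auto
  define \<rho> where "\<rho> = min \<rho>0 d"
  have \<rho>: "0 < \<rho>" "\<rho> \<le> d" "\<rho> \<le> \<rho>0" using \<rho>0 d by (auto simp: \<rho>_def)
  define W where "W = {y. norm (P y - P x) < \<rho>} \<inter> {y. g (P y) < y \<bullet> e} \<inter> {y. y \<bullet> e < g (P y) + d}"
  have Wsub: "y \<in> \<Omega> \<inter> ball x r" if "y \<in> W" for y
  proof -
    have y: "norm (P y - P x) < \<rho>" "g (P y) < y \<bullet> e" "y \<bullet> e < g (P y) + d" using that by (auto simp: W_def)
    have "dist (g (P y)) (g (P x)) < d / 2" using y(1) \<rho> by (intro \<rho>0(2)) (auto simp: P dist_norm)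
    then have "\<bar>y \<bullet> e - x \<bullet> e\<bar> < 2 * d" using y(2,3) d unfolding dist_real_def xg by (simp add: abs_if split: if_splits)
    moreover have "norm (y - x) \<le> norm (P y - P x) + \<bar>y \<bullet> e - x \<bullet> e\<bar>"
    proof -
      have "y - x = (P y - P x) + (y \<bullet> e - x \<bullet> e) *\<^sub>R e" by (simp add: P_def algebra_simps)
      then show ?thesis using norm_triangle_ineq[of "P y - P x" "(y \<bullet> e - x \<bullet> e) *\<^sub>R e"] U0(3) by simp
    qed
    ultimately have "norm (y - x) < 4 * d" using y(1) \<rho>(2) d by linarith
    then have nb: "y \<in> ball x r" "y \<in> ball x r0" by (auto simp: d_def dist_norm norm_minus_commute)
    then have "y \<in> {y \<in> U0. g (y - (y \<bullet> e) *\<^sub>R e) < y \<bullet> e}" using y(2) r0 by (auto simp: P_def)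
    then show ?thesis using nb unfolding U0(5)[symmetric] by simp
  qed
  have "open W" unfolding W_def by (intro open_Int open_Collect_less gc continuous_intros Pc)
  moreover have "connected W"
  proof -
    define C where "C = ({q. q \<bullet> e = 0} \<inter> ball (P x) \<rho>) \<times> {0<..<d}"
    have "convex {q. q \<bullet> e = 0}" using convex_hyperplane[of e 0] by (simp add: inner_commute)
    then have "convex C" unfolding C_def by (intro convex_Times convex_Int) auto
    moreover have "continuous_on C (\<lambda>z. fst z + (g (fst z) + snd z) *\<^sub>R e)"
      by (intro continuous_intros continuous_on_compose2[OF gc0]) (auto simp: C_def)
    ultimately have "connected ((\<lambda>z. fst z + (g (fst z) + snd z) *\<^sub>R e) ` C)"
      by (intro connected_continuous_image convex_connected)
    moreover have "(\<lambda>z. fst z + (g (fst z) + snd z) *\<^sub>R e) ` C = W"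
    proof (intro equalityI subsetI)
      fix y assume "y \<in> (\<lambda>z. fst z + (g (fst z) + snd z) *\<^sub>R e) ` C"
      then obtain q t where q: "y = q + (g q + t) *\<^sub>R e" "q \<bullet> e = 0" "dist (P x) q < \<rho>" "0 < t" "t < d" by (auto simp: C_def)
      have "y \<bullet> e = g q + t" using q by (simp add: inner_add_left ee)
      moreover from this have "P y = q" using q(1) by (simp add: P_def)
      ultimately show "y \<in> W" using q by (simp add: W_def dist_norm norm_minus_commute)
    next
      fix y assume y: "y \<in> W"
      then have "(P y, y \<bullet> e - g (P y)) \<in> C" by (simp add: W_def C_def P(1) dist_norm norm_minus_commute)
      moreover have "y = fst (P y, y \<bullet> e - g (P y)) + (g (fst (P y, y \<bullet> e - g (P y))) + snd (P y, y \<bullet> e - g (P y))) *\<^sub>R e"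
        using P(2)[of y] by simp
      ultimately show "y \<in> (\<lambda>z. fst z + (g (fst z) + snd z) *\<^sub>R e) ` C" by (rule rev_image_eqI)
    qed
    ultimately show ?thesis by simp
  qed
  \<comment> \<open>Within this radius the height of \<open>y\<close> and that of the graph at
    \<open>P y\<close> each differ by less than \<open>d / 2\<close> from the height of
    \<open>x\<close>, so \<open>y\<close> stays below the upper graph.\<close>
  moreover define s where "s = min \<rho> (d / 2)"
  have "\<Omega> \<inter> ball x s \<subseteq> W"
  proof
    fix y assume y: "y \<in> \<Omega> \<inter> ball x s"
    then have n: "norm (y - x) < s" by (simp add: dist_norm norm_minus_commute)
    have "y \<in> ball x r0" using n \<open>0 < r\<close> r0(1) d unfolding s_def d_def by (auto simp: dist_norm norm_minus_commute)
    then have "y \<in> \<Omega> \<inter> U0" using r0 y by blast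
    then have 1: "g (P y) < y \<bullet> e" unfolding U0(5) by (simp add: P_def)
    have 2: "norm (P y - P x) < \<rho>" using Pn[of "y - x"] n by (simp add: P(3) s_def)
    have "dist (g (P y)) (g (P x)) < d / 2" using 2 \<rho> by (intro \<rho>0(2)) (auto simp: P dist_norm)
    moreover have "\<bar>(y - x) \<bullet> e\<bar> < d / 2" using Cauchy_Schwarz_ineq2[of "y - x" e] n U0(3) by (simp add: s_def)
    ultimately have "y \<bullet> e < g (P y) + d" using xg unfolding dist_real_def inner_diff_left by (simp add: abs_if split: if_splits)
    then show "y \<in> W" using 1 2 by (simp add: W_def)
  qed
  moreover have "0 < s" using \<rho> d by (simp add: s_def)
  ultimately show thesis using that[of W s] Wsub by blast
qed

lemma finite_closed_locality:
  fixes \<C> :: "('a::metric_space) set set"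
  assumes "finite \<C>" "\<And>C. C \<in> \<C> \<Longrightarrow> closed C"
  obtains r where "0 < r" "\<And>C y. C \<in> \<C> \<Longrightarrow> y \<in> C \<Longrightarrow> dist x y < r \<Longrightarrow> x \<in> C"
proof -
  have "closed (\<Union>{C \<in> \<C>. x \<notin> C})" using assms by (intro closed_Union) auto
  then have "open (- \<Union>{C \<in> \<C>. x \<notin> C})" "x \<in> - \<Union>{C \<in> \<C>. x \<notin> C}" by auto
  then obtain r where "r > 0" "ball x r \<subseteq> - \<Union>{C \<in> \<C>. x \<notin> C}" using openE by blast
  then show thesis by (intro that[of r]) (auto simp: subset_iff)
qed

text \<open>A segment from \<open>y\<close> that meets the hull of \<open>B\<close> ends in the
  affine hull of \<open>B\<close> together with \<open>y\<close>. This is spanned by at most n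
  points, hence negligible, and finitely many such sets cannot cover an open set.\<close>

lemma generic_segment:
  fixes y :: "real^'n"
  assumes \<B>: "finite \<B>" "\<And>B. B \<in> \<B> \<Longrightarrow> finite B \<and> Suc (card B) \<le> CARD('n)" and U: "open U" "U \<noteq> {}"
    and y: "\<And>B. B \<in> \<B> \<Longrightarrow> y \<notin> convex hull B"
  shows "\<exists>x\<in>U. \<forall>B\<in>\<B>. closed_segment y x \<inter> convex hull B = {}"
proof -
  have "negligible (affine hull (insert y B))" if "B \<in> \<B>" for B
  proof -
    have "card (insert y B) \<le> DIM(real^'n)" using \<B>(2)[OF that] by (simp add: card_insert_if)
    then have "interior (affine hull (insert y B)) = {}" using \<B>(2)[OF that] by (intro empty_interior_affine_hull) auto
    then show ?thesis using negligible_convex_interior affine_imp_convex affine_affine_hull by blast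
  qed
  then have "negligible (\<Union>B\<in>\<B>. affine hull (insert y B))" using \<B>(1) by (intro negligible_Union) auto
  then have "\<not> U \<subseteq> (\<Union>B\<in>\<B>. affine hull (insert y B))" using open_not_negligible[OF U] negligible_subset by blast
  then obtain x where x: "x \<in> U" "\<And>B. B \<in> \<B> \<Longrightarrow> x \<notin> affine hull (insert y B)" by blast
  have "closed_segment y x \<inter> convex hull B = {}" if "B \<in> \<B>" for B
  proof (rule ccontr)
    assume "\<not> ?thesis"
    then obtain t where t: "(1 - t) *\<^sub>R y + t *\<^sub>R x \<in> convex hull B" by (auto simp: closed_segment_def)
    let ?z = "(1 - t) *\<^sub>R y + t *\<^sub>R x"
    have "t \<noteq> 0" using t y[OF that] by auto
    then have e: "x = (1 - 1/t) *\<^sub>R y + (1/t) *\<^sub>R ?z" by (simp add: algebra_simps)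
    have zB: "?z \<in> affine hull (insert y B)" using t convex_hull_subset_affine_hull[of B] hull_mono[of B "insert y B" affine] by blast
    have yB: "y \<in> affine hull (insert y B)" by (simp add: hull_inc)
    have "(1 - 1/t) *\<^sub>R y + (1/t) *\<^sub>R ?z \<in> affine hull (insert y B)"
      by (rule mem_affine[OF affine_affine_hull yB zB]) simp
    then show False using x(2)[OF that] e by metis
  qed
  then show ?thesis using x(1) by blast
qed

section \<open>Conforming meshes and the connectedness of vertex stars\<close>

definition vertices :: "(real^'n) set \<Rightarrow> (real^'n) set" where
  "vertices T = {p. p extreme_point_of closure T}"

definition star :: "(real^'n) set set \<Rightarrow> real^'n \<Rightarrow> (real^'n) set set" where
  "star \<T> x = {T \<in> \<T>. x \<in> closure T}"

definition facet_adjacent :: "(real^'n) set \<Rightarrow> (real^'n) set \<Rightarrow> bool" where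
  "facet_adjacent T T' \<longleftrightarrow> T \<noteq> T' \<and> (\<exists>p\<in>vertices T. closure T \<inter> closure T' = convex hull (vertices T - {p}))"

locale mesh =
  fixes \<Omega> :: "(real^'n) set" and \<T> :: "(real^'n) set set"
  assumes open_domain: "open \<Omega>" and bounded_domain: "bounded \<Omega>" and lipschitz_domain: "lipschitz_boundary \<Omega>"
    and domain_nonempty: "\<Omega> \<noteq> {}" and mesh: "regular_mesh \<Omega> \<T>" and dim: "CARD('n) \<ge> 2"
begin

lemma finite_mesh: "finite \<T>" using mesh by (simp add: regular_mesh_def)

lemma closure_domain: "closure \<Omega> = (\<Union>T\<in>\<T>. closure T)"
  using mesh by (simp add: regular_mesh_def)

lemma mesh_disjoint: "T \<in> \<T> \<Longrightarrow> T' \<in> \<T> \<Longrightarrow> T \<noteq> T' \<Longrightarrow> T \<inter> T' = {}"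
  using mesh by (auto simp: regular_mesh_def pairwise_def disjnt_def)

lemma element:
  assumes "T \<in> \<T>"
  shows "simplex_vertices (vertices T)" "closure T = convex hull (vertices T)" "T = interior (convex hull (vertices T))"
proof -
  obtain S where S: "int CARD('n) simplex S" "T = interior S"
    using mesh assms by (auto simp: regular_mesh_def)
  then obtain V where V: "\<not> affine_dependent V" "int (card V) = int CARD('n) + 1" "S = convex hull V"
    by (auto simp: simplex_def)
  have sV: "simplex_vertices V" using V by (auto simp: simplex_vertices_def)
  have c: "closure T = convex hull V" unfolding S(2) V(3) by (rule closure_interior_simplex[OF sV])
  have "vertices T = V"
    using extreme_point_of_convex_hull_affine_independent[OF V(1)] by (simp add: vertices_def c)
  then show "simplex_vertices (vertices T)" "closure T = convex hull (vertices T)" "T = interior (convex hull (vertices T))"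
    using sV c S(2) V(3) by auto
qed

lemma finite_vertices: "T \<in> \<T> \<Longrightarrow> finite (vertices T)"
  by (rule simplex_vertices_finite[OF element(1)])

lemma card_vertices: "T \<in> \<T> \<Longrightarrow> card (vertices T) = Suc CARD('n)"
  using element(1) by (simp add: simplex_vertices_def)

lemma element_open: "T \<in> \<T> \<Longrightarrow> open T"
  by (subst element(3)) auto

lemma element_nonempty: "T \<in> \<T> \<Longrightarrow> T \<noteq> {}"
  using interior_nonempty[OF element(1)] element(3) by metis

lemma mem_element: "T \<in> \<T> \<Longrightarrow> x \<in> T \<longleftrightarrow> (\<forall>p\<in>vertices T. 0 < bary (vertices T) p x)"
  using interior_convex_hull_bary[OF element(1)] element(3) by blast

lemma mem_closure_element: "T \<in> \<T> \<Longrightarrow> x \<in> closure T \<longleftrightarrow> (\<forall>p\<in>vertices T. 0 \<le> bary (vertices T) p x)"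
  using convex_hull_bary[OF element(1)] element(2) by blast

lemma mem_facet: "T \<in> \<T> \<Longrightarrow> p \<in> vertices T \<Longrightarrow>
   x \<in> convex hull (vertices T - {p}) \<longleftrightarrow> x \<in> closure T \<and> bary (vertices T) p x = 0"
  using facet_bary[OF element(1)] element(2) by blast

lemma disjoint_closure:
  assumes "T \<in> \<T>" "T' \<in> \<T>" "T \<noteq> T'" shows "T \<inter> closure T' = {}"
  using mesh_disjoint[OF assms] element_open[OF assms(1)] by (simp add: open_Int_closure_eq_empty)

text \<open>A Lipschitz domain has no slits: exterior points occur in every neighbourhood of a
  boundary point. The mesh is tied to \<Omega> only through the closure, and this is what puts the
  open elements inside \<Omega>.\<close>

lemma interior_closure_domain: "interior (closure \<Omega>) = \<Omega>"
proof
  show "\<Omega> \<subseteq> interior (closure \<Omega>)" using open_domain closure_subset by (rule interior_maximal[rotated])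
  show "interior (closure \<Omega>) \<subseteq> \<Omega>"
  proof
    fix x assume x: "x \<in> interior (closure \<Omega>)"
    show "x \<in> \<Omega>"
    proof (rule ccontr)
      assume "x \<notin> \<Omega>"
      then have "x \<in> frontier \<Omega>" using x interior_subset open_domain by (auto simp: frontier_def interior_open)
      then obtain y where "y \<in> interior (closure \<Omega>)" "y \<notin> closure \<Omega>"
        by (rule lipschitz_boundary_exterior[OF open_domain lipschitz_domain _ open_interior x])
      then show False using interior_subset by blast
    qed
  qed
qed

lemma element_subset: "T \<in> \<T> \<Longrightarrow> T \<subseteq> \<Omega>"
proof -
  assume T: "T \<in> \<T>"
  have "T \<subseteq> closure T" by (rule closure_subset)
  also have "\<dots> \<subseteq> closure \<Omega>" using closure_domain T by auto
  finally have "T \<subseteq> interior (closure \<Omega>)" using element_open[OF T] by (rule interior_maximal)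
  then show ?thesis by (simp add: interior_closure_domain)
qed

lemma skeleton_negligible: "negligible (\<Omega> - \<Union>\<T>)"
proof -
  have "negligible (\<Union>T\<in>\<T>. frontier (convex hull (vertices T)))"
    using finite_mesh by (intro negligible_Union) (auto intro: negligible_convex_frontier)
  moreover have "\<Omega> - \<Union>\<T> \<subseteq> (\<Union>T\<in>\<T>. frontier (convex hull (vertices T)))"
  proof
    fix x assume x: "x \<in> \<Omega> - \<Union>\<T>"
    then have "x \<in> closure \<Omega>" using closure_subset[of \<Omega>] by auto
    then obtain T where T: "T \<in> \<T>" "x \<in> closure T" using closure_domain by auto
    then have "x \<in> frontier (convex hull (vertices T))"
      using x element(2,3)[OF T(1)] closure_subset[of "convex hull (vertices T)"] by (auto simp: frontier_def)
    then show "x \<in> (\<Union>T\<in>\<T>. frontier (convex hull (vertices T)))" using T by blast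
  qed
  ultimately show ?thesis by (rule negligible_subset)
qed

lemma triangulation_face:
  assumes "T \<in> \<T>" "T' \<in> \<T>"
  obtains c where "c \<subseteq> vertices T" "closure T \<inter> closure T' = convex hull c"
proof -
  have "(closure T \<inter> closure T') face_of closure T"
    using mesh assms by (auto simp: regular_mesh_def triangulation_def)
  then have "(closure T \<inter> closure T') face_of convex hull (vertices T)" using element(2)[OF assms(1)] by simp
  then show thesis using face_of_convex_hull_affine_independent[of "vertices T"] element(1)[OF assms(1)] that
    unfolding simplex_vertices_def by blast
qed

text \<open>The vertex sets of the faces of codimension two.\<close>

definition ridges :: "(real^'n) set set" where
  "ridges = (\<Union>T\<in>\<T>. (\<lambda>(p,q). vertices T - {p,q}) ` {(p,q). p \<in> vertices T \<and> q \<in> vertices T \<and> p \<noteq> q})"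

lemma ridgesI: "T \<in> \<T> \<Longrightarrow> p \<in> vertices T \<Longrightarrow> q \<in> vertices T \<Longrightarrow> p \<noteq> q \<Longrightarrow> vertices T - {p,q} \<in> ridges"
  unfolding ridges_def by force

lemma ridgesE:
  assumes "B \<in> ridges"
  obtains T p q where "T \<in> \<T>" "p \<in> vertices T" "q \<in> vertices T" "p \<noteq> q" "B = vertices T - {p,q}"
  using assms unfolding ridges_def by blast

lemma finite_ridges: "finite ridges"
proof -
  have "finite {(p,q). p \<in> vertices T \<and> q \<in> vertices T \<and> p \<noteq> q}" if "T \<in> \<T>" for T
    by (rule finite_subset[of _ "vertices T \<times> vertices T"]) (use finite_vertices[OF that] in auto)
  then show ?thesis unfolding ridges_def using finite_mesh by blast
qed

lemma card_ridges: "B \<in> ridges \<Longrightarrow> finite B \<and> Suc (card B) \<le> CARD('n)"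
proof (erule ridgesE)
  fix T p q assume *: "T \<in> \<T>" "p \<in> vertices T" "q \<in> vertices T" "p \<noteq> q" "B = vertices T - {p,q}"
  then have "card B = card (vertices T) - card {p,q}" by (intro card_Diff_subset[of "{p,q}", folded *(5)] | simp add: card_Diff_subset)+
  then show ?thesis using * card_vertices[OF *(1)] finite_vertices[OF *(1)] dim by simp
qed

lemma element_not_ridges:
  assumes "T \<in> \<T>" "y \<in> T" "B \<in> ridges" shows "y \<notin> convex hull B"
proof
  assume y: "y \<in> convex hull B"
  obtain T' p q where B: "T' \<in> \<T>" "p \<in> vertices T'" "q \<in> vertices T'" "p \<noteq> q" "B = vertices T' - {p,q}"
    by (rule ridgesE[OF assms(3)])
  have "convex hull B \<subseteq> convex hull (vertices T' - {p})" unfolding B(5) by (intro hull_mono) auto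
  then have yf: "y \<in> closure T'" "bary (vertices T') p y = 0" using y mem_facet[OF B(1,2)] by blast+
  show False
  proof (cases "T = T'")
    case True
    then show ?thesis using yf(2) assms(2) mem_element[OF B(1), of y] B(2) by auto
  next
    case False
    then show ?thesis using disjoint_closure[OF assms(1) B(1)] yf(1) assms(2) by blast
  qed
qed

lemma star_finite: "finite (star \<T> x)" unfolding star_def using finite_mesh by simp

text \<open>By disjointness of the open elements, the common face is spanned by a proper subset of
  the vertices of \<open>T\<close>. Either it misses exactly one vertex and is a facet, or it misses
  two and lies in a ridge.\<close>

lemma intersection_facet_or_ridge:
  assumes T: "T \<in> \<T>" "T' \<in> \<T>" "T \<noteq> T'" and x: "x \<in> closure T \<inter> closure T'"
  shows "facet_adjacent T T' \<or> (\<exists>B\<in>ridges. x \<in> convex hull B)"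
proof -
  obtain c where c: "c \<subseteq> vertices T" "closure T \<inter> closure T' = convex hull c" by (rule triangulation_face[OF T(1,2)])
  have "c \<noteq> vertices T"
  proof
    assume "c = vertices T"
    then have "closure T \<subseteq> closure T'" using c(2) element(2)[OF T(1)] by auto
    then have "T \<inter> closure T' = T" using closure_subset[of T] by auto
    then show False using disjoint_closure[OF T] element_nonempty[OF T(1)] by auto
  qed
  then obtain p where p: "p \<in> vertices T" "p \<notin> c" using c(1) by blast
  show ?thesis
  proof (cases "c = vertices T - {p}")
    case True
    then show ?thesis using p c T(3) unfolding facet_adjacent_def by blast
  next
    case False
    then obtain q where q: "q \<in> vertices T" "q \<noteq> p" "q \<notin> c" using p c(1) by blast
    then have "c \<subseteq> vertices T - {p,q}" using p c(1) by blast
    then have "x \<in> convex hull (vertices T - {p,q})" using x c(2) hull_mono[of c "vertices T - {p,q}" convex] by blast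
    then show ?thesis using ridgesI[OF T(1) p(1) q(1)] q(2) by blast
  qed
qed

lemma star_locality:
  obtains r where "0 < r" "\<And>T y. T \<in> \<T> \<Longrightarrow> y \<in> closure T \<Longrightarrow> dist x y < r \<Longrightarrow> T \<in> star \<T> x"
    "\<And>T p y. T \<in> \<T> \<Longrightarrow> y \<in> convex hull (vertices T - {p}) \<Longrightarrow> dist x y < r \<Longrightarrow> x \<in> convex hull (vertices T - {p})"
proof -
  let ?\<C> = "closure ` \<T> \<union> (\<Union>T\<in>\<T>. (\<lambda>A. convex hull A) ` Pow (vertices T))"
  have "finite ?\<C>" using finite_mesh finite_vertices by auto
  moreover have "closed C" if C: "C \<in> ?\<C>" for C
  proof (cases "C \<in> closure ` \<T>")
    case False
    then obtain T A where "T \<in> \<T>" "A \<subseteq> vertices T" "C = convex hull A" using C by auto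
    then show ?thesis using finite_vertices finite_subset by (auto intro!: compact_imp_closed finite_imp_compact_convex_hull)
  qed auto
  ultimately show thesis
  proof (rule finite_closed_locality[where x=x])
    fix r assume r: "0 < r" "\<And>C y. C \<in> ?\<C> \<Longrightarrow> y \<in> C \<Longrightarrow> dist x y < r \<Longrightarrow> x \<in> C"
    show thesis
    proof (rule that[OF r(1)])
    fix T y assume "T \<in> \<T>" "y \<in> closure T" "dist x y < r"
    then show "T \<in> star \<T> x" using r(2)[of "closure T" y] by (auto simp: star_def)
  next
    fix T p y assume "T \<in> \<T>" "y \<in> convex hull (vertices T - {p})" "dist x y < r"
    then show "x \<in> convex hull (vertices T - {p})" using r(2)[of "convex hull (vertices T - {p})" y] by blast
    qed
  qed
qed

text \<open>Split the star into the elements \<open>A\<close> reachable from \<open>T\<close> and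
  the rest \<open>B\<close>. Connectedness is used twice: for \<open>W\<close>, to find a place
  where the two groups touch, possibly on a ridge, and then for a generic segment near that place,
  to find a touching point off the ridges. Two elements meeting there share a facet, a
  contradiction.\<close>

lemma star_connected:
  assumes x: "x \<in> closure \<Omega>" and T: "T \<in> star \<T> x" "T' \<in> star \<T> x"
  shows "(T, T') \<in> {(A, B). A \<in> star \<T> x \<and> B \<in> star \<T> x \<and> facet_adjacent A B}\<^sup>*"
proof (rule ccontr)
  let ?R = "{(A, B). A \<in> star \<T> x \<and> B \<in> star \<T> x \<and> facet_adjacent A B}"
  assume neg: "(T, T') \<notin> ?R\<^sup>*"
  define A where "A = {S \<in> star \<T> x. (T, S) \<in> ?R\<^sup>*}"
  define B where "B = star \<T> x - A"
  have AB: "T \<in> A" "T' \<in> B" "A \<union> B = star \<T> x" "finite A" "finite B" "A \<subseteq> \<T>" "B \<subseteq> \<T>" "A \<inter> B = {}"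
    using T neg finite_subset[OF _ star_finite[of x], of A] finite_subset[OF _ star_finite[of x], of B]
    by (auto simp: A_def B_def star_def)
  have sep: "\<not> facet_adjacent S S'" if "S \<in> A" "S' \<in> B" for S S'
  proof
    assume "facet_adjacent S S'"
    then have "(S, S') \<in> ?R" using that by (auto simp: A_def B_def)
    moreover have "(T, S) \<in> ?R\<^sup>*" using that by (simp add: A_def)
    ultimately have "(T, S') \<in> ?R\<^sup>*" by (rule rtrancl_into_rtrancl[rotated])
    then show False using that by (auto simp: A_def B_def)
  qed
  obtain r where r: "0 < r" "\<And>T y. T \<in> \<T> \<Longrightarrow> y \<in> closure T \<Longrightarrow> dist x y < r \<Longrightarrow> T \<in> star \<T> x"
    by (rule star_locality[of x]) blast
  obtain W s where W: "open W" "connected W" "W \<subseteq> \<Omega> \<inter> ball x r" "0 < s" "\<Omega> \<inter> ball x s \<subseteq> W"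
    by (rule lipschitz_boundary_connected[OF open_domain lipschitz_domain x r(1)])
  let ?A = "\<Union>S\<in>A. closure S" and ?B = "\<Union>S\<in>B. closure S"
  have cl: "closed ?A" "closed ?B" using AB by (auto intro!: closed_UN)
  have cov: "W \<subseteq> ?A \<union> ?B"
  proof
    fix y assume y: "y \<in> W"
    then have "y \<in> closure \<Omega>" using W(3) closure_subset[of \<Omega>] by auto
    then obtain S where S: "S \<in> \<T>" "y \<in> closure S" using closure_domain by auto
    moreover have "dist x y < r" using y W(3) by auto
    ultimately have "S \<in> star \<T> x" by (rule r(2))
    then have "S \<in> A \<or> S \<in> B" using AB(3) by blast
    then show "y \<in> ?A \<union> ?B" using S(2) by blast
  qed
  have meets: "\<exists>y. y \<in> S \<and> y \<in> W" if S: "S \<in> star \<T> x" for S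
  proof -
    have "x \<in> closure S" "S \<in> \<T>" using S by (auto simp: star_def)
    then obtain y where "y \<in> S" "dist y x < s" using W(4) closure_approachable by blast
    moreover have "y \<in> \<Omega>" using \<open>y \<in> S\<close> element_subset[OF \<open>S \<in> \<T>\<close>] by blast
    ultimately show ?thesis using W(5) by (auto simp: dist_commute)
  qed
  have mT: "?A \<inter> W \<noteq> {}"
  proof -
    obtain y where "y \<in> T" "y \<in> W" using meets[OF T(1)] by blast
    then have "y \<in> closure T" using closure_subset[of T] by auto
    then show ?thesis using AB(1) \<open>y \<in> W\<close> by blast
  qed
  have mT': "?B \<inter> W \<noteq> {}"
  proof -
    obtain y where "y \<in> T'" "y \<in> W" using meets[OF T(2)] by blast
    then have "y \<in> closure T'" using closure_subset[of T'] by auto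
    then show ?thesis using AB(2) \<open>y \<in> W\<close> by blast
  qed
  \<comment> \<open>The two closed unions cover the connected set \<open>W\<close>, and each meets
    it because every element of the star has points close to \<open>x\<close>.\<close>
  have "?A \<inter> ?B \<inter> W \<noteq> {}" using W(2) cl cov mT mT' unfolding connected_closed by blast
  then obtain z S1 S2 where z: "z \<in> W" "S1 \<in> A" "z \<in> closure S1" "S2 \<in> B" "z \<in> closure S2" by blast
  obtain e where e: "e > 0" "ball z e \<subseteq> W" using W(1) z(1) openE by blast
  have S12: "S1 \<in> \<T>" "S2 \<in> \<T>" using z AB by auto
  obtain y where y: "y \<in> S1" "dist y z < e" using z(3) e(1) closure_approachable by blast
  obtain y2 where y2: "y2 \<in> S2" "dist y2 z < e" using z(5) e(1) closure_approachable by blast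
  have o: "open (S2 \<inter> ball z e)" using element_open[OF S12(2)] by auto
  have ne: "S2 \<inter> ball z e \<noteq> {}" using y2 by (auto simp: dist_commute)
  \<comment> \<open>The starting point \<open>y\<close> lies in an open element and so on no ridge,
    which is what a generic choice of the endpoint needs.\<close>
  obtain x' where x': "x' \<in> S2 \<inter> ball z e" "\<And>B. B \<in> ridges \<Longrightarrow> closed_segment y x' \<inter> convex hull B = {}"
    using generic_segment[OF finite_ridges card_ridges o ne element_not_ridges[OF S12(1) y(1)]] by blast
  have seg: "closed_segment y x' \<subseteq> W"
    using x'(1) y(2) e(2) closed_segment_subset[of y "ball z e" x'] by (auto simp: dist_commute)
  have m1: "?A \<inter> closed_segment y x' \<noteq> {}"
  proof -
    have "y \<in> closure S1" using closure_subset[of S1] y by auto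
    then show ?thesis using z(2) by auto
  qed
  have m2: "?B \<inter> closed_segment y x' \<noteq> {}"
  proof -
    have "x' \<in> closure S2" using closure_subset[of S2] x' by auto
    then show ?thesis using z(4) by auto
  qed
  have "?A \<inter> ?B \<inter> closed_segment y x' \<noteq> {}"
    using connected_segment[of y x'] cl m1 m2 subset_trans[OF seg cov] unfolding connected_closed by blast
  then obtain u S3 S4 where u: "u \<in> closed_segment y x'" "S3 \<in> A" "u \<in> closure S3" "S4 \<in> B" "u \<in> closure S4" by blast
  have "S3 \<noteq> S4" using u AB(8) by blast
  moreover have "S3 \<in> \<T>" "S4 \<in> \<T>" using u AB by auto
  ultimately have "facet_adjacent S3 S4 \<or> (\<exists>B\<in>ridges. u \<in> convex hull B)"
    using u by (intro intersection_facet_or_ridge) auto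
  then show False using sep[OF u(2,4)] x'(2) u(1) by blast
qed

end

section \<open>Facets and boundary facets\<close>

locale labelled_mesh = mesh \<Omega> \<T> for \<Omega> :: "(real^'n) set" and \<T> +
  fixes \<gamma> :: real and Tp Tm :: "(real^'n) set \<Rightarrow> (real^'n) set"
  assumes shape: "shape_regular \<gamma> \<T>" and labelling: "facet_labelling \<Omega> \<T> Tp Tm"
begin

definition facet :: "(real^'n) set \<Rightarrow> real^'n \<Rightarrow> (real^'n) set" where
  "facet T p = rel_interior (convex hull (vertices T - {p}))"

lemma facet_vertices_nonempty: "T \<in> \<T> \<Longrightarrow> vertices T - {p} \<noteq> {}"
proof
  assume T: "T \<in> \<T>" and "vertices T - {p} = {}"
  then have "vertices T \<subseteq> {p}" by auto
  then have "card (vertices T) \<le> 1" using card_mono[of "{p}"] by simp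
  then show False using card_vertices[OF T] dim by simp
qed

lemma open_facet_iff:
  assumes "T \<in> \<T>"
  shows "open_facet_of E T \<longleftrightarrow> (\<exists>p\<in>vertices T. E = facet T p)"
proof -
  have a: "\<not> affine_dependent (vertices T)" using element(1)[OF assms] by (simp add: simplex_vertices_def)
  have ne: "convex hull (vertices T - {p}) \<noteq> {}" for p using facet_vertices_nonempty[OF assms] by simp
  show ?thesis unfolding open_facet_of_def facet_def element(2)[OF assms] facet_of_convex_hull_affine_independent[OF a]
    using ne by blast
qed

lemma facet_in_facets: "T \<in> \<T> \<Longrightarrow> p \<in> vertices T \<Longrightarrow> facet T p \<in> facets \<T>"
  unfolding facets_def using open_facet_iff by auto

lemma facetsE:
  assumes "E \<in> facets \<T>"
  obtains T p where "T \<in> \<T>" "p \<in> vertices T" "E = facet T p"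
  using assms unfolding facets_def using open_facet_iff by auto

lemma finite_facets: "finite (facets \<T>)"
proof -
  have "facets \<T> \<subseteq> (\<Union>T\<in>\<T>. facet T ` vertices T)" by (rule subsetI, erule facetsE) auto
  moreover have "finite (\<Union>T\<in>\<T>. facet T ` vertices T)" using finite_mesh finite_vertices by auto
  ultimately show ?thesis by (rule finite_subset)
qed

lemma closure_facet:
  assumes "T \<in> \<T>" shows "closure (facet T p) = convex hull (vertices T - {p})"
proof -
  have "closure (facet T p) = closure (convex hull (vertices T - {p}))"
    unfolding facet_def by (rule convex_closure_rel_interior) simp
  also have "\<dots> = convex hull (vertices T - {p})"
    using finite_vertices[OF assms] by (intro closure_closed compact_imp_closed finite_imp_compact_convex_hull) auto
  finally show ?thesis .
qed

lemma facet_vertices_indep: "T \<in> \<T> \<Longrightarrow> \<not> affine_dependent (vertices T - {p})"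
  using element(1) affine_independent_subset[of "vertices T" "vertices T - {p}"] by (auto simp: simplex_vertices_def)

lemma facet_eq_imp:
  assumes "T \<in> \<T>" "T' \<in> \<T>" "facet T p = facet T' q"
  shows "vertices T - {p} = vertices T' - {q}"
proof -
  have "convex hull (vertices T - {p}) = convex hull (vertices T' - {q})"
    using assms closure_facet by metis
  then show ?thesis
    using extreme_point_of_convex_hull_affine_independent[OF facet_vertices_indep[OF assms(1)], of _ p]
     extreme_point_of_convex_hull_affine_independent[OF facet_vertices_indep[OF assms(2)], of _ q] by auto
qed

text \<open>On a facet the coordinate of the opposite vertex vanishes, so the point is a combination
  of the facet's vertices, which belong to both elements.\<close>

lemma bary_common_facet:
  assumes T: "T \<in> \<T>" "T' \<in> \<T>" and p: "p \<in> vertices T" and eq: "vertices T - {p} = vertices T' - {q}"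
    and x: "x \<in> convex hull (vertices T - {p})" and r: "r \<in> vertices T - {p}"
  shows "bary (vertices T) r x = bary (vertices T') r x"
proof -
  let ?V = "vertices T" and ?W = "vertices T'"
  have x0: "bary ?V p x = 0" using x mem_facet[OF T(1) p] by blast
  have s: "(\<Sum>v\<in>?V - {p}. bary ?V v x) = 1" "(\<Sum>v\<in>?V - {p}. bary ?V v x *\<^sub>R v) = x"
    using bary_represent[OF element(1)[OF T(1)], of x] x0 p finite_vertices[OF T(1)] by (simp_all add: sum_diff1)
  have "bary ?W r x = (\<Sum>v\<in>?V - {p}. bary ?V v x * bary ?W r v)"
    using bary_sum[of "?V - {p}" "\<lambda>v. bary ?V v x" ?W r "\<lambda>v. v"] s finite_vertices[OF T(1)] by simp
  also have "\<dots> = (\<Sum>v\<in>?V - {p}. bary ?V v x * (if r = v then 1 else 0))"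
    using r unfolding eq by (intro sum.cong refl arg_cong2[where f="(*)"] bary_vertex[OF element(1)[OF T(2)]]) auto
  also have "\<dots> = bary ?V r x"
    using r finite_vertices[OF T(1)] by (simp add: if_distrib[of "\<lambda>y. _ * y"] cong: if_cong)
  finally show ?thesis by simp
qed

text \<open>Two elements with a common facet lie on opposite sides of it, since they are disjoint.\<close>

lemma interior_of_shared_facet:
  assumes T: "T \<in> \<T>" "T' \<in> \<T>" "T \<noteq> T'" and p: "p \<in> vertices T" and q: "q \<in> vertices T'"
    and eq: "vertices T - {p} = vertices T' - {q}"
    and z: "z \<in> convex hull (vertices T - {p})" "\<And>r. r \<in> vertices T - {p} \<Longrightarrow> 0 < bary (vertices T) r z"
  shows "z \<in> interior (closure T \<union> closure T')"
proof -
  let ?V = "vertices T" and ?W = "vertices T'"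
  have zW: "0 < bary ?W r z" if "r \<in> ?W - {q}" for r
    using bary_common_facet[OF T(1,2) p eq z(1), of r] z(2)[of r] that eq by simp
  have z0: "bary ?V p z = 0" using z(1) mem_facet[OF T(1) p] by blast
  have w0: "bary ?W q z = 0" using z(1) mem_facet[OF T(2) q] eq by simp
  \<comment> \<open>Both affine functions vanish at the vertices of the common facet, so one is a
    multiple of the other; the sign of the factor tells whether the elements lie on the same
    side.\<close>
  define \<kappa> where "\<kappa> = bary ?W q p"
  have ratio: "bary ?W q y = \<kappa> * bary ?V p y" for y
  proof -
    have "bary ?W q y = (\<Sum>v\<in>?V. bary ?V v y * bary ?W q v)"
      using bary_sum[OF finite_vertices[OF T(1)] bary_represent(1)[OF element(1)[OF T(1)], of y], of ?W q "\<lambda>v. v"]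
        bary_represent(2)[OF element(1)[OF T(1)], of y] by simp
    also have "\<dots> = bary ?V p y * \<kappa> + (\<Sum>v\<in>?V - {p}. bary ?V v y * bary ?W q v)"
      unfolding \<kappa>_def by (rule sum.remove[OF finite_vertices[OF T(1)] p])
    also have "(\<Sum>v\<in>?V - {p}. bary ?V v y * bary ?W q v) = 0"
      using bary_other[OF element(1)[OF T(2)] q] eq by (intro sum.neutral) auto
    finally show ?thesis by simp
  qed
  have "\<kappa> \<noteq> 0" using ratio[of q] by auto
  moreover have "\<not> 0 < \<kappa>"
  proof
    \<comment> \<open>On the same side, a short move from \<open>z\<close> towards \<open>p\<close>
      would enter both open elements.\<close>
    assume k: "0 < \<kappa>"
    have lim: "((\<lambda>e. (1 - e) * bary ?W r z + e * bary ?W r p) \<longlongrightarrow> (1 - 0) * bary ?W r z + 0 * bary ?W r p) (at_right 0)" for r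
      by (intro tendsto_intros)
    have "\<forall>\<^sub>F e in at_right (0::real). 0 < (1 - e) * bary ?W r z + e * bary ?W r p" if "r \<in> ?W - {q}" for r
      using order_tendstoD(1)[OF lim[of r], of 0] zW[OF that] by simp
    then have "\<forall>\<^sub>F e in at_right (0::real). \<forall>r\<in>?W - {q}. 0 < (1 - e) * bary ?W r z + e * bary ?W r p"
      using finite_vertices[OF T(2)] by (intro eventually_ball_finite) auto
    moreover have "\<forall>\<^sub>F e in at_right (0::real). 0 < e \<and> e < 1"
      by (auto simp: eventually_at_right[of 0 1] intro: exI[of _ 1])
    ultimately have "\<forall>\<^sub>F e in at_right (0::real). (\<forall>r\<in>?W - {q}. 0 < (1 - e) * bary ?W r z + e * bary ?W r p) \<and> 0 < e \<and> e < 1"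
      by (rule eventually_conj)
    then obtain e where e: "\<And>r. r\<in>?W - {q} \<Longrightarrow> 0 < (1 - e) * bary ?W r z + e * bary ?W r p" "0 < e" "e < 1"
      using eventually_happens'[OF trivial_limit_at_right_real[of 0]] by blast
    let ?y = "(1 - e) *\<^sub>R z + e *\<^sub>R p"
    have "0 < bary ?V r ?y" if r: "r \<in> ?V" for r
      unfolding bary_convex_comb using z0 z(2)[of r] bary_vertex[OF element(1)[OF T(1)] r p] r e by (cases "r = p") auto
    then have "?y \<in> T" using mem_element[OF T(1)] by blast
    moreover have "0 < bary ?W r ?y" if r: "r \<in> ?W" for r
      unfolding bary_convex_comb using e(1)[of r] w0 k e r by (cases "r = q") (auto simp: \<kappa>_def)
    then have "?y \<in> T'" using mem_element[OF T(2)] by blast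
    ultimately show False using mesh_disjoint[OF T] by blast
  qed
  ultimately have k: "\<kappa> < 0" by simp
  define N where "N = (\<Inter>r\<in>?V - {p}. {y. 0 < bary ?V r y}) \<inter> (\<Inter>r\<in>?W - {q}. {y. 0 < bary ?W r y})"
  have "open N" unfolding N_def using finite_vertices[OF T(1)] finite_vertices[OF T(2)]
    by (intro open_Int open_INT ballI open_Collect_less continuous_intros) auto
  moreover have "z \<in> N" using z(2) zW by (auto simp: N_def)
  moreover have "N \<subseteq> closure T \<union> closure T'"
  proof
    fix y assume y: "y \<in> N"
    have "0 \<le> bary ?V p y \<or> 0 \<le> bary ?W q y" using k unfolding ratio[of y] by (simp add: zero_le_mult_iff) linarith
    then show "y \<in> closure T \<union> closure T'"
    proof
      assume "0 \<le> bary ?V p y"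
      then have "\<forall>r\<in>?V. 0 \<le> bary ?V r y" using y unfolding N_def by (force intro: less_imp_le)
      then show ?thesis using mem_closure_element[OF T(1)] by blast
    next
      assume "0 \<le> bary ?W q y"
      then have "\<forall>r\<in>?W. 0 \<le> bary ?W r y" using y unfolding N_def by (force intro: less_imp_le)
      then show ?thesis using mem_closure_element[OF T(2)] by blast
    qed
  qed
  ultimately show ?thesis by (rule interiorI)
qed

lemma not_boundary_facet:
  assumes "T \<in> \<T>" "p \<in> vertices T" "\<not> facet T p \<subseteq> frontier \<Omega>"
  obtains T' q where "T' \<in> \<T>" "T' \<noteq> T" "q \<in> vertices T'" "vertices T - {p} = vertices T' - {q}"
proof -
  let ?E = "facet T p"
  have "?E \<in> facets \<T>" using facet_in_facets assms by blast
  then have "{T \<in> \<T>. open_facet_of ?E T} = {Tp ?E, Tm ?E}" "Tp ?E \<noteq> Tm ?E"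
    using labelling assms(3) unfolding facet_labelling_def by auto
  then obtain T' where T': "T' \<in> \<T>" "open_facet_of ?E T'" "T' \<noteq> T" by blast
  then obtain q where q: "q \<in> vertices T'" "?E = facet T' q" using open_facet_iff by blast
  show thesis using that[OF T'(1,3) q(1) facet_eq_imp[OF assms(1) T'(1) q(2)]] .
qed

text \<open>Follow a generic segment from an element at \<open>x\<close> to an exterior point close
  to \<open>x\<close>, up to the last point in the closure of \<Omega>. It lies on a facet but on no
  ridge. If that facet had a second element, the two elements would surround the point, which could
  then not be the last one. By the choice of \<open>r\<close>, the facet's closure contains
  \<open>x\<close> too.\<close>

lemma boundary_facet_exists:
  assumes x: "x \<in> frontier \<Omega>"
  obtains T p where "T \<in> \<T>" "p \<in> vertices T" "facet T p \<subseteq> frontier \<Omega>" "x \<in> convex hull (vertices T - {p})"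
proof -
  obtain r where r: "0 < r" "\<And>T y. T \<in> \<T> \<Longrightarrow> y \<in> closure T \<Longrightarrow> dist x y < r \<Longrightarrow> T \<in> star \<T> x"
    "\<And>T p y. T \<in> \<T> \<Longrightarrow> y \<in> convex hull (vertices T - {p}) \<Longrightarrow> dist x y < r \<Longrightarrow> x \<in> convex hull (vertices T - {p})"
    by (rule star_locality[of x]) blast
  have xr: "x \<in> ball x r" using r by simp
  obtain y1 where "y1 \<in> ball x r" "y1 \<notin> closure \<Omega>" by (rule lipschitz_boundary_exterior[OF open_domain lipschitz_domain x open_ball xr])
  then have U: "open (ball x r - closure \<Omega>)" "ball x r - closure \<Omega> \<noteq> {}" by (auto intro: open_Diff)
  have "x \<in> closure \<Omega>" using x by (simp add: frontier_def)
  then obtain T0 where T0: "T0 \<in> \<T>" "x \<in> closure T0" using closure_domain by auto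
  then obtain y where y: "y \<in> T0" "dist y x < r" using r(1) closure_approachable by blast
  obtain x' where x': "x' \<in> ball x r - closure \<Omega>" "\<And>B. B \<in> ridges \<Longrightarrow> closed_segment y x' \<inter> convex hull B = {}"
    using generic_segment[OF finite_ridges card_ridges U element_not_ridges[OF T0(1) y(1)]] by blast
  define c where "c t = (1 - t) *\<^sub>R y + t *\<^sub>R x'" for t
  have cc: "continuous_on A c" for A unfolding c_def by (intro continuous_intros)
  have cseg: "c t \<in> closed_segment y x'" if "t \<in> {0..1}" for t using that by (auto simp: c_def closed_segment_def)
  have cball: "dist x (c t) < r" if "t \<in> {0..1}" for t
    using cseg[OF that] closed_segment_subset[of y "ball x r" x'] x'(1) y(2) by (auto simp: dist_commute)
  \<comment> \<open>The parameters at which the segment is in the closure of \<Omega>; compactness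
    provides a largest one, and it is below 1 because the endpoint is exterior.\<close>
  define S where "S = {0..1} \<inter> c -` closure \<Omega>"
  have "closed S" unfolding S_def by (rule continuous_closed_preimage[OF cc closed_atLeastAtMost closed_closure])
  then have "compact S" using bounded_subset[of "{0..1}" S] by (auto simp: compact_eq_bounded_closed S_def)
  moreover have "0 \<in> S" using y(1) element_subset[OF T0(1)] closure_subset[of \<Omega>] by (auto simp: S_def c_def)
  ultimately obtain t where t: "t \<in> S" "\<And>s. s \<in> S \<Longrightarrow> s \<le> t" using compact_attains_sup[of S] by blast
  have "1 \<notin> S" using x'(1) by (simp add: S_def c_def)
  then have t1: "0 \<le> t" "t < 1" using t(1) by (auto simp: S_def order_le_less)
  let ?z = "c t"
  have nint: "?z \<notin> interior (closure \<Omega>)"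
  proof
    assume "?z \<in> interior (closure \<Omega>)"
    moreover have "(c \<longlongrightarrow> c t) (at_right t)" using cc[of UNIV] by (simp add: continuous_on_def filterlim_at_split)
    ultimately have "\<forall>\<^sub>F s in (at_right t). c s \<in> interior (closure \<Omega>)" by (intro topological_tendstoD) auto
    moreover have "\<forall>\<^sub>F s in (at_right t). t < s \<and> s < 1" using t1 by (auto simp: eventually_at_right[of t 1] intro: exI[of _ 1])
    ultimately have "\<forall>\<^sub>F s in (at_right t). c s \<in> interior (closure \<Omega>) \<and> t < s \<and> s < 1" by (rule eventually_conj)
    then obtain s where s: "c s \<in> interior (closure \<Omega>)" "t < s" "s < 1"
      using eventually_happens'[OF trivial_limit_at_right_real[of t]] by blast
    then have "s \<in> S" using t1 interior_subset by (auto simp: S_def)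
    then show False using t(2) s(2) by fastforce
  qed
  have "?z \<in> closure \<Omega>" using t(1) by (simp add: S_def)
  then obtain T where T: "T \<in> \<T>" "?z \<in> closure T" using closure_domain by auto
  have "?z \<notin> T" using nint element_subset[OF T(1)] interior_closure_domain by auto
  then obtain p where p: "p \<in> vertices T" "bary (vertices T) p ?z \<le> 0" using mem_element[OF T(1)] by (auto simp: not_less)
  then have zp: "?z \<in> convex hull (vertices T - {p})"
    using mem_facet[OF T(1) p(1)] T mem_closure_element[OF T(1)] by (metis order_antisym)
  have tI: "t \<in> {0..1}" using t1 by simp
  \<comment> \<open>A second vanishing coordinate would place the point on a ridge, which the
    segment avoids.\<close>
  have pos: "0 < bary (vertices T) v ?z" if v: "v \<in> vertices T - {p}" for v
  proof (rule ccontr)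
    assume "\<not> ?thesis"
    then have v0: "bary (vertices T) v ?z = 0" using mem_closure_element[OF T(1)] T(2) v by (metis DiffD1 order_antisym not_less)
    have p0: "bary (vertices T) p ?z = 0" using zp mem_facet[OF T(1) p(1)] by blast
    let ?V = "vertices T"
    have fin: "finite ?V" by (rule finite_vertices[OF T(1)])
    have "(\<Sum>w\<in>?V - {p,v}. bary ?V w ?z) = 1" "(\<Sum>w\<in>?V - {p,v}. bary ?V w ?z *\<^sub>R w) = ?z"
      using bary_represent[OF element(1)[OF T(1)], of ?z] p0 v0 p(1) v fin
       sum.mono_neutral_left[of ?V "?V - {p,v}" "\<lambda>w. bary ?V w ?z"] sum.mono_neutral_left[of ?V "?V - {p,v}" "\<lambda>w. bary ?V w ?z *\<^sub>R w"]
      by auto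
    then have "?z \<in> convex hull (?V - {p,v})"
      using convex_hull_finite[of "?V - {p,v}"] fin mem_closure_element[OF T(1)] T(2) by auto
    moreover have "?V - {p,v} \<in> ridges" using ridgesI[OF T(1) p(1), of v] v by blast
    ultimately show False using x'(2) cseg[OF tI] by blast
  qed
  have xF: "x \<in> convex hull (vertices T - {p})" using r(3)[OF T(1) zp cball[OF tI]] .
  have "facet T p \<subseteq> frontier \<Omega>"
  proof (rule ccontr)
    assume "\<not> ?thesis"
    then obtain T' q where T': "T' \<in> \<T>" "T' \<noteq> T" "q \<in> vertices T'" "vertices T - {p} = vertices T' - {q}"
      by (rule not_boundary_facet[OF T(1) p(1)])
    have "?z \<in> interior (closure T \<union> closure T')"
      by (rule interior_of_shared_facet[OF T(1) T'(1) T'(2)[symmetric] p(1) T'(3,4) zp pos])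
    moreover have "closure T \<union> closure T' \<subseteq> closure \<Omega>" using closure_domain T(1) T'(1) by auto
    ultimately show False using nint interior_mono by blast
  qed
  then show thesis using that[OF T(1) p(1)] xF by blast
qed

end

section \<open>Raviart-Thomas fluxes\<close>

text \<open>The integral of the derivative of w^2 x_i along axis \<open>i\<close> vanishes. Thus the
  integral of w^2 equals minus that of 2 w x_i times the partial derivative of w; Cauchy-Schwarz and
  |x_i| \<le> R finish the estimate.\<close>

lemma friedrichs_test:
  fixes w :: "real^'n \<Rightarrow> real"
  assumes \<Omega>: "open \<Omega>" and R: "\<And>x. x \<in> \<Omega> \<Longrightarrow> norm x \<le> R" and w: "w \<in> test_functions \<Omega>" and "0 \<le> R"
  shows "L2_norm \<Omega> w \<le> 2 * R * L2_norm \<Omega> (grad w)"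
proof -
  obtain i :: 'n where True by simp
  note c = test_functionsD(3)[OF w, of UNIV] test_functionsD(4)[OF w, of UNIV]
  have d: "(w has_derivative (\<lambda>h. grad w x \<bullet> h)) (at x)" for x by (rule has_derivative_grad[OF test_functionsD(2)[OF w]])
  have dx: "((\<lambda>x::real^'n. x $ i) has_derivative (\<lambda>h. h $ i)) (at x)" for x
    by (intro bounded_linear_imp_has_derivative bounded_linear_vec_nth)
  let ?f = "\<lambda>x. w x * (w x * x $ i)"
  have df: "(?f has_derivative (\<lambda>h. w x * (w x * h $ i + (grad w x \<bullet> h) * x $ i) + (grad w x \<bullet> h) * (w x * x $ i))) (at x)" for x
    by (rule has_derivative_mult[OF d has_derivative_mult[OF d dx]])
  have g: "grad w x $ j = partial j w x" for x j by (simp add: grad_def)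
  have pf: "partial j ?f = (\<lambda>x. w x * (w x * axis j 1 $ i + partial j w x * x $ i) + partial j w x * (w x * x $ i))" for j
    by (rule ext, subst partial_eq[OF df]) (simp add: inner_axis g)
  have "integral UNIV (partial i ?f) = 0"
  proof (rule integral_partial_zero)
    show "cc ?f" by (intro cc_mult[OF cc_test(1)[OF w]] continuous_intros c)
    show "?f differentiable_on UNIV" using df by (auto simp: differentiable_on_def differentiable_def)
    show "continuous_on UNIV (partial j ?f)" for j unfolding pf by (intro continuous_intros c)
  qed
  moreover have pfi: "partial i ?f = (\<lambda>x. w x * w x + w x * (2 * x $ i * partial i w x))"
    unfolding pf by (simp add: fun_eq_iff algebra_simps)
  moreover have cc1: "cc (\<lambda>x. w x * w x)" by (intro cc_mult[OF cc_test(1)[OF w]] c)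
  moreover have cc2: "cc (\<lambda>x. w x * (2 * x $ i * partial i w x))" by (intro cc_mult[OF cc_test(1)[OF w]] continuous_intros c)
  ultimately have e: "integral UNIV (\<lambda>x. w x * w x) = - integral UNIV (\<lambda>x. w x * (2 * x $ i * partial i w x))"
    using integral_add[OF cc_integrable(2)[OF cc1] cc_integrable(2)[OF cc2]] by simp
  let ?v = "\<lambda>x. 2 * x $ i * partial i w x"
  have ccv: "cc ?v"
    using cc_mult[OF cc_test(2)[OF w, of i], of "\<lambda>x. 2 * x $ i"] by (simp add: continuous_on_mult mult_ac continuous_intros)
  have L: "w \<in> L2 \<Omega>" "?v \<in> L2 \<Omega>" "grad w \<in> L2 \<Omega>"
    by (rule cc_L2[OF cc_test(1)[OF w] \<Omega>], rule cc_L2[OF ccv \<Omega>], rule cc_L2[OF cc_test(3)[OF w] \<Omega>])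
  have "L2_inner \<Omega> w w = integral UNIV (\<lambda>x. w x * w x)" unfolding L2_inner_def
    using cc_lebesgue_on(2)[OF cc1, of \<Omega>] test_functionsD(7)[OF w] \<Omega> by simp
  moreover have "L2_inner \<Omega> w ?v = integral UNIV (\<lambda>x. w x * ?v x)" unfolding L2_inner_def
    using cc_lebesgue_on(2)[OF cc2, of \<Omega>] test_functionsD(7)[OF w] \<Omega> by simp
  ultimately have "L2_inner \<Omega> w w \<le> L2_norm \<Omega> w * L2_norm \<Omega> ?v"
    using L2_Cauchy_Schwarz[OF L(1,2)] e by simp
  \<comment> \<open>The zero summand puts the scaled gradient into the shape of
    \<open>L2_lin\<close>.\<close>
  also have "L2_norm \<Omega> ?v \<le> L2_norm \<Omega> (\<lambda>x. (2 * R) *\<^sub>R grad w x + 0 *\<^sub>R grad w x)"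
  proof (rule L2_norm_cmp[OF L(2) L2_lin[OF L(3) L(3)] _ open_lebesgue[OF \<Omega>]])
    fix x assume x: "x \<in> \<Omega>"
    have "\<bar>x $ i\<bar> \<le> R" using component_le_norm_cart[of x i] R[OF x] by linarith
    moreover have "\<bar>partial i w x\<bar> \<le> norm (grad w x)" using component_le_norm_cart[of "grad w x" i] by (simp add: g)
    ultimately have "\<bar>x $ i\<bar> * \<bar>partial i w x\<bar> \<le> R * norm (grad w x)" by (intro mult_mono) (use \<open>0 \<le> R\<close> in auto)
    then show "norm (2 * x $ i * partial i w x) \<le> norm ((2 * R) *\<^sub>R grad w x + 0 *\<^sub>R grad w x)" using \<open>0 \<le> R\<close> by (simp add: abs_mult)
  qed
  also have "L2_norm \<Omega> (\<lambda>x. (2 * R) *\<^sub>R grad w x + 0 *\<^sub>R grad w x) = 2 * R * L2_norm \<Omega> (grad w)"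
  proof -
    have "(2 * R) * ((2 * R) * L2_inner \<Omega> (grad w) (grad w)) = (2 * R)\<^sup>2 * L2_inner \<Omega> (grad w) (grad w)" by (simp add: power2_eq_square)
    then have "L2_inner \<Omega> (\<lambda>x. (2 * R) *\<^sub>R grad w x + 0 *\<^sub>R grad w x) (\<lambda>x. (2 * R) *\<^sub>R grad w x + 0 *\<^sub>R grad w x) = (2 * R)\<^sup>2 * L2_inner \<Omega> (grad w) (grad w)"
      unfolding L2_inner_def by (simp add: power2_eq_square)
    then show ?thesis using \<open>0 \<le> R\<close> by (simp add: L2_norm_def real_sqrt_mult)
  qed
  finally have "L2_norm \<Omega> w * L2_norm \<Omega> w \<le> L2_norm \<Omega> w * (2 * R * L2_norm \<Omega> (grad w))"
    using L2_norm_ge_0[of \<Omega> w] by (simp add: L2_norm_power2[symmetric] power2_eq_square mult_left_mono)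
  then show ?thesis using L2_norm_ge_0[of \<Omega> w] L2_norm_ge_0[of \<Omega> "grad w"] \<open>0 \<le> R\<close>
    by (cases "L2_norm \<Omega> w = 0") auto
qed

text \<open>Supplies the a priori bound under which the supremum defining \<open>Hm1_norm\<close> is
  finite. Its size does not enter the final constant.\<close>

lemma pairing_bound_exists:
  fixes \<Omega> :: "(real^'n) set"
  assumes \<Omega>: "open \<Omega>" "bounded \<Omega>" and \<phi>: "\<phi> \<in> L2 \<Omega>"
  obtains M where "0 \<le> M" "\<And>w. w \<in> test_functions \<Omega> \<Longrightarrow> L2_inner \<Omega> \<phi> w \<le> M * L2_norm \<Omega> (grad w)"
proof -
  obtain R where R: "R > 0" "\<And>x. x \<in> \<Omega> \<Longrightarrow> norm x \<le> R" using \<Omega>(2) bounded_pos[of \<Omega>] by auto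
  show thesis
  proof (rule that)
    show "0 \<le> L2_norm \<Omega> \<phi> * (2 * R)" using R(1) L2_norm_ge_0[of \<Omega> \<phi>] by simp
    fix w assume w: "w \<in> test_functions \<Omega>"
    have "L2_inner \<Omega> \<phi> w \<le> L2_norm \<Omega> \<phi> * L2_norm \<Omega> w"
      using L2_Cauchy_Schwarz[OF \<phi> cc_L2[OF cc_test(1)[OF w] \<Omega>(1)]] by linarith
    also have "\<dots> \<le> L2_norm \<Omega> \<phi> * (2 * R * L2_norm \<Omega> (grad w))"
      using friedrichs_test[OF \<Omega>(1) R(2) w] R(1) L2_norm_ge_0[of \<Omega> \<phi>] by (intro mult_left_mono) auto
    finally show "L2_inner \<Omega> \<phi> w \<le> L2_norm \<Omega> \<phi> * (2 * R) * L2_norm \<Omega> (grad w)" by (simp add: mult.assoc)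
  qed
qed

lemma divergence_affine:
  fixes f :: "real^'n \<Rightarrow> real^'n" and a :: real
  assumes "open T" "x \<in> T" "\<And>y. y \<in> T \<Longrightarrow> f y = a *\<^sub>R (y - c)"
  shows "divergence f x = CARD('n) * a"
proof -
  have "((\<lambda>y. a *\<^sub>R (y - c)) has_derivative (\<lambda>h. a *\<^sub>R h)) (at x)" by (auto intro!: derivative_eq_intros)
  then have "(f has_derivative (\<lambda>h. a *\<^sub>R h)) (at x)"
    by (rule has_derivative_transform_within_open[OF _ assms(1,2)]) (simp add: assms(3))
  then show ?thesis by (simp add: divergence_def partial_eq)
qed

lemma facet_measure_pos:
  fixes V :: "(real^'n) set"
  assumes V: "simplex_vertices V" and p: "p \<in> V" and n: "2 \<le> CARD('n)"
  shows "0 < facet_measure (rel_interior (convex hull (V - {p})))"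
proof -
  let ?C = "convex hull (V - {p})"
  let ?E = "rel_interior ?C"
  have fin: "finite V" by (rule simplex_vertices_finite[OF V])
  have "\<exists>\<nu>. norm \<nu> = 1 \<and> (\<forall>x\<in>?E. \<forall>y\<in>?E. (x - y) \<bullet> \<nu> = 0)"
  proof -
    \<comment> \<open>The gradient of the coordinate of \<open>p\<close> is normal to the facet, on
      which this coordinate is 0. Normalised, it shows that the choice in
      \<open>facet_measure\<close> has a witness.\<close>
    let ?g = "bary_grad V p"
    have "card (V - {p}) = CARD('n)" using V p fin by (simp add: simplex_vertices_def)
    then have "V - {p} \<noteq> {}" by (metis card.empty zero_neq_one zero_less_card_finite less_numeral_extra(3))
    then obtain q where "q \<in> V" "q \<noteq> p" by blast
    then have "?g \<noteq> 0" using bary_other[OF V p, of q] by (auto simp: bary_def)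
    moreover have "(x - y) \<bullet> ?g = 0" if "x \<in> ?E" "y \<in> ?E" for x y
    proof -
      have "bary V p x = 0" "bary V p y = 0" using that rel_interior_subset[of ?C] facet_bary[OF V p] by blast+
      then show ?thesis using bary_diff[of V p x y] by (simp add: inner_commute)
    qed
    ultimately show ?thesis by (intro exI[of _ "?g /\<^sub>R norm ?g"]) simp
  qed
  then obtain \<nu> where \<nu>: "\<nu> = (SOME \<nu>. norm \<nu> = 1 \<and> (\<forall>x\<in>?E. \<forall>y\<in>?E. (x - y) \<bullet> \<nu> = 0))"
    "norm \<nu> = 1" "\<And>x y. x \<in> ?E \<Longrightarrow> y \<in> ?E \<Longrightarrow> (x - y) \<bullet> \<nu> = 0"
    using someI_ex[of "\<lambda>\<nu>. norm \<nu> = 1 \<and> (\<forall>x\<in>?E. \<forall>y\<in>?E. (x - y) \<bullet> \<nu> = 0)"] by blast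
  define P where "P = {x + t *\<^sub>R \<nu> | x t. x \<in> ?E \<and> 0 \<le> t \<and> t \<le> 1}"
  have Pim: "P = (\<lambda>z. fst z + snd z *\<^sub>R \<nu>) ` (?E \<times> {0..1})" by (force simp: P_def image_iff)
  have "linear (\<lambda>z. fst z + snd z *\<^sub>R \<nu>)" by (intro linearI) (auto simp: algebra_simps)
  then have "convex P" unfolding Pim by (intro convex_linear_image convex_Times convex_rel_interior) auto
  have "bounded P"
  proof -
    have "bounded ?C" using fin by (simp add: finite_imp_bounded_convex_hull)
    then have "bounded ?E" using rel_interior_subset bounded_subset by blast
    then obtain B where B: "\<And>x. x \<in> ?E \<Longrightarrow> norm x \<le> B" unfolding bounded_iff by blast
    have "norm y \<le> B + 1" if y: "y \<in> P" for y
    proof -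
      obtain x t where xt: "y = x + t *\<^sub>R \<nu>" "x \<in> ?E" "0 \<le> t" "t \<le> 1" using y unfolding P_def by blast
      then show ?thesis using norm_triangle_ineq[of x "t *\<^sub>R \<nu>"] B[OF xt(2)] \<nu>(2) by simp
    qed
    then show ?thesis unfolding bounded_iff by blast
  qed
  have "affine hull P = UNIV"
  proof -
    have ind: "\<not> affine_dependent (V - {p})"
      using V affine_independent_subset[of V "V - {p}"] by (auto simp: simplex_vertices_def)
    have "?E \<noteq> {}"
    proof -
      have "card (V - {p}) = CARD('n)" using V p fin by (simp add: simplex_vertices_def)
      then have "V - {p} \<noteq> {}" by (metis card.empty zero_neq_one zero_less_card_finite less_numeral_extra(3))
      then show ?thesis by (simp add: rel_interior_eq_empty)
    qed
    then obtain x0 where x0: "x0 \<in> ?E" by blast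
    have aE: "affine hull ?E = affine hull (V - {p})" by (simp add: rel_interior_same_affine_hull)
    have "aff_dim (affine hull ?E) = aff_dim (V - {p})" unfolding aE by simp
    also have "\<dots> = int CARD('n) - 1"
      using aff_dim_affine_independent[OF ind] V p fin by (simp add: simplex_vertices_def)
    finally have d1: "aff_dim (affine hull ?E) = int CARD('n) - 1" .
    have out: "x0 + \<nu> \<notin> affine hull ?E"
    proof
      assume *: "x0 + \<nu> \<in> affine hull ?E"
      have "affine {y. \<nu> \<bullet> y = \<nu> \<bullet> x0}" by (rule affine_hyperplane)
      moreover have "?E \<subseteq> {y. \<nu> \<bullet> y = \<nu> \<bullet> x0}"
        using \<nu>(3)[OF _ x0] by (auto simp: inner_diff_left inner_commute[of \<nu>])
      ultimately have "affine hull ?E \<subseteq> {y. \<nu> \<bullet> y = \<nu> \<bullet> x0}" by (rule hull_minimal[rotated])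
      then have "\<nu> \<bullet> \<nu> = 0" using * by (auto simp: inner_add_right)
      then show False using \<nu>(2) by simp
    qed
    have EP: "?E \<subseteq> P" unfolding P_def by force
    have xP: "x0 + \<nu> \<in> P" unfolding P_def using x0 by (intro CollectI exI[of _ x0] exI[of _ 1]) simp
    have "int CARD('n) - 1 < aff_dim P"
    proof -
      have "aff_dim (insert (x0 + \<nu>) ?E) = aff_dim ?E + 1" using out by (simp add: aff_dim_insert)
      moreover have "aff_dim (insert (x0 + \<nu>) ?E) \<le> aff_dim P" using EP xP by (intro aff_dim_subset) auto
      ultimately show ?thesis using d1 by simp
    qed
    then have "aff_dim P = int (DIM(real^'n))" using aff_dim_le_DIM[of P] by simp
    then show ?thesis by (rule aff_dim_eq_full[THEN iffD1])
  qed
  then have "interior P \<noteq> {}" using \<open>convex P\<close> rel_interior_interior[of P] rel_interior_eq_empty[of P] by auto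
  then have "\<not> negligible P" using negligible_convex_interior[OF \<open>convex P\<close>] by blast
  moreover have "P \<in> lmeasurable" using measurable_convex[OF \<open>convex P\<close> \<open>bounded P\<close>] .
  ultimately have "0 < measure lebesgue P" by (simp add: negligible_iff_measure zero_less_measure_iff)
  then show ?thesis unfolding facet_measure_def Let_def \<nu>(1)[symmetric] P_def .
qed

section \<open>Elementwise quantities and step functions\<close>

context labelled_mesh
begin

abbreviation vol :: "(real^'n) set \<Rightarrow> real" where "vol T \<equiv> measure lebesgue T"

definition diam :: "(real^'n) set \<Rightarrow> real" where "diam T = diameter (closure T)"

text \<open>On a boundary facet \<open>Tm E\<close> is empty, and no element receives -1 because the
  empty set is not in the mesh.\<close>

definition sgn_label :: "(real^'n) set \<Rightarrow> (real^'n) set \<Rightarrow> real" where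
  "sgn_label E T = (if T = Tp E then 1 else if T = Tm E then -1 else 0)"

text \<open>This is \<open>div \<psi>\<^sub>E\<close> without the factor \<open>|E|\<close>.\<close>

definition flux_div :: "(real^'n) set \<Rightarrow> real^'n \<Rightarrow> real" where
  "flux_div E x = (\<Sum>T\<in>\<T>. (sgn_label E T / vol T) * indicat_real T x)"

lemma empty_notin_mesh: "{} \<notin> \<T>" using element_nonempty by blast

lemma labels:
  assumes "E \<in> facets \<T>"
  shows "{T \<in> \<T>. open_facet_of E T} = {Tp E, Tm E} \<inter> \<T>" "Tp E \<in> \<T>" "Tp E \<noteq> Tm E" "Tm E \<in> \<T> \<or> Tm E = {}"
    "Tm E = {} \<longleftrightarrow> E \<subseteq> frontier \<Omega>"
proof -
  have *: "if E \<subseteq> frontier \<Omega> then {T \<in> \<T>. open_facet_of E T} = {Tp E} \<and> Tm E = {}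
        else {T \<in> \<T>. open_facet_of E T} = {Tp E, Tm E} \<and> Tp E \<noteq> Tm E \<and> closure (Tp E) \<inter> closure (Tm E) = closure E"
    using labelling assms unfolding facet_labelling_def by blast
  have "{T \<in> \<T>. open_facet_of E T} = {Tp E, Tm E} \<inter> \<T> \<and> Tp E \<in> \<T> \<and> Tp E \<noteq> Tm E \<and> (Tm E \<in> \<T> \<or> Tm E = {}) \<and> (Tm E = {} \<longleftrightarrow> E \<subseteq> frontier \<Omega>)"
  proof (cases "E \<subseteq> frontier \<Omega>")
    case True
    then have 1: "{T \<in> \<T>. open_facet_of E T} = {Tp E}" "Tm E = {}" using * by auto
    then have "Tp E \<in> \<T>" by blast
    then show ?thesis using 1 empty_notin_mesh True by auto
  next
    case False
    then have 1: "{T \<in> \<T>. open_facet_of E T} = {Tp E, Tm E}" "Tp E \<noteq> Tm E" using * by auto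
    then have "Tp E \<in> \<T>" "Tm E \<in> \<T>" by blast+
    then show ?thesis using 1 empty_notin_mesh False by auto
  qed
  then show "{T \<in> \<T>. open_facet_of E T} = {Tp E, Tm E} \<inter> \<T>" "Tp E \<in> \<T>" "Tp E \<noteq> Tm E" "Tm E \<in> \<T> \<or> Tm E = {}"
    "Tm E = {} \<longleftrightarrow> E \<subseteq> frontier \<Omega>" by auto
qed

lemma sgn_label_nz: "E \<in> facets \<T> \<Longrightarrow> T \<in> \<T> \<Longrightarrow> sgn_label E T \<noteq> 0 \<longleftrightarrow> open_facet_of E T"
  using labels(1)[of E] unfolding sgn_label_def by auto

lemma sgn_label_abs: "\<bar>sgn_label E T\<bar> = (if sgn_label E T \<noteq> 0 then 1 else 0)"
  by (simp add: sgn_label_def)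

lemma sum_sgn_label:
  assumes "E \<in> facets \<T>"
  shows "(\<Sum>T\<in>\<T>. sgn_label E T * f T) = f (Tp E) - (if Tm E \<in> \<T> then f (Tm E) else 0)"
proof -
  have "(\<Sum>T\<in>\<T>. sgn_label E T * f T) = (\<Sum>T\<in>{Tp E, Tm E} \<inter> \<T>. sgn_label E T * f T)"
    by (rule sum.mono_neutral_right) (auto simp: finite_mesh sgn_label_def)
  also have "\<dots> = f (Tp E) - (if Tm E \<in> \<T> then f (Tm E) else 0)"
    using labels(2,3)[OF assms] by (auto simp: sgn_label_def Int_insert_left)
  finally show ?thesis .
qed

lemma vol_pos: "T \<in> \<T> \<Longrightarrow> 0 < vol T"
  using measure_simplex_pos[OF element(1)] element(3) by metis

lemma bounded_element: "T \<in> \<T> \<Longrightarrow> bounded T"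
  using bounded_subset[OF bounded_domain element_subset] .

lemma diam_shape:
  assumes "T \<in> \<T>"
  shows "diam T = diameter (convex hull (vertices T))"
    "diam T ^ CARD('n) \<le> \<gamma> * measure lebesgue (interior (convex hull (vertices T)))"
proof -
  show "diam T = diameter (convex hull (vertices T))" by (simp add: diam_def element(2)[OF assms])
  have "diameter T ^ CARD('n) / vol T \<le> \<gamma>" using shape assms by (simp add: shape_regular_def)
  moreover have "diam T = diameter T" unfolding diam_def using diameter_closure[OF bounded_element[OF assms]] .
  ultimately have "diam T ^ CARD('n) \<le> \<gamma> * vol T" using vol_pos[OF assms] by (simp add: field_simps)
  then show "diam T ^ CARD('n) \<le> \<gamma> * measure lebesgue (interior (convex hull (vertices T)))"
    using element(3)[OF assms] by simp
qed

lemma diam_pos: "T \<in> \<T> \<Longrightarrow> 0 < diam T"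
  using simplex_diameter_pos[OF element(1) diam_shape] .

lemma dist_le_diam: "T \<in> \<T> \<Longrightarrow> x \<in> closure T \<Longrightarrow> y \<in> closure T \<Longrightarrow> dist x y \<le> diam T"
  using simplex_dist_le[OF element(1) diam_shape] element(2) by metis

definition weight :: "(real^'n) set \<Rightarrow> real" where "weight T = (diam T)\<^sup>2 / vol T"

text \<open>The square of d_E in the overview: the label is nonzero exactly for the elements at
  \<open>E\<close>.\<close>

definition facet_weight :: "(real^'n) set \<Rightarrow> real" where
  "facet_weight E = (\<Sum>T\<in>\<T>. \<bar>sgn_label E T\<bar> * weight T)"

lemma weight_pos: "T \<in> \<T> \<Longrightarrow> 0 < weight T"
  using vol_pos[of T] diam_pos[of T] unfolding weight_def by (intro divide_pos_pos zero_less_power) auto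

lemma facet_weight_pos:
  assumes "E \<in> facets \<T>" shows "0 < facet_weight E"
  unfolding facet_weight_def
proof (rule sum_pos2[OF finite_mesh labels(2)[OF assms]])
  show "0 < \<bar>sgn_label E (Tp E)\<bar> * weight (Tp E)" using weight_pos[OF labels(2)[OF assms]] by (simp add: sgn_label_def)
qed (auto simp: less_imp_le[OF weight_pos])

lemma rt_div_eq:
  assumes E: "E \<in> facets \<T>"
  shows "rt_div \<T> Tp Tm E = (\<lambda>x. facet_measure E * flux_div E x)"
proof
  fix x
  have fd: "flux_div E x = indicat_real (Tp E) x / vol (Tp E) - (if Tm E \<in> \<T> then indicat_real (Tm E) x / vol (Tm E) else 0)"
    unfolding flux_div_def using sum_sgn_label[OF E, of "\<lambda>T. indicat_real T x / vol T"] by (simp add: field_simps)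
  have disj: "T \<in> \<T> \<Longrightarrow> T' \<in> \<T> \<Longrightarrow> y \<in> T \<Longrightarrow> y \<in> T' \<Longrightarrow> T = T'" for T T' y using mesh_disjoint by blast
  show "rt_div \<T> Tp Tm E x = facet_measure E * flux_div E x"
  proof (cases "x \<in> \<Union>\<T>")
    case False
    then have "x \<notin> Tp E" "Tm E \<in> \<T> \<Longrightarrow> x \<notin> Tm E" using labels(2)[OF E] by auto
    then show ?thesis using False by (simp add: rt_div_def fd)
  next
    case True
    then obtain T where T: "T \<in> \<T>" "x \<in> T" by blast
    have n: "real CARD('n) > 0" by simp
    have rd: "rt_div \<T> Tp Tm E x = divergence (rt Tp Tm E) x" using True by (simp add: rt_div_def)
    consider "T = Tp E" | "T = Tm E" "T \<noteq> Tp E" | "T \<noteq> Tp E" "T \<noteq> Tm E" by blast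
    then show ?thesis
    proof cases
      case 1
      have "divergence (rt Tp Tm E) x = CARD('n) * (facet_measure E / (real CARD('n) * vol (Tp E)))"
        using divergence_affine[OF element_open[OF T(1)] T(2), of "rt Tp Tm E" "facet_measure E / (real CARD('n) * vol (Tp E))" "opposite_vertex (Tp E) E"]
        by (simp add: rt_def 1)
      moreover have "Tm E \<in> \<T> \<Longrightarrow> x \<notin> Tm E" using disj[OF T(1) _ T(2)] labels(3)[OF E] 1 by auto
      ultimately show ?thesis using T 1 by (simp add: rd fd)
    next
      case 2
      have out: "y \<notin> Tp E" if "y \<in> T" for y using disj[OF T(1) labels(2)[OF E] that] 2 by blast
      have "divergence (rt Tp Tm E) x = CARD('n) * (- (facet_measure E / (real CARD('n) * vol (Tm E))))"
        using divergence_affine[OF element_open[OF T(1)] T(2), of "rt Tp Tm E" "- (facet_measure E / (real CARD('n) * vol (Tm E)))" "opposite_vertex (Tm E) E"] out 2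
        by (simp add: rt_def)
      then show ?thesis using T 2 out[OF T(2)] by (simp add: rd fd)
    next
      case 3
      have out: "y \<notin> Tp E" "y \<notin> Tm E" if "y \<in> T" for y
        using disj[OF T(1) labels(2)[OF E] that] disj[OF T(1) _ that, of "Tm E"] labels(4)[OF E] 3 by auto
      have "divergence (rt Tp Tm E) x = CARD('n) * 0"
        using divergence_affine[OF element_open[OF T(1)] T(2), of "rt Tp Tm E" 0 0] out by (simp add: rt_def)
      then show ?thesis using out[OF T(2)] by (simp add: rd fd)
    qed
  qed
qed

text \<open>The divergence of the Raviart-Thomas function is the facet measure times
  \<open>flux_div\<close>, and a positive factor leaves the span unchanged.\<close>

lemma X_space_eq:
  assumes E: "E \<in> facets \<T>"
  shows "X_space \<T> Tp Tm E = {\<lambda>x. c * flux_div E x | c. True}"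
proof -
  obtain T p where T: "T \<in> \<T>" "p \<in> vertices T" "E = facet T p" by (rule facetsE[OF E])
  then have f: "0 < facet_measure E" using facet_measure_pos[OF element(1)[OF T(1)] T(2) dim] by (simp add: facet_def)
  show ?thesis unfolding X_space_def rt_div_eq[OF E]
  proof (intro equalityI subsetI; clarify)
    fix c
    show "\<exists>c'. (\<lambda>x. c * (facet_measure E * flux_div E x)) = (\<lambda>x. c' * flux_div E x) \<and> True"
      by (intro exI[of _ "c * facet_measure E"]) (simp add: mult.assoc)
    show "\<exists>c'. (\<lambda>x. c * flux_div E x) = (\<lambda>x. c' * (facet_measure E * flux_div E x)) \<and> True"
      using f by (intro exI[of _ "c / facet_measure E"]) simp
  qed
qed

definition elint :: "(real^'n) set \<Rightarrow> (real^'n \<Rightarrow> real) \<Rightarrow> real" where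
  "elint T f = integral\<^sup>L lborel (\<lambda>x. indicat_real T x * f x)"

definition step :: "((real^'n) set \<Rightarrow> real) \<Rightarrow> real^'n \<Rightarrow> real" where
  "step g x = (\<Sum>T\<in>\<T>. g T * indicat_real T x)"

lemma element_integral:
  assumes T: "T \<in> \<T>" and f: "continuous_on UNIV f"
  shows "integrable (lebesgue_on \<Omega>) (\<lambda>x. indicat_real T x * f x)"
    "integral\<^sup>L (lebesgue_on \<Omega>) (\<lambda>x. indicat_real T x * f x) = elint T f"
proof -
  have o: "open T" by (rule element_open[OF T])
  have i: "integrable lborel (\<lambda>x. indicat_real T x * f x)"
    using o by (intro integrable_indicator_continuous bounded_element[OF T] f) auto
  then have m: "(\<lambda>x. indicat_real T x * f x) \<in> borel_measurable lborel" by (rule borel_measurable_integrable)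
  have e: "(\<lambda>x. indicat_real \<Omega> x *\<^sub>R (indicat_real T x * f x)) = (\<lambda>x. indicat_real T x * f x)"
    using element_subset[OF T] by (auto simp: indicator_def fun_eq_iff)
  show "integrable (lebesgue_on \<Omega>) (\<lambda>x. indicat_real T x * f x)"
    using open_domain i integrable_completion[OF m] by (subst integrable_restrict_space) (auto simp: e[simplified])
  have "integral\<^sup>L (lebesgue_on \<Omega>) (\<lambda>x. indicat_real T x * f x) = integral\<^sup>L lebesgue (\<lambda>x. indicat_real \<Omega> x *\<^sub>R (indicat_real T x * f x))"
    using open_domain by (subst integral_restrict_space) auto
  also have "\<dots> = elint T f" unfolding e elint_def by (rule integral_completion[OF m])
  finally show "integral\<^sup>L (lebesgue_on \<Omega>) (\<lambda>x. indicat_real T x * f x) = elint T f" .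
qed

lemma element_L2:
  fixes f :: "real^'n \<Rightarrow> 'b::euclidean_space"
  assumes T: "T \<in> \<T>" and f: "continuous_on UNIV f"
  shows "(\<lambda>x. indicat_real T x *\<^sub>R f x) \<in> L2 \<Omega>"
proof -
  have "(\<lambda>x. indicat_real T x *\<^sub>R f x) \<in> borel_measurable lborel"
    using element_open[OF T] borel_measurable_continuous_onI[OF f] by simp
  then have "(\<lambda>x. indicat_real T x *\<^sub>R f x) \<in> borel_measurable lebesgue" by (rule measurable_completion)
  then have "(\<lambda>x. indicat_real T x *\<^sub>R f x) \<in> borel_measurable (lebesgue_on \<Omega>)" by (rule measurable_restrict_space1)
  moreover have "continuous_on UNIV (\<lambda>x. (norm (f x))\<^sup>2)" by (intro continuous_intros f)
  then have "integrable (lebesgue_on \<Omega>) (\<lambda>x. indicat_real T x * (norm (f x))\<^sup>2)" by (rule element_integral(1)[OF T])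
  moreover have "(\<lambda>x. indicat_real T x * (norm (f x))\<^sup>2) = (\<lambda>x. (norm (indicat_real T x *\<^sub>R f x))\<^sup>2)"
    by (auto simp: indicator_def fun_eq_iff)
  ultimately show ?thesis unfolding L2_def by auto
qed

lemma L2_inner_element:
  fixes f g :: "real^'n \<Rightarrow> 'b::euclidean_space"
  assumes T: "T \<in> \<T>" and f: "continuous_on UNIV f" and g: "continuous_on UNIV g"
  shows "L2_inner \<Omega> (\<lambda>x. indicat_real T x *\<^sub>R f x) (\<lambda>x. indicat_real T x *\<^sub>R g x) = elint T (\<lambda>x. f x \<bullet> g x)"
proof -
  have "(\<lambda>x. (indicat_real T x *\<^sub>R f x) \<bullet> (indicat_real T x *\<^sub>R g x)) = (\<lambda>x. indicat_real T x * (f x \<bullet> g x))"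
    by (auto simp: indicator_def fun_eq_iff)
  moreover have "continuous_on UNIV (\<lambda>x. f x \<bullet> g x)" by (intro continuous_intros f g)
  ultimately show ?thesis unfolding L2_inner_def using element_integral(2)[OF T] by simp
qed

lemma L2_sum:
  assumes "finite A" "\<And>a. a \<in> A \<Longrightarrow> f a \<in> L2 \<Omega>" shows "(\<lambda>x. \<Sum>a\<in>A. f a x) \<in> L2 \<Omega>"
  using assms
proof (induction A rule: finite_induct)
  case empty
  have "cc (\<lambda>x::real^'n. 0::'b::euclidean_space)" by (auto simp: cc_def intro!: exI[of _ "{}"])
  then show ?case using cc_L2[OF _ open_domain] by simp
next
  case (insert a A)
  then have "(\<lambda>x. 1 *\<^sub>R f a x + 1 *\<^sub>R (\<Sum>a\<in>A. f a x)) \<in> L2 \<Omega>" by (intro L2_lin) auto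
  then show ?case using insert by simp
qed

lemma step_L2: "step g \<in> L2 \<Omega>"
proof -
  have "(\<lambda>x. \<Sum>T\<in>\<T>. indicat_real T x *\<^sub>R g T) \<in> L2 \<Omega>"
    by (intro L2_sum finite_mesh element_L2 continuous_intros)
  moreover have "(\<lambda>x. \<Sum>T\<in>\<T>. indicat_real T x *\<^sub>R g T) = step g" by (simp add: step_def fun_eq_iff mult.commute)
  ultimately show ?thesis by simp
qed

lemma L2_inner_step:
  assumes w: "continuous_on UNIV w"
  shows "L2_inner \<Omega> (step g) w = (\<Sum>T\<in>\<T>. g T * elint T w)"
proof -
  have "L2_inner \<Omega> (step g) w = integral\<^sup>L (lebesgue_on \<Omega>) (\<lambda>x. \<Sum>T\<in>\<T>. g T * (indicat_real T x * w x))"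
    unfolding L2_inner_def step_def by (simp add: sum_distrib_right mult.assoc)
  also have "\<dots> = (\<Sum>T\<in>\<T>. integral\<^sup>L (lebesgue_on \<Omega>) (\<lambda>x. g T * (indicat_real T x * w x)))"
    using element_integral(1)[OF _ w] by (intro Bochner_Integration.integral_sum integrable_mult_right) auto
  also have "\<dots> = (\<Sum>T\<in>\<T>. g T * elint T w)"
    using element_integral(2)[OF _ w] by (intro sum.cong) auto
  finally show ?thesis .
qed

lemma step_at: "T \<in> \<T> \<Longrightarrow> x \<in> T \<Longrightarrow> step g x = g T"
proof -
  assume T: "T \<in> \<T>" "x \<in> T"
  have "step g x = (\<Sum>S\<in>{T}. g S * indicat_real S x)" unfolding step_def
    using T mesh_disjoint[OF T(1)] finite_mesh by (intro sum.mono_neutral_right) (auto simp: indicator_def)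
  then show ?thesis using T by simp
qed

lemma step_outside: "x \<notin> \<Union>\<T> \<Longrightarrow> step g x = 0"
  unfolding step_def by (auto intro!: sum.neutral simp: indicator_def)

lemma P0_step:
  assumes "\<phi> \<in> P0 \<T>"
  obtains g where "\<phi> = step g"
proof -
  obtain g where g: "\<And>T x. T \<in> \<T> \<Longrightarrow> x \<in> T \<Longrightarrow> \<phi> x = g T"
    using bchoice[of \<T> "\<lambda>T c. \<forall>x\<in>T. \<phi> x = c"] assms unfolding P0_def by auto
  have "\<phi> x = step g x" for x
  proof (cases "x \<in> \<Union>\<T>")
    case True then show ?thesis using g step_at by auto
  next
    case False then show ?thesis using assms step_outside unfolding P0_def by auto
  qed
  then show thesis using that by blast
qed

lemma flux_div_step: "flux_div E = step (\<lambda>T. sgn_label E T / vol T)"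
  by (simp add: fun_eq_iff flux_div_def step_def)

lemma flux_comb_step: "(\<lambda>x. \<Sum>E\<in>\<F>. c E * flux_div E x) = step (\<lambda>T. (\<Sum>E\<in>\<F>. c E * sgn_label E T) / vol T)"
proof
  fix x
  have "(\<Sum>E\<in>\<F>. c E * flux_div E x) = (\<Sum>E\<in>\<F>. \<Sum>T\<in>\<T>. c E * sgn_label E T / vol T * indicat_real T x)"
    by (simp add: flux_div_def sum_distrib_left mult_ac)
  also have "\<dots> = (\<Sum>T\<in>\<T>. \<Sum>E\<in>\<F>. c E * sgn_label E T / vol T * indicat_real T x)" by (rule sum.swap)
  finally show "(\<Sum>E\<in>\<F>. c E * flux_div E x) = step (\<lambda>T. (\<Sum>E\<in>\<F>. c E * sgn_label E T) / vol T) x"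
    by (simp add: step_def sum_distrib_right sum_divide_distrib)
qed

definition opposite :: "(real^'n) set \<Rightarrow> (real^'n) set \<Rightarrow> real^'n" where
  "opposite E T = (SOME p. p \<in> vertices T \<and> E = facet T p)"

lemma opposite:
  assumes "E \<in> facets \<T>" "T \<in> \<T>" "sgn_label E T \<noteq> 0"
  shows "opposite E T \<in> vertices T" "E = facet T (opposite E T)"
proof -
  have "\<exists>p. p \<in> vertices T \<and> E = facet T p" using sgn_label_nz[OF assms(1,2)] assms(3) open_facet_iff[OF assms(2)] by blast
  from someI_ex[OF this] show "opposite E T \<in> vertices T" "E = facet T (opposite E T)" unfolding opposite_def by auto
qed

lemma trace_functional_element:
  "T \<in> \<T> \<Longrightarrow> trace_functional (vertices T) p w = (CARD('n) * elint T w + elint T (\<lambda>x. (x - p) \<bullet> grad w x)) / vol T"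
  by (simp only: trace_functional_def elint_def element(3)[symmetric])

text \<open>The weak form of \<open>div \<psi>\<^sub>E\<close>: fluxes through the common facet cancel.\<close>

lemma flux_cancel:
  assumes E: "E \<in> facets \<T>" and w: "w \<in> test_functions \<Omega>"
  shows "(\<Sum>T\<in>\<T>. sgn_label E T * trace_functional (vertices T) (opposite E T) w) = 0"
proof -
  obtain L where L: "L-lipschitz_on UNIV w" by (rule test_function_lipschitz[OF w])
  note wd = test_functionsD(2)[OF w] and wg = continuous_grad[OF w, of UNIV]
  let ?P = "Tp E" and ?M = "Tm E"
  have P: "?P \<in> \<T>" "sgn_label E ?P \<noteq> 0" using labels(2)[OF E] by (auto simp: sgn_label_def)
  define p where "p = opposite E ?P"
  have p: "p \<in> vertices ?P" "E = facet ?P p" using opposite[OF E P] by (auto simp: p_def)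
  have iP: "insert p (vertices ?P - {p}) = vertices ?P" using p(1) by blast
  show ?thesis
  proof (cases "?M \<in> \<T>")
    case True
    have M: "?M \<in> \<T>" "sgn_label E ?M \<noteq> 0" using True labels(3)[OF E] by (auto simp: sgn_label_def)
    define q where "q = opposite E ?M"
    have q: "q \<in> vertices ?M" "E = facet ?M q" using opposite[OF E M] by (auto simp: q_def)
    have eq: "vertices ?P - {p} = vertices ?M - {q}" using facet_eq_imp[OF P(1) M(1)] p(2) q(2) by metis
    have iM: "insert q (vertices ?P - {p}) = vertices ?M" using q(1) eq by blast
    have "trace_functional (insert q (vertices ?P - {p})) q w = trace_functional (insert p (vertices ?P - {p})) p w"
    proof (rule trace_functional_eq[OF _ _ _ _ L wd wg])
      show "simplex_vertices (insert p (vertices ?P - {p}))" unfolding iP by (rule element(1)[OF P(1)])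
      show "simplex_vertices (insert q (vertices ?P - {p}))" unfolding iM by (rule element(1)[OF M(1)])
      show "q \<notin> vertices ?P - {p}" unfolding eq by simp
    qed simp
    then have "trace_functional (vertices ?M) q w = trace_functional (vertices ?P) p w" by (simp only: iP iM)
    then show ?thesis using True unfolding sum_sgn_label[OF E] by (simp add: p_def q_def)
  next
    case False
    then have "E \<subseteq> frontier \<Omega>" using labels(4,5)[OF E] by auto
    then have "closure E \<subseteq> frontier \<Omega>" by (simp add: closure_minimal frontier_closed)
    then have F: "convex hull (vertices ?P - {p}) \<subseteq> frontier \<Omega>" using closure_facet[OF P(1), of p] p(2) by simp
    have "trace_functional (insert p (vertices ?P - {p})) p w = 0"
    proof (rule trace_functional_zero[OF _ _ L wd wg])
      show "simplex_vertices (insert p (vertices ?P - {p}))" using element(1)[OF P(1)] by (simp only: iP)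
      fix x assume "x \<in> convex hull (vertices ?P - {p})"
      then have "x \<notin> \<Omega>" using F open_domain by (auto simp: frontier_def interior_open)
      then show "w x = 0" by (rule test_functionsD(7)[OF w])
    qed auto
    then have "trace_functional (vertices ?P) p w = 0" by (simp only: iP)
    then show ?thesis using False unfolding sum_sgn_label[OF E] by (simp add: p_def)
  qed
qed

section \<open>Upper bound for combinations of fluxes\<close>

definition local_energy :: "(real^'n \<Rightarrow> real) \<Rightarrow> (real^'n) set \<Rightarrow> real" where
  "local_energy w T = L2_norm \<Omega> (\<lambda>x. indicat_real T x *\<^sub>R grad w x)"

lemma elint_1: "T \<in> \<T> \<Longrightarrow> elint T (\<lambda>x. c) = c * vol T"
  unfolding elint_def using integral_indicator_lborel[of T] element_open by simp

lemma elint_mono: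
  assumes "T \<in> \<T>" "continuous_on UNIV f" "continuous_on UNIV g" "\<And>x. x \<in> T \<Longrightarrow> f x \<le> g x"
  shows "elint T f \<le> elint T g"
  unfolding elint_def
  by (intro integral_mono integrable_indicator_continuous bounded_element assms(1-3))
    (use element_open[OF assms(1)] assms(4) in \<open>auto simp: indicator_def\<close>)

lemma flux_term_le:
  assumes T: "T \<in> \<T>" and p: "p \<in> vertices T" and w: "w \<in> test_functions \<Omega>"
  shows "\<bar>elint T (\<lambda>x. (x - p) \<bullet> grad w x)\<bar> \<le> diam T * sqrt (vol T) * local_energy w T"
proof -
  let ?u = "\<lambda>x. indicat_real T x *\<^sub>R (x - p)" and ?v = "\<lambda>x. indicat_real T x *\<^sub>R grad w x"
  have c: "continuous_on UNIV (\<lambda>x. x - p)" by (intro continuous_intros)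
  have g: "continuous_on UNIV (grad w)" by (rule continuous_grad[OF w])
  have "\<bar>L2_inner \<Omega> ?u ?v\<bar> \<le> L2_norm \<Omega> ?u * L2_norm \<Omega> ?v"
    by (intro L2_Cauchy_Schwarz element_L2 T c g)
  moreover have "L2_norm \<Omega> ?u \<le> diam T * sqrt (vol T)"
  proof -
    have pc: "p \<in> closure T" using p element(2)[OF T] by (simp add: hull_inc)
    have "L2_inner \<Omega> ?u ?u = elint T (\<lambda>x. (x - p) \<bullet> (x - p))" by (rule L2_inner_element[OF T c c])
    also have "\<dots> \<le> elint T (\<lambda>x. (diam T)\<^sup>2)"
    proof (rule elint_mono[OF T])
      show "(x - p) \<bullet> (x - p) \<le> (diam T)\<^sup>2" if "x \<in> T" for x
        using dist_le_diam[OF T _ pc, of x] that closure_subset[of T]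
        by (auto simp: dist_norm power_mono simp flip: power2_norm_eq_inner)
    qed (intro continuous_intros)+
    also have "\<dots> = (diam T)\<^sup>2 * vol T" by (rule elint_1[OF T])
    finally have "L2_norm \<Omega> ?u \<le> sqrt ((diam T)\<^sup>2 * vol T)" unfolding L2_norm_def by (rule real_sqrt_le_mono)
    also have "\<dots> = diam T * sqrt (vol T)" using diam_pos[OF T] by (simp add: real_sqrt_mult)
    finally show ?thesis .
  qed
  then have "L2_norm \<Omega> ?u * L2_norm \<Omega> ?v \<le> diam T * sqrt (vol T) * L2_norm \<Omega> ?v"
    by (rule mult_right_mono) (rule L2_norm_ge_0)
  ultimately show ?thesis unfolding local_energy_def L2_inner_element[OF T c g] by linarith
qed

lemma sum_local_energy:
  assumes w: "w \<in> test_functions \<Omega>"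
  shows "(\<Sum>T\<in>\<T>. (local_energy w T)\<^sup>2) \<le> (L2_norm \<Omega> (grad w))\<^sup>2"
proof -
  have g: "continuous_on UNIV (grad w)" by (rule continuous_grad[OF w])
  have gg: "continuous_on UNIV (\<lambda>x. grad w x \<bullet> grad w x)" by (intro continuous_intros g)
  have gL: "grad w \<in> L2 \<Omega>" by (rule cc_L2[OF cc_test(3)[OF w] open_domain])
  have "(\<Sum>T\<in>\<T>. (local_energy w T)\<^sup>2) = (\<Sum>T\<in>\<T>. integral\<^sup>L (lebesgue_on \<Omega>) (\<lambda>x. indicat_real T x * (grad w x \<bullet> grad w x)))"
    unfolding local_energy_def L2_norm_power2 using L2_inner_element[OF _ g g] element_integral(2)[OF _ gg] by (intro sum.cong) auto
  also have "\<dots> = integral\<^sup>L (lebesgue_on \<Omega>) (\<lambda>x. \<Sum>T\<in>\<T>. indicat_real T x * (grad w x \<bullet> grad w x))"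
    using element_integral(1)[OF _ gg] by (intro Bochner_Integration.integral_sum[symmetric]) auto
  also have "\<dots> \<le> integral\<^sup>L (lebesgue_on \<Omega>) (\<lambda>x. grad w x \<bullet> grad w x)"
  proof (rule integral_mono)
    show "integrable (lebesgue_on \<Omega>) (\<lambda>x. \<Sum>T\<in>\<T>. indicat_real T x * (grad w x \<bullet> grad w x))"
      using element_integral(1)[OF _ gg] by (intro Bochner_Integration.integrable_sum) auto
    show "integrable (lebesgue_on \<Omega>) (\<lambda>x. grad w x \<bullet> grad w x)" by (rule L2_inner_integrable[OF gL gL])
    fix x
    have "step (\<lambda>T. 1) x \<le> 1" using step_at[of _ x "\<lambda>T. 1"] step_outside[of x "\<lambda>T. 1"] by (cases "x \<in> \<Union>\<T>") auto
    from mult_right_mono[OF this inner_ge_zero[of "grad w x"]]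
    show "(\<Sum>T\<in>\<T>. indicat_real T x * (grad w x \<bullet> grad w x)) \<le> grad w x \<bullet> grad w x"
      by (simp add: step_def sum_distrib_right)
  qed
  finally show ?thesis unfolding L2_norm_power2 L2_inner_def .
qed

text \<open>By \<open>flux_cancel\<close>, n times the pairing is minus the signed sum of the
  element means of the derivative of \<open>w\<close> along x - p. Cauchy-Schwarz on each element
  bounds these means, and the factor n on the left is dropped because it is at least 1.\<close>

lemma flux_div_pairing_le:
  assumes E: "E \<in> facets \<T>" and w: "w \<in> test_functions \<Omega>"
  shows "\<bar>L2_inner \<Omega> (flux_div E) w\<bar> \<le> (\<Sum>T\<in>\<T>. \<bar>sgn_label E T\<bar> * sqrt (weight T) * local_energy w T)"
proof -
  let ?n = "real CARD('n)"
  have wc: "continuous_on UNIV w" by (rule test_functionsD(3)[OF w])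
  let ?d = "\<lambda>T. elint T (\<lambda>x. (x - opposite E T) \<bullet> grad w x)"
  have "L2_inner \<Omega> (flux_div E) w = (\<Sum>T\<in>\<T>. sgn_label E T / vol T * elint T w)"
    unfolding flux_div_step by (rule L2_inner_step[OF wc])
  then have "?n * L2_inner \<Omega> (flux_div E) w + (\<Sum>T\<in>\<T>. sgn_label E T / vol T * ?d T) = (\<Sum>T\<in>\<T>. sgn_label E T * trace_functional (vertices T) (opposite E T) w)"
    by (simp add: trace_functional_element sum_distrib_left sum.distrib[symmetric] algebra_simps add_divide_distrib)
  then have e: "?n * L2_inner \<Omega> (flux_div E) w = - (\<Sum>T\<in>\<T>. sgn_label E T / vol T * ?d T)"
    unfolding flux_cancel[OF E w] by linarith
  have "\<bar>L2_inner \<Omega> (flux_div E) w\<bar> \<le> ?n * \<bar>L2_inner \<Omega> (flux_div E) w\<bar>"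
    using dim mult_right_mono[of 1 ?n "\<bar>L2_inner \<Omega> (flux_div E) w\<bar>"] by simp
  also have "\<dots> = \<bar>\<Sum>T\<in>\<T>. sgn_label E T / vol T * ?d T\<bar>"
  proof -
    have "?n * \<bar>L2_inner \<Omega> (flux_div E) w\<bar> = \<bar>?n * L2_inner \<Omega> (flux_div E) w\<bar>" by (simp add: abs_mult)
    then show ?thesis unfolding e by simp
  qed
  also have "\<dots> \<le> (\<Sum>T\<in>\<T>. \<bar>sgn_label E T / vol T * ?d T\<bar>)" by (rule sum_abs)
  also have "\<dots> \<le> (\<Sum>T\<in>\<T>. \<bar>sgn_label E T\<bar> * sqrt (weight T) * local_energy w T)"
  proof (rule sum_mono)
    fix T assume T: "T \<in> \<T>"
    show "\<bar>sgn_label E T / vol T * ?d T\<bar> \<le> \<bar>sgn_label E T\<bar> * sqrt (weight T) * local_energy w T"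
    proof (cases "sgn_label E T = 0")
      case False
      have v: "0 < vol T" by (rule vol_pos[OF T])
      have "\<bar>?d T\<bar> / vol T \<le> (diam T * sqrt (vol T) * local_energy w T) / vol T"
        using flux_term_le[OF T opposite(1)[OF E T False] w] v by (intro divide_right_mono) auto
      also have "\<dots> = sqrt (weight T) * local_energy w T"
        using v diam_pos[OF T] by (simp add: weight_def real_sqrt_divide field_simps)
      finally have "\<bar>?d T\<bar> / vol T \<le> sqrt (weight T) * local_energy w T" .
      then have "\<bar>sgn_label E T\<bar> * (\<bar>?d T\<bar> / vol T) \<le> \<bar>sgn_label E T\<bar> * (sqrt (weight T) * local_energy w T)" by (rule mult_left_mono) simp
      then show ?thesis using v by (simp add: abs_mult mult.assoc)
    qed simp
  qed
  finally show ?thesis .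
qed

lemma card_facets_of_element:
  assumes "T \<in> \<T>" shows "(\<Sum>E\<in>facets \<T>. \<bar>sgn_label E T\<bar>) \<le> CARD('n) + 1"
proof -
  let ?A = "{E \<in> facets \<T>. sgn_label E T \<noteq> 0}"
  have "(\<Sum>E\<in>facets \<T>. \<bar>sgn_label E T\<bar>) = (\<Sum>E\<in>?A. 1)"
    using finite_facets by (intro sum.mono_neutral_cong_right) (auto simp: sgn_label_abs)
  also have "\<dots> = card ?A" by simp
  also have "?A \<subseteq> facet T ` vertices T" using sgn_label_nz[OF _ assms] open_facet_iff[OF assms] by auto
  then have "card ?A \<le> card (vertices T)" using finite_vertices[OF assms] by (meson card_image_le card_mono finite_imageI le_trans)
  finally show ?thesis using card_vertices[OF assms] by simp
qed

text \<open>Cauchy-Schwarz over all pairs of a facet and an element: the coefficients collect the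
  facet weights, and each element energy is counted once per facet, at most n+1 times. Treating the
  facets one at a time would lose a factor growing with the mesh.\<close>

lemma flux_comb_pairing_le:
  assumes w: "w \<in> test_functions \<Omega>"
  shows "L2_inner \<Omega> (\<lambda>x. \<Sum>E\<in>facets \<T>. c E * flux_div E x) w
     \<le> sqrt ((CARD('n) + 1) * (\<Sum>E\<in>facets \<T>. (c E)\<^sup>2 * facet_weight E)) * L2_norm \<Omega> (grad w)"
proof -
  have wc: "continuous_on UNIV w" by (rule test_functionsD(3)[OF w])
  have fin: "finite (facets \<T> \<times> \<T>)" using finite_facets finite_mesh by simp
  have "L2_inner \<Omega> (\<lambda>x. \<Sum>E\<in>facets \<T>. c E * flux_div E x) w = (\<Sum>E\<in>facets \<T>. c E * L2_inner \<Omega> (flux_div E) w)"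
  proof -
    have "(\<Sum>E\<in>facets \<T>. c E * L2_inner \<Omega> (flux_div E) w) = (\<Sum>E\<in>facets \<T>. \<Sum>T\<in>\<T>. c E * sgn_label E T / vol T * elint T w)"
      unfolding flux_div_step L2_inner_step[OF wc] sum_distrib_left by (simp add: mult_ac)
    also have "\<dots> = (\<Sum>T\<in>\<T>. (\<Sum>E\<in>facets \<T>. c E * sgn_label E T) / vol T * elint T w)"
      by (subst sum.swap) (simp add: sum_distrib_right sum_divide_distrib)
    finally show ?thesis unfolding flux_comb_step L2_inner_step[OF wc] by simp
  qed
  also have "\<dots> \<le> (\<Sum>E\<in>facets \<T>. \<bar>c E\<bar> * \<bar>L2_inner \<Omega> (flux_div E) w\<bar>)"
    by (intro sum_mono) (metis abs_ge_self abs_mult)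
  also have "\<dots> \<le> (\<Sum>E\<in>facets \<T>. \<bar>c E\<bar> * (\<Sum>T\<in>\<T>. \<bar>sgn_label E T\<bar> * sqrt (weight T) * local_energy w T))"
    by (intro sum_mono mult_left_mono flux_div_pairing_le w) auto
  \<comment> \<open>The modulus of \<open>sgn_label\<close> is 0 or 1, so it may be put into both
    factors.\<close>
  also have "\<dots> = (\<Sum>(E,T)\<in>facets \<T> \<times> \<T>. (\<bar>c E\<bar> * \<bar>sgn_label E T\<bar> * sqrt (weight T)) * (\<bar>sgn_label E T\<bar> * local_energy w T))"
    unfolding sum.cartesian_product[symmetric] sum_distrib_left by (intro sum.cong) (auto simp: sgn_label_abs)
  also have "\<dots> = (\<Sum>z\<in>facets \<T> \<times> \<T>. (\<bar>c (fst z)\<bar> * \<bar>sgn_label (fst z) (snd z)\<bar> * sqrt (weight (snd z))) * (\<bar>sgn_label (fst z) (snd z)\<bar> * local_energy w (snd z)))"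
    by (simp add: split_beta)
  also have "\<dots> \<le> sqrt (\<Sum>z\<in>facets \<T> \<times> \<T>. (\<bar>c (fst z)\<bar> * \<bar>sgn_label (fst z) (snd z)\<bar> * sqrt (weight (snd z)))\<^sup>2) * sqrt (\<Sum>z\<in>facets \<T> \<times> \<T>. (\<bar>sgn_label (fst z) (snd z)\<bar> * local_energy w (snd z))\<^sup>2)"
    unfolding real_sqrt_mult[symmetric] by (rule real_le_rsqrt[OF Cauchy_Schwarz_ineq_sum])
  also have "(\<Sum>z\<in>facets \<T> \<times> \<T>. (\<bar>c (fst z)\<bar> * \<bar>sgn_label (fst z) (snd z)\<bar> * sqrt (weight (snd z)))\<^sup>2) = (\<Sum>E\<in>facets \<T>. (c E)\<^sup>2 * facet_weight E)"
    unfolding facet_weight_def sum_distrib_left sum.cartesian_product using less_imp_le[OF weight_pos]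
    by (intro sum.cong) (auto simp: power_mult_distrib sgn_label_abs)
  also have "(\<Sum>z\<in>facets \<T> \<times> \<T>. (\<bar>sgn_label (fst z) (snd z)\<bar> * local_energy w (snd z))\<^sup>2) = (\<Sum>E\<in>facets \<T>. \<Sum>T\<in>\<T>. \<bar>sgn_label E T\<bar> * (local_energy w T)\<^sup>2)"
    unfolding sum.cartesian_product by (intro sum.cong) (auto simp: power_mult_distrib sgn_label_abs)
  also have "\<dots> = (\<Sum>T\<in>\<T>. (\<Sum>E\<in>facets \<T>. \<bar>sgn_label E T\<bar>) * (local_energy w T)\<^sup>2)"
    unfolding sum_distrib_right by (rule sum.swap)
  finally have 1: "L2_inner \<Omega> (\<lambda>x. \<Sum>E\<in>facets \<T>. c E * flux_div E x) w \<le> sqrt (\<Sum>E\<in>facets \<T>. (c E)\<^sup>2 * facet_weight E) * sqrt (\<Sum>T\<in>\<T>. (\<Sum>E\<in>facets \<T>. \<bar>sgn_label E T\<bar>) * (local_energy w T)\<^sup>2)" .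
  have "(\<Sum>T\<in>\<T>. (\<Sum>E\<in>facets \<T>. \<bar>sgn_label E T\<bar>) * (local_energy w T)\<^sup>2) \<le> (\<Sum>T\<in>\<T>. (CARD('n) + 1) * (local_energy w T)\<^sup>2)"
    using card_facets_of_element by (intro sum_mono mult_right_mono) auto
  also have "\<dots> \<le> (CARD('n) + 1) * (L2_norm \<Omega> (grad w))\<^sup>2"
    unfolding sum_distrib_left[symmetric] by (intro mult_left_mono sum_local_energy w) auto
  finally have "sqrt (\<Sum>T\<in>\<T>. (\<Sum>E\<in>facets \<T>. \<bar>sgn_label E T\<bar>) * (local_energy w T)\<^sup>2) \<le> sqrt (CARD('n) + 1) * L2_norm \<Omega> (grad w)"
    using real_sqrt_le_mono L2_norm_ge_0[of \<Omega> "grad w"] by (fastforce simp: real_sqrt_mult)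
  then have "sqrt (\<Sum>E\<in>facets \<T>. (c E)\<^sup>2 * facet_weight E) * sqrt (\<Sum>T\<in>\<T>. (\<Sum>E\<in>facets \<T>. \<bar>sgn_label E T\<bar>) * (local_energy w T)\<^sup>2)
     \<le> sqrt (\<Sum>E\<in>facets \<T>. (c E)\<^sup>2 * facet_weight E) * (sqrt (CARD('n) + 1) * L2_norm \<Omega> (grad w))"
    using less_imp_le[OF facet_weight_pos] by (intro mult_left_mono) (auto intro!: sum_nonneg)
  then show ?thesis using 1 by (simp add: real_sqrt_mult mult_ac)
qed

end

text \<open>Let \<open>t\<close> be the last parameter on the segment from \<open>x\<close> at which
  the estimate from \<open>x\<close> holds. If \<open>t < 1\<close>, each later point close enough
  to \<open>c t\<close> lies in a piece that also contains \<open>c t\<close>, and the bound on this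
  piece carries the estimate further. This avoids subdividing the segment.\<close>

lemma lipschitz_closed_cover:
  fixes f :: "'a::real_normed_vector \<Rightarrow> real"
  assumes \<C>: "finite \<C>" "\<And>C. C \<in> \<C> \<Longrightarrow> closed C" "\<Union>\<C> = UNIV" and f: "\<And>C. C \<in> \<C> \<Longrightarrow> L-lipschitz_on C f" and "0 \<le> L"
  shows "L-lipschitz_on UNIV f"
proof (rule lipschitz_onI)
  fix x y :: 'a
  define c where "c t = x + t *\<^sub>R (y - x)" for t :: real
  have fc: "continuous_on UNIV f"
  proof -
    have "continuous_on (\<Union>C\<in>\<C>. C) f"
      using \<C>(1,2) f by (intro continuous_on_closed_Union) (auto intro: lipschitz_on_continuous_on)
    then show ?thesis using \<C>(3) by simp
  qed
  have dc: "dist (c s) (c t) = \<bar>s - t\<bar> * norm (y - x)" for s t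
  proof -
    have "c s - c t = (s - t) *\<^sub>R (y - x)" by (simp add: c_def algebra_simps)
    then show ?thesis by (simp add: dist_norm)
  qed
  have cc: "continuous_on A c" for A unfolding c_def by (intro continuous_intros)
  define K where "K = L * norm (y - x)"
  have K0: "0 \<le> K" using \<open>0 \<le> L\<close> by (simp add: K_def)
  define S where "S = {t \<in> {0..1}. \<bar>f (c t) - f x\<bar> \<le> K * t}"
  have "closed S"
  proof -
    have "closed ({0..1} \<inter> {t. \<bar>f (c t) - f x\<bar> \<le> K * t})"
      by (intro closed_Int closed_atLeastAtMost closed_Collect_le continuous_intros continuous_on_compose2[OF fc cc]) auto
    moreover have "{0..1} \<inter> {t. \<bar>f (c t) - f x\<bar> \<le> K * t} = S" by (auto simp: S_def)
    ultimately show ?thesis by simp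
  qed
  moreover have "bounded S" by (rule bounded_subset[OF bounded_closed_interval[of 0 1]]) (auto simp: S_def)
  ultimately have "compact S" by (simp add: compact_eq_bounded_closed)
  moreover have "0 \<in> S" by (simp add: S_def c_def)
  ultimately obtain t where t: "t \<in> S" "\<And>s. s \<in> S \<Longrightarrow> s \<le> t" using compact_attains_sup[of S] by blast
  have "t = 1"
  proof (rule ccontr)
    assume "t \<noteq> 1"
    then have t01: "0 \<le> t" "t < 1" using t(1) by (auto simp: S_def)
    \<comment> \<open>The pieces that miss \<open>c t\<close> are finitely many and closed, so they
      stay away from it.\<close>
    have "closed (\<Union>{C \<in> \<C>. c t \<notin> C})" using \<C> by (intro closed_Union) auto
    then have "open (- \<Union>{C \<in> \<C>. c t \<notin> C})" "c t \<in> - \<Union>{C \<in> \<C>. c t \<notin> C}" by auto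
    moreover have "(c \<longlongrightarrow> c t) (at_right t)" using cc[of UNIV] by (simp add: continuous_on_def filterlim_at_split)
    ultimately have "\<forall>\<^sub>F s in (at_right t). c s \<in> - \<Union>{C \<in> \<C>. c t \<notin> C}" by (intro topological_tendstoD) auto
    moreover have "\<forall>\<^sub>F s in (at_right t). t < s \<and> s < 1" using t01 by (auto simp: eventually_at_right[of t 1] intro: exI[of _ 1])
    ultimately have "\<forall>\<^sub>F s in (at_right t). c s \<in> - \<Union>{C \<in> \<C>. c t \<notin> C} \<and> t < s \<and> s < 1" by (rule eventually_conj)
    then obtain s where s: "c s \<in> - \<Union>{C \<in> \<C>. c t \<notin> C}" "t < s" "s < 1"
      using eventually_happens'[OF trivial_limit_at_right_real[of t]] by blast
    obtain C where C: "C \<in> \<C>" "c s \<in> C" using \<C>(3) by blast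
    then have "c t \<in> C" using s(1) by blast
    then have "\<bar>f (c s) - f (c t)\<bar> \<le> L * (\<bar>s - t\<bar> * norm (y - x))"
      using lipschitz_onD[OF f[OF C(1)] C(2) \<open>c t \<in> C\<close>] by (simp add: dist_real_def dc)
    also have "\<dots> = K * (s - t)" using s by (simp add: K_def)
    finally have "\<bar>f (c s) - f x\<bar> \<le> K * s"
      using t(1) abs_triangle_ineq[of "f (c s) - f (c t)" "f (c t) - f x"] by (simp add: S_def algebra_simps)
    then have "s \<in> S" using s t01 by (simp add: S_def)
    then show False using t(2) s(2) by fastforce
  qed
  then show "dist (f x) (f y) \<le> L * dist x y"
    using t(1) by (simp add: S_def K_def c_def dist_real_def dist_norm norm_minus_commute abs_minus_commute)
qed (rule \<open>0 \<le> L\<close>)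

section \<open>Two-sided bounds for a single flux\<close>

context labelled_mesh
begin

definition shape_factor :: real where "shape_factor = 6 ^ CARD('n) * \<gamma>"

definition bubble_const :: real where "bubble_const = 2 ^ CARD('n) * (2 * (CARD('n) + 1))"

lemma bubble_const_pos: "0 < bubble_const" unfolding bubble_const_def of_nat_0_less_iff by simp

lemma edge_length: "T \<in> \<T> \<Longrightarrow> a \<in> vertices T \<Longrightarrow> b \<in> vertices T \<Longrightarrow> a \<noteq> b \<Longrightarrow> diam T \<le> shape_factor * dist a b"
  unfolding shape_factor_def using simplex_edge_ge[OF element(1) diam_shape] by blast

lemma gamma_pos: "T \<in> \<T> \<Longrightarrow> 0 < \<gamma>"
  using shape_constant_pos[OF element(1) diam_shape] by blast

text \<open>An edge is at most as long as the diameter and at least the diameter divided by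
  \<open>shape_factor\<close>.\<close>

lemma shape_factor_ge_1: assumes "T \<in> \<T>" shows "1 \<le> shape_factor"
proof -
  obtain p where p: "p \<in> vertices T" using card_vertices[OF assms] by (metis card.empty ex_in_conv nat.simps(3))
  obtain q where q: "q \<in> vertices T" "q \<noteq> p" using simplex_two_vertices[OF element(1) diam_shape p] assms by blast
  have d: "diam T \<le> shape_factor * dist p q" using edge_length[OF assms p q(1)] q by blast
  have "dist p q \<le> diam T" using dist_le_diam[OF assms] p q element(2)[OF assms] by (simp add: hull_inc)
  moreover have "0 \<le> shape_factor" using gamma_pos[OF assms] by (simp add: shape_factor_def)
  ultimately have "shape_factor * dist p q \<le> shape_factor * diam T" by (intro mult_left_mono)
  then have "1 * diam T \<le> shape_factor * diam T" using d by simp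
  then show ?thesis using diam_pos[OF assms] by (simp only: mult_le_cancel_right_pos)
qed

lemma bary_lipschitz_element: "T \<in> \<T> \<Longrightarrow> p \<in> vertices T \<Longrightarrow> (shape_factor / diam T)-lipschitz_on A (bary (vertices T) p)"
  unfolding shape_factor_def using bary_lipschitz[OF element(1) diam_shape] by blast

lemma vol_le: "T \<in> \<T> \<Longrightarrow> vol T \<le> (2 * diam T) ^ CARD('n)"
  using simplex_measure_le[OF element(1) diam_shape] element(3) by metis

lemma vol_ge: "T \<in> \<T> \<Longrightarrow> diam T ^ CARD('n) \<le> \<gamma> * vol T"
  using diam_shape(2) element(3) by metis

lemma bubble_element:
  assumes T: "T \<in> \<T>"
  shows "(shape_factor / diam T)-lipschitz_on UNIV (bubble (vertices T))" "x \<notin> T \<Longrightarrow> bubble (vertices T) x = 0"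
    "elint T (bubble (vertices T)) = integral UNIV (bubble (vertices T))"
    "vol T / bubble_const \<le> elint T (bubble (vertices T))"
    "T' \<in> \<T> \<Longrightarrow> T' \<noteq> T \<Longrightarrow> elint T' (bubble (vertices T)) = 0"
proof -
  note V = element(1)[OF T]
  show "(shape_factor / diam T)-lipschitz_on UNIV (bubble (vertices T))" by (rule bubble_lipschitz[OF V bary_lipschitz_element[OF T]])
  show o: "x \<notin> T \<Longrightarrow> bubble (vertices T) x = 0" for x using bubble_outside[OF V] element(3)[OF T] by blast
  have "(\<lambda>x. indicat_real T x * bubble (vertices T) x) = bubble (vertices T)" using o by (auto simp: indicator_def fun_eq_iff)
  then show e: "elint T (bubble (vertices T)) = integral UNIV (bubble (vertices T))"
    unfolding elint_def using cc_lborel(2)[OF cc_bubble[OF V]] by simp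
  show "vol T / bubble_const \<le> elint T (bubble (vertices T))"
    unfolding e bubble_const_def using bubble_integral[OF V] element(3)[OF T] by simp
  assume T': "T' \<in> \<T>" "T' \<noteq> T"
  have "indicat_real T' x * bubble (vertices T) x = 0" for x
    using o[of x] mesh_disjoint[OF T'(1) T T'(2)] by (auto simp: indicator_def)
  then show "elint T' (bubble (vertices T)) = 0" unfolding elint_def by (simp only: integral_zero)
qed

lemma pairing_le_Hm1_piecewise:
  assumes w: "l0-lipschitz_on UNIV w" "\<And>x. x \<notin> \<Omega> \<Longrightarrow> w x = 0" and l: "\<And>T. T \<in> \<T> \<Longrightarrow> (l T)-lipschitz_on T w"
  shows "(\<Sum>T\<in>\<T>. g T * elint T w) \<le> Hm1_norm \<Omega> (step g) * sqrt (\<Sum>T\<in>\<T>. vol T * (l T)\<^sup>2)"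
proof -
  obtain M where M: "0 \<le> M" "\<And>w. w \<in> test_functions \<Omega> \<Longrightarrow> L2_inner \<Omega> (step g) w \<le> M * L2_norm \<Omega> (grad w)"
    by (rule pairing_bound_exists[OF open_domain bounded_domain step_L2]) blast
  have pw: "pairwise disjnt \<T>" using mesh by (simp add: regular_mesh_def)
  have "L2_inner \<Omega> (step g) w \<le> Hm1_norm \<Omega> (step g) * sqrt (\<Sum>T\<in>\<T>. vol T * (l T)\<^sup>2)"
    by (rule pairing_le_lipschitz[OF open_domain bounded_domain domain_nonempty step_L2 M w finite_mesh element_open element_subset pw skeleton_negligible l])
  then show ?thesis unfolding L2_inner_step[OF lipschitz_on_continuous_on[OF w(1)]] .
qed

lemma Hm1_norm_step_ge_0: "0 \<le> Hm1_norm \<Omega> (step g)"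
proof -
  obtain M where M: "0 \<le> M" "\<And>w. w \<in> test_functions \<Omega> \<Longrightarrow> L2_inner \<Omega> (step g) w \<le> M * L2_norm \<Omega> (grad w)"
    by (rule pairing_bound_exists[OF open_domain bounded_domain step_L2]) blast
  obtain y where "y \<in> \<Omega>" using domain_nonempty by blast
  then obtain u x where u: "u \<in> test_functions \<Omega>" "u x \<noteq> 0" by (rule nontrivial_test_function[OF open_domain bounded_domain])
  show ?thesis by (rule Hm1_norm_ge_0[OF open_domain step_L2 M u])
qed

lemma Hm1_norm_flux_comb_le:
  "Hm1_norm \<Omega> (\<lambda>x. \<Sum>E\<in>facets \<T>. c E * flux_div E x) \<le> sqrt ((CARD('n) + 1) * (\<Sum>E\<in>facets \<T>. (c E)\<^sup>2 * facet_weight E))"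
proof -
  obtain y where "y \<in> \<Omega>" using domain_nonempty by blast
  then obtain u x where u: "u \<in> test_functions \<Omega>" "u x \<noteq> 0" by (rule nontrivial_test_function[OF open_domain bounded_domain])
  have L: "(\<lambda>x. \<Sum>E\<in>facets \<T>. c E * flux_div E x) \<in> L2 \<Omega>" unfolding flux_comb_step by (rule step_L2)
  show ?thesis
    by (rule Hm1_norm_le[OF open_domain L _ flux_comb_pairing_le u])
      (use less_imp_le[OF facet_weight_pos] in \<open>auto intro!: mult_nonneg_nonneg sum_nonneg\<close>)
qed

lemma Hm1_norm_flux_div_le:
  assumes E: "E \<in> facets \<T>"
  shows "(Hm1_norm \<Omega> (\<lambda>x. c * flux_div E x))\<^sup>2 \<le> (CARD('n) + 1) * (c\<^sup>2 * facet_weight E)"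
proof -
  let ?c = "\<lambda>E'. if E' = E then c else 0"
  have 1: "(\<lambda>x. \<Sum>E'\<in>facets \<T>. ?c E' * flux_div E' x) = (\<lambda>x. c * flux_div E x)"
    using E finite_facets by (simp add: if_distrib[of "\<lambda>y. y * _"] cong: if_cong)
  have 2: "(\<Sum>E'\<in>facets \<T>. (?c E')\<^sup>2 * facet_weight E') = c\<^sup>2 * facet_weight E"
    using E finite_facets by (simp add: if_distrib[of "\<lambda>y. y\<^sup>2"] if_distrib[of "\<lambda>y. y * _"] cong: if_cong)
  have "Hm1_norm \<Omega> (\<lambda>x. c * flux_div E x) \<le> sqrt ((CARD('n) + 1) * (c\<^sup>2 * facet_weight E))"
    using Hm1_norm_flux_comb_le[of ?c] unfolding 1 2 .
  moreover have "0 \<le> Hm1_norm \<Omega> (\<lambda>x. c * flux_div E x)"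
    using Hm1_norm_step_ge_0 unfolding 1[symmetric] flux_comb_step .
  ultimately have "(Hm1_norm \<Omega> (\<lambda>x. c * flux_div E x))\<^sup>2 \<le> (sqrt ((CARD('n) + 1) * (c\<^sup>2 * facet_weight E)))\<^sup>2" by (rule power_mono)
  then show ?thesis using facet_weight_pos[OF E] by (simp add: less_imp_le)
qed

text \<open>Each element at \<open>E\<close> is tested separately with its own bubble, on whose
  support the flux is constant, so that the two signs cannot cancel. This gives the weight of one
  element; the factor 2 counts the elements at a facet.\<close>

lemma Hm1_norm_flux_div_ge:
  assumes E: "E \<in> facets \<T>"
  shows "c\<^sup>2 * facet_weight E \<le> 2 * (shape_factor * bubble_const)\<^sup>2 * (Hm1_norm \<Omega> (\<lambda>x. c * flux_div E x))\<^sup>2"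
proof -
  let ?H = "Hm1_norm \<Omega> (\<lambda>x. c * flux_div E x)"
  have st: "(\<lambda>x. c * flux_div E x) = step (\<lambda>T. c * sgn_label E T / vol T)"
    by (simp add: fun_eq_iff flux_div_def step_def sum_distrib_left mult.assoc)
  have one: "c\<^sup>2 * weight T \<le> (shape_factor * bubble_const)\<^sup>2 * ?H\<^sup>2" if T: "T \<in> \<T>" "sgn_label E T \<noteq> 0" for T
  proof -
    let ?b = "bubble (vertices T)"
    have v: "0 < vol T" "0 < diam T" using vol_pos diam_pos T(1) by auto
    \<comment> \<open>The sign makes the pairing with the bubble nonnegative.\<close>
    define s where "s = (if 0 \<le> c * sgn_label E T then 1 else -1 :: real)"
    have cs: "c * sgn_label E T * s = \<bar>c\<bar>" using T(2) by (auto simp: s_def sgn_label_def split: if_splits)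
    have s1: "\<bar>s\<bar> = 1" by (simp add: s_def)
    define w where "w x = s * ?b x" for x
    have dw: "dist (w x) (w y) = dist (?b x) (?b y)" for x y
      using s1 unfolding w_def dist_real_def by (simp add: abs_mult flip: right_diff_distrib)
    have wl: "(shape_factor / diam T)-lipschitz_on A w" for A
      using bubble_element(1)[OF T(1)] unfolding lipschitz_on_def dw by auto
    have w0: "w x = 0" if "x \<notin> T" for x using bubble_element(2)[OF T(1) that] by (simp add: w_def)
    have wz: "0-lipschitz_on T' w" if "T' \<in> \<T>" "T' \<noteq> T" for T'
    proof (rule lipschitz_onI)
      fix x y assume "x \<in> T'" "y \<in> T'"
      then have "x \<notin> T" "y \<notin> T" using mesh_disjoint[OF that(1) T(1) that(2)] by auto
      then show "dist (w x) (w y) \<le> 0 * dist x y" using w0 by simp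
    qed simp
    let ?l = "\<lambda>T'. if T' = T then shape_factor / diam T else 0"
    have "(\<Sum>T'\<in>\<T>. c * sgn_label E T' / vol T' * elint T' w) \<le> ?H * sqrt (\<Sum>T'\<in>\<T>. vol T' * (?l T')\<^sup>2)"
      unfolding st using wl wz w0 element_subset[OF T(1)] by (intro pairing_le_Hm1_piecewise[OF wl]) auto
    moreover have "(\<Sum>T'\<in>\<T>. vol T' * (?l T')\<^sup>2) = vol T * (shape_factor / diam T)\<^sup>2"
      using T(1) finite_mesh by (simp add: if_distrib[of "\<lambda>y. y\<^sup>2"] if_distrib[of "\<lambda>y. _ * y"] cong: if_cong)
    moreover have ew: "elint T' w = s * elint T' ?b" for T' unfolding elint_def w_def by (simp add: mult.left_commute)
    have "(\<Sum>T'\<in>\<T>. c * sgn_label E T' / vol T' * elint T' w) = (\<Sum>T'\<in>{T}. c * sgn_label E T' / vol T' * elint T' w)"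
      using T(1) finite_mesh bubble_element(5)[OF T(1)] by (intro sum.mono_neutral_right) (auto simp: ew)
    moreover have "\<dots> = \<bar>c\<bar> / vol T * elint T ?b" using cs by (simp add: ew mult_ac)
    ultimately have "\<bar>c\<bar> / vol T * elint T ?b \<le> ?H * (sqrt (vol T) * (shape_factor / diam T))"
      using v shape_factor_ge_1[OF T(1)] by (simp add: real_sqrt_mult)
    moreover have "\<bar>c\<bar> / bubble_const \<le> \<bar>c\<bar> / vol T * elint T ?b"
      using mult_left_mono[OF bubble_element(4)[OF T(1)], of "\<bar>c\<bar> / vol T"] v by simp
    ultimately have "\<bar>c\<bar> / bubble_const \<le> ?H * (sqrt (vol T) * (shape_factor / diam T))" by linarith
    then have "\<bar>c\<bar> / bubble_const * (bubble_const * diam T / sqrt (vol T)) \<le> ?H * (sqrt (vol T) * (shape_factor / diam T)) * (bubble_const * diam T / sqrt (vol T))"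
      using v bubble_const_pos by (intro mult_right_mono) auto
    then have "\<bar>c\<bar> * (diam T / sqrt (vol T)) \<le> ?H * (shape_factor * bubble_const)" using v bubble_const_pos by (simp add: field_simps)
    then have "(\<bar>c\<bar> * (diam T / sqrt (vol T)))\<^sup>2 \<le> (?H * (shape_factor * bubble_const))\<^sup>2" using v by (intro power_mono) auto
    then show ?thesis using v by (simp add: power_mult_distrib power_divide weight_def mult.commute)
  qed
  have "c\<^sup>2 * facet_weight E = (\<Sum>T\<in>\<T>. \<bar>sgn_label E T\<bar> * (c\<^sup>2 * weight T))"
    unfolding facet_weight_def sum_distrib_left by (simp add: mult_ac)
  also have "\<dots> \<le> (\<Sum>T\<in>\<T>. \<bar>sgn_label E T\<bar> * ((shape_factor * bubble_const)\<^sup>2 * ?H\<^sup>2))"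
  proof (rule sum_mono)
    fix T assume "T \<in> \<T>"
    then show "\<bar>sgn_label E T\<bar> * (c\<^sup>2 * weight T) \<le> \<bar>sgn_label E T\<bar> * ((shape_factor * bubble_const)\<^sup>2 * ?H\<^sup>2)"
      using one[of T] by (cases "sgn_label E T = 0") (auto intro!: mult_left_mono)
  qed
  also have "\<dots> = (\<Sum>T\<in>\<T>. \<bar>sgn_label E T\<bar>) * ((shape_factor * bubble_const)\<^sup>2 * ?H\<^sup>2)" by (simp add: sum_distrib_right)
  also have "(\<Sum>T\<in>\<T>. \<bar>sgn_label E T\<bar>) = (\<Sum>T\<in>\<T>. sgn_label E T * sgn_label E T)"
    by (intro sum.cong) (auto simp: sgn_label_def)
  also have "\<dots> \<le> 2" unfolding sum_sgn_label[OF E] using labels(3)[OF E] by (simp add: sgn_label_def)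
  finally show ?thesis by (simp add: mult_right_mono mult.assoc)
qed

section \<open>Lifting piecewise constant functions\<close>

text \<open>At a boundary facet only \<open>Tp E\<close> contributes, and the jump is the value
  there, as if \<open>v\<close> were 0 outside \<Omega>.\<close>

definition jump :: "(real^'n) set \<Rightarrow> ((real^'n) set \<Rightarrow> real) \<Rightarrow> real" where
  "jump E v = (\<Sum>T\<in>\<T>. sgn_label E T * v T)"

section \<open>Uniform bounds on vertex stars\<close>

definition starbound :: nat where "starbound = nat \<lceil>2 ^ CARD('n) * \<gamma>\<rceil>"

text \<open>Shrink every element at \<open>x\<close> by a homothety centred at \<open>x\<close>
  until its diameter is \<open>r\<close>, the smallest one. The copies remain disjoint, lie in the
  ball of radius \<open>r\<close>, and by shape regularity each has volume at least r^n/\<gamma>;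
  comparing volumes bounds their number.\<close>

lemma card_star: "card (star \<T> x) \<le> starbound"
proof (cases "star \<T> x = {}")
  case False
  let ?S = "star \<T> x"
  have fin: "finite ?S" by (rule star_finite)
  have S: "T \<in> \<T>" "x \<in> closure T" if "T \<in> ?S" for T using that by (auto simp: star_def)
  define r where "r = Min (diam ` ?S)"
  have r: "0 < r" "\<And>T. T \<in> ?S \<Longrightarrow> r \<le> diam T"
    using fin False diam_pos[OF S(1)] by (auto simp: r_def)
  obtain T0 where T0: "T0 \<in> \<T>" using False S(1) by blast
  have g: "0 < \<gamma>" by (rule gamma_pos[OF T0])
  define A where "A T = (\<lambda>y. (r / diam T) *\<^sub>R y + (1 - r / diam T) *\<^sub>R x) ` T" for T
  have AT: "A T \<subseteq> T" "A T \<subseteq> cball x r" "A T \<in> lmeasurable" "r ^ CARD('n) / \<gamma> \<le> vol (A T)" if T: "T \<in> ?S" for T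
  proof -
    have d: "0 < diam T" by (rule diam_pos[OF S(1)[OF T]])
    have t: "0 < r / diam T" "r / diam T \<le> 1" using r(1) r(2)[OF T] d by auto
    show "A T \<subseteq> T"
    proof
      fix z assume "z \<in> A T"
      then obtain y where y: "y \<in> T" "z = (1 - r / diam T) *\<^sub>R x + (r / diam T) *\<^sub>R y" unfolding A_def by (auto simp: add.commute)
      have "0 < bary (vertices T) p z" if p: "p \<in> vertices T" for p
      proof -
        have "0 < bary (vertices T) p y" "0 \<le> bary (vertices T) p x"
          using y(1) S(2)[OF T] mem_element[OF S(1)[OF T]] mem_closure_element[OF S(1)[OF T]] p by blast+
        then show ?thesis unfolding y(2) bary_convex_comb using t by (intro add_nonneg_pos mult_nonneg_nonneg mult_pos_pos) auto
      qed
      then show "z \<in> T" using mem_element[OF S(1)[OF T]] by blast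
    qed
    then have b: "bounded (A T)" using bounded_element[OF S(1)[OF T]] bounded_subset by blast
    show "A T \<subseteq> cball x r"
    proof
      fix z assume "z \<in> A T"
      then obtain y where y: "y \<in> T" "z = (r / diam T) *\<^sub>R y + (1 - r / diam T) *\<^sub>R x" unfolding A_def by auto
      have "x - z = (r / diam T) *\<^sub>R (x - y)" unfolding y(2) by (simp add: algebra_simps)
      then have "dist x z = (r / diam T) * dist x y" unfolding dist_norm using abs_of_pos[OF t(1)] by (simp only: norm_scaleR)
      also have "\<dots> \<le> (r / diam T) * diam T"
        using dist_le_diam[OF S(1)[OF T] S(2)[OF T], of y] y(1) closure_subset[of T] t by (intro mult_left_mono) auto
      finally show "z \<in> cball x r" using d by simp
    qed
    have "open (A T)" unfolding A_def
      using open_affinity[OF element_open[OF S(1)[OF T]], of "r / diam T" "(1 - r / diam T) *\<^sub>R x"] r(1) d by (simp add: add.commute)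
    then show "A T \<in> lmeasurable" using b by (rule lmeasurable_open[rotated])
    have "vol (A T) = (r / diam T) ^ CARD('n) * vol T"
      unfolding A_def using measure_lebesgue_affine[of "r / diam T" "(1 - r / diam T) *\<^sub>R x" T] r(1) d by simp
    moreover have "(r / diam T) ^ CARD('n) * (diam T ^ CARD('n)) \<le> (r / diam T) ^ CARD('n) * (\<gamma> * vol T)"
      using t by (intro mult_left_mono vol_ge S(1)[OF T]) auto
    moreover have "(r / diam T) ^ CARD('n) * (diam T ^ CARD('n)) = r ^ CARD('n)" using d by (simp add: power_divide)
    ultimately show "r ^ CARD('n) / \<gamma> \<le> vol (A T)" using g by (simp add: field_simps)
  qed
  have "card ?S * (r ^ CARD('n) / \<gamma>) \<le> (\<Sum>T\<in>?S. vol (A T))" using sum_bounded_below[of ?S "r ^ CARD('n) / \<gamma>" "\<lambda>T. vol (A T)"] AT(4) by simp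
  also have "\<dots> = vol (\<Union>T\<in>?S. A T)"
  proof (rule measure_UNION'[symmetric, OF fin AT(3)])
    show "pairwise (\<lambda>T T'. disjnt (A T) (A T')) ?S"
      unfolding pairwise_def disjnt_def using AT(1) mesh_disjoint S(1) by blast
  qed
  also have "\<dots> \<le> vol (cball x r)"
    using AT(2,3) fin by (intro measure_mono_fmeasurable) (auto intro!: sets.finite_UN fmeasurableD)
  also have "\<dots> \<le> (2 * r) ^ CARD('n)" using measure_cball_le[of r x] r(1) by (simp add: less_imp_le)
  finally have "card ?S * (r ^ CARD('n) / \<gamma>) * (\<gamma> / r ^ CARD('n)) \<le> (2 * r) ^ CARD('n) * (\<gamma> / r ^ CARD('n))"
    using g r(1) by (intro mult_right_mono) auto
  then have "real (card ?S) \<le> 2 ^ CARD('n) * \<gamma>" using g r(1) by (simp add: power_mult_distrib)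
  then show ?thesis unfolding starbound_def by linarith
qed simp

lemma simplex_face_unique:
  assumes "T \<in> \<T>" "T' \<in> \<T>" "c \<subseteq> vertices T" "c' \<subseteq> vertices T'" "convex hull c = convex hull c'"
  shows "c = c'"
proof -
  have "\<not> affine_dependent c" "\<not> affine_dependent c'"
    using element(1)[OF assms(1)] element(1)[OF assms(2)] affine_independent_subset[OF _ assms(3)] affine_independent_subset[OF _ assms(4)]
    unfolding simplex_vertices_def by auto
  then show ?thesis
    using extreme_point_of_convex_hull_affine_independent[of c] extreme_point_of_convex_hull_affine_independent[of c'] assms(5) by auto
qed

lemma common_face:
  assumes "T \<in> \<T>" "T' \<in> \<T>"
  obtains c where "c \<subseteq> vertices T" "c \<subseteq> vertices T'" "closure T \<inter> closure T' = convex hull c"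
proof -
  obtain c where c: "c \<subseteq> vertices T" "closure T \<inter> closure T' = convex hull c" by (rule triangulation_face[OF assms])
  obtain c' where c': "c' \<subseteq> vertices T'" "closure T' \<inter> closure T = convex hull c'" by (rule triangulation_face[OF assms(2,1)])
  have "convex hull c = convex hull c'" unfolding c(2)[symmetric] c'(2)[symmetric] by (rule Int_commute)
  then have "c = c'" by (rule simplex_face_unique[OF assms c(1) c'(1)])
  then show thesis using that c c' by blast
qed

lemma vertex_in_face:
  assumes "T \<in> \<T>" "c \<subseteq> vertices T" "p \<in> vertices T" "p \<in> convex hull c"
  shows "p \<in> c"
proof (rule ccontr)
  assume "p \<notin> c"
  then have "c \<subseteq> vertices T - {p}" using assms(2) by blast
  from hull_mono[OF this, of convex] have "p \<in> convex hull (vertices T - {p})" using assms(4) by auto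
  then show False using mem_facet[OF assms(1,3), of p] by simp
qed

text \<open>The common face has n vertices, so it is a facet of both elements. Both are therefore
  labelled at \<open>E\<close>, with opposite signs.\<close>

lemma adjacent_facet:
  assumes T: "A \<in> \<T>" "B \<in> \<T>" and adj: "facet_adjacent A B"
  obtains E where "E \<in> facets \<T>" "closure E = closure A \<inter> closure B" "\<And>v. \<bar>jump E v\<bar> = \<bar>v A - v B\<bar>"
proof -
  obtain p where p: "p \<in> vertices A" "closure A \<inter> closure B = convex hull (vertices A - {p})" and ne: "A \<noteq> B"
    using adj unfolding facet_adjacent_def by blast
  obtain c where c: "c \<subseteq> vertices A" "c \<subseteq> vertices B" "closure A \<inter> closure B = convex hull c" by (rule common_face[OF T])
  have "convex hull c = convex hull (vertices A - {p})" unfolding c(3)[symmetric] p(2)[symmetric] ..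
  then have cA: "c = vertices A - {p}" by (rule simplex_face_unique[OF T(1,1) c(1) Diff_subset])
  have "card c = CARD('n)" unfolding cA using p(1) card_vertices[OF T(1)] finite_vertices[OF T(1)] by simp
  then have "card (vertices B - c) = 1" using c(2) card_vertices[OF T(2)] finite_vertices[OF T(2)] by (simp add: card_Diff_subset finite_subset)
  then obtain q where q: "vertices B - c = {q}" by (auto simp: card_1_singleton_iff)
  then have qB: "q \<in> vertices B" "c = vertices B - {q}" using c(2) by auto
  define E where "E = facet A p"
  have EB: "E = facet B q" unfolding E_def facet_def using cA qB(2) by simp
  have E: "E \<in> facets \<T>" unfolding E_def by (rule facet_in_facets[OF T(1) p(1)])
  have "sgn_label E A \<noteq> 0" "sgn_label E B \<noteq> 0"
    using sgn_label_nz[OF E] T open_facet_iff p(1) qB(1) E_def EB by blast+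
  then have AB: "A \<in> {Tp E, Tm E}" "B \<in> {Tp E, Tm E}" by (auto simp: sgn_label_def split: if_splits)
  have "\<bar>jump E v\<bar> = \<bar>v A - v B\<bar>" for v
    unfolding jump_def sum_sgn_label[OF E] using AB ne T by auto
  moreover have "closure E = closure A \<inter> closure B" unfolding E_def closure_facet[OF T(1)] p(2) ..
  ultimately show thesis using that E by blast
qed

text \<open>In dimension at least 2 a facet has two vertices, so the elements share an edge. Its
  length is comparable to the diameter of \<open>A\<close> from below and at most that of
  \<open>B\<close>.\<close>

lemma adjacent_diam:
  assumes T: "A \<in> \<T>" "B \<in> \<T>" and adj: "facet_adjacent A B"
  shows "diam A \<le> shape_factor * diam B"
proof -
  obtain p where p: "p \<in> vertices A" "closure A \<inter> closure B = convex hull (vertices A - {p})"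
    using adj unfolding facet_adjacent_def by blast
  have "card (vertices A - {p}) \<ge> 2" using p(1) card_vertices[OF T(1)] finite_vertices[OF T(1)] dim by simp
  then have c2: "2 \<le> card (vertices A - {p})" .
  then have "vertices A - {p} \<noteq> {}" by (intro notI) simp
  then obtain a where a: "a \<in> vertices A - {p}" by blast
  have "card (vertices A - {p} - {a}) \<noteq> 0" using c2 a finite_vertices[OF T(1)] by simp
  then have "vertices A - {p} - {a} \<noteq> {}" by (intro notI) simp
  then obtain b where "b \<in> vertices A - {p} - {a}" by blast
  then have ab: "a \<in> vertices A - {p}" "b \<in> vertices A - {p}" "a \<noteq> b" using a by auto
  have "a \<in> closure B" "b \<in> closure B" using ab p(2) hull_inc[of _ "vertices A - {p}" convex] by blast+
  then have "dist a b \<le> diam B" by (rule dist_le_diam[OF T(2)])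
  moreover have "0 \<le> shape_factor" using shape_factor_ge_1[OF T(1)] by simp
  ultimately have "shape_factor * dist a b \<le> shape_factor * diam B" by (intro mult_left_mono)
  then show ?thesis using edge_length[OF T(1), of a b] ab by auto
qed

definition chainbound :: nat where "chainbound = starbound\<^sup>2"

text \<open>Reachability in a finite relation needs at most as many steps as the relation has pairs,
  and here these are pairs of elements of one star.\<close>

lemma star_path:
  assumes x: "x \<in> closure \<Omega>" and T: "A \<in> star \<T> x" "B \<in> star \<T> x"
  obtains k where "k \<le> chainbound" "(A, B) \<in> {(A, B). A \<in> star \<T> x \<and> B \<in> star \<T> x \<and> facet_adjacent A B} ^^ k"
proof -
  let ?R = "{(A, B). A \<in> star \<T> x \<and> B \<in> star \<T> x \<and> facet_adjacent A B}"
  have RS: "?R \<subseteq> star \<T> x \<times> star \<T> x" by auto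
  have finS: "finite (star \<T> x \<times> star \<T> x)" using star_finite by simp
  have finR: "finite ?R" by (rule finite_subset[OF RS finS])
  have "card ?R \<le> card (star \<T> x \<times> star \<T> x)" by (rule card_mono[OF finS RS])
  also have "\<dots> \<le> chainbound" unfolding chainbound_def power2_eq_square card_cartesian_product using card_star by (intro mult_le_mono)
  finally have cR: "card ?R \<le> chainbound" .
  have "(A, B) \<in> ?R\<^sup>*" by (rule star_connected[OF x T])
  then obtain k where k: "k \<le> card ?R" "(A, B) \<in> ?R ^^ k" unfolding rtrancl_finite_eq_relpow[OF finR] by blast
  show thesis by (rule that[OF order_trans[OF k(1) cR] k(2)])
qed

lemma starD: "S \<in> star \<T> x \<Longrightarrow> S \<in> \<T>" "S \<in> star \<T> x \<Longrightarrow> x \<in> closure S"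
  by (auto simp: star_def)

lemma star_diam:
  assumes x: "x \<in> closure \<Omega>" and T: "A \<in> star \<T> x" "B \<in> star \<T> x"
  shows "diam A \<le> shape_factor ^ chainbound * diam B"
proof -
  let ?R = "{(A, B). A \<in> star \<T> x \<and> B \<in> star \<T> x \<and> facet_adjacent A B}"
  obtain k where k: "k \<le> chainbound" "(A, B) \<in> ?R ^^ k" by (rule star_path[OF x T])
  have K1: "1 \<le> shape_factor" by (rule shape_factor_ge_1[OF starD(1)[OF T(1)]])
  have "diam A \<le> shape_factor ^ k * diam B" if "(A, B) \<in> ?R ^^ k" for k B
    using that
  proof (induction k arbitrary: B)
    case (Suc k)
    then obtain C where C: "(A, C) \<in> ?R ^^ k" "(C, B) \<in> ?R" by auto
    then have "diam A \<le> shape_factor ^ k * diam C" using Suc.IH by blast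
    also have "\<dots> \<le> shape_factor ^ k * (shape_factor * diam B)" using C(2) starD(1) K1 by (intro mult_left_mono adjacent_diam) auto
    finally show ?case by (simp add: mult_ac)
  qed simp
  from this[OF k(2)] have "diam A \<le> shape_factor ^ k * diam B" .
  also have "\<dots> \<le> shape_factor ^ chainbound * diam B"
    using k(1) K1 diam_pos[OF starD(1)[OF T(2)]] by (intro mult_right_mono power_increasing) auto
  finally show ?thesis .
qed

text \<open>Telescope along the chain. The facet between consecutive elements contains
  \<open>x\<close>, since both elements do, so its jump is among those bounded by
  \<open>D\<close>.\<close>

lemma star_jump:
  fixes D :: real
  assumes x: "x \<in> closure \<Omega>" and T: "A \<in> star \<T> x" "B \<in> star \<T> x"
    and D: "\<And>E. E \<in> facets \<T> \<Longrightarrow> x \<in> closure E \<Longrightarrow> \<bar>jump E v\<bar> \<le> D" "0 \<le> D"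
  shows "\<bar>v A - v B\<bar> \<le> chainbound * D"
proof -
  let ?R = "{(A, B). A \<in> star \<T> x \<and> B \<in> star \<T> x \<and> facet_adjacent A B}"
  obtain k where k: "k \<le> chainbound" "(A, B) \<in> ?R ^^ k" by (rule star_path[OF x T])
  have "\<bar>v A - v B\<bar> \<le> k * D" if "(A, B) \<in> ?R ^^ k" for k B
    using that
  proof (induction k arbitrary: B)
    case (Suc k)
    then obtain C where C: "(A, C) \<in> ?R ^^ k" "(C, B) \<in> ?R" by auto
    have CB: "C \<in> \<T>" "B \<in> \<T>" "x \<in> closure C" "x \<in> closure B" "facet_adjacent C B" using C(2) starD by auto
    obtain E where E: "E \<in> facets \<T>" "closure E = closure C \<inter> closure B" "\<And>v. \<bar>jump E v\<bar> = \<bar>v C - v B\<bar>"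
      by (rule adjacent_facet[OF CB(1,2,5)]) blast
    have "\<bar>v C - v B\<bar> \<le> D" using D(1)[OF E(1)] E(2,3) CB by auto
    then show ?case using Suc.IH[OF C(1)] by (simp add: algebra_simps)
  qed simp
  from this[OF k(2)] have "\<bar>v A - v B\<bar> \<le> k * D" .
  also have "\<dots> \<le> chainbound * D" using k(1) D(2) by (intro mult_right_mono) auto
  finally show ?thesis .
qed

definition weight_ratio :: real where "weight_ratio = \<gamma> * 2 ^ CARD('n) * (shape_factor ^ chainbound) ^ (CARD('n) - 2)"

text \<open>By shape regularity the weight of an element behaves like its diameter to the power 2 -
  n. The diameters within a star are comparable, and the exponent n - 2 is a natural number by
  \<open>dim\<close>.\<close>

lemma weight_compare:
  assumes x: "x \<in> closure \<Omega>" and T: "A \<in> star \<T> x" "B \<in> star \<T> x"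
  shows "weight B \<le> weight_ratio * weight A"
proof -
  let ?m = "CARD('n) - 2"
  have n: "CARD('n) = 2 + ?m" using dim by simp
  have AB: "A \<in> \<T>" "B \<in> \<T>" using T by (auto simp: star_def)
  have d: "0 < diam A" "0 < diam B" "0 < vol A" "0 < vol B" using diam_pos vol_pos AB by auto
  have g: "0 < \<gamma>" by (rule gamma_pos[OF AB(1)])
  have pA: "diam A ^ CARD('n) = (diam A)\<^sup>2 * diam A ^ ?m" and pB: "diam B ^ CARD('n) = (diam B)\<^sup>2 * diam B ^ ?m"
    by (subst n, simp only: power_add)+
  have "(diam B)\<^sup>2 * vol A \<le> (diam B)\<^sup>2 * (2 * diam A) ^ CARD('n)" using vol_le[OF AB(1)] by (intro mult_left_mono) auto
  also have "\<dots> = 2 ^ CARD('n) * (diam A)\<^sup>2 * ((diam B)\<^sup>2 * diam A ^ ?m)" unfolding power_mult_distrib[of 2 "diam A"] pA by simp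
  also have "\<dots> \<le> 2 ^ CARD('n) * (diam A)\<^sup>2 * ((diam B)\<^sup>2 * (shape_factor ^ chainbound * diam B) ^ ?m)"
    using star_diam[OF x T] d by (intro mult_left_mono power_mono) auto
  also have "\<dots> = 2 ^ CARD('n) * (shape_factor ^ chainbound) ^ ?m * (diam A)\<^sup>2 * diam B ^ CARD('n)" unfolding power_mult_distrib pB by simp
  also have "\<dots> \<le> 2 ^ CARD('n) * (shape_factor ^ chainbound) ^ ?m * (diam A)\<^sup>2 * (\<gamma> * vol B)"
    using vol_ge[OF AB(2)] shape_factor_ge_1[OF AB(1)] by (intro mult_left_mono) auto
  finally have "(diam B)\<^sup>2 * vol A \<le> weight_ratio * (diam A)\<^sup>2 * vol B" by (simp add: weight_ratio_def mult_ac)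
  then show ?thesis unfolding weight_def using d by (simp add: field_simps)
qed

lemma facet_weight_compare:
  assumes E: "E \<in> facets \<T>" "x \<in> closure E" and T: "T \<in> star \<T> x"
  shows "facet_weight E \<le> 2 * weight_ratio * weight T"
proof -
  have xc: "x \<in> closure \<Omega>" using T closure_domain by (auto simp: star_def)
  have s: "S \<in> star \<T> x" if S: "S \<in> \<T>" "sgn_label E S \<noteq> 0" for S
  proof -
    obtain p where "p \<in> vertices S" "E = facet S p" using opposite[OF E(1) S] by blast
    then have "closure E \<subseteq> closure S" using closure_facet[OF S(1)] mem_facet[OF S(1)] by auto
    then show ?thesis using E(2) S(1) by (auto simp: star_def)
  qed
  have "facet_weight E \<le> (\<Sum>S\<in>\<T>. \<bar>sgn_label E S\<bar> * (weight_ratio * weight T))"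
    unfolding facet_weight_def
  proof (rule sum_mono)
    fix S assume S: "S \<in> \<T>"
    show "\<bar>sgn_label E S\<bar> * weight S \<le> \<bar>sgn_label E S\<bar> * (weight_ratio * weight T)"
      using weight_compare[OF xc T s[OF S]] by (cases "sgn_label E S = 0") (auto intro!: mult_left_mono)
  qed
  also have "\<dots> = (\<Sum>S\<in>\<T>. sgn_label E S * sgn_label E S) * (weight_ratio * weight T)"
    unfolding sum_distrib_right by (intro sum.cong) (auto simp: sgn_label_def)
  also have "(\<Sum>S\<in>\<T>. sgn_label E S * sgn_label E S) \<le> 2" unfolding sum_sgn_label[OF E(1)] using labels(3)[OF E(1)] by (simp add: sgn_label_def)
  finally show ?thesis
    using weight_pos[of T] T weight_compare[OF xc T T] by (simp add: mult_right_mono mult.assoc star_def)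
qed

section \<open>Nodal interpolation and correction of the means\<close>

definition nodal :: "(real^'n \<Rightarrow> real) \<Rightarrow> (real^'n) set \<Rightarrow> real^'n \<Rightarrow> real" where
  "nodal a T x = (\<Sum>p\<in>vertices T. bary (vertices T) p x * a p)"

text \<open>On a face only the values at its own vertices enter. This makes the affine pieces agree
  between elements and vanish on boundary facets.\<close>

lemma nodal_face:
  assumes T: "T \<in> \<T>" and c: "c \<subseteq> vertices T" and t: "sum t c = 1"
  shows "nodal a T (\<Sum>v\<in>c. t v *\<^sub>R v) = (\<Sum>v\<in>c. t v * a v)"
proof -
  have fin: "finite c" using c finite_vertices[OF T] finite_subset by blast
  have "nodal a T (\<Sum>v\<in>c. t v *\<^sub>R v) = (\<Sum>p\<in>vertices T. (\<Sum>v\<in>c. t v * bary (vertices T) p v) * a p)"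
    unfolding nodal_def bary_sum[OF fin t] ..
  also have "\<dots> = (\<Sum>v\<in>c. \<Sum>p\<in>vertices T. t v * bary (vertices T) p v * a p)"
    unfolding sum_distrib_right by (rule sum.swap)
  also have "\<dots> = (\<Sum>v\<in>c. t v * a v)"
  proof (rule sum.cong[OF refl])
    fix v assume v: "v \<in> c"
    have "(\<Sum>p\<in>vertices T. t v * bary (vertices T) p v * a p) = (\<Sum>p\<in>vertices T. if p = v then t v * a v else 0)"
      using bary_vertex[OF element(1)[OF T]] v c by (intro sum.cong) auto
    then show "(\<Sum>p\<in>vertices T. t v * bary (vertices T) p v * a p) = t v * a v"
      using v c finite_vertices[OF T] by auto
  qed
  finally show ?thesis .
qed

lemma nodal_consistent:
  assumes T: "T \<in> \<T>" "T' \<in> \<T>" and x: "x \<in> closure T" "x \<in> closure T'"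
  shows "nodal a T x = nodal a T' x"
proof -
  obtain c where c: "c \<subseteq> vertices T" "c \<subseteq> vertices T'" "closure T \<inter> closure T' = convex hull c" by (rule common_face[OF T])
  have fin: "finite c" using c(1) finite_vertices[OF T(1)] finite_subset by blast
  have "x \<in> convex hull c" using x c(3) by blast
  then obtain t where t: "sum t c = 1" "(\<Sum>v\<in>c. t v *\<^sub>R v) = x" unfolding convex_hull_finite[OF fin] by blast
  show ?thesis using nodal_face[OF T(1) c(1) t(1), of a] nodal_face[OF T(2) c(2) t(1), of a] t(2) by simp
qed

text \<open>Any element containing \<open>x\<close> in its closure may be chosen, since
  \<open>nodal_consistent\<close> makes the value independent of the choice.\<close>

definition interpolant :: "(real^'n \<Rightarrow> real) \<Rightarrow> real^'n \<Rightarrow> real" where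
  "interpolant a x = (if x \<in> closure \<Omega> then nodal a (SOME T. T \<in> star \<T> x) x else 0)"

lemma interpolant_eq:
  assumes "T \<in> star \<T> x" shows "interpolant a x = nodal a T x"
proof -
  have s: "(SOME T. T \<in> star \<T> x) \<in> star \<T> x" using assms by (rule someI)
  have "x \<in> closure \<Omega>" using starD[OF assms] closure_domain by blast
  then show ?thesis unfolding interpolant_def
    using nodal_consistent[OF starD(1)[OF s] starD(1)[OF assms] starD(2)[OF s] starD(2)[OF assms]] by simp
qed

text \<open>A boundary point may lie in an element having vertices inside \<Omega>. What helps is a
  boundary facet through the point: all its vertices are on the boundary, where \<open>a\<close>
  vanishes, and they determine the value.\<close>

lemma interpolant_outside:
  assumes a: "\<And>z. z \<notin> \<Omega> \<Longrightarrow> a z = 0" and x: "x \<notin> \<Omega>"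
  shows "interpolant a x = 0"
proof (cases "x \<in> closure \<Omega>")
  case True
  then have "x \<in> frontier \<Omega>" using x open_domain by (simp add: frontier_def interior_open)
  then obtain T p where T: "T \<in> \<T>" "p \<in> vertices T" "facet T p \<subseteq> frontier \<Omega>" "x \<in> convex hull (vertices T - {p})"
    by (rule boundary_facet_exists)
  have "closure (facet T p) \<subseteq> frontier \<Omega>" using T(3) by (simp add: closure_minimal frontier_closed)
  then have F: "convex hull (vertices T - {p}) \<subseteq> frontier \<Omega>" using closure_facet[OF T(1)] by simp
  have az: "a z = 0" if z: "z \<in> vertices T - {p}" for z
  proof (rule a)
    have "z \<in> frontier \<Omega>" using F hull_inc[OF z, of convex] by auto
    then show "z \<notin> \<Omega>" using open_domain by (simp add: frontier_def interior_open)
  qed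
  have fin: "finite (vertices T - {p})" using finite_vertices[OF T(1)] by simp
  obtain t where t: "sum t (vertices T - {p}) = 1" "(\<Sum>v\<in>vertices T - {p}. t v *\<^sub>R v) = x"
    using T(4) unfolding convex_hull_finite[OF fin] by blast
  have "x \<in> closure T" using mem_facet[OF T(1,2)] T(4) by blast
  then have "T \<in> star \<T> x" using T(1) by (simp add: star_def)
  from interpolant_eq[OF this] have "interpolant a x = nodal a T x" .
  also have "\<dots> = (\<Sum>v\<in>vertices T - {p}. t v * a v)" using nodal_face[OF T(1) Diff_subset t(1), of a] t(2) by simp
  also have "\<dots> = 0" using az by simp
  finally show ?thesis .
qed (simp add: interpolant_def)

definition spread :: "(real^'n \<Rightarrow> real) \<Rightarrow> ((real^'n) set \<Rightarrow> real) \<Rightarrow> (real^'n) set \<Rightarrow> real" where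
  "spread a v T = (\<Sum>p\<in>vertices T. \<bar>a p - v T\<bar>)"

lemma spread_ge_0: "0 \<le> spread a v T" unfolding spread_def by (intro sum_nonneg) auto

lemma nodal_diff:
  assumes T: "T \<in> \<T>"
  shows "nodal a T x - s = (\<Sum>p\<in>vertices T. bary (vertices T) p x * (a p - s))"
proof -
  have "(\<Sum>p\<in>vertices T. bary (vertices T) p x * (a p - s)) = nodal a T x - s * (\<Sum>p\<in>vertices T. bary (vertices T) p x)"
    by (simp add: nodal_def algebra_simps sum_subtractf sum_distrib_left)
  then show ?thesis using bary_represent(1)[OF element(1)[OF T], of x] by simp
qed

text \<open>The coordinates sum to 1, so the constant \<open>v T\<close> can be subtracted from all
  nodal values; only their deviations from it then enter the slope and the error.\<close>

lemma interpolant_element: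
  assumes T: "T \<in> \<T>"
  shows "(shape_factor / diam T * spread a v T)-lipschitz_on (closure T) (interpolant a)"
    "x \<in> closure T \<Longrightarrow> \<bar>interpolant a x - v T\<bar> \<le> spread a v T"
proof -
  have i: "interpolant a x = nodal a T x" if "x \<in> closure T" for x
    using interpolant_eq[of T x] that T by (simp add: star_def)
  show "(shape_factor / diam T * spread a v T)-lipschitz_on (closure T) (interpolant a)"
  proof (rule lipschitz_onI)
    fix x y assume xy: "x \<in> closure T" "y \<in> closure T"
    have "interpolant a x - interpolant a y = (\<Sum>p\<in>vertices T. (bary (vertices T) p x - bary (vertices T) p y) * (a p - v T))"
      using nodal_diff[OF T, of a x "v T"] nodal_diff[OF T, of a y "v T"] i[OF xy(1)] i[OF xy(2)]
      by (simp add: left_diff_distrib sum_subtractf)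
    also have "\<bar>\<dots>\<bar> \<le> (\<Sum>p\<in>vertices T. \<bar>bary (vertices T) p x - bary (vertices T) p y\<bar> * \<bar>a p - v T\<bar>)"
      unfolding abs_mult[symmetric] by (rule sum_abs)
    also have "\<dots> \<le> (\<Sum>p\<in>vertices T. (shape_factor / diam T * dist x y) * \<bar>a p - v T\<bar>)"
      using lipschitz_onD[OF bary_lipschitz_element[OF T], of _ x UNIV y] by (intro sum_mono mult_right_mono) (auto simp: dist_real_def)
    also have "\<dots> = shape_factor / diam T * spread a v T * dist x y" unfolding spread_def by (simp add: sum_distrib_left sum_distrib_right mult_ac)
    finally show "dist (interpolant a x) (interpolant a y) \<le> shape_factor / diam T * spread a v T * dist x y" by (simp add: dist_real_def)
  qed (use shape_factor_ge_1[OF T] diam_pos[OF T] spread_ge_0[of a v T] in simp)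
  assume x: "x \<in> closure T"
  have "\<bar>interpolant a x - v T\<bar> \<le> (\<Sum>p\<in>vertices T. \<bar>bary (vertices T) p x * (a p - v T)\<bar>)"
    unfolding i[OF x] nodal_diff[OF T] by (rule sum_abs)
  also have "\<dots> \<le> spread a v T" unfolding spread_def
  proof (rule sum_mono)
    fix p assume p: "p \<in> vertices T"
    have "0 \<le> bary (vertices T) p x" "bary (vertices T) p x \<le> 1"
      using x mem_closure_element[OF T] p bary_le_1[OF element(1)[OF T] _ p] element(2)[OF T] by auto
    then show "\<bar>bary (vertices T) p x * (a p - v T)\<bar> \<le> \<bar>a p - v T\<bar>" by (simp add: abs_mult mult_left_le_one_le)
  qed
  finally show "\<bar>interpolant a x - v T\<bar> \<le> spread a v T" .
qed

lemma interpolant_lipschitz: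
  assumes a: "\<And>z. z \<notin> \<Omega> \<Longrightarrow> a z = 0"
  obtains L where "L-lipschitz_on UNIV (interpolant a)"
proof -
  \<comment> \<open>Only the existence of a global constant matters here, so deviations from 0
    serve.\<close>
  let ?l = "\<lambda>T. shape_factor / diam T * spread a (\<lambda>_. 0) T"
  have l0: "0 \<le> ?l T" if "T \<in> \<T>" for T using shape_factor_ge_1[OF that] diam_pos[OF that] spread_ge_0[of a "\<lambda>_. 0" T] by simp
  have L0: "0 \<le> (\<Sum>T\<in>\<T>. ?l T)" using l0 by (rule sum_nonneg)
  have "(\<Sum>T\<in>\<T>. ?l T)-lipschitz_on UNIV (interpolant a)"
  proof (rule lipschitz_closed_cover[where \<C>="insert (- \<Omega>) (closure ` \<T>)"])
    show "finite (insert (- \<Omega>) (closure ` \<T>))" using finite_mesh by simp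
    show "closed C" if "C \<in> insert (- \<Omega>) (closure ` \<T>)" for C using that open_domain by auto
    show "\<Union> (insert (- \<Omega>) (closure ` \<T>)) = UNIV" using closure_domain closure_subset[of \<Omega>] by auto
    show "(\<Sum>T\<in>\<T>. ?l T)-lipschitz_on C (interpolant a)" if C: "C \<in> insert (- \<Omega>) (closure ` \<T>)" for C
    proof (cases "C = - \<Omega>")
      case True
      then show ?thesis using interpolant_outside[OF a] L0 by (intro lipschitz_onI) auto
    next
      case False
      then obtain T where T: "T \<in> \<T>" "C = closure T" using C by auto
      have "?l T \<le> (\<Sum>T\<in>\<T>. ?l T)" using T(1) finite_mesh l0 by (intro member_le_sum) auto
      then show ?thesis unfolding T(2) using interpolant_element(1)[OF T(1), of a "\<lambda>_. 0"] lipschitz_on_le by blast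
    qed
  qed (rule L0)
  then show thesis by (rule that)
qed

text \<open>The bubble of \<open>T\<close> lives on \<open>T\<close> alone; its coefficient is the
  one that brings the integral over \<open>T\<close> to \<open>vol T * v T\<close> and leaves the
  other elements untouched.\<close>

definition corrected :: "(real^'n \<Rightarrow> real) \<Rightarrow> ((real^'n) set \<Rightarrow> real) \<Rightarrow> real^'n \<Rightarrow> real" where
  "corrected a v x = interpolant a x + (\<Sum>T\<in>\<T>. (vol T * v T - elint T (interpolant a)) / elint T (bubble (vertices T)) * bubble (vertices T) x)"

lemma corrected_properties:
  assumes a: "\<And>z. z \<notin> \<Omega> \<Longrightarrow> a z = 0"
  shows "\<exists>L. L-lipschitz_on UNIV (corrected a v)" "x \<notin> \<Omega> \<Longrightarrow> corrected a v x = 0"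
    "T \<in> \<T> \<Longrightarrow> elint T (corrected a v) = vol T * v T"
    "T \<in> \<T> \<Longrightarrow> (shape_factor / diam T * ((1 + bubble_const) * spread a v T))-lipschitz_on T (corrected a v)"
proof -
  let ?\<beta> = "\<lambda>T. (vol T * v T - elint T (interpolant a)) / elint T (bubble (vertices T))"
  obtain L where L: "L-lipschitz_on UNIV (interpolant a)" by (rule interpolant_lipschitz[OF a])
  have ic: "continuous_on UNIV (interpolant a)" by (rule lipschitz_on_continuous_on[OF L])
  have bl: "(\<bar>s\<bar> * (shape_factor / diam T))-lipschitz_on A (\<lambda>x. s * bubble (vertices T) x)" if T: "T \<in> \<T>" for T s A
    using lipschitz_on_cmult_real[OF lipschitz_on_subset[OF bubble_element(1)[OF T] subset_UNIV], where a=s] .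
  have bcont: "continuous_on UNIV (bubble (vertices T))" if "T \<in> \<T>" for T
    by (rule lipschitz_on_continuous_on[OF bubble_element(1)[OF that]])
  have "\<exists>L. L-lipschitz_on UNIV (\<lambda>x. \<Sum>T\<in>S. ?\<beta> T * bubble (vertices T) x)" if "S \<subseteq> \<T>" for S
    using finite_subset[OF that finite_mesh] that
  proof (induction S rule: finite_induct)
    case empty
    have "0-lipschitz_on UNIV (\<lambda>x::real^'n. 0::real)" by (intro lipschitz_onI) auto
    then show ?case by auto
  next
    case (insert T S)
    then obtain L' where "L'-lipschitz_on UNIV (\<lambda>x. \<Sum>T\<in>S. ?\<beta> T * bubble (vertices T) x)" by auto
    from lipschitz_on_add[OF bl[of T "?\<beta> T" UNIV] this] show ?case using insert by auto
  qed
  from this[OF subset_refl] obtain L' where L': "L'-lipschitz_on UNIV (\<lambda>x. \<Sum>T\<in>\<T>. ?\<beta> T * bubble (vertices T) x)" by blast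
  show "\<exists>L. L-lipschitz_on UNIV (corrected a v)" unfolding corrected_def using lipschitz_on_add[OF L L'] by blast
  have bz: "bubble (vertices T) x = 0" if "T \<in> \<T>" "x \<notin> T" for T x by (rule bubble_element(2)[OF that])
  show "corrected a v x = 0" if x: "x \<notin> \<Omega>"
  proof -
    have "bubble (vertices T) x = 0" if "T \<in> \<T>" for T using bz[OF that] element_subset[OF that] x by blast
    then have "(\<Sum>T\<in>\<T>. ?\<beta> T * bubble (vertices T) x) = 0" by (intro sum.neutral) simp
    then show ?thesis unfolding corrected_def using interpolant_outside[where a=a and x=x, OF a x] by simp
  qed
  assume T: "T \<in> \<T>"
  have onT: "corrected a v x = interpolant a x + ?\<beta> T * bubble (vertices T) x" if x: "x \<in> T" for x
  proof -
    have "(\<Sum>S\<in>\<T>. ?\<beta> S * bubble (vertices S) x) = (\<Sum>S\<in>{T}. ?\<beta> S * bubble (vertices S) x)"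
      using T finite_mesh bz[of _ x] mesh_disjoint[OF T] x by (intro sum.mono_neutral_right) auto
    then show ?thesis by (simp add: corrected_def)
  qed
  have o: "T \<in> sets borel" using element_open[OF T] by simp
  have bpos: "0 < elint T (bubble (vertices T))"
    using bubble_element(4)[OF T] vol_pos[OF T] bubble_const_pos divide_pos_pos[of "vol T" bubble_const] by linarith
  have "elint T (corrected a v) = integral\<^sup>L lborel (\<lambda>x. indicat_real T x * interpolant a x + ?\<beta> T * (indicat_real T x * bubble (vertices T) x))"
    unfolding elint_def by (intro Bochner_Integration.integral_cong) (auto simp: indicator_def onT algebra_simps elint_def)
  also have "\<dots> = elint T (interpolant a) + ?\<beta> T * elint T (bubble (vertices T))"
    using integrable_indicator_continuous[OF o bounded_element[OF T] ic] integrable_indicator_continuous[OF o bounded_element[OF T] bcont[OF T]]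
    by (simp add: elint_def)
  also have "\<dots> = vol T * v T" using bpos by simp
  finally show "elint T (corrected a v) = vol T * v T" .
  \<comment> \<open>The interpolant deviates from \<open>v T\<close> by at most the spread on all of
    \<open>T\<close>, hence so does its mean. The correction therefore costs no more slope than the
    interpolant, up to \<open>bubble_const\<close>.\<close>
  have "\<bar>vol T * v T - elint T (interpolant a)\<bar> \<le> spread a v T * vol T"
  proof -
    have e: "elint T (\<lambda>x. interpolant a x - v T) = elint T (interpolant a) - v T * vol T"
    proof -
      have "elint T (\<lambda>x. interpolant a x - v T) = integral\<^sup>L lborel (\<lambda>x. indicat_real T x * interpolant a x - indicat_real T x * v T)"
        unfolding elint_def by (simp add: right_diff_distrib)
      also have "\<dots> = elint T (interpolant a) - elint T (\<lambda>x. v T)" unfolding elint_def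
        by (intro Bochner_Integration.integral_diff integrable_indicator_continuous[OF o bounded_element[OF T]] ic continuous_intros)
      finally show ?thesis by (simp add: elint_1[OF T])
    qed
    have ub: "interpolant a x - v T \<le> spread a v T" "- spread a v T \<le> interpolant a x - v T" if "x \<in> T" for x
      using interpolant_element(2)[OF T, of x a v] that closure_subset[of T] by auto
    have "elint T (\<lambda>x. interpolant a x - v T) \<le> elint T (\<lambda>x. spread a v T)"
      by (rule elint_mono[OF T]) (intro continuous_intros ic ub | assumption)+
    moreover have "elint T (\<lambda>x. - spread a v T) \<le> elint T (\<lambda>x. interpolant a x - v T)"
      by (rule elint_mono[OF T]) (intro continuous_intros ic ub | assumption)+
    ultimately show ?thesis unfolding e elint_1[OF T] by (simp add: abs_le_iff mult.commute)
  qed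
  then have "\<bar>?\<beta> T\<bar> \<le> spread a v T * vol T / (vol T / bubble_const)"
    unfolding abs_divide using bubble_element(4)[OF T] bpos vol_pos[OF T] bubble_const_pos spread_ge_0[of a v T]
    by (intro frac_le) (auto intro!: divide_pos_pos)
  then have \<beta>: "\<bar>?\<beta> T\<bar> \<le> bubble_const * spread a v T" using vol_pos[OF T] bubble_const_pos by (simp add: mult.commute)
  have "(shape_factor / diam T * spread a v T + \<bar>?\<beta> T\<bar> * (shape_factor / diam T))-lipschitz_on T (\<lambda>x. interpolant a x + ?\<beta> T * bubble (vertices T) x)"
    by (intro lipschitz_on_add bl[OF T] lipschitz_on_subset[OF interpolant_element(1)[OF T] closure_subset])
  then have l1: "(shape_factor / diam T * spread a v T + \<bar>?\<beta> T\<bar> * (shape_factor / diam T))-lipschitz_on T (corrected a v)"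
    unfolding lipschitz_on_def using onT by simp
  have "\<bar>?\<beta> T\<bar> * (shape_factor / diam T) \<le> bubble_const * spread a v T * (shape_factor / diam T)"
    using \<beta> shape_factor_ge_1[OF T] diam_pos[OF T] by (intro mult_right_mono) auto
  then have "shape_factor / diam T * spread a v T + \<bar>?\<beta> T\<bar> * (shape_factor / diam T) \<le> shape_factor / diam T * ((1 + bubble_const) * spread a v T)"
    by (simp add: algebra_simps)
  then show "(shape_factor / diam T * ((1 + bubble_const) * spread a v T))-lipschitz_on T (corrected a v)" by (rule lipschitz_on_le[OF l1])
qed

text \<open>At an interior vertex the value on any one element serves as well as the usual average.\<close>

definition nodal_values :: "((real^'n) set \<Rightarrow> real) \<Rightarrow> real^'n \<Rightarrow> real" where
  "nodal_values v z = (if z \<in> \<Omega> then v (SOME T. T \<in> star \<T> z) else 0)"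

section \<open>Energy of the lifted function in terms of jumps\<close>

definition jumps_at :: "((real^'n) set \<Rightarrow> real) \<Rightarrow> real^'n \<Rightarrow> real" where
  "jumps_at v z = (\<Sum>E\<in>facets \<T>. if z \<in> closure E then (jump E v)\<^sup>2 else 0)"

text \<open>At an interior vertex, a chain leads from the chosen element to \<open>T\<close>. At a
  boundary vertex the nodal value is 0; there a chain leads from \<open>T\<close> to an element with
  a boundary facet at \<open>z\<close>, and the value on that element is itself a jump. This last
  step accounts for the added 1.\<close>

lemma nodal_values_near:
  assumes T: "T \<in> star \<T> z"
  shows "(nodal_values v z - v T)\<^sup>2 \<le> (real chainbound + 1)\<^sup>2 * jumps_at v z"
proof -
  have zc: "z \<in> closure \<Omega>" using starD[OF T] closure_domain by blast
  define D where "D = sqrt (jumps_at v z)"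
  have j0: "0 \<le> jumps_at v z" unfolding jumps_at_def by (intro sum_nonneg) auto
  have D0: "0 \<le> D" "D\<^sup>2 = jumps_at v z" using j0 by (auto simp: D_def)
  have D: "\<bar>jump E v\<bar> \<le> D" if E: "E \<in> facets \<T>" "z \<in> closure E" for E
  proof -
    have "(if z \<in> closure E then (jump E v)\<^sup>2 else 0) \<le> jumps_at v z"
      unfolding jumps_at_def using E(1) finite_facets by (intro member_le_sum) auto
    then have "\<bar>jump E v\<bar>\<^sup>2 \<le> D\<^sup>2" using E(2) D0(2) by simp
    then show ?thesis using D0(1) by (rule power2_le_imp_le)
  qed
  have "\<bar>nodal_values v z - v T\<bar> \<le> (real chainbound + 1) * D"
  proof (cases "z \<in> \<Omega>")
    case True
    have s: "(SOME T. T \<in> star \<T> z) \<in> star \<T> z" using T by (rule someI)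
    have "\<bar>v (SOME T. T \<in> star \<T> z) - v T\<bar> \<le> chainbound * D" by (rule star_jump[OF zc s T D D0(1)])
    then show ?thesis using True D0(1) by (simp add: nodal_values_def algebra_simps)
  next
    case False
    then have "z \<in> frontier \<Omega>" using zc open_domain by (simp add: frontier_def interior_open)
    then obtain S p where S: "S \<in> \<T>" "p \<in> vertices S" "facet S p \<subseteq> frontier \<Omega>" "z \<in> convex hull (vertices S - {p})"
      by (rule boundary_facet_exists)
    let ?E = "facet S p"
    have E: "?E \<in> facets \<T>" by (rule facet_in_facets[OF S(1,2)])
    have zE: "z \<in> closure ?E" using S(4) closure_facet[OF S(1)] by simp
    have "z \<in> closure S" using mem_facet[OF S(1,2)] S(4) by blast
    then have Ss: "S \<in> star \<T> z" using S(1) by (simp add: star_def)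
    have M: "Tm ?E = {}" using labels(5)[OF E] S(3) by blast
    have "sgn_label ?E S \<noteq> 0" using sgn_label_nz[OF E S(1)] open_facet_iff[OF S(1)] S(2) by blast
    then have "S = Tp ?E" using M S(1) empty_notin_mesh by (auto simp: sgn_label_def split: if_splits)
    then have "jump ?E v = v S" unfolding jump_def sum_sgn_label[OF E] using M empty_notin_mesh by simp
    then have "\<bar>v S\<bar> \<le> D" using D[OF E zE] by simp
    moreover have "\<bar>v S - v T\<bar> \<le> chainbound * D" by (rule star_jump[OF zc Ss T D D0(1)])
    ultimately have "\<bar>v T\<bar> \<le> (real chainbound + 1) * D" by (simp add: algebra_simps)
    then show ?thesis using False by (simp add: nodal_values_def)
  qed
  then have "\<bar>nodal_values v z - v T\<bar>\<^sup>2 \<le> ((real chainbound + 1) * D)\<^sup>2" by (intro power_mono) auto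
  then show ?thesis using D0(2) by (simp add: power_mult_distrib)
qed

lemma spread_le:
  assumes T: "T \<in> \<T>"
  shows "(spread (nodal_values v) v T)\<^sup>2 \<le> (CARD('n) + 1) * (real chainbound + 1)\<^sup>2 * (\<Sum>p\<in>vertices T. jumps_at v p)"
proof -
  have "(\<Sum>p\<in>vertices T. 1 * \<bar>nodal_values v p - v T\<bar>)\<^sup>2 \<le> (\<Sum>p\<in>vertices T. 1\<^sup>2) * (\<Sum>p\<in>vertices T. \<bar>nodal_values v p - v T\<bar>\<^sup>2)"
    by (rule Cauchy_Schwarz_ineq_sum)
  then have "(spread (nodal_values v) v T)\<^sup>2 \<le> (CARD('n) + 1) * (\<Sum>p\<in>vertices T. (nodal_values v p - v T)\<^sup>2)"
    using card_vertices[OF T] by (simp add: spread_def add.commute)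
  also have "\<dots> \<le> (CARD('n) + 1) * (\<Sum>p\<in>vertices T. (real chainbound + 1)\<^sup>2 * jumps_at v p)"
  proof (intro mult_left_mono sum_mono)
    fix p assume "p \<in> vertices T"
    then have "p \<in> closure T" using element(2)[OF T] by (simp add: hull_inc)
    then show "(nodal_values v p - v T)\<^sup>2 \<le> (real chainbound + 1)\<^sup>2 * jumps_at v p"
      using T by (intro nodal_values_near) (simp add: star_def)
  qed simp
  finally show ?thesis by (simp only: sum_distrib_left[symmetric] mult.assoc)
qed

text \<open>By conformity a mesh vertex in the closure of \<open>E\<close> is a vertex of
  \<open>Tp E\<close>. So at most n+1 points occur, each in boundedly many elements.\<close>

lemma vertex_facet_count:
  assumes E: "E \<in> facets \<T>"
  shows "card {(T, p). T \<in> \<T> \<and> p \<in> vertices T \<and> p \<in> closure E} \<le> (CARD('n) + 1) * starbound"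
proof -
  let ?P = "Tp E"
  have P: "?P \<in> \<T>" by (rule labels(2)[OF E])
  have "sgn_label E ?P \<noteq> 0" by (simp add: sgn_label_def)
  then obtain q where q: "q \<in> vertices ?P" "E = facet ?P q" using opposite[OF E P] by blast
  have "closure E = convex hull (vertices ?P - {q})" by (rule trans[OF arg_cong[OF q(2), of closure] closure_facet[OF P]])
  then have EP: "closure E \<subseteq> closure ?P" using mem_facet[OF P q(1)] by blast
  have "{(T, p). T \<in> \<T> \<and> p \<in> vertices T \<and> p \<in> closure E} \<subseteq> (\<lambda>(p, T). (T, p)) ` (SIGMA p:vertices ?P. star \<T> p)"
  proof clarify
    fix T p assume T: "T \<in> \<T>" "p \<in> vertices T" "p \<in> closure E"
    have pT: "p \<in> closure T" using T element(2)[OF T(1)] by (simp add: hull_inc)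
    obtain c where c: "c \<subseteq> vertices T" "c \<subseteq> vertices ?P" "closure T \<inter> closure ?P = convex hull c" by (rule common_face[OF T(1) P])
    have "p \<in> convex hull c" using pT T(3) EP c(3) by blast
    then have "p \<in> vertices ?P" using vertex_in_face[OF T(1) c(1) T(2)] c(2) by blast
    then have "(p, T) \<in> (SIGMA p:vertices ?P. star \<T> p)" using T(1) pT by (simp add: star_def)
    then show "(T, p) \<in> (\<lambda>(p, T). (T, p)) ` (SIGMA p:vertices ?P. star \<T> p)" by force
  qed
  moreover have fin: "finite (SIGMA p:vertices ?P. star \<T> p)" using finite_vertices[OF P] star_finite by auto
  ultimately have "card {(T, p). T \<in> \<T> \<and> p \<in> vertices T \<and> p \<in> closure E} \<le> card (SIGMA p:vertices ?P. star \<T> p)"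
    by (meson card_image_le card_mono finite_imageI le_trans)
  also have "\<dots> = (\<Sum>p\<in>vertices ?P. card (star \<T> p))" using finite_vertices[OF P] star_finite by simp
  also have "\<dots> \<le> card (vertices ?P) * starbound" using card_star by (intro sum_bounded_above[of _ _ starbound, simplified]) auto
  finally show ?thesis using card_vertices[OF P] by simp
qed

definition lift_const :: real where
  "lift_const = (shape_factor * (1 + bubble_const))\<^sup>2 * ((CARD('n) + 1) * (real chainbound + 1)\<^sup>2) * (2 * weight_ratio) * ((CARD('n) + 1) * starbound)"

text \<open>The volume divided by the squared diameter is the reciprocal weight, and
  \<open>spread_le\<close> replaces the spread by jumps at the vertices. After exchanging the sums,
  each jump is charged once for every pair of an element and a vertex of it in the facet's closure;
  their number is bounded, and the weights involved are comparable.\<close>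

lemma lift_energy:
  "(\<Sum>T\<in>\<T>. vol T * (shape_factor / diam T * ((1 + bubble_const) * spread (nodal_values v) v T))\<^sup>2) \<le> lift_const * (\<Sum>E\<in>facets \<T>. (jump E v)\<^sup>2 / facet_weight E)"
proof -
  let ?c = "(shape_factor * (1 + bubble_const))\<^sup>2 * ((CARD('n) + 1) * (real chainbound + 1)\<^sup>2)"
  let ?X = "\<lambda>E. (jump E v)\<^sup>2 / facet_weight E"
  have c0: "0 \<le> ?c" by (intro mult_nonneg_nonneg) auto
  have "(\<Sum>T\<in>\<T>. vol T * (shape_factor / diam T * ((1 + bubble_const) * spread (nodal_values v) v T))\<^sup>2)
    \<le> (\<Sum>T\<in>\<T>. \<Sum>p\<in>vertices T. \<Sum>E\<in>facets \<T>. ?c * (2 * weight_ratio) * (?X E * of_bool (p \<in> closure E)))"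
  proof (rule sum_mono)
    fix T assume T: "T \<in> \<T>"
    have d: "0 < diam T" "0 < vol T" "0 < weight T" using diam_pos vol_pos weight_pos T by auto
    have "vol T * (shape_factor / diam T * ((1 + bubble_const) * spread (nodal_values v) v T))\<^sup>2 = (shape_factor * (1 + bubble_const))\<^sup>2 * ((spread (nodal_values v) v T)\<^sup>2 / weight T)"
      unfolding weight_def by (simp add: power_mult_distrib power_divide)
    also have "\<dots> \<le> (shape_factor * (1 + bubble_const))\<^sup>2 * (((CARD('n) + 1) * (real chainbound + 1)\<^sup>2 * (\<Sum>p\<in>vertices T. jumps_at v p)) / weight T)"
      using d by (intro mult_left_mono divide_right_mono spread_le T) auto
    also have "\<dots> = (\<Sum>p\<in>vertices T. \<Sum>E\<in>facets \<T>. ?c * ((jump E v)\<^sup>2 * of_bool (p \<in> closure E) / weight T))"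
      unfolding jumps_at_def sum_distrib_left sum_divide_distrib by (intro sum.cong) (auto simp: mult_ac)
    also have "\<dots> \<le> (\<Sum>p\<in>vertices T. \<Sum>E\<in>facets \<T>. ?c * ((2 * weight_ratio) * (?X E * of_bool (p \<in> closure E))))"
    proof (intro sum_mono mult_left_mono[OF _ c0])
      fix p E assume p: "p \<in> vertices T" and E: "E \<in> facets \<T>"
      have Ts: "T \<in> star \<T> p" using T p element(2)[OF T] by (simp add: star_def hull_inc)
      have fw: "0 < facet_weight E" by (rule facet_weight_pos[OF E])
      show "(jump E v)\<^sup>2 * of_bool (p \<in> closure E) / weight T \<le> (2 * weight_ratio) * (?X E * of_bool (p \<in> closure E))"
      proof (cases "p \<in> closure E")
        case True
        have "facet_weight E \<le> 2 * weight_ratio * weight T" by (rule facet_weight_compare[OF E True Ts])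
        then have "1 / weight T \<le> 2 * weight_ratio / facet_weight E" using d fw by (simp add: field_simps)
        from mult_left_mono[OF this zero_le_power2[of "jump E v"]] show ?thesis using True by (simp add: mult_ac)
      qed simp
    qed
    finally show "vol T * (shape_factor / diam T * ((1 + bubble_const) * spread (nodal_values v) v T))\<^sup>2 \<le> (\<Sum>p\<in>vertices T. \<Sum>E\<in>facets \<T>. ?c * (2 * weight_ratio) * (?X E * of_bool (p \<in> closure E)))"
      by (simp add: mult.assoc)
  qed
  also have "\<dots> = (\<Sum>z\<in>(SIGMA T:\<T>. vertices T). \<Sum>E\<in>facets \<T>. ?c * (2 * weight_ratio) * (?X E * of_bool (snd z \<in> closure E)))"
    using finite_mesh finite_vertices by (subst sum.Sigma) (auto simp: split_beta)
  also have "\<dots> = (\<Sum>E\<in>facets \<T>. \<Sum>z\<in>(SIGMA T:\<T>. vertices T). ?c * (2 * weight_ratio) * (?X E * of_bool (snd z \<in> closure E)))"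
    by (rule sum.swap)
  also have "\<dots> = (\<Sum>E\<in>facets \<T>. ?c * (2 * weight_ratio) * ?X E * card {(T, p). T \<in> \<T> \<and> p \<in> vertices T \<and> p \<in> closure E})"
  proof (rule sum.cong[OF refl])
    fix E
    let ?S = "SIGMA T:\<T>. vertices T"
    have finS: "finite ?S" using finite_mesh finite_vertices by auto
    have "(\<Sum>z\<in>?S. of_bool (snd z \<in> closure E) :: real) = card {z \<in> ?S. snd z \<in> closure E}"
      using finS by (simp add: of_bool_def sum.If_cases Int_def)
    also have "{z \<in> ?S. snd z \<in> closure E} = {(T, p). T \<in> \<T> \<and> p \<in> vertices T \<and> p \<in> closure E}" by auto
    finally have cnt: "(\<Sum>z\<in>?S. of_bool (snd z \<in> closure E) :: real) = card {(T, p). T \<in> \<T> \<and> p \<in> vertices T \<and> p \<in> closure E}" .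
    show "(\<Sum>z\<in>?S. ?c * (2 * weight_ratio) * (?X E * of_bool (snd z \<in> closure E))) = ?c * (2 * weight_ratio) * ?X E * card {(T, p). T \<in> \<T> \<and> p \<in> vertices T \<and> p \<in> closure E}"
      unfolding cnt[symmetric] sum_distrib_left by (simp add: mult.assoc)
  qed
  also have "\<dots> \<le> (\<Sum>E\<in>facets \<T>. ?c * (2 * weight_ratio) * ?X E * ((CARD('n) + 1) * starbound))"
  proof (rule sum_mono)
    fix E assume E: "E \<in> facets \<T>"
    have P: "Tp E \<in> \<T>" by (rule labels(2)[OF E])
    have "0 \<le> weight_ratio" using gamma_pos[OF P] shape_factor_ge_1[OF P] unfolding weight_ratio_def by (intro mult_nonneg_nonneg) auto
    then have "0 \<le> ?c * (2 * weight_ratio) * ?X E" using c0 facet_weight_pos[OF E] by (intro mult_nonneg_nonneg divide_nonneg_pos) auto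
    moreover have "real (card {(T, p). T \<in> \<T> \<and> p \<in> vertices T \<and> p \<in> closure E}) \<le> real ((CARD('n) + 1) * starbound)"
      using vertex_facet_count[OF E] by (rule of_nat_mono)
    ultimately show "?c * (2 * weight_ratio) * ?X E * card {(T, p). T \<in> \<T> \<and> p \<in> vertices T \<and> p \<in> closure E}
      \<le> ?c * (2 * weight_ratio) * ?X E * ((CARD('n) + 1) * starbound)" by (intro mult_left_mono) auto
  qed
  also have "\<dots> = lift_const * (\<Sum>E\<in>facets \<T>. ?X E)"
    unfolding lift_const_def sum_distrib_left by (simp add: mult_ac)
  finally show ?thesis .
qed

text \<open>The corrected interpolant has the element means of \<open>v\<close>, so its pairing with
  \<open>step g\<close> is the left-hand side, while its elementwise Lipschitz constants are
  controlled by jumps.\<close>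

lemma dual_bound:
  "(\<Sum>T\<in>\<T>. g T * (vol T * v T)) \<le> Hm1_norm \<Omega> (step g) * sqrt (lift_const * (\<Sum>E\<in>facets \<T>. (jump E v)\<^sup>2 / facet_weight E))"
proof -
  have a: "nodal_values v z = 0" if "z \<notin> \<Omega>" for z using that by (simp add: nodal_values_def)
  note w = corrected_properties[where a="nodal_values v" and v=v, OF a]
  obtain L where L: "L-lipschitz_on UNIV (corrected (nodal_values v) v)" using w(1) by blast
  have "(\<Sum>T\<in>\<T>. g T * elint T (corrected (nodal_values v) v)) \<le> Hm1_norm \<Omega> (step g) * sqrt (\<Sum>T\<in>\<T>. vol T * (shape_factor / diam T * ((1 + bubble_const) * spread (nodal_values v) v T))\<^sup>2)"
    by (rule pairing_le_Hm1_piecewise[OF L w(2) w(4)])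
  also have "\<dots> \<le> Hm1_norm \<Omega> (step g) * sqrt (lift_const * (\<Sum>E\<in>facets \<T>. (jump E v)\<^sup>2 / facet_weight E))"
    by (intro mult_left_mono real_sqrt_le_mono lift_energy Hm1_norm_step_ge_0)
  finally show ?thesis using w(3) by simp
qed

section \<open>Stable decomposition and equivalence of the norms\<close>

text \<open>Dividing the labels by the root of the facet weight turns the weighted norm of the
  coefficients into the Euclidean norm of the duality lemma. The factor \<open>vol T\<close> on the
  right-hand side offsets the 1/|T| in \<open>flux_div\<close>.\<close>

lemma stable_decomposition:
  obtains c where "step g = (\<lambda>x. \<Sum>E\<in>facets \<T>. c E * flux_div E x)"
    "(\<Sum>E\<in>facets \<T>. (c E)\<^sup>2 * facet_weight E) \<le> (Hm1_norm \<Omega> (step g))\<^sup>2 * \<bar>lift_const\<bar>"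
proof -
  \<comment> \<open>With the absolute value, the square of the root gives back
    \<open>\<bar>lift_const\<bar>\<close> without a discussion of signs.\<close>
  let ?K = "Hm1_norm \<Omega> (step g) * sqrt \<bar>lift_const\<bar>"
  let ?l = "\<lambda>E T. sgn_label E T / sqrt (facet_weight E)"
  have b: "(\<Sum>T\<in>\<T>. (g T * vol T) * v T) \<le> ?K * sqrt (\<Sum>E\<in>facets \<T>. (\<Sum>T\<in>\<T>. ?l E T * v T)\<^sup>2)" for v
  proof -
    have "(\<Sum>T\<in>\<T>. ?l E T * v T)\<^sup>2 = (jump E v)\<^sup>2 / facet_weight E" if E: "E \<in> facets \<T>" for E
    proof -
      have "(\<Sum>T\<in>\<T>. ?l E T * v T) = jump E v / sqrt (facet_weight E)" by (simp add: jump_def sum_divide_distrib)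
      then show ?thesis using facet_weight_pos[OF E] by (simp add: power_divide)
    qed
    then have e: "(\<Sum>E\<in>facets \<T>. (\<Sum>T\<in>\<T>. ?l E T * v T)\<^sup>2) = (\<Sum>E\<in>facets \<T>. (jump E v)\<^sup>2 / facet_weight E)" by simp
    have s0: "0 \<le> (\<Sum>E\<in>facets \<T>. (jump E v)\<^sup>2 / facet_weight E)"
      using facet_weight_pos by (intro sum_nonneg divide_nonneg_pos) auto
    have "(\<Sum>T\<in>\<T>. (g T * vol T) * v T) \<le> Hm1_norm \<Omega> (step g) * sqrt (lift_const * (\<Sum>E\<in>facets \<T>. (jump E v)\<^sup>2 / facet_weight E))"
      using dual_bound[of g v] by (simp add: mult.assoc)
    also have "\<dots> \<le> Hm1_norm \<Omega> (step g) * sqrt (\<bar>lift_const\<bar> * (\<Sum>E\<in>facets \<T>. (jump E v)\<^sup>2 / facet_weight E))"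
      using s0 by (intro mult_left_mono real_sqrt_le_mono mult_right_mono Hm1_norm_step_ge_0) auto
    finally show ?thesis unfolding e by (simp add: real_sqrt_mult mult.assoc)
  qed
  obtain d where d: "\<And>T. T \<in> \<T> \<Longrightarrow> (\<Sum>E\<in>facets \<T>. d E * ?l E T) = g T * vol T" "(\<Sum>E\<in>facets \<T>. (d E)\<^sup>2) \<le> ?K\<^sup>2"
    by (rule finite_dual_decomposition[OF finite_mesh finite_facets b]) blast
  define c where "c E = d E / sqrt (facet_weight E)" for E
  show thesis
  proof (rule that)
    have "(\<Sum>E\<in>facets \<T>. c E * sgn_label E T) / vol T = g T" if T: "T \<in> \<T>" for T
      using d(1)[OF T] vol_pos[OF T] by (simp add: c_def field_simps)
    then show "step g = (\<lambda>x. \<Sum>E\<in>facets \<T>. c E * flux_div E x)"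
      unfolding flux_comb_step step_def by simp
    have "(\<Sum>E\<in>facets \<T>. (c E)\<^sup>2 * facet_weight E) = (\<Sum>E\<in>facets \<T>. (d E)\<^sup>2)"
      using facet_weight_pos by (intro sum.cong) (auto simp: c_def power_divide less_imp_le less_imp_neq[symmetric])
    then show "(\<Sum>E\<in>facets \<T>. (c E)\<^sup>2 * facet_weight E) \<le> (Hm1_norm \<Omega> (step g))\<^sup>2 * \<bar>lift_const\<bar>"
      using d(2) by (simp add: power_mult_distrib)
  qed
qed

text \<open>One direction needs a single good decomposition, the stable one, together with the upper
  bound for each flux. The other has to hold for every decomposition: the bound for combinations is
  followed by the lower bound for each flux, and then the infimum is taken.\<close>

lemma norm_equivalence:
  assumes \<phi>: "\<phi> \<in> P0 \<T>"
  shows "(X_norm \<Omega> \<T> Tp Tm \<phi>) \<le> sqrt ((CARD('n) + 1) * \<bar>lift_const\<bar>) * Hm1_norm \<Omega> \<phi>"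
    "Hm1_norm \<Omega> \<phi> \<le> sqrt ((CARD('n) + 1) * (2 * (shape_factor * bubble_const)\<^sup>2)) * X_norm \<Omega> \<T> Tp Tm \<phi>"
    "0 \<le> Hm1_norm \<Omega> \<phi>" "0 \<le> X_norm \<Omega> \<T> Tp Tm \<phi>"
proof -
  obtain g where g: "\<phi> = step g" by (rule P0_step[OF \<phi>])
  show H0: "0 \<le> Hm1_norm \<Omega> \<phi>" unfolding g by (rule Hm1_norm_step_ge_0)
  define S where "S = {\<Sum>E\<in>facets \<T>. (Hm1_norm \<Omega> (\<phi>E E))\<^sup>2 | \<phi>E.
                  (\<forall>E \<in> facets \<T>. \<phi>E E \<in> X_space \<T> Tp Tm E) \<and> \<phi> = (\<lambda>x. \<Sum>E\<in>facets \<T>. \<phi>E E x)}"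
  have X: "X_norm \<Omega> \<T> Tp Tm \<phi> = sqrt (Inf S)" unfolding X_norm_def S_def ..
  obtain c where c: "step g = (\<lambda>x. \<Sum>E\<in>facets \<T>. c E * flux_div E x)"
    "(\<Sum>E\<in>facets \<T>. (c E)\<^sup>2 * facet_weight E) \<le> (Hm1_norm \<Omega> (step g))\<^sup>2 * \<bar>lift_const\<bar>"
    by (rule stable_decomposition)
  have S1: "(\<Sum>E\<in>facets \<T>. (Hm1_norm \<Omega> (\<lambda>x. c E * flux_div E x))\<^sup>2) \<in> S"
    unfolding S_def using c(1) by (intro CollectI exI[of _ "\<lambda>E x. c E * flux_div E x"]) (auto simp: X_space_eq g)
  have bdd: "bdd_below S" unfolding S_def bdd_below_def by (intro exI[of _ 0]) (auto intro!: sum_nonneg)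
  have "Inf S \<le> (\<Sum>E\<in>facets \<T>. (Hm1_norm \<Omega> (\<lambda>x. c E * flux_div E x))\<^sup>2)" by (rule cInf_lower[OF S1 bdd])
  also have "\<dots> \<le> (\<Sum>E\<in>facets \<T>. (CARD('n) + 1) * ((c E)\<^sup>2 * facet_weight E))"
    by (intro sum_mono Hm1_norm_flux_div_le)
  also have "\<dots> \<le> (CARD('n) + 1) * ((Hm1_norm \<Omega> \<phi>)\<^sup>2 * \<bar>lift_const\<bar>)"
    unfolding sum_distrib_left[symmetric] g by (intro mult_left_mono c(2)) simp
  finally have "sqrt (Inf S) \<le> sqrt ((CARD('n) + 1) * ((Hm1_norm \<Omega> \<phi>)\<^sup>2 * \<bar>lift_const\<bar>))" by (rule real_sqrt_le_mono)
  also have "\<dots> = sqrt ((CARD('n) + 1) * \<bar>lift_const\<bar>) * Hm1_norm \<Omega> \<phi>" using H0 by (simp add: real_sqrt_mult)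
  finally show "(X_norm \<Omega> \<T> Tp Tm \<phi>) \<le> sqrt ((CARD('n) + 1) * \<bar>lift_const\<bar>) * Hm1_norm \<Omega> \<phi>" unfolding X .
  let ?C = "(CARD('n) + 1) * (2 * (shape_factor * bubble_const)\<^sup>2)"
  obtain y where "y \<in> \<Omega>" using domain_nonempty by blast
  then have "y \<in> closure \<Omega>" using closure_subset by (rule subsetD[rotated])
  then obtain T where "T \<in> \<T>" using closure_domain by auto
  then have C0: "0 < ?C" using shape_factor_ge_1[of T] bubble_const_pos by (intro mult_pos_pos zero_less_power) auto
  have Inf: "(Hm1_norm \<Omega> \<phi>)\<^sup>2 / ?C \<le> Inf S"
  proof (rule cInf_greatest)
    show "S \<noteq> {}" using S1 by blast
    fix s assume "s \<in> S"
    then obtain \<phi>E where s: "s = (\<Sum>E\<in>facets \<T>. (Hm1_norm \<Omega> (\<phi>E E))\<^sup>2)" "\<And>E. E \<in> facets \<T> \<Longrightarrow> \<phi>E E \<in> X_space \<T> Tp Tm E"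
      "\<phi> = (\<lambda>x. \<Sum>E\<in>facets \<T>. \<phi>E E x)" unfolding S_def by blast
    have "\<exists>c. \<phi>E E = (\<lambda>x. c * flux_div E x)" if "E \<in> facets \<T>" for E using s(2)[OF that] X_space_eq[OF that] by blast
    then obtain d where d: "\<And>E. E \<in> facets \<T> \<Longrightarrow> \<phi>E E = (\<lambda>x. d E * flux_div E x)" by metis
    have "\<phi> = (\<lambda>x. \<Sum>E\<in>facets \<T>. d E * flux_div E x)" unfolding s(3) using d by (intro ext sum.cong) auto
    then have "Hm1_norm \<Omega> \<phi> \<le> sqrt ((CARD('n) + 1) * (\<Sum>E\<in>facets \<T>. (d E)\<^sup>2 * facet_weight E))"
      using Hm1_norm_flux_comb_le[of d] by simp
    then have "(Hm1_norm \<Omega> \<phi>)\<^sup>2 \<le> (sqrt ((CARD('n) + 1) * (\<Sum>E\<in>facets \<T>. (d E)\<^sup>2 * facet_weight E)))\<^sup>2" using H0 by (rule power_mono)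
    also have "\<dots> = (CARD('n) + 1) * (\<Sum>E\<in>facets \<T>. (d E)\<^sup>2 * facet_weight E)"
      using less_imp_le[OF facet_weight_pos] by (intro real_sqrt_pow2 mult_nonneg_nonneg sum_nonneg) auto
    also have "\<dots> \<le> (CARD('n) + 1) * (\<Sum>E\<in>facets \<T>. 2 * (shape_factor * bubble_const)\<^sup>2 * (Hm1_norm \<Omega> (\<phi>E E))\<^sup>2)"
      using Hm1_norm_flux_div_ge d by (intro mult_left_mono sum_mono) auto
    also have "\<dots> = ?C * s" unfolding s(1) by (simp add: sum_distrib_left mult.assoc)
    finally show "(Hm1_norm \<Omega> \<phi>)\<^sup>2 / ?C \<le> s" using C0 by (simp add: field_simps)
  qed
  have "0 \<le> (Hm1_norm \<Omega> \<phi>)\<^sup>2 / ?C" using C0 by (intro divide_nonneg_pos) auto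
  from this Inf have "0 \<le> Inf S" by (rule order_trans)
  then show "0 \<le> X_norm \<Omega> \<T> Tp Tm \<phi>" unfolding X by simp
  from Inf have "(Hm1_norm \<Omega> \<phi>)\<^sup>2 \<le> ?C * Inf S" using C0 by (simp add: field_simps)
  then have "sqrt ((Hm1_norm \<Omega> \<phi>)\<^sup>2) \<le> sqrt (?C * Inf S)" by (rule real_sqrt_le_mono)
  then show "Hm1_norm \<Omega> \<phi> \<le> sqrt ?C * X_norm \<Omega> \<T> Tp Tm \<phi>" unfolding X using H0 by (simp add: real_sqrt_mult)
qed

end

theorem theorem3:
  fixes \<Omega> :: "(real^'n) set" and \<gamma> :: real
  assumes "CARD('n) \<ge> 2"
    and "polyhedral_lipschitz_domain \<Omega>"
  shows "\<exists>C>0. \<forall>\<T> Tp Tm.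
           regular_mesh \<Omega> \<T> \<longrightarrow> shape_regular \<gamma> \<T> \<longrightarrow> facet_labelling \<Omega> \<T> Tp Tm \<longrightarrow>
           (\<forall>\<phi> \<in> P0 \<T>.
              inverse C * X_norm \<Omega> \<T> Tp Tm \<phi> \<le> Hm1_norm \<Omega> \<phi> \<and>
              Hm1_norm \<Omega> \<phi> \<le> C * X_norm \<Omega> \<T> Tp Tm \<phi>)"
proof -
  let ?n = "real (CARD('n) + 1)"
  \<comment> \<open>Outside the locale the constants take only the dimension type and \<gamma> as
    arguments, so they can be fixed before the mesh is given.\<close>
  define A where "A = sqrt (?n * \<bar>labelled_mesh.lift_const TYPE('n) \<gamma>\<bar>)"
  define B where "B = sqrt (?n * (2 * (labelled_mesh.shape_factor TYPE('n) \<gamma> * labelled_mesh.bubble_const TYPE('n))\<^sup>2))"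
  have AB: "0 \<le> A" "0 \<le> B" unfolding A_def B_def by auto
  \<comment> \<open>The summand 1 makes \<open>C\<close> positive even if the other two
    vanish.\<close>
  define C where "C = 1 + A + B"
  have C: "0 < C" "A \<le> C" "B \<le> C" using AB by (auto simp: C_def)
  have "inverse C * X_norm \<Omega> \<T> Tp Tm \<phi> \<le> Hm1_norm \<Omega> \<phi> \<and> Hm1_norm \<Omega> \<phi> \<le> C * X_norm \<Omega> \<T> Tp Tm \<phi>"
    if "regular_mesh \<Omega> \<T>" "shape_regular \<gamma> \<T>" "facet_labelling \<Omega> \<T> Tp Tm" and \<phi>: "\<phi> \<in> P0 \<T>" for \<T> Tp Tm \<phi>
  proof -
    interpret labelled_mesh \<Omega> \<T> \<gamma> Tp Tm
      using assms that unfolding polyhedral_lipschitz_domain_def by unfold_locales auto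
    note eq = norm_equivalence[OF \<phi>]
    have "X_norm \<Omega> \<T> Tp Tm \<phi> \<le> C * Hm1_norm \<Omega> \<phi>"
      using eq(1) mult_right_mono[OF C(2) eq(3)] unfolding A_def by linarith
    then have "inverse C * X_norm \<Omega> \<T> Tp Tm \<phi> \<le> Hm1_norm \<Omega> \<phi>" using C(1) by (simp add: field_simps)
    moreover have "Hm1_norm \<Omega> \<phi> \<le> C * X_norm \<Omega> \<T> Tp Tm \<phi>"
      using eq(2) mult_right_mono[OF C(3) eq(4)] unfolding B_def by linarith
    ultimately show ?thesis ..
  qed
  then show ?thesis using C(1) by blast
qed

end
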